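(* Assume that $\Omega$ is star-shaped with respect to a ball centred at the origin, with $\mathbf{x}\cdot\mathbf{n}(\mathbf{x})\ge\gamma L$ for a.e. $\mathbf{x}\in\Gamma$ ($\gamma>0$, $L=\operatorname{diam}\Omega$), that $\frac{L}{2}\left(1+\frac{4}{\gamma}+\frac{\gamma}{2}\right)\le\beta\le CL$ for some $C>0$ independent of $k$ and $L$, and that $A=k^2$. Let $\mathbf{u}^m$ denote the $m$th iterate of weighted GMRES applied to the system $\mathsf{B}^{(2)}\mathbf{u}=\mathbf{g}^{(2)}$, left preconditioned with $(\mathsf{D}_k^{(2)})^{-1}$, i.e. the residual $\mathbf{r}^m=(\mathsf{D}_k^{(2)})^{-1}(\mathbf{g}^{(2)}-\mathsf{B}^{(2)}\mathbf{u}^m)$ is minimised in the norm $\|\cdot\|_{\mathsf{D}_k^{(2)}}$. (i) Given $k_0>0$, there exists $C_2>0$, dependent on $k_0$ but independent of $k$ (and of the finite-dimensional subspace $V_N$), such that, given $0<\delta<1$, if $$m\ge C_2\log\left(\frac{12}{\delta}\right),$$ then $$\frac{\|\mathbf{r}^m\|_{\mathsf{D}_k^{(2)}}}{\|\mathbf{r}^0\|_{\mathsf{D}_k^{(2)}}}\le\delta$$ for all $k\ge k_0$. (ii) Moreover, let $u_N\in V_N$ be the Galerkin solution (the function with coefficient vector $\mathbf{u}$) and let $u_N^m\in V_N$ be the function with coefficient vector $\mathbf{u}^m$. If the initial guess is $\mathbf{u}^0=\mathbf{0}$, then for all $m$ satisfying $m\ge C_2\log(12/\delta)$, $$\frac{\|u_N-u_N^m\|_{V_2}}{\|u_N\|_{V_2}}\le\frac{C_{\rm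 cont}^{(2)}}{C_{\rm coer}^{(2)}}\,\delta\sim\delta,$$ where $C_{\rm cont}^{(2)}$ and $C_{\rm coer}^{(2)}$ are the continuity and coercivity constants of $b(\cdot,\cdot)$ (with $A=k^2$) in the norm $\|\cdot\|_{V_2}$.
   Context: Setting. $\Omega\subset\mathbb{R}^d$, $d\ge1$, is a bounded Lipschitz open set with boundary $\Gamma$ and outward unit normal $\mathbf{n}$; $k>0$; $f\in L^2(\Omega)$, $g\in L^2(\Gamma)$; functions are complex-valued; $\mathcal{L}v:=\Delta v+k^2v$; $\partial_n$ is the normal derivative; $\nabla_\Gamma$ is the surface gradient on $\Gamma$ ($\nabla_\Gamma v=\nabla v-\mathbf{n}\,\partial_nv$ for $v$ smooth near $\Gamma$). For $d=1$, $\nabla_\Gamma$ terms are zero and integrals over $\Gamma$ are sums over the endpoints. $\Omega$ is star-shaped with respect to a ball if it is star-shaped with respect to every point of that ball. $V:=\{v\in H^1(\Omega):\Delta v\in L^2(\Omega),\ v\in H^1(\Gamma),\ \partial_nv\in L^2(\Gamma)\}$. MS formulation. For real $\beta,A$ let $\mathcal{M}v:=\mathbf{x}\cdot\nabla v-\mathrm{i}k\beta v+\frac{d-1}{2}v$ and $$b(u,v):=\int_\Omega\Big(\nabla u\cdot\overline{\nabla v}+k^2u\overline v+\big(\mathcal{M}u+\tfrac{A}{k^2}\mathcal{L}u\big)\overline{\mathcal{L}v}\Big)d\mathbf{x}-\int_\Gamma\Big(\mathrm{i}ku\,\overline{\mathcal{M}v}+\big(\mathbf{x}\cdot\nabla_\Gamma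 u-\mathrm{i}k\beta u+\tfrac{d-1}{2}u\big)\overline{\partial_nv}+(\mathbf{x}\cdot\mathbf{n})\big(k^2u\overline v-\nabla_\Gamma u\cdot\overline{\nabla_\Gamma v}\big)\Big)ds,$$ $$G(v):=\int_\Omega\Big(\overline{\mathcal{M}v}-\tfrac{A}{k^2}\overline{\mathcal{L}v}\Big)f\,d\mathbf{x}+\int_\Gamma\overline{\mathcal{M}v}\,g\,ds.$$ The formulation is: find $u\in V$ with $b(u,v)=G(v)$ for all $v\in V$; the Galerkin solution in a finite-dimensional subspace $V_N\subset V$ is $u_N\in V_N$ with $b(u_N,v_N)=G(v_N)$ for all $v_N\in V_N$. Norm (with the length scale set to 1): $\|v\|_{V_2}^2:=\|\mathcal{L}v\|_{L^2(\Omega)}^2+\|\nabla v\|_{L^2(\Omega)}^2+k^2\|v\|_{L^2(\Omega)}^2+\|\partial_nv\|_{L^2(\Gamma)}^2+\|\nabla_\Gamma v\|_{L^2(\Gamma)}^2+k^2\|v\|_{L^2(\Gamma)}^2$. Continuity and coercivity constants in a norm $\|\cdot\|$: $|b(u,v)|\le C_{\rm cont}\|u\|\|v\|$ and $|b(v,v)|\ge C_{\rm coer}\|v\|^2$ for all $u,v\in V$. Here constants are taken with $C_{\rm cont}^{(2)}\sim1$ and $C_{\rm coer}^{(2)}\sim1$; $a\sim b$ means $c\,b\le a\le C\,b$ with $c,C>0$ independent of $h$ (mesh diameter of $V_N$) and $k\ge k_0$ (they may depend on $\Omega$, $L$, $k_0$). Matrices. Let $\{\phi_j\}_{j=1}^N$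 be a real basis of $V_N$ ($C^1$ basis functions). $\mathsf{B}^{(2)}_{ij}:=b(\phi_j,\phi_i)$ and $g^{(2)}_i:=G(\phi_i)$ with $A=k^2$. $\mathsf{D}^{(2)}_k$ is the real symmetric positive-definite Gram matrix of $\|\cdot\|_{V_2}$: $(\mathsf{D}^{(2)}_k)_{\ell,m}=\int_\Omega\big((\Delta\phi_\ell+k^2\phi_\ell)(\Delta\phi_m+k^2\phi_m)+\nabla\phi_\ell\cdot\nabla\phi_m+k^2\phi_\ell\phi_m\big)d\mathbf{x}+\int_\Gamma\big(k^2\phi_\ell\phi_m+\nabla_\Gamma\phi_\ell\cdot\nabla_\Gamma\phi_m+\partial_n\phi_\ell\,\partial_n\phi_m\big)ds$. For Hermitian positive definite $\mathsf{P}$: $\langle\mathbf{v},\mathbf{w}\rangle_{\mathsf{P}}:=\mathbf{w}^*\mathsf{P}\mathbf{v}$, $\|\mathbf{v}\|_{\mathsf{P}}^2:=\langle\mathbf{v},\mathbf{v}\rangle_{\mathsf{P}}$. Weighted GMRES for $\mathsf{C}\mathbf{x}=\mathbf{d}$ with weight $\mathsf{D}$ and initial guess $\mathbf{x}^0$: with $\mathbf{r}^0=\mathbf{d}-\mathsf{C}\mathbf{x}^0$ and $\mathcal{K}^m=\operatorname{span}\{\mathsf{C}^j\mathbf{r}^0:0\le j\le m-1\}$, $\mathbf{x}^m$ is the unique element of $\mathbf{x}^0+\mathcal{K}^m$ minimising $\|\mathbf{d}-\mathsf{C}\mathbf{x}\|_{\mathsf{D}}$. Here $\mathsf{C}=(\mathsf{D}^{(2)}_k)^{-1}\mathsf{B}^{(2)}$,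 $\mathbf{d}=(\mathsf{D}^{(2)}_k)^{-1}\mathbf{g}^{(2)}$, $\mathsf{D}=\mathsf{D}^{(2)}_k$. *)

theory Defs
  imports "HOL-Analysis.Analysis" "Jordan_Normal_Form.Gauss_Jordan_Elimination"
begin

text \<open>The space dimension is \<open>d = CARD('n)\<close>; vector fields on \<open>\<Omega>\<close> and \<open>\<Gamma> = frontier \<Omega>\<close> have values in
  \<open>real ^ 'n\<close> or \<open>complex ^ 'n\<close>. The vectors and matrices of Jordan_Normal_Form are used for the linear
  systems, whose size is a variable.\<close>

text \<open>All iterated directional derivatives exist everywhere as Frechet-differentiable functions, that
  is, \<open>f\<close> is of class \<open>C\<^sup>\<infinity>\<close> on the whole space.\<close>

coinductive smooth :: "('a::real_normed_vector \<Rightarrow> 'b::real_normed_vector) \<Rightarrow> bool" where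
  "(\<And>x. f differentiable (at x)) \<Longrightarrow> (\<And>h. smooth (\<lambda>x. frechet_derivative f (at x) h)) \<Longrightarrow> smooth f"

definition partial :: "'n::finite \<Rightarrow> (real ^ 'n \<Rightarrow> 'b::real_normed_vector) \<Rightarrow> real ^ 'n \<Rightarrow> 'b" where
  "partial i f x = frechet_derivative f (at x) (axis i 1)"

definition grad :: "(real ^ 'n::finite \<Rightarrow> 'b::real_normed_vector) \<Rightarrow> real ^ 'n \<Rightarrow> 'b ^ 'n" where
  "grad f x = (\<chi> i. partial i f x)"

definition laplacian :: "(real ^ 'n::finite \<Rightarrow> 'b::real_normed_vector) \<Rightarrow> real ^ 'n \<Rightarrow> 'b" where
  "laplacian f x = (\<Sum>i\<in>UNIV. partial i (partial i f) x)"

definition test_function :: "(real ^ 'n::finite) set \<Rightarrow> (real ^ 'n \<Rightarrow> complex) \<Rightarrow> bool" where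
  "test_function \<Omega> \<phi> \<longleftrightarrow>
     smooth \<phi> \<and> compact (closure {x. \<phi> x \<noteq> 0}) \<and> closure {x. \<phi> x \<noteq> 0} \<subseteq> \<Omega>"

definition complexify :: "real ^ 'n::finite \<Rightarrow> complex ^ 'n" where
  "complexify x = (\<chi> i. complex_of_real (x $ i))"

text \<open>\<open>cdot\<close> is bilinear and \<open>hdot\<close> is sesquilinear, \<open>hdot a b\<close> being the product of \<open>a\<close> with the
  conjugate of \<open>b\<close>.\<close>

definition cdot :: "complex ^ 'n::finite \<Rightarrow> complex ^ 'n \<Rightarrow> complex" where
  "cdot a b = (\<Sum>i\<in>UNIV. a $ i * b $ i)"

definition hdot :: "complex ^ 'n::finite \<Rightarrow> complex ^ 'n \<Rightarrow> complex" where
  "hdot a b = (\<Sum>i\<in>UNIV. a $ i * cnj (b $ i))"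

definition star_shaped_wrt_ball :: "'a::euclidean_space set \<Rightarrow> 'a \<Rightarrow> bool" where
  "star_shaped_wrt_ball \<Omega> c \<longleftrightarrow>
     (\<exists>r>0. \<forall>p\<in>ball c r. p \<in> \<Omega> \<and> (\<forall>x\<in>\<Omega>. closed_segment p x \<subseteq> \<Omega>))"

text \<open>Inside \<open>U\<close>, the set \<open>\<Omega>\<close> lies below the graph, in the direction \<open>e\<close>, of a Lipschitz function \<open>\<zeta>\<close> of the
  coordinates orthogonal to \<open>e\<close>. Such a function is represented by its extension to the whole space
  that is constant along \<open>e\<close>, so \<open>grad \<zeta>\<close> is orthogonal to \<open>e\<close> wherever it exists.\<close>

definition local_graph ::
    "(real ^ 'n::finite) set \<Rightarrow> (real ^ 'n) set \<Rightarrow> real ^ 'n \<Rightarrow> (real ^ 'n \<Rightarrow> real) \<Rightarrow> bool" where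
  "local_graph \<Omega> U e \<zeta> \<longleftrightarrow>
     open U \<and> norm e = 1 \<and> (\<exists>K. K-lipschitz_on UNIV \<zeta>) \<and> (\<forall>y t. \<zeta> (y + t *\<^sub>R e) = \<zeta> y) \<and>
     \<Omega> \<inter> U = {y \<in> U. inner y e < \<zeta> y}"

definition graph_point :: "real ^ 'n::finite \<Rightarrow> (real ^ 'n \<Rightarrow> real) \<Rightarrow> real ^ 'n \<Rightarrow> real ^ 'n" where
  "graph_point e \<zeta> y = y + (\<zeta> y - inner y e) *\<^sub>R e"

definition lipschitz_domain :: "(real ^ 'n::finite) set \<Rightarrow> bool" where
  "lipschitz_domain \<Omega> \<longleftrightarrow> open \<Omega> \<and> bounded \<Omega> \<and>
     (\<forall>x\<in>frontier \<Omega>. \<exists>U e \<zeta>. x \<in> U \<and> local_graph \<Omega> U e \<zeta>)"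

text \<open>In a local graph the surface measure is \<open>sqrt (1 + |grad \<zeta>|\<^sup>2) dy'\<close>, with \<open>y'\<close> in the hyperplane orthogonal
  to \<open>e\<close>, and the outward normal is \<open>(e - grad \<zeta>) / sqrt (1 + |grad \<zeta>|\<^sup>2)\<close>; note that
  \<open>sqrt (1 + |grad \<zeta>|\<^sup>2) = |e - grad \<zeta>|\<close>. Integration over the hyperplane is written as integration
  over the slab \<open>0 \<le> y \<bullet> e < 1\<close> of integrands that are constant along \<open>e\<close>. The gradient exists
  almost everywhere. For \<open>d = 1\<close> the result is the counting measure on the finite boundary.\<close>

definition surface_measure :: "(real ^ 'n::finite) set \<Rightarrow> (real ^ 'n) measure \<Rightarrow> bool" where
  "surface_measure \<Omega> \<sigma> \<longleftrightarrow>
     sets \<sigma> = sets borel \<and> emeasure \<sigma> (- frontier \<Omega>) = 0 \<and>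
     (\<forall>U e \<zeta>. local_graph \<Omega> U e \<zeta> \<longrightarrow>
        (\<forall>B\<in>sets borel. B \<subseteq> U \<inter> frontier \<Omega> \<longrightarrow>
           emeasure \<sigma> B =
             (\<integral>\<^sup>+y. indicator {y. 0 \<le> inner y e \<and> inner y e < 1} y * indicator B (graph_point e \<zeta> y)
                  * ennreal (norm (e - grad \<zeta> y)) \<partial>lborel)))"

definition outward_normal :: "(real ^ 'n::finite) set \<Rightarrow> (real ^ 'n \<Rightarrow> real ^ 'n) \<Rightarrow> bool" where
  "outward_normal \<Omega> \<nu> \<longleftrightarrow>
     \<nu> \<in> borel_measurable borel \<and>
     (\<forall>U e \<zeta>. local_graph \<Omega> U e \<zeta> \<longrightarrow>
        (AE y in lborel. graph_point e \<zeta> y \<in> U \<longrightarrow>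
           \<nu> (graph_point e \<zeta> y) = (e - grad \<zeta> y) /\<^sub>R norm (e - grad \<zeta> y)))"

definition L2 :: "'a measure \<Rightarrow> ('a \<Rightarrow> 'b::euclidean_space) \<Rightarrow> bool" where
  "L2 M f \<longleftrightarrow> f \<in> borel_measurable M \<and> integrable M (\<lambda>x. (norm (f x))\<^sup>2)"

definition L2_lim :: "'a measure \<Rightarrow> (nat \<Rightarrow> 'a \<Rightarrow> 'b::euclidean_space) \<Rightarrow> ('a \<Rightarrow> 'b) \<Rightarrow> bool" where
  "L2_lim M F f \<longleftrightarrow> (\<forall>j. L2 M (F j)) \<and> L2 M f \<and>
     (\<lambda>j. \<integral>x. (norm (F j x - f x))\<^sup>2 \<partial>M) \<longlonglongrightarrow> 0"

definition weak_grad_of ::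
    "(real ^ 'n::finite) set \<Rightarrow> (real ^ 'n \<Rightarrow> complex) \<Rightarrow> (real ^ 'n \<Rightarrow> complex ^ 'n) \<Rightarrow> bool" where
  "weak_grad_of \<Omega> v W \<longleftrightarrow> L2 (lebesgue_on \<Omega>) W \<and>
     (\<forall>\<phi> i. test_function \<Omega> \<phi> \<longrightarrow>
        (\<integral>x. v x * partial i \<phi> x \<partial>lebesgue_on \<Omega>) = - (\<integral>x. W x $ i * \<phi> x \<partial>lebesgue_on \<Omega>))"

definition weak_laplacian_of ::
    "(real ^ 'n::finite) set \<Rightarrow> (real ^ 'n \<Rightarrow> complex) \<Rightarrow> (real ^ 'n \<Rightarrow> complex) \<Rightarrow> bool" where
  "weak_laplacian_of \<Omega> v w \<longleftrightarrow> L2 (lebesgue_on \<Omega>) w \<and>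
     (\<forall>\<phi>. test_function \<Omega> \<phi> \<longrightarrow>
        (\<integral>x. v x * laplacian \<phi> x \<partial>lebesgue_on \<Omega>) = (\<integral>x. w x * \<phi> x \<partial>lebesgue_on \<Omega>))"

text \<open>The operators below pick a representative of an object that is unique up to a null set (in
  \<open>\<Omega>\<close>, respectively on \<open>\<Gamma>\<close>).\<close>

definition wgrad :: "(real ^ 'n::finite) set \<Rightarrow> (real ^ 'n \<Rightarrow> complex) \<Rightarrow> real ^ 'n \<Rightarrow> complex ^ 'n" where
  "wgrad \<Omega> v = (SOME W. weak_grad_of \<Omega> v W)"

definition wlap :: "(real ^ 'n::finite) set \<Rightarrow> (real ^ 'n \<Rightarrow> complex) \<Rightarrow> real ^ 'n \<Rightarrow> complex" where
  "wlap \<Omega> v = (SOME w. weak_laplacian_of \<Omega> v w)"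

definition H1 :: "(real ^ 'n::finite) set \<Rightarrow> (real ^ 'n \<Rightarrow> complex) set" where
  "H1 \<Omega> = {v. L2 (lebesgue_on \<Omega>) v \<and> (\<exists>W. weak_grad_of \<Omega> v W)}"

text \<open>The trace is the extension by continuity, from \<open>H1 \<Omega>\<close> to \<open>L2 \<sigma>\<close>, of the restriction of smooth
  functions to the boundary.\<close>

definition trace_of ::
    "(real ^ 'n::finite) set \<Rightarrow> (real ^ 'n) measure \<Rightarrow> (real ^ 'n \<Rightarrow> complex) \<Rightarrow> (real ^ 'n \<Rightarrow> complex) \<Rightarrow> bool" where
  "trace_of \<Omega> \<sigma> v t \<longleftrightarrow>
     (\<exists>\<psi>. (\<forall>j::nat. smooth (\<psi> j)) \<and> L2_lim (lebesgue_on \<Omega>) \<psi> v \<and>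
          L2_lim (lebesgue_on \<Omega>) (\<lambda>j. grad (\<psi> j)) (wgrad \<Omega> v) \<and> L2_lim \<sigma> \<psi> t)"

definition bdry_trace ::
    "(real ^ 'n::finite) set \<Rightarrow> (real ^ 'n) measure \<Rightarrow> (real ^ 'n \<Rightarrow> complex) \<Rightarrow> real ^ 'n \<Rightarrow> complex" where
  "bdry_trace \<Omega> \<sigma> v = (SOME t. trace_of \<Omega> \<sigma> v t)"

text \<open>For \<open>\<psi>\<close> smooth near \<open>\<Gamma>\<close> the surface gradient is \<open>grad \<psi>\<close> minus its normal component; on \<open>H\<^sup>1(\<Gamma>)\<close>,
  in which the restrictions of smooth functions are dense, it is the \<open>L\<^sup>2(\<Gamma>)\<close>-closure of this
  operator. For \<open>d = 1\<close> it vanishes because \<open>\<nu> = \<plusminus>1\<close>.\<close>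

definition tangential_grad ::
    "(real ^ 'n::finite \<Rightarrow> real ^ 'n) \<Rightarrow> (real ^ 'n \<Rightarrow> complex) \<Rightarrow> real ^ 'n \<Rightarrow> complex ^ 'n" where
  "tangential_grad \<nu> \<psi> x = grad \<psi> x - cdot (complexify (\<nu> x)) (grad \<psi> x) *s complexify (\<nu> x)"

definition surface_grad_of ::
    "(real ^ 'n::finite) measure \<Rightarrow> (real ^ 'n \<Rightarrow> real ^ 'n) \<Rightarrow>
     (real ^ 'n \<Rightarrow> complex) \<Rightarrow> (real ^ 'n \<Rightarrow> complex ^ 'n) \<Rightarrow> bool" where
  "surface_grad_of \<sigma> \<nu> t q \<longleftrightarrow>
     (\<exists>\<psi>. (\<forall>j::nat. smooth (\<psi> j)) \<and> L2_lim \<sigma> \<psi> t \<and> L2_lim \<sigma> (\<lambda>j. tangential_grad \<nu> (\<psi> j)) q)"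

definition H1_boundary ::
    "(real ^ 'n::finite) measure \<Rightarrow> (real ^ 'n \<Rightarrow> real ^ 'n) \<Rightarrow> (real ^ 'n \<Rightarrow> complex) set" where
  "H1_boundary \<sigma> \<nu> = {t. \<exists>q. surface_grad_of \<sigma> \<nu> t q}"

definition sgrad ::
    "(real ^ 'n::finite) set \<Rightarrow> (real ^ 'n) measure \<Rightarrow> (real ^ 'n \<Rightarrow> real ^ 'n) \<Rightarrow>
     (real ^ 'n \<Rightarrow> complex) \<Rightarrow> real ^ 'n \<Rightarrow> complex ^ 'n" where
  "sgrad \<Omega> \<sigma> \<nu> v = (SOME q. surface_grad_of \<sigma> \<nu> (bdry_trace \<Omega> \<sigma> v) q)"

text \<open>The normal derivative is the weak one, defined by Green's first identity.\<close>

definition normal_deriv_of ::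
    "(real ^ 'n::finite) set \<Rightarrow> (real ^ 'n) measure \<Rightarrow> (real ^ 'n \<Rightarrow> complex) \<Rightarrow> (real ^ 'n \<Rightarrow> complex) \<Rightarrow> bool" where
  "normal_deriv_of \<Omega> \<sigma> v w \<longleftrightarrow> L2 \<sigma> w \<and>
     (\<forall>\<psi>. smooth \<psi> \<longrightarrow>
        (\<integral>x. cdot (wgrad \<Omega> v x) (grad \<psi> x) + wlap \<Omega> v x * \<psi> x \<partial>lebesgue_on \<Omega>) = (\<integral>x. w x * \<psi> x \<partial>\<sigma>))"

definition nderiv ::
    "(real ^ 'n::finite) set \<Rightarrow> (real ^ 'n) measure \<Rightarrow> (real ^ 'n \<Rightarrow> complex) \<Rightarrow> real ^ 'n \<Rightarrow> complex" where
  "nderiv \<Omega> \<sigma> v = (SOME w. normal_deriv_of \<Omega> \<sigma> v w)"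

definition V_space ::
    "(real ^ 'n::finite) set \<Rightarrow> (real ^ 'n) measure \<Rightarrow> (real ^ 'n \<Rightarrow> real ^ 'n) \<Rightarrow> (real ^ 'n \<Rightarrow> complex) set" where
  "V_space \<Omega> \<sigma> \<nu> =
     {v \<in> H1 \<Omega>. (\<exists>w. weak_laplacian_of \<Omega> v w) \<and>
               (\<exists>t. trace_of \<Omega> \<sigma> v t) \<and> bdry_trace \<Omega> \<sigma> v \<in> H1_boundary \<sigma> \<nu> \<and>
               (\<exists>w. normal_deriv_of \<Omega> \<sigma> v w)}"

definition helm :: "(real ^ 'n::finite) set \<Rightarrow> real \<Rightarrow> (real ^ 'n \<Rightarrow> complex) \<Rightarrow> real ^ 'n \<Rightarrow> complex" where
  "helm \<Omega> k v x = wlap \<Omega> v x + (complex_of_real k)\<^sup>2 * v x"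

definition mult_dom ::
    "(real ^ 'n::finite) set \<Rightarrow> real \<Rightarrow> real \<Rightarrow> (real ^ 'n \<Rightarrow> complex) \<Rightarrow> real ^ 'n \<Rightarrow> complex" where
  "mult_dom \<Omega> k \<beta> v x =
     cdot (complexify x) (wgrad \<Omega> v x) - \<i> * complex_of_real (k * \<beta>) * v x
     + complex_of_real ((real CARD('n) - 1) / 2) * v x"

text \<open>\<open>mult_tan\<close> is the tangential part \<open>x \<cdot> \<nabla>\<^sub>\<Gamma> v - ik\<beta> v + (d - 1)/2 v\<close> of the multiplier on \<open>\<Gamma>\<close>, and
  \<open>mult_bdry\<close> is the whole multiplier, with \<open>\<nabla> v = \<nabla>\<^sub>\<Gamma> v + \<nu> \<partial>\<^sub>\<nu> v\<close> on \<open>\<Gamma>\<close>.\<close>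

definition mult_tan ::
    "(real ^ 'n::finite) set \<Rightarrow> (real ^ 'n) measure \<Rightarrow> (real ^ 'n \<Rightarrow> real ^ 'n) \<Rightarrow> real \<Rightarrow> real \<Rightarrow>
     (real ^ 'n \<Rightarrow> complex) \<Rightarrow> real ^ 'n \<Rightarrow> complex" where
  "mult_tan \<Omega> \<sigma> \<nu> k \<beta> v x =
     cdot (complexify x) (sgrad \<Omega> \<sigma> \<nu> v x) - \<i> * complex_of_real (k * \<beta>) * bdry_trace \<Omega> \<sigma> v x
     + complex_of_real ((real CARD('n) - 1) / 2) * bdry_trace \<Omega> \<sigma> v x"

definition mult_bdry ::
    "(real ^ 'n::finite) set \<Rightarrow> (real ^ 'n) measure \<Rightarrow> (real ^ 'n \<Rightarrow> real ^ 'n) \<Rightarrow> real \<Rightarrow> real \<Rightarrow>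
     (real ^ 'n \<Rightarrow> complex) \<Rightarrow> real ^ 'n \<Rightarrow> complex" where
  "mult_bdry \<Omega> \<sigma> \<nu> k \<beta> v x =
     mult_tan \<Omega> \<sigma> \<nu> k \<beta> v x + complex_of_real (inner x (\<nu> x)) * nderiv \<Omega> \<sigma> v x"

definition form_b ::
    "(real ^ 'n::finite) set \<Rightarrow> (real ^ 'n) measure \<Rightarrow> (real ^ 'n \<Rightarrow> real ^ 'n) \<Rightarrow> real \<Rightarrow> real \<Rightarrow> real \<Rightarrow>
     (real ^ 'n \<Rightarrow> complex) \<Rightarrow> (real ^ 'n \<Rightarrow> complex) \<Rightarrow> complex" where
  "form_b \<Omega> \<sigma> \<nu> k \<beta> A u v =
     (\<integral>x. hdot (wgrad \<Omega> u x) (wgrad \<Omega> v x) + (complex_of_real k)\<^sup>2 * u x * cnj (v x)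
          + (mult_dom \<Omega> k \<beta> u x + complex_of_real (A / k\<^sup>2) * helm \<Omega> k u x) * cnj (helm \<Omega> k v x)
        \<partial>lebesgue_on \<Omega>)
     - (\<integral>x. \<i> * complex_of_real k * bdry_trace \<Omega> \<sigma> u x * cnj (mult_bdry \<Omega> \<sigma> \<nu> k \<beta> v x)
          + mult_tan \<Omega> \<sigma> \<nu> k \<beta> u x * cnj (nderiv \<Omega> \<sigma> v x)
          + complex_of_real (inner x (\<nu> x)) *
              ((complex_of_real k)\<^sup>2 * bdry_trace \<Omega> \<sigma> u x * cnj (bdry_trace \<Omega> \<sigma> v x)
               - hdot (sgrad \<Omega> \<sigma> \<nu> u x) (sgrad \<Omega> \<sigma> \<nu> v x))
        \<partial>\<sigma>)"

definition form_G ::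
    "(real ^ 'n::finite) set \<Rightarrow> (real ^ 'n) measure \<Rightarrow> (real ^ 'n \<Rightarrow> real ^ 'n) \<Rightarrow> real \<Rightarrow> real \<Rightarrow> real \<Rightarrow>
     (real ^ 'n \<Rightarrow> complex) \<Rightarrow> (real ^ 'n \<Rightarrow> complex) \<Rightarrow> (real ^ 'n \<Rightarrow> complex) \<Rightarrow> complex" where
  "form_G \<Omega> \<sigma> \<nu> k \<beta> A f g v =
     (\<integral>x. (cnj (mult_dom \<Omega> k \<beta> v x) - complex_of_real (A / k\<^sup>2) * cnj (helm \<Omega> k v x)) * f x
        \<partial>lebesgue_on \<Omega>)
     + (\<integral>x. cnj (mult_bdry \<Omega> \<sigma> \<nu> k \<beta> v x) * g x \<partial>\<sigma>)"

definition norm_V2 ::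
    "(real ^ 'n::finite) set \<Rightarrow> (real ^ 'n) measure \<Rightarrow> (real ^ 'n \<Rightarrow> real ^ 'n) \<Rightarrow> real \<Rightarrow>
     (real ^ 'n \<Rightarrow> complex) \<Rightarrow> real" where
  "norm_V2 \<Omega> \<sigma> \<nu> k v = sqrt (
     (\<integral>x. (norm (helm \<Omega> k v x))\<^sup>2 \<partial>lebesgue_on \<Omega>)
     + (\<integral>x. (norm (wgrad \<Omega> v x))\<^sup>2 \<partial>lebesgue_on \<Omega>)
     + k\<^sup>2 * (\<integral>x. (norm (v x))\<^sup>2 \<partial>lebesgue_on \<Omega>)
     + (\<integral>x. (norm (nderiv \<Omega> \<sigma> v x))\<^sup>2 \<partial>\<sigma>)
     + (\<integral>x. (norm (sgrad \<Omega> \<sigma> \<nu> v x))\<^sup>2 \<partial>\<sigma>)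
     + k\<^sup>2 * (\<integral>x. (norm (bdry_trace \<Omega> \<sigma> v x))\<^sup>2 \<partial>\<sigma>))"

definition continuity_constant ::
    "(real ^ 'n::finite) set \<Rightarrow> (real ^ 'n) measure \<Rightarrow> (real ^ 'n \<Rightarrow> real ^ 'n) \<Rightarrow> real \<Rightarrow> real \<Rightarrow> real \<Rightarrow>
     real \<Rightarrow> bool" where
  "continuity_constant \<Omega> \<sigma> \<nu> k \<beta> A c \<longleftrightarrow> 0 < c \<and>
     (\<forall>u\<in>V_space \<Omega> \<sigma> \<nu>. \<forall>v\<in>V_space \<Omega> \<sigma> \<nu>.
        cmod (form_b \<Omega> \<sigma> \<nu> k \<beta> A u v) \<le> c * norm_V2 \<Omega> \<sigma> \<nu> k u * norm_V2 \<Omega> \<sigma> \<nu> k v)"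

definition coercivity_constant ::
    "(real ^ 'n::finite) set \<Rightarrow> (real ^ 'n) measure \<Rightarrow> (real ^ 'n \<Rightarrow> real ^ 'n) \<Rightarrow> real \<Rightarrow> real \<Rightarrow> real \<Rightarrow>
     real \<Rightarrow> bool" where
  "coercivity_constant \<Omega> \<sigma> \<nu> k \<beta> A c \<longleftrightarrow> 0 < c \<and>
     (\<forall>v\<in>V_space \<Omega> \<sigma> \<nu>. c * (norm_V2 \<Omega> \<sigma> \<nu> k v)\<^sup>2 \<le> cmod (form_b \<Omega> \<sigma> \<nu> k \<beta> A v v))"

definition comparable :: "real \<Rightarrow> (real \<Rightarrow> real) \<Rightarrow> (real \<Rightarrow> real) \<Rightarrow> bool" where
  "comparable k0 a b \<longleftrightarrow> (\<exists>c>0. \<exists>C>0. \<forall>k\<ge>k0. c * b k \<le> a k \<and> a k \<le> C * b k)"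

text \<open>\<open>C\<^sup>1\<close> up to the boundary: the gradient in the open set \<open>\<Omega>\<close> extends continuously to the closure.\<close>

definition C1_closure :: "(real ^ 'n::finite) set \<Rightarrow> (real ^ 'n \<Rightarrow> real) \<Rightarrow> bool" where
  "C1_closure \<Omega> \<phi> \<longleftrightarrow> continuous_on (closure \<Omega>) \<phi> \<and>
     (\<exists>W. continuous_on (closure \<Omega>) W \<and> (\<forall>x\<in>\<Omega>. (\<phi> has_derivative (\<lambda>h. inner (W x) h)) (at x)))"

definition cfun :: "(real ^ 'n::finite \<Rightarrow> real) \<Rightarrow> real ^ 'n \<Rightarrow> complex" where
  "cfun \<phi> x = complex_of_real (\<phi> x)"

definition coeff_fun ::
    "nat \<Rightarrow> (nat \<Rightarrow> real ^ 'n::finite \<Rightarrow> real) \<Rightarrow> complex Matrix.vec \<Rightarrow> real ^ 'n \<Rightarrow> complex" where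
  "coeff_fun N \<phi> c x = (\<Sum>j<N. vec_index c j * cfun (\<phi> j) x)"

definition galerkin_space ::
    "nat \<Rightarrow> (nat \<Rightarrow> real ^ 'n::finite \<Rightarrow> real) \<Rightarrow> (real ^ 'n \<Rightarrow> complex) set" where
  "galerkin_space N \<phi> = coeff_fun N \<phi> ` carrier_vec N"

text \<open>Elements of \<open>V\<close> are classes of functions modulo equality almost everywhere in \<open>\<Omega>\<close>, hence the form of
  the linear independence.\<close>

definition galerkin_basis ::
    "(real ^ 'n::finite) set \<Rightarrow> (real ^ 'n) measure \<Rightarrow> (real ^ 'n \<Rightarrow> real ^ 'n) \<Rightarrow>
     nat \<Rightarrow> (nat \<Rightarrow> real ^ 'n \<Rightarrow> real) \<Rightarrow> bool" where
  "galerkin_basis \<Omega> \<sigma> \<nu> N \<phi> \<longleftrightarrow>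
     (\<forall>j<N. C1_closure \<Omega> (\<phi> j)) \<and> galerkin_space N \<phi> \<subseteq> V_space \<Omega> \<sigma> \<nu> \<and>
     (\<forall>c\<in>carrier_vec N. (AE x in lebesgue_on \<Omega>. coeff_fun N \<phi> c x = 0) \<longrightarrow> c = 0\<^sub>v N)"

definition galerkin_solution ::
    "(real ^ 'n::finite) set \<Rightarrow> (real ^ 'n) measure \<Rightarrow> (real ^ 'n \<Rightarrow> real ^ 'n) \<Rightarrow> real \<Rightarrow> real \<Rightarrow> real \<Rightarrow>
     (real ^ 'n \<Rightarrow> complex) \<Rightarrow> (real ^ 'n \<Rightarrow> complex) \<Rightarrow> nat \<Rightarrow> (nat \<Rightarrow> real ^ 'n \<Rightarrow> real) \<Rightarrow>
     (real ^ 'n \<Rightarrow> complex) \<Rightarrow> bool" where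
  "galerkin_solution \<Omega> \<sigma> \<nu> k \<beta> A f g N \<phi> u \<longleftrightarrow> u \<in> galerkin_space N \<phi> \<and>
     (\<forall>v\<in>galerkin_space N \<phi>. form_b \<Omega> \<sigma> \<nu> k \<beta> A u v = form_G \<Omega> \<sigma> \<nu> k \<beta> A f g v)"

definition mat_B ::
    "(real ^ 'n::finite) set \<Rightarrow> (real ^ 'n) measure \<Rightarrow> (real ^ 'n \<Rightarrow> real ^ 'n) \<Rightarrow> real \<Rightarrow> real \<Rightarrow> real \<Rightarrow>
     nat \<Rightarrow> (nat \<Rightarrow> real ^ 'n \<Rightarrow> real) \<Rightarrow> complex Matrix.mat" where
  "mat_B \<Omega> \<sigma> \<nu> k \<beta> A N \<phi> =
     Matrix.mat N N (\<lambda>(i, j). form_b \<Omega> \<sigma> \<nu> k \<beta> A (cfun (\<phi> j)) (cfun (\<phi> i)))"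

definition vec_g ::
    "(real ^ 'n::finite) set \<Rightarrow> (real ^ 'n) measure \<Rightarrow> (real ^ 'n \<Rightarrow> real ^ 'n) \<Rightarrow> real \<Rightarrow> real \<Rightarrow> real \<Rightarrow>
     (real ^ 'n \<Rightarrow> complex) \<Rightarrow> (real ^ 'n \<Rightarrow> complex) \<Rightarrow> nat \<Rightarrow> (nat \<Rightarrow> real ^ 'n \<Rightarrow> real) \<Rightarrow>
     complex Matrix.vec" where
  "vec_g \<Omega> \<sigma> \<nu> k \<beta> A f g N \<phi> = Matrix.vec N (\<lambda>i. form_G \<Omega> \<sigma> \<nu> k \<beta> A f g (cfun (\<phi> i)))"

text \<open>No conjugates are needed, since the basis functions are real.\<close>

definition mat_D ::
    "(real ^ 'n::finite) set \<Rightarrow> (real ^ 'n) measure \<Rightarrow> (real ^ 'n \<Rightarrow> real ^ 'n) \<Rightarrow> real \<Rightarrow>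
     nat \<Rightarrow> (nat \<Rightarrow> real ^ 'n \<Rightarrow> real) \<Rightarrow> complex Matrix.mat" where
  "mat_D \<Omega> \<sigma> \<nu> k N \<phi> = Matrix.mat N N (\<lambda>(l, m). let u = cfun (\<phi> l); v = cfun (\<phi> m) in
     (\<integral>x. helm \<Omega> k u x * helm \<Omega> k v x + cdot (wgrad \<Omega> u x) (wgrad \<Omega> v x)
          + (complex_of_real k)\<^sup>2 * u x * v x \<partial>lebesgue_on \<Omega>)
     + (\<integral>x. (complex_of_real k)\<^sup>2 * bdry_trace \<Omega> \<sigma> u x * bdry_trace \<Omega> \<sigma> v x
          + cdot (sgrad \<Omega> \<sigma> \<nu> u x) (sgrad \<Omega> \<sigma> \<nu> v x)
          + nderiv \<Omega> \<sigma> u x * nderiv \<Omega> \<sigma> v x \<partial>\<sigma>))"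

definition norm_P :: "complex Matrix.mat \<Rightarrow> complex Matrix.vec \<Rightarrow> real" where
  "norm_P P v = sqrt (Re ((P *\<^sub>v v) \<bullet>c v))"

definition krylov :: "nat \<Rightarrow> complex Matrix.mat \<Rightarrow> complex Matrix.vec \<Rightarrow> nat \<Rightarrow> complex Matrix.vec set" where
  "krylov N M r m =
     {finsum_vec TYPE(complex) N (\<lambda>j. c j \<cdot>\<^sub>v ((M ^\<^sub>m j) *\<^sub>v r)) {..<m} | c :: nat \<Rightarrow> complex. True}"

definition gmres_iterate ::
    "nat \<Rightarrow> complex Matrix.mat \<Rightarrow> complex Matrix.mat \<Rightarrow> complex Matrix.vec \<Rightarrow> complex Matrix.vec \<Rightarrow>
     nat \<Rightarrow> complex Matrix.vec \<Rightarrow> bool" where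
  "gmres_iterate N P M d x0 m x \<longleftrightarrow>
     is_arg_min (\<lambda>y. norm_P P (d - M *\<^sub>v y)) (\<lambda>y. \<exists>z\<in>krylov N M (d - M *\<^sub>v x0) m. y = x0 + z) x"

definition mat_inv :: "complex Matrix.mat \<Rightarrow> complex Matrix.mat" where
  "mat_inv M = the (mat_inverse M)"

definition precond_gmres_iterate ::
    "nat \<Rightarrow> complex Matrix.mat \<Rightarrow> complex Matrix.mat \<Rightarrow> complex Matrix.vec \<Rightarrow> complex Matrix.vec \<Rightarrow>
     nat \<Rightarrow> complex Matrix.vec \<Rightarrow> bool" where
  "precond_gmres_iterate N D B g x0 m x \<longleftrightarrow>
     gmres_iterate N D (mat_inv D * B) (mat_inv D *\<^sub>v g) x0 m x"

definition precond_residual ::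
    "complex Matrix.mat \<Rightarrow> complex Matrix.mat \<Rightarrow> complex Matrix.vec \<Rightarrow> complex Matrix.vec \<Rightarrow>
     complex Matrix.vec" where
  "precond_residual D B g x = mat_inv D *\<^sub>v (g - B *\<^sub>v x)"

end

theory Submission imports Defs "Jordan_Normal_Form.Determinant" begin

text \<open>Galerkin functions are \<open>C\<^sup>1\<close> up to the boundary. The boundary is the level set \<open>\<rho> = 1\<close> of the gauge \<open>\<rho>\<close> of
the star-shaped domain, so the surface measure is \<open>norm (grad \<rho>)\<close> times a cone measure and the divergence theorem
follows by testing with Lipschitz cut-offs that decay across thin shells \<open>a \<le> \<rho> < b\<close>. The Rellich inequality comes from comparing
\<open>v\<close> with its dilations \<open>v (c x)\<close>, which satisfy Green's identity in a slightly larger domain, as \<open>c\<close> tends to \<open>1\<close> from below.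
It makes the form coercive with a constant independent of \<open>k\<close>; together with the \<open>k\<close>-uniform bound
of the form, one Richardson step in the \<open>D\<close>-norm contracts the residual by a factor independent of \<open>k\<close>, and the minimal
residual of GMRES is at most that of \<open>m\<close> such steps.
In the lemmas \<open>Y\<close>, \<open>sg\<close>, \<open>nu\<close> are the \<open>\<Omega>\<close>, \<open>\<sigma>\<close>, \<open>\<nu>\<close> of the statement.\<close>

section \<open>Lipschitz functions\<close>

abbreviation ind where "ind == indicator"
abbreviation "indr == indicat_real"
abbreviation cont where "cont == continuous_on"
abbreviation "cplx == complexify"
abbreviation "ilb == integrable lborel"
abbreviation "cvec == carrier_vec"
abbreviation ae_lborel (binder "AEL " 10) where "ae_lborel P == almost_everywhere lborel P"
notation has_derivative (infix "hder" 50)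
notation lipschitz_on ("_-lip" [1000])
notation mult_mat_vec (infixl "*w" 70)
notation tendsto (infixr "--->" 55)
hide_fact (open) Henstock_Kurzweil_Integration.integrable_add Henstock_Kurzweil_Integration.integrable_bound Henstock_Kurzweil_Integration.integrable_cong Henstock_Kurzweil_Integration.integrable_diff Henstock_Kurzweil_Integration.integrable_sum Henstock_Kurzweil_Integration.integral_add Henstock_Kurzweil_Integration.integral_cnj Henstock_Kurzweil_Integration.integral_cong Henstock_Kurzweil_Integration.integral_diff Henstock_Kurzweil_Integration.integral_sum
lemmas bmc_onI = borel_measurable_continuous_onI
lemmas set_lint_def = set_lebesgue_integral_def
abbreviation lint_lborel (binder "LB " 10) where "lint_lborel f == integral\<^sup>L lborel f"
notation scaleR (infixr "*r" 75)
abbreviation seq_lim (infixr "---->" 60) where "f ----> l == f \<longlonglongrightarrow> l"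
abbreviation "fd f x == frechet_derivative f (at x)"
abbreviation "supp f == closure {x. f x ~= 0}"
abbreviation "nsq x == (norm x)^2"
abbreviation "BM == borel_measurable borel"
abbreviation "cr == complex_of_real"

lemma increasing_image_meas_le: fixes h g :: "real => real"
assumes mono: "strict_mono h" and lip: "K-lip UNIV h" and g: "cont UNIV g" "!!x. g (h x) = x" "!!y. h (g y) = y"
 and S: "S : sets borel" "bounded S" and p: "0 < p"
 and small: "!!x d. x : S ==> 0 < d ==> EX a b. a < x & x < b & b - a < d & h b - h a < p * (b - a)"
shows "measure lebesgue (h ` S) <= p * measure lebesgue S"
proof (rule field_le_epsilon)
fix e :: real assume "0 < e"
have Sm: "S : lmeasurable" using S by (auto intro!: bounded_set_imp_lmeasurable)
let ?b = "measure lebesgue S"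
have "0 < e / p" using `0 < e` p by simp
then obtain T where T: "open T" "S <= T" "T : lmeasurable" "measure lebesgue T < ?b + e / p"
proof -
 obtain T where T: "open T" "S <= T" "T - S : lmeasurable" "emeasure lebesgue (T - S) < ennreal (e/p)"
  using sets_lebesgue_outer_open[of S "e/p"] Sm `0 < e / p` by (metis fmeasurableD)
 have "measure lebesgue (T - S) < e / p" using T(3,4) `0 < e / p` by (simp add: emeasure_eq_measure2 ennreal_less_iff)
 moreover have TS: "T : lmeasurable" using fmeasurable.Un[OF Sm T(3)] T(2) by (simp add: Un_absorb1)
 moreover have "measure lebesgue (T - S) = measure lebesgue T - ?b" using TS Sm T(2) by (intro measurable_measure_Diff) auto
 ultimately show thesis using that T by auto
qed
define K where "K = {(a, b). a < b & {a..b} <= T & h b - h a < p * (b - a)}"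
define c r where "c i = (fst i + snd i) / 2" and "r i = (snd i - fst i) / 2" for i :: "real \<times> real"
have cb: "cball (c i) (r i) = {fst i..snd i}" for i by (auto simp: c_def r_def cball_eq_atLeastAtMost field_simps)
have rpos: "0 < r i" if "i : K" for i using that by (auto simp: K_def r_def)
have cov: "EX i. i : K & x : cball (c i) (r i) & r i < d" if "x : S" "0 < d" for x d
proof -
 obtain k where k: "k > 0" "ball x k <= T" using T `x \<in> S` open_contains_ball by blast
 obtain a b where ab: "a < x" "x < b" "b - a < min d k" "h b - h a < p * (b - a)"
  using small[OF `x \<in> S`, of "min d k"] `0 < d` k by auto
 have "{a..b} <= ball x k" using ab by (auto simp: dist_real_def)
 then have "(a, b) : K" using ab k by (auto simp: K_def)
 then show ?thesis using ab unfolding cb by (intro exI[of _ "(a,b)"]) (auto simp: r_def)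
qed
obtain C where C: "countable C" "C <= K"
  "pairwise (%i j. disjnt (cball (c i) (r i)) (cball (c j) (r j))) C"
  "negligible (S - (\<Union>i\<in>C. cball (c i) (r i)))" using Vitali_covering_theorem_cballs[of K r S c, OF rpos cov] by blast
define N where "N = S - (\<Union>i\<in>C. cball (c i) (r i))"
have "negligible (h ` N)"
proof (rule negligible_locally_Lipschitz_image)
 show "negligible N" using C by (simp add: N_def)
 fix x assume "x : N"
 show "EX T B. open T & x : T & (ALL y:N \<inter> T. norm (h y - h x) <= B * norm (y - x))"
  using lipschitz_onD[OF lip] by (intro exI[of _ UNIV] exI[of _ K]) (auto simp: dist_norm)
qed simp
have hI: "h ` {a..b} <= {h a..h b}" for a b using strict_mono_less_eq[OF mono] by auto
let ?a = "\<Union>i\<in>C. {h (fst i)..h (snd i)}"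
have sub: "h ` S <= h ` N \<union> ?a"
proof
 fix y assume "y : h ` S"
 then obtain x where x: "x : S" "y = h x" by auto
 show "y : h ` N \<union> ?a"
 proof (cases "x : N")
  case False
  then obtain i where "i : C" "x : {fst i..snd i}" using x by (auto simp: N_def cb)
  then show ?thesis using hI[of "fst i" "snd i"] x by (intro UnI2 UN_I[of i]) (auto simp: strict_mono_less_eq[OF mono])
 qed (use x in auto)
qed
have disj: "disjoint_family_on (%i. {fst i..snd i}) C"
 using C(3) unfolding cb disjoint_family_on_def pairwise_def disjnt_def by auto
let ?c = "\<Union>i\<in>C. {fst i..snd i}"
have Um: "?c <= T"
proof (rule UN_least)
 fix i assume "i : C"
 then have "i : K" using C(2) by blast
 then show "{fst i..snd i} <= T" by (auto simp: K_def)
qed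
have hNs: "h ` N : sets lebesgue" "?a : sets lebesgue"
 using C(1) \<open>negligible (h ` N)\<close> by (auto simp: negligible_iff_null_sets)
have disj': "disjoint_family_on (%i. {h (fst i)..h (snd i)}) C" unfolding disjoint_family_on_def
proof (intro ballI impI equals0I)
 fix i j y assume *: "i : C" "j : C" "i ~= j" "y : {h (fst i)..h (snd i)} \<inter> {h (fst j)..h (snd j)}"
 then have "h (fst i) <= h (g y)" "h (g y) <= h (snd i)" "h (fst j) <= h (g y)" "h (g y) <= h (snd j)" by (auto simp: g)
 then have "g y : {fst i..snd i} \<inter> {fst j..snd j}" by (simp add: strict_mono_less_eq[OF mono])
 with disj * show False unfolding disjoint_family_on_def by blast
qed
have e1: "emeasure lebesgue ?c = (\<integral>\<^sup>+i. ennreal (snd i - fst i) \<partial>count_space C)"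
 using C(1,2) disj by (subst emeasure_UN_countable) (auto intro!: nn_integral_cong simp: K_def)
have "emeasure lebesgue (h ` S) <= emeasure lebesgue (h ` N \<union> ?a)" using hNs by (intro emeasure_mono sub) auto
also have "... <= emeasure lebesgue (h ` N) + emeasure lebesgue ?a" using hNs by (intro emeasure_subadditive) auto
also have "... = emeasure lebesgue ?a" using \<open>negligible (h ` N)\<close> by (auto simp: negligible_iff_null_sets)
also have "... = (\<integral>\<^sup>+i. emeasure lebesgue {h (fst i)..h (snd i)} \<partial>count_space C)"
 using C(1) disj' by (intro emeasure_UN_countable) auto
also have "... <= (\<integral>\<^sup>+i. ennreal p * ennreal (snd i - fst i) \<partial>count_space C)"
proof (rule nn_integral_mono)
 fix i assume "i : space (count_space C)"
 then have "i : K" using C(2) by auto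
 then have "fst i < snd i" "h (snd i) - h (fst i) < p * (snd i - fst i)" by (auto simp: K_def)
 then show "emeasure lebesgue {h (fst i)..h (snd i)} <= ennreal p * ennreal (snd i - fst i)"
  using p strict_monoD[OF mono, of "fst i" "snd i"] by (auto simp flip: ennreal_mult intro!: ennreal_leI)
qed
also have "... = ennreal p * emeasure lebesgue ?c" unfolding e1 by (rule nn_integral_cmult) auto
also have "... <= ennreal p * emeasure lebesgue T" using T(3) Um by (intro mult_left_mono emeasure_mono) auto
also have "... = ennreal (p * measure lebesgue T)" using T(3) p by (subst emeasure_eq_measure2) (auto simp: ennreal_mult)
finally have "measure lebesgue (h ` S) <= p * measure lebesgue T" unfolding measure_def using p by (intro enn2real_leI) auto
also have "... <= p * (?b + e / p)" using T(4) p by (intro mult_left_mono) auto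
also have "... = p * ?b + e" using p by (simp add: distrib_left)
finally show "measure lebesgue (h ` S) <= p * ?b + e" .
qed

lemma straddling_slopes_deriv: fixes h :: "real => real"
assumes cont: "cont UNIV h"
 and sl: "!!e. 0 < e ==> EX d>0. ALL a b. a < x & x < b & b - a < d --> \<bar>h b - h a - D * (b - a)\<bar> <= e * (b - a)"
shows "(h has_real_derivative D) (at x)"
proof -
have ic: "isCont h z" for z using cont by (simp add: continuous_on_eq_continuous_at)
have "EX d>0. ALL y. norm (y - x) < d --> norm (h y - h x - D * (y - x)) <= e * norm (y - x)" if "0 < e" for e
proof -
 obtain d where d: "0 < d" "!!a b. a < x ==> x < b ==> b - a < d ==> \<bar>h b - h a - D * (b - a)\<bar> <= e * (b - a)"
  using sl[OF `0 < e`] by blast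
 let ?a = "%y a. abs (h y - h a - D * (y - a))"
 have right: "abs (h y - h x - D * (y - x)) <= e * (y - x)" if "x < y" "y < x + d" for y
 proof (rule tendsto_le[of "at_left x" "%a. e * (y - a)" _ "%a. ?a y a"])
  show "((%a. ?a y a) ---> \<bar>h y - h x - D * (y - x)\<bar>) (at_left x)"
   using ic[of x] by (intro tendsto_intros) (auto simp: isCont_def intro: filterlim_mono at_le)
  show "((%a. e * (y - a)) ---> e * (y - x)) (at_left x)" by (intro tendsto_intros)
  have "eventually (%a. y - d < a) (at_left x)" using that by (intro eventually_at_leftI[of "y - d"]) auto
  then show "eventually (%a. ?a y a <= e * (y - a)) (at_left x)"
   using eventually_at_leftI[of "x - 1" x "%a. a < x", simplified] by eventually_elim (use d that in auto)
 qed simp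
 let ?b = "at_right x"
 let ?c = "%b y. abs (h b - h y - D * (b - y))"
 have left: "abs (h x - h y - D * (x - y)) <= e * (x - y)" if "y < x" "x < y + d" for y
 proof (rule tendsto_le[of "?b" "%b. e * (b - y)" _ "%b. ?c b y"])
  show "((%b. ?c b y) ---> \<bar>h x - h y - D * (x - y)\<bar>) ?b"
   using ic[of x] by (intro tendsto_intros) (auto simp: isCont_def intro: filterlim_mono at_le)
  show "((%b. e * (b - y)) ---> e * (x - y)) ?b" by (intro tendsto_intros)
  have "eventually (%b. b < y + d) ?b" using that by (intro eventually_at_rightI[of _ "y + d"]) auto
  then show "eventually (%b. ?c b y <= e * (b - y)) ?b"
   using eventually_at_right_less[of x] by eventually_elim (use d that in auto)
 qed simp
 show ?thesis
 proof (intro exI[of _ d] conjI allI impI d(1))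
  fix y assume "norm (y - x) < d"
  then consider "y = x" | "x < y" "y < x + d" | "y < x" "x < y + d" unfolding real_norm_def abs_less_iff by argo
  then show "norm (h y - h x - D * (y - x)) <= e * norm (y - x)"
  proof cases
   case 2
   then show ?thesis using right[of y] by simp
  next
   case 3
   have "h y - h x - D * (y - x) = - (h x - h y - D * (x - y))" by (simp add: algebra_simps)
   then show ?thesis using left[of y] 3 by simp
  qed simp
 qed
qed
then show ?thesis unfolding has_field_derivative_def has_derivative_at_alt by (auto simp: bounded_linear_mult_right)
qed

lemma lip_real_diffble_ae: fixes f :: "real => real"
assumes lip: "L-lip UNIV f"
shows "negligible {x. \<not> f differentiable (at x)}"
proof -
have L0: "0 <= L" using lip lipschitz_on_nonneg by blast
define h where "h x = f x + (L + 1) * x" for x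
have fL: "abs (f y - f x) <= L * abs (y - x)" for x y using lipschitz_onD[OF lip, of y x] by (simp add: dist_real_def)
have low: "y - x <= h y - h x" if "x <= y" for x y
 using fL[of y x] that by (auto simp: h_def algebra_simps abs_if split: if_splits)
let ?d = "2 * L + 1"
have hL: "abs (h y - h x) <= ?d * abs (y - x)" for x y
proof -
 have "abs (h y - h x) <= abs (f y - f x) + abs ((L + 1) * (y - x))" by (simp add: h_def algebra_simps)
 also have "... <= L * abs (y - x) + (L + 1) * abs (y - x)" using fL[of y x] L0 by (simp add: abs_mult)
 finally show ?thesis by (simp add: algebra_simps)
qed
have lip_h: "?d-lip UNIV h" using hL L0 by (auto simp: lipschitz_on_def dist_real_def)
have mono: "strict_mono h"
proof (rule strict_monoI)
 fix x y :: real assume "x < y"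
 then show "h x < h y" using low[of x y] by simp
qed
have cont: "cont UNIV h" using lip_h by (rule lipschitz_on_continuous_on)
have surj: "EX x. h x = y" for y
proof -
 define z where "z = abs (y - h 0)"
 have "h (- z) <= y" "y <= h z" using low[of "-z" 0] low[of 0 z] by (auto simp: z_def)
 then show ?thesis using IVT'[of h "- z" y z] cont continuous_on_subset by (fastforce simp: z_def)
qed
define g where "g = inv_into UNIV h"
have inj: "inj h" using mono by (rule strict_mono_imp_inj_on)
have gh: "g (h x) = x" for x using inj by (simp add: g_def)
have hg: "h (g y) = y" for y using surj by (metis gh)
have lip_g: "1-lip UNIV g"
proof (rule lipschitz_onI)
 fix u v :: real
 show "dist (g u) (g v) <= 1 * dist u v" using low[of "g u" "g v"] low[of "g v" "g u"] hg by (auto simp: dist_real_def abs_if)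
qed simp
have cont_g: "cont UNIV g" using lip_g by (rule lipschitz_on_continuous_on)
have mono_g: "strict_mono g" using mono by (metis gh hg not_less_iff_gr_or_eq strict_monoD strict_monoI)
define lo where "lo p = {x. ALL d>0. EX a b. a < x & x < b & b - a < d & h b - h a < p * (b - a)}" for p
define hi where "hi q = {x. ALL d>0. EX a b. a < x & x < b & b - a < d & q * (b - a) < h b - h a}" for q
let ?a = "%d P. {x. ALL d>0. EX a b. a < x & x < b & b - a < d & P a b}"
have G: "?a d P : sets borel" for P :: "real => real => bool"
proof -
 define Ow where "Ow n = (\<Union>i\<in>{(a, b). b - a < 1 / real (Suc n) & P a b}. {fst i<..<snd i})" for n
 have "?a d P = (\<Inter>n. Ow n)"
 proof (intro Set.set_eqI HOL.iffI)
  fix x assume "x : (\<Inter>n. Ow n)"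
  then have *: "EX a b. a < x & x < b & b - a < 1 / real (Suc n) & P a b" for n by (fastforce simp: Ow_def)
  show "x : ?a d P"
  proof safe
   fix d :: real assume "0 < d"
   then obtain n where "1 / real (Suc n) < d" using nat_approx_posE by blast
   with *[of n] show "EX a b. a < x & x < b & b - a < d & P a b" by (meson less_trans)
  qed
 next
  fix x assume *: "x : ?a d P"
  show "x : (\<Inter>n. Ow n)"
  proof
   fix n
   have "(0::real) < 1 / real (Suc n)" by simp
   with * obtain a b where "a < x" "x < b" "b - a < 1 / real (Suc n)" "P a b" by blast
   then show "x : Ow n" unfolding Ow_def by (intro UN_I[of "(a, b)"]) auto
  qed
 qed
 also have "... : sets borel"
 proof (rule sets.countable_INT'')
  show "Ow n : sets borel" for n unfolding Ow_def by (intro borel_open open_UN) auto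
 qed auto
 finally show ?thesis .
qed
define E where "E p q m = lo p \<inter> hi q \<inter> {- real m<..<real m}" for p q m
have negE: "negligible (E p q m)" if pq: "0 < p" "p < q" for p q m
proof -
 have EB: "E p q m : sets borel" unfolding E_def lo_def hi_def using G by auto
 have bd: "bounded (E p q m)" by (rule bounded_subset[of "{- real m<..<real m}"]) (auto simp: E_def)
 let ?f = "h ` E p q m"
 have EL: "E p q m : lmeasurable" using EB bd by (auto intro!: bounded_set_imp_lmeasurable)
 let ?b = "measure lebesgue (E p q m)"
 let ?c = "measure lebesgue ?f"
 have 1: "?c <= p * ?b" by (rule increasing_image_meas_le[OF mono lip_h cont_g gh hg EB bd pq(1)]) (auto simp: E_def lo_def)
 have hE: "?f = g -` E p q m"
 proof (intro Set.set_eqI HOL.iffI)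
  fix y assume "y : g -` E p q m"
  then show "y : ?f" using hg[of y] by (intro image_eqI[of _ _ "g y"]) auto
 qed (auto simp: gh)
 have hEB: "?f : sets borel" unfolding hE using measurable_sets[OF bmc_onI[OF cont_g] EB] by simp
 have "measure lebesgue (g ` ?f) <= (1 / q) * ?c"
 proof (rule increasing_image_meas_le[OF mono_g lip_g cont hg gh hEB])
  show "bounded ?f"
   using lipschitz_on_subset[OF lip_h] by (intro bounded_uniformly_continuous_image[OF lipschitz_on_uniformly_continuous bd]) auto
  show "0 < 1 / q" using pq by simp
  fix y d :: real assume y: "y : ?f" and d: "0 < d"
  then obtain x where x: "x : hi q" "y = h x" by (auto simp: E_def)
  have "0 < d / ?d" using d L0 by simp
  then obtain a b where ab: "a < x" "x < b" "b - a < d / ?d" "q * (b - a) < h b - h a" using x(1) unfolding hi_def by blast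
  have "h b - h a <= ?d * (b - a)" using hL[of b a] ab by auto
  also have "... < d" using ab(3) L0 by (simp add: field_simps)
  finally have "h b - h a < d" .
  moreover have "g (h b) - g (h a) < 1 / q * (h b - h a)" using ab(4) pq by (simp add: gh field_simps)
  ultimately show "EX a b. a < y & y < b & b - a < d & g b - g a < 1 / q * (b - a)" using ab strict_monoD[OF mono] x(2) by blast
 qed
 then have 2: "?b <= (1 / q) * ?c" by (simp add: image_image gh)
 have "q * ?b <= ?c" using 2 pq by (simp add: field_simps)
 with 1 have "(q - p) * ?b <= 0" by (simp add: algebra_simps)
 then have "?b = 0" using pq measure_nonneg[of lebesgue "E p q m"] by (simp add: mult_le_0_iff)
 then show ?thesis using EL negligible_iff_measure by blast
qed
have main: "f differentiable (at x)" if x: "!!p q m. p : \<rat> ==> q : \<rat> ==> 0 < p ==> p < q ==> x ~: E p q m" for x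
proof -
 obtain m :: nat where m: "abs x < real m" using reals_Archimedean2[of "abs x"] by auto
 have x': "x ~: lo p \<or> x ~: hi q" if "p : \<rat>" "q : \<rat>" "0 < p" "p < q" for p q
 proof -
  have "x : {- real m<..<real m}" using m by auto
  then show ?thesis using x[OF that, of m] unfolding E_def by blast
 qed
 define Q where "Q = {q : \<rat>. 0 < q & x : hi q}"
 have half: "1/2 : Q"
 proof -
  have "x : hi (1/2)" unfolding hi_def
  proof safe
   fix d :: real assume "0 < d"
   then show "EX a b. a < x & x < b & b - a < d & 1 / 2 * (b - a) < h b - h a"
    using low[of "x - d/4" "x + d/4"] by (intro exI[of _ "x - d/4"] exI[of _ "x + d/4"]) auto
  qed
  then show ?thesis by (simp add: Q_def)
 qed
 have bddQ: "q <= ?d" if "q : Q" for q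
 proof -
  have "x : hi q" using that by (simp add: Q_def)
  then have "ALL d>0. EX a b. a < x & x < b & b - a < d & q * (b - a) < h b - h a" by (simp add: hi_def)
  from this[rule_format, of 1] obtain a b where ab: "a < x" "x < b" "q * (b - a) < h b - h a" by auto
  then have "h b - h a <= ?d * (b - a)" using hL[of b a] by auto
  with ab have "q * (b - a) <= ?d * (b - a)" by linarith
  moreover have "0 < b - a" using ab by simp
  ultimately show ?thesis using mult_le_cancel_right_pos by blast
 qed
 then have bdd: "bdd_above Q" by (meson bdd_above.I)
 define D where "D = Sup Q"
 have D0: "0 < D" using cSup_upper[OF half bdd] by (simp add: D_def)
 have "(h has_real_derivative D) (at x)"
 proof (rule straddling_slopes_deriv[OF cont])
  fix e :: real assume e: "0 < e"
  obtain q1 where q1: "q1 : Q" "D - e < q1" using less_cSupD[of Q "D - e"] half e unfolding D_def by force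
  have "max 0 (D - e) < q1" using q1 by (simp add: Q_def)
  then obtain p where p: "p : \<rat>" "max 0 (D - e) < p" "p < q1" using Rats_dense_in_real[of "max 0 (D - e)" q1] by auto
  have "x ~: lo p" using x'[of p q1] p q1 by (auto simp: Q_def)
  then obtain d1 where d1: "0 < d1" "!!a b. a < x ==> x < b ==> b - a < d1 ==> p * (b - a) <= h b - h a"
   unfolding lo_def mem_Collect_eq by (metis not_less)
  obtain q where q: "q : \<rat>" "D < q" "q < D + e" using Rats_dense_in_real[of D "D + e"] e by auto
  have "q ~: Q" using q(2) cSup_upper[OF _ bdd, of q] by (auto simp: D_def)
  then have "x ~: hi q" using q D0 by (auto simp: Q_def)
  then obtain d2 where d2: "0 < d2" "!!a b. a < x ==> x < b ==> b - a < d2 ==> h b - h a <= q * (b - a)"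
   unfolding hi_def mem_Collect_eq by (metis not_less)
  show "EX d>0. ALL a b. a < x & x < b & b - a < d --> \<bar>h b - h a - D * (b - a)\<bar> <= e * (b - a)"
  proof (intro exI[of _ "min d1 d2"] conjI allI impI)
   fix a b assume ab: "a < x & x < b & b - a < min d1 d2"
   have "(D - e) * (b - a) <= p * (b - a)" using ab p by (intro mult_right_mono) auto
   moreover have "q * (b - a) <= (D + e) * (b - a)" using ab q by (intro mult_right_mono) auto
   ultimately show "abs (h b - h a - D * (b - a)) <= e * (b - a)"
    using d1(2)[of a b] d2(2)[of a b] ab by (auto simp: abs_le_iff algebra_simps)
  qed (use d1 d2 in auto)
 qed
 then have "h differentiable (at x)" unfolding has_field_derivative_def differentiable_def by blast
 then have "(%x. h x - (L + 1) * x) differentiable (at x)" by (intro derivative_intros)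
 then show ?thesis by (simp add: h_def)
qed
define I where "I = {(p :: real, q :: real, m). p : \<rat> & q : \<rat> & 0 < p & p < q} \<inter> (\<rat> \<times> \<rat> \<times> (UNIV :: nat set))"
let ?e = "(%(p, q, m). E p q m) ` I"
have "countable I" unfolding I_def by (intro countable_Int2 countable_SIGMA countable_rat) auto
then have "negligible (\<Union>?e)" using negE by (intro negligible_countable_Union countable_image) (auto simp: I_def)
moreover have "{x. \<not> f differentiable (at x)} <= \<Union>?e"
proof
 fix x assume "x : {x. \<not> f differentiable (at x)}"
 then obtain p q m where "p : \<rat>" "q : \<rat>" "0 < p" "p < q" "x : E p q m" using main[of x] by blast
 then show "x : \<Union>?e" unfolding I_def by (intro UN_I[of "(p, q, m)"]) auto
qed
ultimately show ?thesis using negligible_subset by blast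
qed

primrec diff_times :: "nat => ('a::real_normed_vector => 'b::real_normed_vector) => bool" where
"diff_times 0 f = True"
| "diff_times (Suc n) f \<longleftrightarrow>
  (ALL x. f differentiable (at x)) & (ALL h. diff_times n (%x. fd f x h))"

lemma smooth_iff_dt: "smooth f \<longleftrightarrow> (ALL n. diff_times n f)"
proof
have "smooth f ==> diff_times n f" for n
proof (induction n arbitrary: f)
 case (Suc n)
 from Suc.prems show ?case by (cases rule: smooth.cases) (auto intro: Suc.IH)
qed simp
then show "smooth f ==> ALL n. diff_times n f" by blast
assume "ALL n. diff_times n f"
then show "smooth f"
proof (coinduction arbitrary: f rule: smooth.coinduct)
 case (smooth f)
 have "f differentiable (at x)" for x using smooth[rule_format, of "Suc 0"] by simp
 moreover have "diff_times n (%x. fd f x h)" for n h using smooth[rule_format, of "Suc n"] by simp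
 ultimately show ?case by blast
qed
qed

lemma smoothI:
assumes "!!x. (f hder f' x) (at x)" "!!h. smooth (%x. f' x h)"
shows "smooth f"
proof (rule smooth.intros)
fix h
have "fd f x = f' x" for x using frechet_derivative_at[OF assms(1)[of x]] by simp
then show "smooth (%x. fd f x h)" using assms(2) by simp
qed (use assms(1) differentiable_def in blast)

lemma smooth_deriv: "smooth f ==> (f hder fd f x) (at x)" by (metis frechet_derivative_works smooth.cases)

lemma smooth_frechet: "smooth f ==> smooth (%x. fd f x h)" by (erule smooth.cases) simp

lemma smooth_cont: "smooth f ==> cont S f" by (rule has_derivative_continuous_on[OF has_derivative_at_withinI[OF smooth_deriv]])

lemma dt_deriv:
assumes "diff_times (Suc n) f"
shows "(f hder fd f x) (at x)" using assms frechet_derivative_works by (metis diff_times.simps(2))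

lemma dt_SucI:
assumes "!!x. (f hder f' x) (at x)" "!!h. diff_times n (%x. f' x h)"
shows "diff_times (Suc n) f"
proof -
have "fd f x = f' x" for x using frechet_derivative_at[OF assms(1)[of x]] by simp
then show ?thesis using assms differentiable_def by (auto, blast)
qed

lemma dt_frechet: "diff_times (Suc n) f ==> diff_times n (%x. fd f x h)" by simp

lemma dt_const: "diff_times n (%x. c)"
by (induction n arbitrary: c) (auto intro!: dt_SucI[where f' = "%x h. 0"] simp del: diff_times.simps(2))

lemma dt_Suc_imp: "diff_times (Suc n) f ==> diff_times n f" by (induction n arbitrary: f) auto

lemma dt_add: "diff_times n f ==> diff_times n g ==> diff_times n (%x. f x + g x)"
proof (induction n arbitrary: f g)
case (Suc n)
show ?case by (rule dt_SucI[OF has_derivative_add[OF dt_deriv[OF Suc.prems(1)] dt_deriv[OF Suc.prems(2)]]]) (use Suc in simp)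
qed simp

lemma (in bounded_linear) dt_compose:
"diff_times n g ==> diff_times n (%x. f (g x))"
proof (induction n arbitrary: g)
case (Suc n)
show ?case by (rule dt_SucI[OF has_derivative[OF dt_deriv[OF Suc.prems]]]) (use Suc in simp)
qed simp

lemma dt_affine:
assumes "bounded_linear A"
shows "diff_times n f ==> diff_times n (%x. f (A x + b))"
proof (induction n arbitrary: f)
case (Suc n)
have "((%x. A x + b) hder A) (at x)" for x by (rule has_derivative_add_const[OF bounded_linear_imp_has_derivative[OF assms]])
then have "((%x. f (A x + b)) hder (%h. fd f (A x + b) (A h))) (at x)" for x
 by (rule has_derivative_compose[OF _ dt_deriv[OF Suc.prems]])
then show ?case using Suc by (intro dt_SucI) auto
qed simp

lemma (in bounded_bilinear) dt_prod:
"diff_times n f ==> diff_times n g ==> diff_times n (%x. prod (f x) (g x))"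
proof (induction n arbitrary: f g)
case (Suc n)
show ?case
proof (rule dt_SucI)
 show "((%x. prod (f x) (g x)) hder
   (%h. prod (f x) (fd g x h) + prod (fd f x h) (g x))) (at x)" for x
  by (rule FDERIV[OF dt_deriv[OF Suc.prems(1)] dt_deriv[OF Suc.prems(2)]])
 show "diff_times n (%x. prod (f x) (fd g x h) + prod (fd f x h) (g x))" for h
  by (rule dt_add[OF Suc.IH[OF dt_Suc_imp[OF Suc.prems(1)] dt_frechet[OF Suc.prems(2)]]
    Suc.IH[OF dt_frechet[OF Suc.prems(1)] dt_Suc_imp[OF Suc.prems(2)]]])
qed
qed simp

lemma dt_real_compose: fixes g :: "real => real" shows "diff_times n g ==> diff_times n f ==> diff_times n (%x. g (f x))"
proof (induction n arbitrary: f g)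
case (Suc n)
let ?a = "%x h. fd f x h * fd g (f x) 1"
show ?case
proof (rule dt_SucI)
 fix x
 have lin: "linear (fd g (f x))" using dt_deriv[OF Suc.prems(1)] has_derivative_linear by blast
 have "(%h. fd g (f x) (fd f x h)) =
   (%h. ?a x h)"
 proof
  fix h
  show "fd g (f x) (fd f x h) =
    ?a x h" using linear_scale[OF lin, of "fd f x h" 1] by simp
 qed
 then show "((%x. g (f x)) hder (%h. ?a x h)) (at x)"
  using has_derivative_compose[OF dt_deriv[OF Suc.prems(2)] dt_deriv[OF Suc.prems(1)], of x] by (simp only:)
next
 fix h
 show "diff_times n (%x. ?a x h)" by (rule bounded_bilinear.dt_prod[OF bounded_bilinear_mult dt_frechet[OF Suc.prems(2)]
    Suc.IH[OF dt_frechet[OF Suc.prems(1)] dt_Suc_imp[OF Suc.prems(2)]]])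
qed
qed simp

lemma smooth_const: "smooth (%x. c)" by (simp add: smooth_iff_dt dt_const)

lemma smooth_add: "smooth f ==> smooth g ==> smooth (%x. f x + g x)" by (simp add: smooth_iff_dt dt_add)

lemma smooth_bdd_linear: "bounded_linear L ==> smooth f ==> smooth (%x. L (f x))"
by (simp add: smooth_iff_dt bounded_linear.dt_compose)

lemma smooth_mult: "smooth f ==> smooth g ==> smooth (%x. f x * g x :: 'a :: real_normed_algebra)"
by (simp add: smooth_iff_dt bounded_bilinear.dt_prod[OF bounded_bilinear_mult])

lemma smooth_affine: "bounded_linear A ==> smooth f ==> smooth (%x. f (A x + b))" by (simp add: smooth_iff_dt dt_affine)

lemma smooth_real_compose: "smooth (g :: real => real) ==> smooth f ==> smooth (%x. g (f x))"
by (simp add: smooth_iff_dt dt_real_compose)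

lemma smooth_linear: "bounded_linear L ==> smooth L"
by (rule smoothI[where f' = "%x. L"]) (auto intro: bounded_linear_imp_has_derivative smooth_const)

lemma smooth_prod:
assumes "finite I" "!!i. i : I ==> smooth (f i)"
shows "smooth (%x. \<Prod>i\<in>I. f i x :: 'a :: real_normed_field)"
using assms by (induction I) (auto intro: smooth_const smooth_mult)

lemma smooth_exp: "smooth (exp :: real => real)"
proof -
have "diff_times n (%x :: real. c * exp x)" for n c
proof (induction n arbitrary: c)
 case (Suc n)
 show ?case
 proof (rule dt_SucI)
  show "((%x. c * exp x) hder (%h. c * (exp x * h))) (at x)" for x by (auto intro!: derivative_eq_intros)
  show "diff_times n (%x. c * (exp x * h))" for h using Suc[of "c * h"] by (simp add: mult_ac)
 qed
qed simp
from this[of _ 1] show ?thesis by (simp add: smooth_iff_dt)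
qed

definition flat :: "real poly => real => real" where
"flat p x = (if 0 < x then poly p (1 / x) * exp (- (1 / x)) else 0)"

lemma poly_mult_exp_tendsto_0: "((%y :: real. poly p y * exp (- y)) ---> 0) at_top"
proof -
let ?a = "%y. \<Sum>i\<le>degree p. poly.coeff p i * (y ^ i / exp y)"
have "((%y :: real. ?a y) ---> (\<Sum>i\<le>degree p. poly.coeff p i * 0)) at_top"
 by (intro tendsto_intros tendsto_power_div_exp_0)
moreover have "?a y = poly p y * exp (- y)" for y :: real
 by (simp add: poly_altdef sum_distrib_right exp_minus divide_inverse mult.assoc)
ultimately show ?thesis by simp
qed

lemma flat_tendsto_0: "((%x. flat p x / x) ---> 0) (at 0)"
proof (rule filterlim_split_at)
show "((%x. flat p x / x) ---> 0) (at_left 0)" by (rule tendsto_eventually) (auto simp: flat_def eventually_at_filter)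
let ?a = "%x. poly (p * [:0, 1:]) (inverse x) * exp (- inverse x)"
have "((%x. ?a x) ---> 0) (at_right 0)" by (rule filterlim_compose[OF poly_mult_exp_tendsto_0 filterlim_inverse_at_top_right])
moreover have "eventually (%x. ?a x = flat p x / x) (at_right 0)" by (auto simp: flat_def eventually_at_filter field_simps)
ultimately show "((%x. flat p x / x) ---> 0) (at_right 0)" by (rule Lim_transform_eventually)
qed

lemma flat_deriv: "(flat p has_real_derivative flat (monom 1 2 * (p - pderiv p)) x) (at x)"
proof -
consider "x < 0" | "x = 0" | "0 < x" by linarith
then show ?thesis
proof cases
 case 1
 have "(flat p has_real_derivative 0) (at x)"
  by (rule has_field_derivative_transform_within_open[of "%x. 0" 0 x "{..<0}"]) (use 1 in "auto simp: flat_def")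
 then show ?thesis using 1 by (simp add: flat_def)
next
 case 2
 then show ?thesis using flat_tendsto_0[of p] by (simp add: has_field_derivative_iff flat_def)
next
 case 3
 have d: "((%x. 1 / x) has_real_derivative - (1 / x^2)) (at x)"
  using 3 by (auto intro!: derivative_eq_intros simp: power2_eq_square)
 have "((%x. exp (- (1 / x))) has_real_derivative exp (- (1 / x)) * (- (- (1 / x^2)))) (at x)"
  by (rule DERIV_chain2[OF DERIV_exp DERIV_minus[OF d]])
 from DERIV_mult[OF DERIV_chain2[OF poly_DERIV d] this, of p]
 have "((%x. poly p (1 / x) * exp (- (1 / x))) has_real_derivative flat (monom 1 2 * (p - pderiv p)) x) (at x)"
  using 3 by (simp add: flat_def poly_monom power_divide left_diff_distrib right_diff_distrib mult_ac)
 then show ?thesis by (rule has_field_derivative_transform_within_open[of _ _ x "{0<..}"]) (use 3 in "auto simp: flat_def")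
qed
qed

lemma smooth_flat: "smooth (flat p)"
proof -
have "diff_times n (%x. c * flat p x)" for n c p
proof (induction n arbitrary: c p)
 case (Suc n)
 show ?case
 proof (rule dt_SucI)
  show "((%x. c * flat p x) hder (%h. c * (flat (monom 1 2 * (p - pderiv p)) x * h))) (at x)" for x
   using flat_deriv[of p x] by (auto intro!: derivative_eq_intros simp: has_field_derivative_def)
  show "diff_times n (%x. c * (flat (monom 1 2 * (p - pderiv p)) x * h))" for h using Suc[of "c * h"] by (simp add: mult_ac)
 qed
qed simp
from this[of _ 1] show ?thesis by (simp add: smooth_iff_dt)
qed

definition bump :: "'a::euclidean_space => 'a => 'a => real" where
"bump a b x = (\<Prod>i\<in>Basis. flat 1 (inner (x - a) i) * flat 1 (inner (b - x) i))"

lemma smooth_bump: "smooth (bump a b)" unfolding bump_def[abs_def]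
proof (intro smooth_prod smooth_mult)
fix i :: 'a
have "smooth (%x. flat 1 (inner (x + - a) i))"
 by (intro smooth_real_compose[OF smooth_flat] smooth_affine[of "%x. x" "%x. inner x i" "- a"] smooth_linear
    bounded_linear_ident bounded_linear_inner_left)
then show "smooth (%x. flat 1 (inner (x - a) i))" by simp
have "smooth (%x. flat 1 (inner (- x + b) i))"
 by (intro smooth_real_compose[OF smooth_flat] smooth_affine[of "%x. - x" "%x. inner x i" "b"] smooth_linear
    bounded_linear_minus bounded_linear_ident bounded_linear_inner_left)
then show "smooth (%x. flat 1 (inner (b - x) i))" by simp
qed auto

lemma bump_pos: "x : box a b ==> 0 < bump a b x"
unfolding bump_def mem_box by (intro prod_pos) (auto simp: flat_def inner_diff_left)

lemma bump_nonneg: "0 <= bump a b x" unfolding bump_def by (intro prod_nonneg) (auto simp: flat_def)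

lemma bump_eq_0: "x ~: box a b ==> bump a b x = 0" unfolding bump_def mem_box by (auto simp: flat_def inner_diff_left)

lemma smooth_box_approx:
obtains c :: "nat => 'a::euclidean_space => real"
where "!!j. smooth (c j)" "!!j x. 0 <= c j x" "!!j x. c j x <= 1" "!!j x. x ~: box a b ==> c j x = 0"
 "!!x. (%j. c j x) ----> ind (box a b) x"
proof
let ?c = "%(j::nat) x. 1 + (- 1) * exp (- real j * bump a b x)"
show "smooth (?c j)" for j
 by (intro smooth_add smooth_mult[OF smooth_const] smooth_const smooth_real_compose[OF smooth_exp] smooth_bump)
show "0 <= ?c j x" "?c j x <= 1" for j x using bump_nonneg[of a b x] by auto
show "?c j x = 0" if "x ~: box a b" for j x using bump_eq_0[OF that] by simp
show "(%j. ?c j x) ----> ind (box a b) x" for x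
proof (cases "x : box a b")
 case True
 have "filterlim (%j. real j * bump a b x) at_top sequentially"
  using bump_pos[OF True] by (intro filterlim_at_top_mult_tendsto_pos[OF tendsto_const] filterlim_real_sequentially) auto
 then have "filterlim (%j. - real j * bump a b x) at_bot sequentially" by (simp add: filterlim_uminus_at_top)
 then have "(%j. exp (- real j * bump a b x)) ----> 0" by (rule filterlim_compose[OF exp_at_bot])
 then have "(%j. ?c j x) ----> 1 + (- 1) * 0" by (intro tendsto_intros)
 then show ?thesis using True by simp
qed (simp add: bump_eq_0)
qed

lemma cl_supp_in_box: fixes f :: "'a::euclidean_space => 'b::zero"
assumes "!!x. x ~: box a b ==> f x = 0"
shows "supp f <= cbox a b" "compact (supp f)"
proof -
have "{x. f x ~= 0} <= cbox a b" using assms box_subset_cbox by blast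
then show *: "supp f <= cbox a b" by (rule closure_minimal) (rule closed_cbox)
show "compact (supp f)" using bounded_subset[OF bounded_cbox *] by (simp add: compact_eq_bounded_closed)
qed

lemma flemma_box: fixes M :: "'a::euclidean_space measure" and f :: "'a => real"
assumes M: "sets M = sets borel" and f: "integrable M f" and cd: "cbox c d <= U"
 and test: "!!h. smooth h ==> compact (supp h) ==> supp h <= U ==>
  (LINT x|M. h x * f x) = 0"
shows "AE x in M. x : box c d --> f x = 0"
proof -
note [measurable_cong] = M
have fM[measurable]: "f : borel_measurable M" using f by simp
define g where "g x = ind (box c d) x * f x" for x
have gM[measurable]: "g : borel_measurable M" unfolding g_def by measurable
have g: "integrable M g" using integrable_mult_indicator[of "box c d" M f] f unfolding g_def by (simp add: M)
have si: "set_integrable M A g" if "A : sets M" for A using integrable_mult_indicator[OF that g] by (simp add: set_integrable_def)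
have box: "(LINT x:box a b|M. g x) = 0" for a b
proof -
 obtain a' b' where ab: "box a b \<inter> box c d = box a' b'" by (rule that[OF box_Int_box])
 obtain h :: "nat => 'a => real" where h: "!!j. smooth (h j)" "!!j x. 0 <= h j x" "!!j x. h j x <= 1"
  "!!j x. x ~: box a' b' ==> h j x = 0" "!!x. (%j. h j x) ----> ind (box a' b') x" using smooth_box_approx[of a' b'] by blast
 have sub: "closure {x. h j x ~= 0} <= U" for j
 proof -
  have "{x. h j x ~= 0} <= cbox c d" using h(4) ab box_subset_cbox[of c d] by blast
  then have "closure {x. h j x ~= 0} <= cbox c d" by (rule closure_minimal) (rule closed_cbox)
  then show ?thesis using cd by blast
 qed
 have [measurable]: "h j : borel_measurable M" for j
  using bmc_onI[OF smooth_cont[OF h(1)[of j]]] by (simp cong: measurable_cong_sets add: M)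
 let ?a = "LINT x|M. ind (box a' b') x * f x"
 have "(%j. (LINT x|M. h j x * f x)) ----> ?a"
 proof (rule integral_dominated_convergence)
  show "integrable M (%x. abs (f x))" using f by simp
  show "AE x in M. (%j. h j x * f x) ----> ind (box a' b') x * f x" by (intro AE_I2 tendsto_mult h(5) tendsto_const)
  show "AE x in M. norm (h j x * f x) <= abs (f x)" for j using h(2,3) by (intro AE_I2) (simp add: abs_mult mult_left_le_one_le)
 qed measurable
 moreover have "(LINT x|M. h j x * f x) = 0" for j by (rule test[OF h(1) _ sub]) (rule cl_supp_in_box(2)[of a' b'], rule h(4))
 ultimately have "?a = 0" by (simp add: LIMSEQ_const_iff)
 moreover have "(LINT x:box a b|M. g x) = ?a" unfolding set_lint_def g_def ab[symmetric]
  by (intro integral_cong) (auto simp: indicator_def)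
 ultimately show ?thesis by simp
qed
have total: "(LINT x:UNIV|M. g x) = 0"
proof -
 have "(LINT x:UNIV|M. g x) = (LINT x:box c d|M. g x)"
  unfolding set_lint_def g_def by (intro integral_cong) (auto simp: indicator_def)
 then show ?thesis using box by simp
qed
have zero: "(LINT x:A|M. g x) = 0" if A: "A : sets borel" for A
proof -
 have S: "sigma_sets UNIV (range (%(a, b). box a b :: 'a set)) = sets M"
  unfolding M by (subst borel_eq_box) (simp add: sets_measure_of)
 have "Int_stable (range (%(a, b). box a b :: 'a set))" by (auto simp: Int_stable_def box_Int_box)
 moreover have "range (%(a, b). box a b :: 'a set) <= Pow UNIV" by auto
 moreover have "A : sigma_sets UNIV (range (%(a, b). box a b))" using A unfolding S M .
 ultimately show ?thesis
 proof (induction rule: sigma_sets_induct_disjoint)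
  case (basic A) then show ?case using box by auto
 next
  case empty show ?case by (simp add: set_lint_def)
 next
  case (compl A)
  then have AM: "A : sets M" "UNIV - A : sets M" unfolding S by (auto simp: M)
  have "(LINT x:A \<union> (UNIV - A)|M. g x) = (LINT x:A|M. g x) + (LINT x:UNIV - A|M. g x)"
   by (rule set_integral_Un) (use si AM in auto)
  then show ?case using total compl by (simp add: Un_UNIV_right Un_commute)
 next
  case (union A)
  then have AM: "A i : sets M" for i unfolding S by auto
  have "(LINT x:(\<Union>i. A i)|M. g x) = (\<Sum>i. (LINT x:(A i)|M. g x))"
   by (rule lebesgue_integral_countable_add) (use union si AM in "auto simp: disjoint_family_on_def")
  then show ?case using union by simp
 qed
qed
have sgn: "AE x in M. \<not> 0 < s * g x" for s :: real
proof -
 define A where "A = {x : space M. 0 < s * g x}"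
 have AM: "A : sets M" unfolding A_def by measurable
 let ?b = "%x. ind A x * (s * g x)"
 have "(LINT x|M. ?b x) = s * (LINT x:A|M. g x)"
  unfolding set_lint_def by (subst Bochner_Integration.integral_mult_right_zero[symmetric]) (simp add: mult_ac)
 also have "... = 0" using zero AM M by simp
 finally have 0: "(LINT x|M. ?b x) = 0" .
 have "integrable M (%x. ?b x)" using integrable_mult_indicator[OF AM, of "%x. s * g x"] g by simp
 then have "AE x in M. ?b x = 0" using integral_nonneg_eq_0_iff_AE[of M "%x. ?b x"] 0 by (auto simp: A_def indicator_def)
 then show ?thesis using AE_space by eventually_elim (auto simp: A_def indicator_def)
qed
show ?thesis using sgn[of 1] sgn[of "-1"] by eventually_elim (auto simp: g_def)
qed

lemma flemma_real: fixes M :: "'a::euclidean_space measure" and f :: "'a => real"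
assumes M: "sets M = sets borel" and f: "integrable M f" and U: "open U"
 and test: "!!g. smooth g ==> compact (supp g) ==> supp g <= U ==>
  (LINT x|M. g x * f x) = 0"
shows "AE x in M. x : U --> f x = 0"
proof -
define F where "F = {box c d | c d :: 'a. cbox c d <= U}"
obtain F' where F': "F' <= F" "countable F'" "\<Union>F' = \<Union>F"
proof (rule Lindelof[of F])
 show "open S" if "S : F" for S using that unfolding F_def by auto
qed
have cov: "U <= \<Union>F"
proof
 fix x assume "x : U"
 then obtain a b where "cbox a b <= U" "x : box a b" using open_contains_cbox[OF U] by metis
 then show "x : \<Union>F" unfolding F_def by blast
qed
have "AE x in M. x : X --> f x = 0" if X: "X : F'" for X
proof -
 have "X : F" using X F'(1) by blast
 then obtain c d where "X = box c d" "cbox c d <= U" unfolding F_def by blast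
 then show ?thesis using flemma_box[OF M f _ test] by simp
qed
then have "AE x in M. ALL X:F'. x : X --> f x = 0" by (subst AE_ball_countable[OF F'(2)]) blast
then show ?thesis using cov F'(3) by (auto elim!: eventually_mono)
qed

lemma flemma: fixes M :: "'a::euclidean_space measure" and f :: "'a => 'b::euclidean_space"
assumes M: "sets M = sets borel" and f: "integrable M f" and U: "open U"
 and test: "!!c :: 'a => real. smooth c ==> compact (supp c) ==> supp c <= U ==>
  (LINT x|M. c x *r f x) = 0"
shows "AE x in M. x : U --> f x = 0"
proof -
have "AE x in M. x : U --> inner (f x) b = 0" for b
proof (rule flemma_real[OF M _ U])
 show "integrable M (%x. inner (f x) b)" using f by simp
 fix c :: "'a => real"
 assume c: "smooth c" "compact (supp c)" "supp c <= U"
 have [measurable]: "c : borel_measurable M" using bmc_onI[OF smooth_cont[OF c(1)]] by (simp cong: measurable_cong_sets add: M)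
 have "bounded (range c)"
 proof -
  have "compact (c ` supp c)" using c smooth_cont compact_continuous_image by blast
  then have "bounded (insert 0 (c ` supp c))" using compact_imp_bounded by simp
  moreover have "range c <= insert 0 (c ` supp c)" using closure_subset by fastforce
  ultimately show ?thesis by (rule bounded_subset)
 qed
 then obtain B where B: "!!x. abs (c x) <= B" by (auto simp: bounded_iff)
 have "integrable M (%x. c x *r f x)"
 proof (rule integrable_bound)
  show "integrable M (%x. B *r f x)" using f by simp
  have "norm (c x *r f x) <= norm (B *r f x)" for x using B[of x] by (auto intro!: mult_right_mono)
  then show "AE x in M. norm (c x *r f x) <= norm (B *r f x)" by simp
  show "(%x. c x *r f x) : borel_measurable M" using borel_measurable_integrable[OF f] by measurable
 qed
 then have "(LINT x|M. inner (c x *r f x) b) = inner (LINT x|M. c x *r f x) b" by (rule integral_inner_left)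
 then show "(LINT x|M. c x * inner (f x) b) = 0" using test[OF c] by simp
qed
then have "AE x in M. ALL b:Basis. x : U --> inner (f x) b = 0" by (intro AE_finite_allI finite_Basis) blast
then show ?thesis
proof eventually_elim
 case (elim x)
 show ?case
 proof
  assume "x : U"
  show "f x = 0"
  proof (rule euclidean_eqI)
   fix b :: 'b assume "b : Basis"
   with elim `x \<in> U` show "inner (f x) b = inner 0 b" unfolding inner_zero_left by blast
  qed
 qed
qed
qed

lemma compl_borel_version: fixes f :: "'a::euclidean_space => 'b::euclidean_space"
assumes "f : borel_measurable lebesgue"
obtains g where "g : BM" "AEL x. f x = g x"
proof -
have "EX g:borel_measurable lborel. AEL x. inner (f x) b = g x" for b
 using assms by (intro completion_ex_borel_measurable_real) simp
then obtain g where g: "!!b. g b : borel_measurable lborel" "!!b. AEL x. inner (f x) b = g b x" by metis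
have "AEL x. ALL b:Basis. inner (f x) b = g b x" using g(2) by (intro AE_finite_allI finite_Basis) blast
then have "AEL x. f x = (\<Sum>b\<in>Basis. g b x *r b)"
 by eventually_elim (metis (no_types, lifting) euclidean_representation sum.cong)
moreover have "(%x. \<Sum>b\<in>Basis. g b x *r b) : BM" using g(1) by simp
ultimately show thesis using that by blast
qed

lemma flemma_leb: fixes f :: "'a::euclidean_space => 'b::euclidean_space"
assumes U: "open U" and f: "integrable (lebesgue_on U) f"
 and test: "!!c :: 'a => real. smooth c ==> compact (supp c) ==> supp c <= U ==>
  (LINT x|lebesgue_on U. c x *r f x) = 0"
shows "AE x in lebesgue_on U. f x = 0"
proof -
have UL: "U \<inter> space lebesgue : sets lebesgue" using U by simp
let ?a = "%x. ind U x *r f x"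
have i: "integrable lebesgue (%x. ?a x)" using f integrable_restrict_space[OF UL] by blast
obtain g where g[measurable]: "g : BM" and fg: "AEL x. ?a x = g x"
 using compl_borel_version[OF borel_measurable_integrable[OF i]] by blast
have fg': "AE x in lebesgue. ?a x = g x" using fg by (rule AE_completion)
have "integrable lebesgue g" using i fg' by (subst integrable_cong_AE[of _ _ "%x. ?a x"]) (auto intro: measurable_completion)
then have gi: "ilb g" by (simp add: integrable_completion)
have "AEL x. x : U --> g x = 0"
proof (rule flemma[OF _ gi U])
 fix c :: "'a => real"
 assume c: "smooth c" "compact (supp c)" "supp c <= U"
 have m[measurable]: "c : BM" using bmc_onI[OF smooth_cont[OF c(1)]] .
 have "(LB x. c x *r g x) = (LINT x|lebesgue. c x *r g x)" by (subst integral_completion) auto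
 also have "... = (LINT x|lebesgue. ind U x *r (c x *r f x))"
 proof (rule integral_cong_AE)
  show "AE x in lebesgue. c x *r g x = ind U x *r (c x *r f x)" using fg'
  proof eventually_elim
   case (elim x)
   show ?case unfolding elim[symmetric] by (simp add: mult.commute)
  qed
  have "(%x. c x *r ?a x) : borel_measurable lebesgue"
   using m by (intro borel_measurable_scaleR[OF _ borel_measurable_integrable[OF i]] measurable_completion) simp
  then show "(%x. ind U x *r (c x *r f x)) : borel_measurable lebesgue" by (simp add: mult.commute)
 qed (auto intro!: measurable_completion)
 also have "... = (LINT x|lebesgue_on U. c x *r f x)" by (rule integral_restrict_space[OF UL, symmetric])
 also have "... = 0" by (rule test[OF c])
 finally show "(LB x. c x *r g x) = 0" .
qed simp
then have "AE x in lebesgue. x : U --> g x = 0" by (rule AE_completion)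
with fg' have "AE x in lebesgue. x : U --> f x = 0"
proof eventually_elim
 case (elim x)
 then show ?case by (cases "x : U") simp_all
qed
then show ?thesis by (subst AE_restrict_space_iff[OF UL])
qed

lemma smooth_onorm_bdd_on_compact: fixes f :: "'a::euclidean_space => 'b::real_normed_vector"
assumes f: "smooth f" and K: "compact K"
obtains C where "0 <= C" "!!x. x : K ==> onorm (fd f x) <= C"
proof -
have "EX B. ALL x:K. norm (fd f x i) <= B" for i
proof -
 have "bounded ((%x. fd f x i) ` K)" by (intro compact_imp_bounded compact_continuous_image K smooth_cont smooth_frechet f)
 then show ?thesis unfolding bounded_iff by blast
qed
then obtain B where B: "!!i x. x : K ==> norm (fd f x i) <= B i" by metis
show thesis
proof
 let ?a = "\<Sum>i\<in>Basis. abs (B i)"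
 show "0 <= ?a" by (simp add: sum_nonneg)
 fix x assume x: "x : K"
 have lin: "linear (fd f x)" using smooth_deriv[OF f] has_derivative_linear by blast
 show "onorm (fd f x) <= ?a"
 proof (rule onorm_le)
  fix h :: 'a
  have "fd f x h = fd f x (\<Sum>i\<in>Basis. inner h i *r i)" by (simp add: euclidean_representation)
  also have "... = (\<Sum>i\<in>Basis. inner h i *r fd f x i)" by (simp add: linear_sum[OF lin] linear_scale[OF lin])
  also have "norm ... <= (\<Sum>i\<in>Basis. abs (B i) * norm h)"
  proof (rule sum_norm_le)
   fix i :: 'a assume i: "i : Basis"
   have "abs (inner h i) * norm (fd f x i) <= norm h * abs (B i)"
    using Basis_le_norm[OF i] B[OF x, of i] by (intro mult_mono) auto
   then show "norm (inner h i *r fd f x i) <= abs (B i) * norm h" by (simp add: mult.commute)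
  qed
  finally show "norm (fd f x h) <= ?a * norm h" by (simp add: sum_distrib_right)
 qed
qed
qed

lemma fd_off_supp:
assumes "x ~: supp f"
shows "fd f x h = 0"
proof -
have "(f hder (%h. 0)) (at x)" by (rule has_derivative_transform_within_open[of "%x. 0" _ x UNIV "- supp f"])
   (use assms closure_subset[of "{x. f x ~= 0}"] in auto)
then show ?thesis using frechet_derivative_at by metis
qed

lemma smooth_compact_supp_lip: fixes f :: "'a::euclidean_space => 'b::real_normed_vector"
assumes f: "smooth f" and K: "compact (supp f)"
obtains C where "C-lip UNIV f"
proof -
obtain C where C: "0 <= C" "!!x. x : supp f ==> onorm (fd f x) <= C" using smooth_onorm_bdd_on_compact[OF f K] by blast
have "onorm (fd f x) <= C" for x
proof (cases "x : supp f")
 case False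
 show ?thesis by (rule onorm_le) (simp add: fd_off_supp[OF False] C(1))
qed (rule C(2))
then have "C-lip UNIV f"
 by (intro bounded_derivative_imp_lipschitz[OF has_derivative_at_withinI[OF smooth_deriv[OF f]] convex_UNIV _ C(1)])
then show thesis by (rule that)
qed

lemma intbl_cont_bdd_supp: fixes f :: "'a::euclidean_space => 'b::{banach, second_countable_topology}"
assumes f: "cont UNIV f" and S: "bounded S" "!!x. x ~: S ==> f x = 0"
shows "ilb f"
proof -
obtain R where R: "ALL x:S. norm x <= R" using S(1) unfolding bounded_iff by blast
let ?a = "%x. ind (cball 0 R) x *r f x"
have "?a = f"
proof
 fix x
 show "ind (cball 0 R) x *r f x = f x" using R S(2)[of x] by (cases "x : S") auto
qed
moreover have "ilb ?a" by (rule borel_integrable_compact) (auto intro: continuous_on_subset[OF f])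
ultimately show ?thesis by simp
qed

lemma lb_int_affine: fixes f :: "'a::euclidean_space => 'b::{banach, second_countable_topology}"
assumes [measurable]: "f : BM" and c: "c ~= 0"
shows "(LB x. f x) = abs c ^ DIM('a) *r (LB x. f (t + c *r x))"
proof -
let ?a = "distr lborel borel (%x. t + c *r x)"
have "(LB x. f x) = (\<integral>x. f x \<partial>density ?a (%_. ennreal (abs c ^ DIM('a))))"
 using lborel_affine[OF c, of t] by (simp add: ennreal_power)
also have "... = (\<integral>x. abs c ^ DIM('a) *r f x \<partial>?a)" by (rule integral_density) auto
also have "... = (LB x. abs c ^ DIM('a) *r f (t + c *r x))" by (rule integral_distr) auto
finally show ?thesis by simp
qed

lemma intbl_scaleR_iff: fixes f :: "'a => 'b::{banach, second_countable_topology}"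
assumes "c ~= 0"
shows "integrable M (%x. c *r f x) \<longleftrightarrow> integrable M f"
proof
assume "integrable M (%x. c *r f x)"
then have "integrable M (%x. inverse c *r (c *r f x))" by (rule integrable_scaleR_right)
then show "integrable M f" using assms by simp
qed (rule integrable_scaleR_right)

lemma lb_intbl_affine: fixes f :: "'a::euclidean_space => 'b::{banach, second_countable_topology}"
assumes [measurable]: "f : BM" and c: "c ~= 0"
shows "ilb f \<longleftrightarrow> ilb (%x. f (t + c *r x))"
proof -
let ?a = "distr lborel borel (%x. t + c *r x)"
have "ilb f \<longleftrightarrow> integrable (density ?a (%_. ennreal (abs c ^ DIM('a)))) f"
 using lborel_affine[OF c, of t] by (simp add: ennreal_power)
also have "... \<longleftrightarrow> integrable ?a (%x. abs c ^ DIM('a) *r f x)" by (rule integrable_density) auto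
also have "... \<longleftrightarrow> ilb (%x. abs c ^ DIM('a) *r f (t + c *r x))" by (rule integrable_distr_eq) auto
also have "... \<longleftrightarrow> ilb (%x. f (t + c *r x))" using c by (intro intbl_scaleR_iff) simp
finally show ?thesis .
qed

abbreviation "dq f v n x == real (Suc n) *r (f (x + (1 / real (Suc n)) *r v) - f x)"

lemma dq_LIMSEQ:
assumes "(f hder f') (at x)"
shows "(%n. dq f v n x) ----> f' v"
proof (cases "v = 0")
case True
then show ?thesis by (simp add: linear_0[OF has_derivative_linear[OF assms]])
next
case False
let ?y = "%n. x + (1 / real (Suc n)) *r v"
let ?a = "%n. norm (f (?y n) - f x - f' (?y n - x)) / norm (?y n - x)"
have "?y ----> x + 0 *r v" using LIMSEQ_inverse_real_of_nat by (intro tendsto_intros) (simp add: inverse_eq_divide)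
then have "filterlim ?y (at x) sequentially" using False by (auto simp: filterlim_at)
moreover have "((%y. norm (f y - f x - f' (y - x)) / norm (y - x)) ---> 0) (at x)"
 using assms by (simp add: has_derivative_iff_norm)
ultimately have "(%n. ?a n) ----> 0" by (rule filterlim_compose[rotated])
then have "(%n. norm v * ?a n) ----> norm v * 0" by (rule tendsto_mult_left)
moreover have "norm v * ?a n = norm (dq f v n x - f' v)" for n
proof -
 have "f (?y n) - f x - f' (?y n - x) = (1 / real (Suc n)) *r (dq f v n x - f' v)"
  by (simp add: linear_scale[OF has_derivative_linear[OF assms]] scaleR_diff_right del: of_nat_Suc)
 then show ?thesis using False by (simp del: of_nat_Suc)
qed
ultimately have "(%n. norm (dq f v n x - f' v)) ----> 0" by (simp only: mult_zero_right)
then show ?thesis by (subst (asm) tendsto_norm_zero_iff) (simp only: LIM_zero_iff)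
qed

lemma lip_dq_bound:
assumes "L-lip UNIV f"
shows "norm (dq f v n x) <= L * norm v"
proof -
let ?a = "x + (1 / real (Suc n)) *r v"
have "norm (f ?a - f x) <= L * (norm v / real (Suc n))" using lipschitz_onD[OF assms, of "?a" x] by (simp add: dist_norm)
then have "real (Suc n) * norm (f ?a - f x) <= real (Suc n) * (L * (norm v / real (Suc n)))" by (rule mult_left_mono) simp
then show ?thesis by (simp del: of_nat_Suc)
qed

lemma ibp_dir: fixes f :: "'a::euclidean_space => 'b::euclidean_space" and c :: "'a => real"
assumes lip: "L-lip UNIV f" and c: "smooth c" "compact (supp c)"
 and g[measurable]: "g : BM" and lim: "AEL x. (%n. dq f v n x) ----> g x"
shows "(LB x. c x *r g x) = - (LB x. fd c x v *r f x)" and "ilb (%x. c x *r g x)"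
proof -
have fc: "cont UNIV f" using lip by (rule lipschitz_on_continuous_on)
have cc: "cont UNIV c" using c(1) by (rule smooth_cont)
have fdc: "cont UNIV (%x. fd c x w)" for w by (rule smooth_cont[OF smooth_frechet[OF c(1)]])
have [measurable]: "f : BM" "c : BM" "(%x. fd c x w) : BM" for w using fc cc fdc by (auto intro: bmc_onI)
have S: "c x = 0" if "x ~: supp c" for x using that closure_subset[of "{x. c x ~= 0}"] by blast
note bS = compact_imp_bounded[OF c(2)]
obtain R where "supp c <= ball 0 R" using bounded_subset_ballD[OF bS] by blast
then have R: "supp c <= cball 0 R" using ball_subset_cball by (rule order_trans)
obtain C where C: "C-lip UNIV c" using smooth_compact_supp_lip[OF c] by blast
let ?c = "%x. norm (c x) * (L * norm v)"
have ic: "ilb ?c"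
proof (rule intbl_cont_bdd_supp[OF _ bS])
 show "cont UNIV ?c" by (intro continuous_intros cc)
qed (simp only: S norm_zero mult_zero_left not_False_eq_True)
have b1: "AEL x. norm (c x *r dq f v n x) <= norm (c x) * (L * norm v)" for n
 unfolding norm_scaleR[of "c _"] real_norm_def by (intro AE_I2 mult_left_mono lip_dq_bound[OF lip] abs_ge_zero)
have lim1: "AEL x. (%n. c x *r dq f v n x) ----> c x *r g x" using lim by eventually_elim (intro tendsto_intros)
show "ilb (%x. c x *r g x)" by (rule integrable_dominated_convergence[OF _ _ ic lim1 b1]) measurable
have l1: "(%n. LB x. c x *r dq f v n x) ----> (LB x. c x *r g x)"
 by (rule integral_dominated_convergence[OF _ _ ic lim1 b1]) measurable
let ?K = "cball 0 (R + norm v)"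
have z: "dq c (- v) n x = 0" if x: "x ~: ?K" for n x
proof -
 let ?w = "(1 / real (Suc n)) *r v"
 have "norm ?w <= norm v" by (simp add: divide_le_eq mult_le_cancel_left1)
 moreover have "R + norm v < norm x" using x by simp
 ultimately have "R < norm x" "R < norm (x - ?w)" using norm_triangle_sub[of x ?w] norm_ge_zero[of v] by linarith+
 then have "x ~: cball 0 R" "x - ?w ~: cball 0 R" by simp_all
 then have "c x = 0" "c (x - ?w) = 0" using S R by blast+
 then show ?thesis by simp
qed
let ?a = "%n x. dq c (- v) n x *r f x"
let ?b = "%x. ind ?K x *r (C * norm v * norm (f x))"
have b2: "AEL x. norm (?a n x) <= ?b x" for n
proof (rule AE_I2)
 fix x show "norm (?a n x) <= ?b x"
 proof (cases "x : ?K")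
  case True
  then show ?thesis unfolding norm_scaleR[of "dq c (- v) n x"]
   using mult_right_mono[OF lip_dq_bound[OF C, where v = "- v" and n = n and x = x] norm_ge_zero[of "f x"]] by simp
 next
  case False
  then show ?thesis by (simp only: z[OF False]) simp
 qed
qed
have l2: "(%n. LB x. ?a n x) ----> (LB x. fd c x (- v) *r f x)"
proof (rule integral_dominated_convergence[OF _ _ _ AE_I2 b2])
 show "ilb (%x. ?b x)" by (rule borel_integrable_compact) (auto intro!: continuous_intros continuous_on_subset[OF fc])
 show "(%n. ?a n x) ----> fd c x (- v) *r f x" for x by (intro tendsto_intros dq_LIMSEQ smooth_deriv[OF c(1)])
qed measurable
have eq: "(LB x. c x *r dq f v n x) = (LB x. ?a n x)" for n
proof -
 let ?w = "(1 / real (Suc n)) *r v"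
 let ?h = "%x. c (x - ?w) *r f x"
 have i1: "ilb (%x. c x *r f (x + ?w))"
 proof (rule intbl_cont_bdd_supp[OF _ bS])
  show "cont UNIV (%x. c x *r f (x + ?w))"
   by (intro continuous_on_scaleR cc continuous_on_compose2[OF fc]) (auto intro!: continuous_intros)
 qed (simp only: S scaleR_zero_left not_False_eq_True)
 have i2: "ilb (%x. c x *r f x)"
  by (rule intbl_cont_bdd_supp[OF continuous_on_scaleR[OF cc fc] bS]) (simp only: S scaleR_zero_left not_False_eq_True)
 have i3: "ilb ?h" using lb_intbl_affine[of ?h 1 ?w] i1 by (simp add: add.commute)
 have tr: "(LB x. ?h x) = (LB x. c x *r f (x + ?w))" using lb_int_affine[of ?h 1 ?w] by (simp add: add.commute)
 have e: "c x *r dq f v n x = real (Suc n) *r (c x *r f (x + ?w) - c x *r f x)"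
  "?a n x = real (Suc n) *r (?h x - c x *r f x)" for x
  by (simp add: scaleR_diff_right mult.commute, simp add: scaleR_diff_left[symmetric] del: of_nat_Suc)
 show ?thesis by (simp only: e integral_scaleR_right integral_diff[OF i1 i2] integral_diff[OF i3 i2] tr)
qed
have "(LB x. c x *r g x) = (LB x. fd c x (- v) *r f x)" using LIMSEQ_unique[OF l1 l2[folded eq]] .
moreover have "fd c x (- v) = - fd c x v" for x by (rule linear_neg[OF has_derivative_linear[OF smooth_deriv[OF c(1)]]])
ultimately show "(LB x. c x *r g x) = - (LB x. fd c x v *r f x)" by simp
qed

lemma null_if_null_along_dir: fixes N :: "'a::euclidean_space set"
assumes N[measurable]: "N : sets borel" and line: "!!x. AEL s. x + s *r v ~: N"
shows "AEL x. x ~: N"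
proof -
let ?b = "emeasure lborel N"
have tr: "?b = (\<integral>\<^sup>+x. ind N (x + s *r v) \<partial>lborel)" for s
proof -
 have "?b = (\<integral>\<^sup>+x. ind N x \<partial>distr lborel borel ((+) (s *r v)))" by (simp add: lborel_distr_plus)
 also have "... = (\<integral>\<^sup>+x. ind N (s *r v + x) \<partial>lborel)" by (rule nn_integral_distr) auto
 finally show ?thesis by (simp add: add.commute)
qed
let ?a = "%s x. ind {0..1} s * ind N (x + s *r v)"
let ?c = "%s. \<integral>\<^sup>+x. ?a s x \<partial>lborel"
have "?b = (\<integral>\<^sup>+s. ind {0..1} s * ?b \<partial>(lborel :: real measure))" by (subst nn_integral_multc) auto
also have "... = (\<integral>\<^sup>+s. ?c s \<partial>(lborel :: real measure))"
proof (rule nn_integral_cong)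
 fix s :: real
 show "ind {0..1} s * ?b = ?c s" by (subst nn_integral_cmult) (auto simp: tr[of s, symmetric])
qed
also have "... = (\<integral>\<^sup>+x. (\<integral>\<^sup>+s. ?a s x \<partial>(lborel :: real measure)) \<partial>lborel)"
 by (rule lborel_pair.Fubini'[symmetric, of "%s x. ?a s x"]) simp
also have "... = (\<integral>\<^sup>+x. 0 \<partial>(lborel :: 'a measure))"
proof (rule nn_integral_cong)
 fix x :: 'a
 have "AEL s. ?a s x = (0 :: ennreal)" using line[of x] by eventually_elim simp
 then show "(\<integral>\<^sup>+s. ?a s x \<partial>(lborel :: real measure)) = 0" by (subst nn_integral_0_iff_AE) auto
qed
finally have "N : null_sets lborel" by (auto simp: null_sets_def)
then show ?thesis by (rule AE_not_in)
qed

lemma lip_dd_ae: fixes f :: "'a::euclidean_space => real"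
assumes lip: "L-lip UNIV f"
shows "AEL x. convergent (%n. dq f v n x)"
proof -
have [measurable]: "f : BM" by (rule bmc_onI[OF lipschitz_on_continuous_on[OF lip]])
define N where "N = {x. \<not> Cauchy (%n. dq f v n x)}"
have NB: "N : sets borel" unfolding N_def by measurable
have "AEL s. x + s *r v ~: N" for x
proof -
 define h where "h s = f (x + s *r v)" for s
 have "(L * norm v)-lip UNIV h"
 proof (rule lipschitz_onI)
  fix s t :: real
  have "dist (h s) (h t) <= L * dist (x + s *r v) (x + t *r v)" unfolding h_def by (rule lipschitz_onD[OF lip]) auto
  also have "dist (x + s *r v) (x + t *r v) = abs (s - t) * norm v" by (simp add: dist_norm scaleR_diff_left[symmetric])
  finally show "dist (h s) (h t) <= L * norm v * dist s t" by (simp add: dist_real_def mult_ac)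
 qed (use lipschitz_on_nonneg[OF lip] in simp)
 then have "AE s in lebesgue. s ~: {s. \<not> h differentiable (at s)}"
  by (intro AE_not_in lip_real_diffble_ae[unfolded negligible_iff_null_sets])
 then have "AEL s. h differentiable (at s)" by (simp add: AE_completion_iff)
 then show ?thesis
 proof eventually_elim
  case (elim s)
  then obtain D where "(h hder D) (at s)" by (auto simp: differentiable_def)
  from dq_LIMSEQ[OF this, of 1]
  have "(%n. dq f v n (x + s *r v)) ----> D 1" by (simp add: h_def scaleR_add_left add.assoc)
  then show ?case using LIMSEQ_imp_Cauchy by (simp add: N_def)
 qed
qed
from null_if_null_along_dir[OF NB this] show ?thesis by (simp add: N_def Cauchy_convergent_iff)
qed

lemma lip_dd_linear: fixes f :: "'a::euclidean_space => real" and L v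
defines "D == %w x. lim (%n. dq f w n x)"
assumes lip: "L-lip UNIV f"
shows "AEL x. (%n. dq f v n x) ----> D v x" and "AEL x. D v x = (\<Sum>i\<in>Basis. inner v i * D i x)"
proof -
have fc: "cont UNIV f" by (rule lipschitz_on_continuous_on[OF lip])
have [measurable]: "f : BM" by (rule bmc_onI[OF fc])
have Dm[measurable]: "D w : BM" for w unfolding D_def by measurable
have lim: "AEL x. (%n. dq f w n x) ----> D w x" for w
 using lip_dd_ae[OF lip, of w] by eventually_elim (simp only: D_def convergent_LIMSEQ_iff)
then show "AEL x. (%n. dq f v n x) ----> D v x" .
let ?b = "\<Sum>i\<in>Basis. abs (inner v i) * (L * norm i)"
have bnd: "AEL x. abs (D w x) <= L * norm w" for w using lim[of w]
proof eventually_elim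
 case (elim x)
 show ?case by (rule LIMSEQ_le_const2[OF tendsto_rabs[OF elim]]) (use lip_dq_bound[OF lip] in auto)
qed
let ?s = "%x. \<Sum>i\<in>Basis. inner v i * D i x"
let ?M = "L * norm v + ?b"
define e where "e x = D v x - ?s x" for x
have em[measurable]: "e : BM" unfolding e_def[abs_def] by measurable
have eM: "AEL x. abs (e x) <= ?M"
 using AE_finite_allI[OF finite.insertI[OF finite_Basis], of v "%w x. abs (D w x) <= L * norm w" lborel, OF bnd]
proof eventually_elim
 case (elim x)
 have "abs (?s x) <= ?b" by (rule order_trans[OF sum_abs sum_mono]) (use elim in "auto simp: abs_mult intro!: mult_left_mono")
 moreover have "abs (D v x) <= L * norm v" using elim by blast
 ultimately show ?case unfolding e_def by linarith
qed
let ?a = "%R x. ind (ball 0 R) x * e x"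
have ball: "AEL x. x : ball 0 R --> ?a R x = 0" for R
proof (rule flemma_real)
 show "ilb (%x. ?a R x)"
 proof (rule integrable_bound)
  show "ilb (%x :: 'a. ind (ball 0 R) x *r ?M)"
   by (intro integrable_scaleR_left integrable_real_indicator) (simp_all add: emeasure_bounded_finite[OF bounded_ball, unfolded infinity_ennreal_def])
  show "AEL x. norm (?a R x) <= norm (ind (ball 0 R) x *r ?M)" using eM by eventually_elim (auto simp: indicator_def)
  show "(%x. ?a R x) : borel_measurable lborel" by (intro borel_measurable_times borel_measurable_indicator) (simp_all add: em)
 qed
 fix b :: "'a => real"
 assume b: "smooth b" "compact (supp b)" and sub: "supp b <= ball 0 R"
 have ibp: "(LB x. b x * D w x) = - (LB x. fd b x w * f x)" "ilb (%x. b x * D w x)" for w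
  using ibp_dir[OF lip b Dm lim] by simp_all
 have ii: "ilb (%x. fd b x i * f x)" for i by (rule intbl_cont_bdd_supp[OF _ compact_imp_bounded[OF b(2)]])
    (auto intro!: continuous_on_mult[OF smooth_cont[OF smooth_frechet[OF b(1)]] fc] simp: fd_off_supp)
 have ptw: "fd b x v = (\<Sum>i\<in>Basis. inner v i * fd b x i)" for x
 proof -
  have lin: "linear (fd b x)" by (rule has_derivative_linear[OF smooth_deriv[OF b(1)]])
  show ?thesis by (subst euclidean_representation[of v, symmetric]) (simp add: linear_sum[OF lin] linear_scale[OF lin])
 qed
 have "b x * ?a R x = b x * D v x - (\<Sum>i\<in>Basis. inner v i * (b x * D i x))" for x
 proof -
  have "b x = 0 \<or> x : ball 0 R" using sub closure_subset[of "{x. b x ~= 0}"] by blast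
  then show ?thesis by (auto simp: e_def right_diff_distrib sum_distrib_left mult_ac simp del: mem_ball_0 mem_ball)
 qed
 then have "(LB x. b x * ?a R x) = (LB x. b x * D v x) - (\<Sum>i\<in>Basis. inner v i * (LB x. b x * D i x))"
  using ibp(2) by (subst integral_diff[symmetric] | simp add: integral_sum)+
 also have "... = - (LB x. fd b x v * f x) + (\<Sum>i\<in>Basis. inner v i * (LB x. fd b x i * f x))"
  unfolding ibp(1) by (simp add: sum_negf)
 also have "... = 0" unfolding ptw sum_distrib_right mult.assoc using ii by (subst integral_sum) auto
 finally show "(LB x. b x * ?a R x) = 0" .
qed simp_all
have "AEL x. ALL n :: nat. x : ball 0 (real n) --> ind (ball 0 (real n)) x * e x = 0"
 by (subst AE_all_countable) (use ball in blast)
then show "AEL x. D v x = ?s x"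
proof eventually_elim
 case (elim x)
 obtain n :: nat where "norm x < real n" using reals_Archimedean2[of "norm x"] by blast
 with elim[rule_format, of n] show ?case by (simp add: e_def)
qed
qed

theorem lip_diffble_ae:
fixes f :: "'a::euclidean_space => real"
assumes lip: "L-lip UNIV f"
shows "AEL x. f differentiable (at x)"
proof -
define D where "D w x = lim (%n. dq f w n x)" for w x
note dd = lip_dd_linear[OF lip, folded D_def]
have L0: "0 <= L" using lip lipschitz_on_nonneg by blast
obtain B :: "'a set" where B: "countable B" "!!X. open X ==> X ~= {} ==> EX d:B. d : X" by (rule countable_dense_setE) blast
let ?c = "%v x. %n. dq f v n x"
have "AEL x. ?c v x ----> D v x & D v x = (\<Sum>i\<in>Basis. inner v i * D i x)" for v using dd[of v] by eventually_elim simp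
then have "AEL x. ALL v:B. ?c v x ----> D v x & D v x = (\<Sum>i\<in>Basis. inner v i * D i x)"
 by (subst AE_ball_countable[OF B(1)]) blast
then show ?thesis
proof eventually_elim
 case (elim x)
 define A where "A h = (\<Sum>i\<in>Basis. inner h i * D i x)" for h
 have blA: "bounded_linear A" unfolding A_def[abs_def]
  by (intro bounded_linear_sum bounded_linear_mult_const bounded_linear_inner_left)
 note lin = bounded_linear.linear[OF blA]
 obtain M where M: "0 < M" "!!h. norm (A h) <= norm h * M" using bounded_linear.pos_bounded[OF blA] by blast
 have "(f hder A) (at x)" unfolding has_derivative_at_alt
 proof (intro conjI allI impI blA)
  fix e' :: real assume e': "0 < e'"
  define K where "K = 3 * L + 3 * M + 2"
  have K: "0 < K" using L0 M(1) by (simp add: K_def)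
  define e where "e = min 1 (e' / K)"
  have e: "0 < e" "e <= 1" "K * e <= e'" using e' K by (auto simp: e_def min_def field_simps)
  have "sphere 0 1 <= (\<Union>v\<in>B. ball v e)"
  proof
   fix u :: 'a
   obtain v where "v : B" "v : ball u e" using B(2)[of "ball u e"] e by auto
   then show "u : (\<Union>v\<in>B. ball v e)" by (auto simp: dist_commute)
  qed
  then obtain F where F: "F <= B" "finite F" "sphere 0 1 <= (\<Union>v\<in>F. ball v e)"
   by (rule compactE_image[OF compact_sphere, of B "%v. ball v e", rotated]) auto
  have "ALL v:F. \<forall>\<^sub>F n in sequentially. dist (dq f v n x) (A v) < e"
  proof
   fix v assume "v : F"
   then have "?c v x ----> D v x" "D v x = A v" using elim F(1) unfolding A_def by blast+
   then have "?c v x ----> A v" by (simp only:)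
   then show "\<forall>\<^sub>F n in sequentially. dist (dq f v n x) (A v) < e" using e(1) by (rule tendstoD)
  qed
  then have "\<forall>\<^sub>F n in sequentially. (ALL v:F. dist (dq f v n x) (A v) < e) & 1 / real (Suc n) < e"
   using e(1) LIMSEQ_inverse_real_of_nat F(2)
   by (intro eventually_conj eventually_ball_finite) (auto simp: order_tendsto_iff inverse_eq_divide simp del: of_nat_Suc)
  then obtain n0 where n0: "!!n v. n0 <= n ==> v : F ==> \<bar>dq f v n x - A v\<bar> < e" "!!n. n0 <= n ==> 1 / real (Suc n) < e"
   unfolding eventually_sequentially dist_real_def by blast
  show "EX d>0. ALL y. norm (y - x) < d --> norm (f y - f x - A (y - x)) <= e' * norm (y - x)"
  proof (intro exI[of _ "1 / real (Suc n0)"] conjI allI impI)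
   fix y assume y: "norm (y - x) < 1 / real (Suc n0)"
   show "norm (f y - f x - A (y - x)) <= e' * norm (y - x)"
   proof (cases "y = x")
    case False
    define t where "t = norm (y - x)"
    have t: "0 < t" "real (Suc n0) < 1 / t" using False y by (simp_all add: t_def less_divide_eq mult.commute del: of_nat_Suc)
    define k where "k = nat \<lfloor>1 / t\<rfloor>"
    have k: "real k <= 1 / t" "1 / t < real k + 1" unfolding k_def using t by linarith+
    then obtain n where n: "k = Suc n" "n0 <= n" using t(2) by (cases k) auto
    define s where "s = 1 / real (Suc n)"
    define m where "m = real (Suc n)"
    have m: "1 <= m" "m * t <= 1" "1 < m * t + t"
     using k t(1) unfolding n(1) m_def[symmetric] by (simp_all add: field_simps) (simp add: m_def)
    have "t <= m * t" "m * 1 <= m * (t + m * t)" using m t(1) by (simp, intro mult_left_mono) simp_all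
    moreover from this m have "1 <= 2 * (m * t)" by linarith
    ultimately have s: "t <= s" "s - t <= t * s" "s <= 2 * t" "s < e" "0 < s"
     using m t(1) n0(2)[OF n(2)] unfolding s_def m_def[symmetric] by (simp_all add: field_simps)
    let ?a = "%v. v - (y - x) /\<^sub>R t"
    let ?b = "(y - x) /\<^sub>R t"
    have "norm ?b = 1" using t by (simp add: t_def)
    then have "?b : sphere 0 1" by simp
    then obtain v where "v : F" "?b : ball v e" using F(3) by blast
    then have v: "v : F" "norm (?a v) < e" by (simp_all add: dist_norm)
    have "norm v <= norm (?a v) + norm ?b" by (metis diff_add_cancel norm_triangle_ineq)
    then have v2: "norm v <= 2" using v(2) e(2) `norm ((y - x) /\<^sub>R t) = 1` by linarith
    define w where "w = s *r v - (y - x)"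
    have "w = (s - t) *r v + t *r ?a v" using t by (simp add: w_def algebra_simps)
    then have "norm w <= (s - t) * norm v + t * norm (?a v)"
     using norm_triangle_ineq[of "(s - t) *r v" "t *r ?a v"] s(1) t(1) by simp
    also have "... <= (t * e) * 2 + t * e"
     using s order_trans[OF s(2) mult_left_mono[OF less_imp_le[OF s(4)] less_imp_le[OF t(1)]]] v v2 t by (intro add_mono mult_mono) auto
    finally have w: "norm w <= 3 * (t * e)" by (simp add: mult.commute)
    let ?d = "x + s *r v"
    have "abs (f y - f ?d) <= L * norm w"
     using lipschitz_onD[OF lip, of "?d" y] by (simp add: dist_norm w_def norm_minus_commute algebra_simps)
    moreover have "abs (f ?d - f x - s * A v) <= 2 * (t * e)"
    proof -
     have "f ?d - f x - s * A v = s * (dq f v n x - A v)" by (simp add: s_def right_diff_distrib del: of_nat_Suc)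
     then have "abs (f ?d - f x - s * A v) = s * abs (dq f v n x - A v)" using s(5) by (simp only: abs_mult abs_of_pos)
     also have "... <= (2 * t) * e" using s n0(1)[OF n(2) v(1)] t by (intro mult_mono) auto
     finally show ?thesis by simp
    qed
    moreover have "abs (s * A v - A (y - x)) <= norm w * M"
     using M(2)[of w] by (simp add: w_def linear_diff[OF lin] linear_scale[OF lin])
    ultimately have "abs (f y - f x - A (y - x)) <= (L + M) * norm w + 2 * (t * e)"
     unfolding distrib_right mult.commute[of M] by linarith
    also have "... <= (L + M) * (3 * (t * e)) + 2 * (t * e)" using w L0 M(1) t(1) e(1) by (intro add_mono mult_left_mono) auto
    also have "... = (K * e) * t" by (simp add: K_def algebra_simps)
    also have "... <= e' * t" using e(3) t by (intro mult_right_mono) auto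
    finally show ?thesis by (simp add: t_def)
   qed (simp add: linear_0[OF lin])
  qed simp
 qed
 then show ?case unfolding differentiable_def by blast
qed
qed

definition lip_grad :: "('a::euclidean_space => real) => 'a => 'a" where
"lip_grad f x = (\<Sum>i\<in>Basis. lim (%n. dq f i n x) *r i)"

lemma lip_grad_borel:
assumes "cont UNIV f"
shows "lip_grad f : BM"
proof -
note [measurable] = bmc_onI[OF assms]
show ?thesis unfolding lip_grad_def[abs_def] by measurable
qed

lemma inner_representation: fixes D :: "'a::euclidean_space => real"
assumes lin: "linear D"
shows "D h = inner (\<Sum>i\<in>Basis. D i *r i) h"
proof -
have "D h = D (\<Sum>i\<in>Basis. inner h i *r i)" by (simp add: euclidean_representation)
also have "... = (\<Sum>i\<in>Basis. inner h i * D i)" by (simp add: linear_sum[OF lin] linear_scale[OF lin])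
also have "... = inner (\<Sum>i\<in>Basis. D i *r i) h" by (simp add: inner_sum_left inner_commute[of h] mult.commute)
finally show ?thesis .
qed

lemma lip_grad_deriv:
assumes "f differentiable (at x)"
shows "(f hder (%h. inner (lip_grad f x) h)) (at x)"
proof -
obtain D where D: "(f hder D) (at x)" using assms unfolding differentiable_def by blast
have "lim (%n. dq f i n x) = D i" for i using dq_LIMSEQ[OF D, of i] by (rule limI)
then have g: "lip_grad f x = (\<Sum>i\<in>Basis. D i *r i)" by (simp add: lip_grad_def)
have "D = (%h. inner (lip_grad f x) h)" unfolding g by (rule ext) (rule inner_representation[OF has_derivative_linear[OF D]])
with D show ?thesis by simp
qed

lemma lip_grad_unique:
assumes "(f hder (%h. inner g h)) (at x)"
shows "lip_grad f x = g"
proof -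
have "f differentiable (at x)" using assms unfolding differentiable_def by blast
from has_derivative_unique[OF lip_grad_deriv[OF this] assms]
show ?thesis using vector_eq_rdot[of "lip_grad f x" g] by (simp add: fun_eq_iff)
qed

lemma norm_lip_grad_le:
assumes lip: "L-lip UNIV f" and d: "f differentiable (at x)"
shows "norm (lip_grad f x) <= L"
proof -
let ?g = "lip_grad f x"
have "(%n. norm (dq f ?g n x)) ----> norm (inner ?g ?g)" by (intro tendsto_norm dq_LIMSEQ lip_grad_deriv d)
then have "norm (inner ?g ?g) <= L * norm ?g" by (rule LIMSEQ_le_const2) (use lip_dq_bound[OF lip] in auto)
then have "norm ?g * norm ?g <= norm ?g * L" by (simp add: dot_square_norm power2_eq_square mult.commute)
then show ?thesis using lipschitz_on_nonneg[OF lip] mult_left_le_imp_le[of "norm ?g" "norm ?g" L] by (cases "?g = 0") auto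
qed

lemma clamp_deriv: fixes h :: "'a::real_normed_vector => real"
assumes u: "((%y. max 0 (min 1 (h y))) hder D) (at x)" and h: "(h hder D') (at x)" and c: "cont UNIV h"
shows "D = (if 0 < h x & h x < 1 then D' else (%_. 0))"
proof (cases "0 < h x & h x < 1")
case True
have "open {y. 0 < h y & h y < 1}" by (intro open_Collect_conj open_Collect_less c continuous_on_const)
from has_derivative_transform_within_open[OF h this, of "%y. max 0 (min 1 (h y))"] True
have "((%y. max 0 (min 1 (h y))) hder D') (at x)" by simp
then show ?thesis using True has_derivative_unique[OF u] by simp
next
case False
then have "(ALL y:UNIV. max 0 (min 1 (h y)) <= max 0 (min 1 (h x))) \<or> (ALL y:UNIV. max 0 (min 1 (h x)) <= max 0 (min 1 (h y)))" by auto
from differential_zero_maxmin[OF _ open_UNIV u this] show ?thesis using False by auto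
qed

section \<open>Star-shaped domains and the gauge\<close>

locale star_domain =
fixes Y :: "'a::euclidean_space set" and r :: real
assumes open_domain: "open Y" and bounded_domain: "bounded Y" and r_pos: "0 < r" and ball_subset: "ball 0 r <= Y"
 and star: "!!p x. p : ball 0 r ==> x : Y ==> closed_segment p x <= Y"
begin

abbreviation "vol == lebesgue_on Y"
abbreviation lint_vol (binder "LV " 10) where "lint_vol f == integral\<^sup>L vol f"
abbreviation "cc == continuous_on (closure Y)"

definition rho :: "'a => real" where
"rho x = Inf {s. 0 < s & x /\<^sub>R s : Y}"

definition hat :: "'a => 'a" where
"hat x = x /\<^sub>R rho x"

lemma scale_in_dom:
assumes "x : Y" "0 <= t" "t <= 1"
shows "t *r x : Y"
proof -
have "t *r x : closed_segment 0 x" using assms by (auto simp: closed_segment_def)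
then show ?thesis using star[of 0 x] r_pos assms(1) by auto
qed

lemma gauge_set_nonempty: "{s. 0 < s & x /\<^sub>R s : Y} ~= {}"
proof -
have "norm (x /\<^sub>R ((norm x + 1) / r)) < r" using r_pos by (simp add: norm_divide field_simps add_pos_nonneg)
then have "x /\<^sub>R ((norm x + 1) / r) : Y" using ball_subset by auto
moreover have "0 < (norm x + 1) / r" using r_pos by (simp add: add_nonneg_pos)
ultimately show ?thesis by blast
qed

lemma gauge_set_bdd: "bdd_below {s. 0 < s & x /\<^sub>R s : Y}" by (rule bdd_belowI[of _ 0]) auto

lemma rho_nonneg: "0 <= rho x" unfolding rho_def by (rule cInf_greatest[OF gauge_set_nonempty]) auto

lemma rho_less_iff:
assumes s: "0 < s"
shows "rho x < s \<longleftrightarrow> x /\<^sub>R s : Y"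
proof
assume "rho x < s"
then obtain t where t: "0 < t" "x /\<^sub>R t : Y" "t < s"
 unfolding rho_def using cInf_less_iff[OF gauge_set_nonempty gauge_set_bdd, of x s] by auto
have "(t / s) *r (x /\<^sub>R t) : Y" by (rule scale_in_dom[OF t(2)]) (use t s in auto)
moreover have "(t / s) * inverse t = inverse s" using t s by (simp add: field_simps)
ultimately show "x /\<^sub>R s : Y" by (simp only: scaleR_scaleR)
next
assume x: "x /\<^sub>R s : Y"
have "isCont (%t. x /\<^sub>R t) s" using s by (intro continuous_intros) auto
then have "(%t. x /\<^sub>R t) \<midarrow>s\<rightarrow> x /\<^sub>R s" by (simp add: isCont_def)
then have "eventually (%t. x /\<^sub>R t : Y) (at s)" using open_domain x by (rule topological_tendstoD)
then obtain d where d: "0 < d" "!!t. t ~= s ==> dist t s < d ==> x /\<^sub>R t : Y" unfolding eventually_at by auto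
define t where "t = s - min (d / 2) (s / 2)"
have t: "0 < t" "t < s" "dist t s < d" using d s by (auto simp: t_def dist_real_def min_def)
then have "rho x <= t" unfolding rho_def using d(2)[of t] by (intro cInf_lower gauge_set_bdd) auto
then show "rho x < s" using t by simp
qed

lemma mem_domain: "x : Y \<longleftrightarrow> rho x < 1" using rho_less_iff[of 1 x] by simp

lemma rho_scale: "0 <= t ==> rho (t *r x) = t * rho x"
proof -
have 0: "rho 0 = 0"
proof (rule antisym)
 show "rho 0 <= 0"
 proof (rule field_le_epsilon)
  fix e :: real assume "0 < e"
  moreover have "(0::'a) : Y" using ball_subset r_pos by auto
  ultimately show "rho 0 <= 0 + e" using rho_less_iff[of e 0] by simp
 qed
qed (rule rho_nonneg)
assume "0 <= t"
then consider "t = 0" | "0 < t" by linarith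
then show ?thesis
proof cases
 case 2
 let ?a = "t * rho x"
 let ?b = "rho (t *r x)"
 have iff: "?b < s \<longleftrightarrow> ?a < s" if "0 < s" for s
 proof -
  have "?b < s \<longleftrightarrow> x /\<^sub>R (s / t) : Y" using rho_less_iff[OF that, of "t *r x"] by (simp add: divide_inverse mult.commute)
  also have "... \<longleftrightarrow> rho x < s / t" using rho_less_iff[of "s / t" x] that 2 by simp
  also have "... \<longleftrightarrow> ?a < s" using 2 by (simp add: field_simps)
  finally show ?thesis .
 qed
 show ?thesis
 proof (rule ccontr)
  assume "?b ~= ?a"
  then consider "?b < ?a" | "?a < ?b" by linarith
  then show False
  proof cases
   case 1
   then have "0 < ?a" using rho_nonneg[of "t *r x"] by linarith
   from iff[OF this] 1 show False by blast
  next
   case 2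
   moreover have "0 <= ?a" using `0 < t` rho_nonneg[of x] by simp
   ultimately have "0 < ?b" by linarith
   from iff[OF this] 2 show False by blast
  qed
 qed
qed (simp add: 0)
qed

lemma rho_0: "rho 0 = 0" using rho_scale[of 0 0] by simp

lemma rho_triangle: "rho y <= rho x + norm (y - x) / r"
proof (rule field_le_epsilon)
fix e :: real assume e: "0 < e"
define s where "s = rho x + e / 2"
let ?c = "norm (y - x)"
define t where "t = ?c / r + e / 2"
have st: "0 < s" "0 < t" "rho x < s" "?c / r < t" using e rho_nonneg[of x] r_pos by (auto simp: s_def t_def add_nonneg_pos)
let ?a = "(y - x) /\<^sub>R t"
have "?c < t * r" using st(4) r_pos by (simp add: divide_less_eq)
moreover have "norm ?a = ?c / t" using st(2) by (simp add: divide_inverse mult.commute)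
ultimately have p: "?a : ball 0 r" using st(2) by (simp add: divide_less_eq mult.commute)
have x: "x /\<^sub>R s : Y" using rho_less_iff[OF st(1)] st(3) by blast
let ?b = "(1 - s / (s + t)) *r ?a + (s / (s + t)) *r (x /\<^sub>R s)"
have "y /\<^sub>R (s + t) = ?b"
proof -
 let ?d = "inverse (s + t)"
 have "(1 - s / (s + t)) * inverse t = ?d" "(s / (s + t)) * inverse s = ?d" using st by (simp_all add: field_simps)
 then have "?b =
   ?d *r (y - x) + ?d *r x" by (simp only: scaleR_scaleR)
 then show ?thesis by (simp add: scaleR_add_right[symmetric])
qed
then have "y /\<^sub>R (s + t) : closed_segment ?a (x /\<^sub>R s)"
 unfolding closed_segment_def using st by (intro CollectI exI[of _ "s / (s + t)"]) auto
then have "y /\<^sub>R (s + t) : Y" using star[OF p x] by blast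
then have "rho y < s + t" using rho_less_iff[of "s + t" y] st by simp
then show "rho y <= rho x + ?c / r + e" by (simp add: s_def t_def)
qed

lemma rho_lip: "(1 / r)-lip UNIV rho"
proof (rule lipschitz_onI)
fix x y :: 'a
show "dist (rho x) (rho y) <= 1 / r * dist x y"
 using rho_triangle[of x y] rho_triangle[of y x] by (simp add: dist_real_def dist_norm norm_minus_commute abs_le_iff)
qed (use r_pos in simp)

lemma cont_on_rho: "cont S rho" using lipschitz_on_continuous_on[OF rho_lip] continuous_on_subset by blast

lemma rho_borel[measurable]: "rho : BM" by (rule bmc_onI[OF cont_on_rho])

lemma hat_borel[measurable]: "hat : BM" unfolding hat_def[abs_def] by measurable

lemma norm_le_rho: "EX R>0. (ALL x. norm x <= R * rho x)"
proof -
obtain R where R: "0 < R" "!!x. x : Y ==> norm x <= R" using bounded_domain unfolding bounded_pos by blast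
have "norm x <= R * rho x" for x
proof (rule field_le_epsilon)
 fix e :: real assume e: "0 < e"
 define s where "s = rho x + e / R"
 have s: "0 < s" "rho x < s" using e R rho_nonneg[of x] by (auto simp: s_def add_nonneg_pos)
 then have "norm (x /\<^sub>R s) <= R" using rho_less_iff[OF s(1)] R by blast
 moreover have "norm (x /\<^sub>R s) = norm x / s" using s by (simp add: divide_inverse mult.commute)
 ultimately have "norm x <= R * s" using s(1) by (simp add: divide_le_eq)
 also have "R * s = R * rho x + e" using R(1) by (simp add: s_def distrib_left)
 finally show "norm x <= R * rho x + e" .
qed
then show ?thesis using R(1) by blast
qed

lemma rho_pos: "x ~= 0 ==> 0 < rho x"
using norm_le_rho rho_nonneg[of x] by (metis linorder_not_le mult_zero_right norm_le_zero_iff order_le_less)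

lemma rho_hat: "x ~= 0 ==> rho (hat x) = 1" unfolding hat_def using rho_scale[of "inverse (rho x)" x] rho_pos[of x] by simp

lemma hat_scale: "0 < t ==> hat (t *r x) = hat x" by (simp add: hat_def rho_scale)

lemma rho_times_hat: "rho x *r hat x = x" using rho_pos[of x] by (cases "x = 0") (auto simp: hat_def)

lemma closure_eq: "closure Y = {x. rho x <= 1}"
proof
show "closure Y <= {x. rho x <= 1}" by (rule closure_minimal) (auto simp: mem_domain intro!: closed_Collect_le cont_on_rho)
show "{x. rho x <= 1} <= closure Y"
proof
 fix x assume x: "x : {x. rho x <= 1}"
 let ?a = "%n. 1 - 1 / real (Suc n)"
 have "(%n. ?a n *r x) ----> (1 - 0) *r x"
  using LIMSEQ_inverse_real_of_nat by (intro tendsto_intros) (simp add: inverse_eq_divide)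
 moreover have "?a n *r x : Y" for n
 proof -
  have "rho (?a n *r x) = ?a n * rho x" by (rule rho_scale) simp
  also have "... <= ?a n * 1" using x by (intro mult_left_mono) auto
  also have "... < 1" by simp
  finally show ?thesis by (simp add: mem_domain)
 qed
 ultimately show "x : closure Y" unfolding closure_sequential by (intro exI[of _ "%n. ?a n *r x"]) simp
qed
qed

lemma frontier_eq: "frontier Y = {x. rho x = 1}"
unfolding frontier_def closure_eq interior_open[OF open_domain] by (auto simp: mem_domain)

lemma compact_cl_dom: "compact (closure Y)" using bounded_domain by simp

definition diff_set :: "'a set" where
"diff_set = {x. rho differentiable (at x)}"

abbreviation "grho == lip_grad rho"

lemmas grho_borel[measurable] = lip_grad_borel[OF cont_on_rho]

lemma AE_diff_set: "AEL x. x : diff_set" using lip_diffble_ae[OF rho_lip] by (simp add: diff_set_def)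

lemma rho_deriv: "x : diff_set ==> (rho hder (%h. inner (grho x) h)) (at x)" by (simp add: diff_set_def lip_grad_deriv)

lemma grho_unique:
assumes "(rho hder (%h. inner g h)) (at x)"
shows "x : diff_set" "grho x = g" using assms lip_grad_unique[OF assms] by (auto simp: diff_set_def differentiable_def)

lemma grho_scale:
assumes x: "x : diff_set" and t: "0 < t"
shows "t *r x : diff_set" "grho (t *r x) = grho x"
proof -
have 1: "((%y. y /\<^sub>R t) hder (%h. h /\<^sub>R t)) (at (t *r x))"
 by (intro bounded_linear_imp_has_derivative bounded_linear_scaleR_right)
let ?a = "%h. inner (grho x) h"
let ?b = "%h. t * inner (grho x) (h /\<^sub>R t)"
let ?c = "%y. t * rho (y /\<^sub>R t)"
have "(rho hder ?a) (at ((t *r x) /\<^sub>R t))" using rho_deriv[OF x] t by simp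
from has_derivative_compose[OF 1 this]
have "(?c hder ?b) (at (t *r x))" by (rule has_derivative_mult_right)
moreover have "?c = rho" using t by (simp add: rho_scale fun_eq_iff mult.assoc[symmetric])
moreover have "?b = ?a" using t by (simp add: fun_eq_iff mult.assoc[symmetric])
ultimately have "(rho hder ?a) (at (t *r x))" by simp
from grho_unique[OF this] show "t *r x : diff_set" "grho (t *r x) = grho x" .
qed

lemma grho_hat:
assumes x: "x : diff_set" "x ~= 0"
shows "hat x : diff_set" "grho (hat x) = grho x"
unfolding hat_def using grho_scale[OF x(1), of "inverse (rho x)"] rho_pos[OF x(2)] by simp_all

lemma grho_radial:
assumes x: "x : diff_set"
shows "inner (grho x) x = rho x"
proof -
have "(%n. dq rho x n x) ----> inner (grho x) x" by (rule dq_LIMSEQ[OF rho_deriv[OF x]])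
moreover have "dq rho x n x = rho x" for n
proof -
 have "rho (x + (1 / real (Suc n)) *r x) = (1 + 1 / real (Suc n)) * rho x"
  using rho_scale[of "1 + 1 / real (Suc n)" x] by (simp add: scaleR_add_left del: of_nat_Suc)
 then show ?thesis by (simp add: field_simps del: of_nat_Suc)
qed
ultimately have "(%n. rho x) ----> inner (grho x) x" by simp
then show ?thesis using LIMSEQ_unique[OF tendsto_const] by metis
qed

lemma norm_grho_le: "x : diff_set ==> norm (grho x) <= 1 / r" using norm_lip_grad_le[OF rho_lip] by (simp add: diff_set_def)

end

lemma set_int_norm_le: fixes f :: "'a => 'b::{banach, second_countable_topology}"
assumes A: "A : sets M" "emeasure M A < \<infinity>" and B: "0 <= B" and f: "AE x in M. x : A --> norm (f x) <= B"
shows "norm (LINT x:A|M. f x) <= B * measure M A"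
proof -
have "norm (LINT x:A|M. f x) <= (LINT x|M. B * ind A x)" unfolding set_lint_def
proof (rule order_trans[OF integral_norm_bound integral_mono_AE'])
 show "integrable M (%x. B * ind A x)" using A by simp
 show "AE x in M. norm (indr A x *r f x) <= B * indr A x" using f by eventually_elim (simp add: indicator_def)
 show "AE x in M. 0 <= B * indr A x" using B by simp
qed
also have "... = B * measure M A" using A by simp
finally show ?thesis .
qed

context star_domain
begin

definition cmeas :: "'a measure" where
"cmeas = distr (density lborel (%x. ennreal (real DIM('a) * ind Y x))) borel hat"

lemma sets_cone[simp, measurable_cong]: "sets cmeas = sets borel" by (simp add: cmeas_def)

lemma space_cone[simp]: "space cmeas = UNIV" by (simp add: cmeas_def)

lemma dom_borel[measurable]: "Y : sets borel" using open_domain by simp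

lemma intbl_cone_iff: fixes f :: "'a => 'b::{banach, second_countable_topology}"
assumes [measurable]: "f : BM"
shows "integrable cmeas f \<longleftrightarrow> set_integrable lborel Y (%x. f (hat x))"
proof -
have "integrable cmeas f \<longleftrightarrow> integrable (density lborel (%x. ennreal (real DIM('a) * ind Y x))) (%x. f (hat x))"
 unfolding cmeas_def by (rule integrable_distr_eq) auto
also have "... \<longleftrightarrow> ilb (%x. (real DIM('a) * ind Y x) *r f (hat x))" by (rule integrable_density) auto
also have "... \<longleftrightarrow> set_integrable lborel Y (%x. f (hat x))"
 unfolding set_integrable_def scaleR_scaleR[symmetric] by (rule intbl_scaleR_iff) simp
finally show ?thesis .
qed

lemma int_cone: fixes f :: "'a => 'b::{banach, second_countable_topology}"
assumes [measurable]: "f : BM"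
shows "(LINT x|cmeas. f x) = real DIM('a) *r (LINT x:Y|lborel. f (hat x))"
proof -
have "(LINT x|cmeas. f x) = (\<integral>x. f (hat x) \<partial>density lborel (%x. ennreal (real DIM('a) * ind Y x)))"
 unfolding cmeas_def by (rule integral_distr) auto
also have "... = (LB x. (real DIM('a) * ind Y x) *r f (hat x))" by (rule integral_density) auto
finally show ?thesis unfolding set_lint_def by (simp add: scaleR_scaleR[symmetric] del: scaleR_scaleR)
qed

lemma AE_cone_iff:
assumes [measurable]: "Measurable.pred borel P"
shows "(AE x in cmeas. P x) \<longleftrightarrow> (AEL x. x : Y --> P (hat x))"
proof -
have "(AE x in cmeas. P x) \<longleftrightarrow> (AE x in density lborel (%x. ennreal (real DIM('a) * ind Y x)). P (hat x))"
 unfolding cmeas_def by (rule AE_distr_iff) auto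
also have "... \<longleftrightarrow> (AEL x. x : Y --> P (hat x))" by (subst AE_density) (auto simp: indicator_def)
finally show ?thesis .
qed

lemma emeas_dom: "emeasure lborel Y < \<infinity>" using bounded_domain by (rule emeasure_bounded_finite)

lemma finite_cone: "finite_measure cmeas"
proof (rule finite_measureI)
have "emeasure cmeas (space cmeas) = (\<integral>\<^sup>+x. ennreal (real DIM('a) * ind Y x) \<partial>lborel)"
 unfolding cmeas_def by (simp add: emeasure_distr emeasure_density)
also have "... = (\<integral>\<^sup>+x. ennreal (real DIM('a)) * ind Y x \<partial>lborel)"
 by (intro nn_integral_cong) (simp add: indicator_def)
also have "... = ennreal (real DIM('a)) * emeasure lborel Y" by (subst nn_integral_cmult_indicator) auto
also have "... < \<infinity>" using emeas_dom by (simp add: ennreal_mult_less_top)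
finally show "emeasure cmeas (space cmeas) ~= \<infinity>" by simp
qed

lemma AE_nonzero: "AEL x. x ~= (0 :: 'a)" using AE_not_in[of "{0 :: 'a}" lborel] by (simp add: null_sets_def)

lemma AE_cone: shows "AE x in cmeas. rho x = 1" "AE x in cmeas. inner (grho x) x = 1"
 "AE x in cmeas. norm (grho x) <= 1 / r"
proof -
show "AE x in cmeas. rho x = 1" by (subst AE_cone_iff) (use AE_nonzero in "auto elim!: eventually_mono simp: rho_hat")
have "AEL x. hat x : diff_set & rho (hat x) = 1" using AE_nonzero AE_diff_set by eventually_elim (simp add: grho_hat rho_hat)
note H = this
have *: "AEL x. inner (grho (hat x)) (hat x) = 1" "AEL x. norm (grho (hat x)) <= 1 / r"
 using H by (eventually_elim, simp add: grho_radial norm_grho_le)+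
show "AE x in cmeas. inner (grho x) x = 1" by (subst AE_cone_iff) (use *(1) in "auto elim!: eventually_mono")
show "AE x in cmeas. norm (grho x) <= 1 / r" by (subst AE_cone_iff) (use *(2) in "auto elim!: eventually_mono")
qed

lemma int_hat_sublevel: fixes f :: "'a => 'b::{banach, second_countable_topology}"
assumes [measurable]: "f : BM" and a: "0 < a"
shows "(LINT x:{x. rho x < a}|lborel. f (hat x)) = (a ^ DIM('a) / DIM('a)) *r (LINT x|cmeas. f x)"
 and "integrable cmeas f ==> set_integrable lborel {x. rho x < a} (%x. f (hat x))"
proof -
have eq: "ind {x. rho x < a} (0 + a *r x) *r f (hat (0 + a *r x)) = ind Y x *r f (hat x)" for x
 using a by (simp add: hat_scale rho_scale mem_domain indicator_def)
have [measurable]: "{x. rho x < a} : sets borel" by measurable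
show "(LINT x:{x. rho x < a}|lborel. f (hat x)) = (a ^ DIM('a) / DIM('a)) *r (LINT x|cmeas. f x)"
 unfolding set_lint_def int_cone[OF assms(1)] using a by (subst lb_int_affine[of _ a 0]) (simp_all only: eq, simp_all)
assume "integrable cmeas f"
then have "ilb (%x. ind {x. rho x < a} (0 + a *r x) *r f (hat (0 + a *r x)))"
 unfolding eq using intbl_cone_iff[OF assms(1)] by (simp add: set_integrable_def)
then show "set_integrable lborel {x. rho x < a} (%x. f (hat x))" unfolding set_integrable_def
 using a by (subst lb_intbl_affine[of _ a 0]) simp_all
qed

lemma int_hat_shell: fixes f :: "'a => 'b::{banach, second_countable_topology}"
assumes [measurable]: "f : BM" and i: "integrable cmeas f" and a: "0 < a" "a <= b"
shows "(LINT x:{x. a <= rho x & rho x < b}|lborel. f (hat x)) = ((b ^ DIM('a) - a ^ DIM('a)) / DIM('a)) *r (LINT x|cmeas. f x)"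
 and "set_integrable lborel {x. a <= rho x & rho x < b} (%x. f (hat x))"
proof -
have b: "0 < b" using a by simp
have sb: "set_integrable lborel {x. rho x < b} (%x. f (hat x))" by (rule int_hat_sublevel(2)[OF assms(1) b i])
have m: "{x. a <= rho x & rho x < b} : sets lborel" "{x. rho x < a} : sets lborel" by auto
show s: "set_integrable lborel {x. a <= rho x & rho x < b} (%x. f (hat x))" by (rule set_integrable_subset[OF sb m(1)]) auto
let ?a = "LINT x:{x. a <= rho x & rho x < b}|lborel. f (hat x)"
have "{x. rho x < b} = {x. rho x < a} \<union> {x. a <= rho x & rho x < b}" using a by auto
then have "(LINT x:{x. rho x < b}|lborel. f (hat x)) = (LINT x:{x. rho x < a}|lborel. f (hat x)) + ?a"
 using set_integral_Un[OF _ int_hat_sublevel(2)[OF assms(1) a(1) i] s] by (simp add: disjoint_iff)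
then have "?a =
  (b ^ DIM('a) / DIM('a)) *r (LINT x|cmeas. f x) - (a ^ DIM('a) / DIM('a)) *r (LINT x|cmeas. f x)"
 using int_hat_sublevel(1)[OF assms(1) a(1)] int_hat_sublevel(1)[OF assms(1) b] by simp
then show "?a = ((b ^ DIM('a) - a ^ DIM('a)) / DIM('a)) *r (LINT x|cmeas. f x)"
 by (simp add: scaleR_diff_left[symmetric] diff_divide_distrib)
qed

lemma meas_shell:
assumes "0 < a" "a <= b"
shows "measure lborel {x. a <= rho x & rho x < b} = (b ^ DIM('a) - a ^ DIM('a)) / DIM('a) * measure cmeas UNIV"
 and "emeasure lborel {x. a <= rho x & rho x < b} < \<infinity>"
proof -
interpret finite_measure cmeas by (rule finite_cone)
have i: "integrable cmeas (%x. 1 :: real)" by simp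
have m: "{x. a <= rho x & rho x < b} : sets lborel" by auto
have s: "set_integrable lborel {x. a <= rho x & rho x < b} (%x. 1 :: real)" using int_hat_shell(2)[OF _ i assms] by simp
show "measure lborel {x. a <= rho x & rho x < b} = (b ^ DIM('a) - a ^ DIM('a)) / DIM('a) * measure cmeas UNIV"
 using int_hat_shell(1)[OF _ i assms] m by (simp add: set_lint_def)
show "emeasure lborel {x. a <= rho x & rho x < b} < \<infinity>"
 using s m unfolding set_integrable_def by (simp add: integrable_indicator_iff)
qed

lemma power_quotient_tendsto: fixes a b :: "nat => real"
assumes "!!n. a n < b n" "a ----> 1" "b ----> 1"
shows "(%n. (b n ^ d - a n ^ d) / (b n - a n)) ----> real d"
proof -
have "(%n. \<Sum>i<d. a n ^ (d - Suc i) * b n ^ i) ----> (\<Sum>i<d. 1 ^ (d - Suc i) * 1 ^ i)"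
 using assms by (intro tendsto_intros)
moreover have "(\<Sum>i<d. a n ^ (d - Suc i) * b n ^ i) = (b n ^ d - a n ^ d) / (b n - a n)" for n
 using power_diff_sumr2[of "b n" d "a n"] assms(1)[of n] by simp
ultimately show ?thesis by simp
qed

lemma layer_limit: fixes A :: "'a => 'b::euclidean_space" and g :: "'a => real" and a b :: "nat => real"
assumes ab: "!!n. 0 < a n" "!!n. a n < b n" "!!n. b n <= 1" "a ----> 1" and A: "cc A" and Am[measurable]: "A : BM"
 and gm[measurable]: "g : BM" and gC: "AEL x. abs (g (hat x)) <= C"
shows "(%n. (1 / (b n - a n)) *r (LINT x:{x. a n <= rho x & rho x < b n}|lborel. g (hat x) *r A x))
 ----> (LINT x|cmeas. g x *r A x)" and "integrable cmeas (%x. g x *r A x)"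
proof -
interpret finite_measure cmeas by (rule finite_cone)
have b1: "b ----> 1"
 by (rule tendsto_sandwich[OF _ _ ab(4) tendsto_const]) (use ab in "auto intro!: always_eventually less_imp_le")
let ?e = "closure Y"
obtain M where M: "!!x. x : ?e ==> norm (A x) <= M"
 using compact_imp_bounded[OF compact_continuous_image[OF A compact_cl_dom]] unfolding bounded_iff by blast
have gC': "AE x in cmeas. abs (g x) <= C" by (subst AE_cone_iff) (use gC in "auto elim!: eventually_mono")
have C0: "0 <= C"
proof (rule ccontr)
 assume "\<not> 0 <= C"
 then have "AE x :: 'a in lborel. False" using gC by (auto elim!: eventually_mono)
 then show False using AE_iff_measurable[of UNIV lborel "%x :: 'a. False"] emeasure_lborel_UNIV[where 'a='a] by simp
qed
show i: "integrable cmeas (%x. g x *r A x)"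
proof (rule integrable_const_bound)
 show "AE x in cmeas. norm (g x *r A x) <= C * M" using gC' AE_cone(1)
 proof eventually_elim
  case (elim x)
  then have "norm (A x) <= M" by (intro M) (simp add: closure_eq)
  with elim(1) C0 show ?case by (simp add: mult_mono)
 qed
qed measurable
define S where "S n = {x. a n <= rho x & rho x < b n}" for n
have Sm: "S n : sets lborel" for n unfolding S_def by auto
define q where "q n = (b n ^ DIM('a) - a n ^ DIM('a)) / (b n - a n)" for n
have q: "q ----> real DIM('a)" unfolding q_def[abs_def] by (rule power_quotient_tendsto[OF ab(2) ab(4) b1])
let ?d = "measure cmeas UNIV"
have mS: "measure lborel (S n) = (b n - a n) * (q n / DIM('a) * ?d)" "emeasure lborel (S n) < \<infinity>" for n
 using meas_shell[OF ab(1)[of n] less_imp_le[OF ab(2)[of n]]] ab(2)[of n] by (simp_all add: S_def q_def)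
let ?b = "LINT x|cmeas. g x *r A x"
let ?f = "%x. g (hat x)"
have main: "(LINT x:S n|lborel. ?f x *r A (hat x)) = ((b n - a n) * (q n / DIM('a))) *r ?b"
 "set_integrable lborel (S n) (%x. ?f x *r A (hat x))" for n
 using int_hat_shell[OF _ i ab(1)[of n] less_imp_le[OF ab(2)[of n]]] ab(2)[of n] by (simp_all add: S_def q_def)
have hat_in: "x : ?e" "hat x : ?e" if "x : S n" for x n
proof -
 show "x : ?e" using that ab(3)[of n] by (simp add: S_def closure_eq)
 have "x ~= 0" using that ab(1)[of n] rho_0 by (auto simp: S_def)
 then show "hat x : ?e" by (simp add: closure_eq rho_hat)
qed
let ?h = "%x. A x - A (hat x)"
have i2: "set_integrable lborel (S n) (%x. ?f x *r A x)" for n unfolding set_integrable_def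
proof (rule integrable_bound)
 show "ilb (%x. indr (S n) x *r (C * M))" using Sm mS(2) by (intro integrable_scaleR_left integrable_real_indicator) auto
 show "AEL x. norm (indr (S n) x *r ?f x *r A x) <= norm (indr (S n) x *r (C * M))" using gC
 proof eventually_elim
  case (elim x)
  show ?case
  proof (cases "x : S n")
   case True
   have "abs (g (hat x)) * norm (A x) <= C * M" using elim M[OF hat_in(1)[OF True]] C0 by (intro mult_mono) auto
   then show ?thesis using True by simp
  qed simp
 qed
 show "(%x. indr (S n) x *r ?f x *r A x) : borel_measurable lborel" using Sm[of n] by measurable
qed
let ?a = "%n. LINT x:S n|lborel. ?f x *r ?h x"
let ?c = "%n. 1 / (b n - a n)"
have err: "(%n. ?c n *r ?a n) ----> 0"
proof (rule LIMSEQ_I)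
 fix e :: real assume e: "0 < e"
 define K where "K = C * (?d * 2) + 1"
 have K: "0 < K" using C0 by (simp add: K_def add_nonneg_pos)
 have "uniformly_continuous_on ?e A" by (rule compact_uniformly_continuous[OF A compact_cl_dom])
 then obtain d where d: "0 < d" "!!x y. x : ?e ==> y : ?e ==> dist y x < d ==> dist (A y) (A x) < e / K"
  unfolding uniformly_continuous_on_def using e K by (metis divide_pos_pos)
 obtain R where R: "0 < R" "!!x. norm x <= R * rho x" using norm_le_rho by blast
 have "eventually (%n. (1 - a n) * R < d) sequentially"
 proof -
  have "(%n. (1 - a n) * R) ----> (1 - 1) * R" by (intro tendsto_intros ab(4))
  then show ?thesis using d(1) by (auto simp: order_tendsto_iff)
 qed
 moreover have "eventually (%n. q n < 2 * real DIM('a)) sequentially" using q by (auto simp: order_tendsto_iff)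
 ultimately have "eventually (%n. norm (?c n *r ?a n - 0) < e) sequentially"
 proof eventually_elim
  case (elim n)
  let ?g = "C * (e / K)"
  have "norm (?a n) <= ?g * measure lborel (S n)"
  proof (rule set_int_norm_le[OF Sm mS(2)])
   show "0 <= ?g" using C0 e K by simp
   show "AEL x. x : S n --> norm (?f x *r ?h x) <= ?g" using gC
   proof eventually_elim
    case (elim x)
    show ?case
    proof
     assume x: "x : S n"
     have rx: "a n <= rho x" "rho x < 1" using x ab(3)[of n] by (auto simp: S_def)
     have "x ~= 0" using rx ab(1)[of n] rho_0 by auto
     have "x - hat x = (rho x - 1) *r hat x" using rho_times_hat[of x] by (simp add: scaleR_diff_left)
     then have "norm (x - hat x) = (1 - rho x) * norm (hat x)" using rx by simp
     also have "... <= (1 - a n) * R" using rx R(2)[of "hat x"] rho_hat[OF `x \<noteq> 0`] by (intro mult_mono) auto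
     finally have "dist x (hat x) < d" using `(1 - a n) * R < d` by (simp add: dist_norm)
     then have "norm (?h x) <= e / K" using d(2)[OF hat_in(2)[OF x] hat_in(1)[OF x]] by (simp add: dist_norm less_imp_le)
     with elim C0 have "abs (g (hat x)) * norm (?h x) <= ?g" by (intro mult_mono) auto
     then show "norm (?f x *r ?h x) <= ?g" by (simp only: norm_scaleR)
    qed
   qed
  qed
  then have "norm (?c n *r ?a n) <= ?c n * (?g * measure lborel (S n))"
   using ab(2)[of n] unfolding norm_scaleR by (intro mult_mono) auto
  also have "... = C * (e / K) * (q n / DIM('a) * ?d)" using ab(2)[of n] unfolding mS(1) by simp
  also have "... <= C * (e / K) * (2 * ?d)" using elim C0 e K by (intro mult_left_mono mult_right_mono) (auto simp: divide_le_eq)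
  also have "... = (C * (?d * 2)) * (e / K)" by simp
  also have "... < K * (e / K)" using e K by (intro mult_strict_right_mono) (auto simp: K_def)
  also have "... = e" using K by simp
  finally show ?case by simp
 qed
 then show "EX no. \<forall>n\<ge>no. norm (?c n *r ?a n - 0) < e" by (simp add: eventually_sequentially)
qed
have lim: "(%n. (q n / DIM('a)) *r ?b) ----> (real DIM('a) / DIM('a)) *r ?b" using q by (intro tendsto_intros) auto
have eq: "?c n *r (LINT x:S n|lborel. ?f x *r A x) =
  ?c n *r ?a n + (q n / DIM('a)) *r ?b" for n
proof -
 have "?a n = (LINT x:S n|lborel. ?f x *r A x) - (LINT x:S n|lborel. ?f x *r A (hat x))"
  unfolding scaleR_diff_right by (rule set_integral_diff(2)[OF i2 main(2)])
 then show ?thesis unfolding main(1) using ab(2)[of n] by (simp add: scaleR_diff_right)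
qed
show "(%n. ?c n *r (LINT x:{x. a n <= rho x & rho x < b n}|lborel. ?f x *r A x))
 ----> ?b" unfolding S_def[symmetric] eq using tendsto_add[OF err lim] by simp
qed

end

definition box_conv :: "'a::euclidean_space => ('a => real) => ('a => real) => 'a => real" where
"box_conv p b k x = integral (cbox (- p) p) (%y. b y * k (x - y))"

lemma box_conv_deriv: fixes b :: "'a::euclidean_space => real"
assumes b: "cont UNIV b" and k: "smooth k"
shows "(box_conv p b k hder (%h. box_conv p b (%z. fd k z h) x)) (at x)"
proof -
let ?b = "%y x. %h. b y * fd k (x - y) h"
define fx where "fx x y = Blinfun (?b y x)" for x y
have bl: "bounded_linear (?b y x)" for x y
 by (rule bounded_linear_compose[OF bounded_linear_mult_right has_derivative_bounded_linear[OF smooth_deriv[OF k]]])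
have fx_apply: "blinfun_apply (fx x y) h = b y * fd k (x - y) h" for x y h
 unfolding fx_def by (subst bounded_linear_Blinfun_apply[OF bl]) simp
have kc: "cont UNIV k" by (rule smooth_cont[OF k])
have Dc: "cont UNIV (%z. fd k z i)" for i by (rule smooth_cont[OF smooth_frechet[OF k]])
let ?a = "cbox (- p) p"
have cfx: "cont (UNIV \<times> ?a) (%(x, y). fx x y)"
proof (rule continuous_on_blinfun_componentwise)
 fix i :: 'a
 have "cont (UNIV \<times> ?a) (%xy. b (snd xy) * fd k (fst xy - snd xy) i)"
  by (intro continuous_on_mult continuous_on_compose2[OF b] continuous_on_compose2[OF Dc]) (auto intro!: continuous_intros)
 then show "cont (UNIV \<times> ?a) (%x. blinfun_apply (case x of (x, y) => fx x y) i)" by (simp add: case_prod_beta fx_apply)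
qed
have "((%x. integral ?a (%y. b y * k (x - y))) hder blinfun_apply (integral ?a (fx x))) (at x within UNIV)"
proof (rule leibniz_rule)
 fix x y :: 'a
 have "((%x. x - y) hder (%h. h)) (at x)" by (auto intro!: derivative_eq_intros)
 from has_derivative_mult_right[OF has_derivative_compose[OF this smooth_deriv[OF k]], of "b y"]
 have "((%x. b y * k (x - y)) hder (?b y x)) (at x)" .
 then show "((%x. b y * k (x - y)) hder blinfun_apply (fx x y)) (at x within UNIV)" by (simp add: fx_apply[abs_def] cong: )
next
 fix x :: 'a
 show "(%y. b y * k (x - y)) integrable_on cbox (- p) p"
  by (intro integrable_continuous continuous_on_mult continuous_on_subset[OF b] continuous_on_compose2[OF kc]) (auto intro!: continuous_intros)
qed (use cfx in auto)
moreover have "blinfun_apply (integral ?a (fx x)) = (%h. box_conv p b (%z. fd k z h) x)"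
proof
 fix h
 have "cont ?a (%y. case (x, y) of (x, y) => fx x y)" by (rule continuous_on_compose2[OF cfx]) (auto intro!: continuous_intros)
 then have "cont ?a (fx x)" by simp
 then have "fx x integrable_on cbox (- p) p" by (rule integrable_continuous)
 then show "blinfun_apply (integral ?a (fx x)) h = box_conv p b (%z. fd k z h) x"
  by (simp add: blinfun_apply_integral fx_apply box_conv_def)
qed
ultimately show ?thesis by (simp add: box_conv_def[abs_def])
qed

lemma smooth_box_conv:
assumes a: "cont UNIV a" and k: "smooth k"
shows "smooth (box_conv p a k)"
proof -
have "smooth k ==> diff_times n (box_conv p a k)" for n
proof (induction n arbitrary: k)
 case (Suc n)
 show ?case by (rule dt_SucI[OF box_conv_deriv[OF a Suc.prems]]) (rule Suc.IH[OF smooth_frechet[OF Suc.prems]])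
qed simp
then show ?thesis using k by (simp add: smooth_iff_dt)
qed

lemma box_conv_scaled: fixes b :: "'a::euclidean_space => real"
assumes b: "cont UNIV b" "!!x. x ~: cbox (- p) p ==> b x = 0" and k: "cont UNIV k" and c: "0 < c"
shows "box_conv p b (%z. s * k (z /\<^sub>R c)) x = s * c ^ DIM('a) * (LB z. b (x + (- c) *r z) * k z)"
proof -
have [measurable]: "b : BM" "k : BM" using bmc_onI[OF b(1)] bmc_onI[OF k] by auto
let ?a = "%y. b y * (s * k ((x - y) /\<^sub>R c))"
have cont: "cont (cbox (- p) p) (%y. ?a y)"
 by (intro continuous_on_mult continuous_on_subset[OF b(1)] continuous_on_compose2[OF k] continuous_on_const)
   (auto intro!: continuous_intros)
let ?b = "%z. b (x + (- c) *r z) * (s * k ((x - (x + (- c) *r z)) /\<^sub>R c))"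
have "box_conv p b (%z. s * k (z /\<^sub>R c)) x = (LINT y:cbox (- p) p|lborel. ?a y)"
 unfolding box_conv_def using borel_integrable_compact[OF compact_cbox cont]
 by (intro set_borel_integral_eq_integral(2)[symmetric]) (simp add: set_integrable_def)
also have "... = (LB y. ?a y)" unfolding set_lint_def
 by (intro integral_cong refl) (use b(2) in "auto simp: indicator_def simp del: mem_box")
also have "... = abs (- c) ^ DIM('a) *r (LB z. ?b z)" using c by (intro lb_int_affine) auto
also have "(%z. ?b z) = (%z. s * (b (x + (- c) *r z) * k z))" using c by (simp add: fun_eq_iff mult_ac)
finally show ?thesis using c by (simp add: mult_ac)
qed

lemma mollification: fixes d :: "'a::euclidean_space => real"
assumes lip: "C-lip UNIV d" and K: "compact K" "!!x. x ~: K ==> d x = 0" and U: "open U" "K <= U"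
obtains g :: "nat => 'a => real" and B :: real and Bd :: "'a => real"
where "!!n. smooth (g n)" "!!n. compact (supp (g n))" "!!n. supp (g n) <= U"
 "!!n x. abs (g n x) <= B" "!!x. (%n. g n x) ----> d x"
 "!!n x h. abs (fd (g n) x h) <= Bd h"
 "!!x D h. (d hder D) (at x) ==> (%n. fd (g n) x h) ----> D h"
proof -
have dc: "cont UNIV d" using lip by (rule lipschitz_on_continuous_on)
have C0: "0 <= C" using lip lipschitz_on_nonneg by blast
define b0 :: "'a => real" where "b0 = bump (- One) One"
have b0: "smooth b0" "!!x. 0 <= b0 x" "!!x. x ~: box (- One) One ==> b0 x = 0"
 unfolding b0_def by (auto simp: smooth_bump bump_nonneg bump_eq_0)
have b0i: "ilb b0" by (rule intbl_cont_bdd_supp[OF smooth_cont[OF b0(1)] bounded_box b0(3)])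
define m where "m = (LB x. b0 x)"
have "m ~= 0"
proof
 assume "m = 0"
 then have "AEL x. b0 x = 0" unfolding m_def using integral_nonneg_eq_0_iff_AE[OF b0i] b0(2) by simp
 then have "AEL x. x ~: box (- One) (One :: 'a)" by eventually_elim (use bump_pos b0_def in fastforce)
 then have "box (- One) (One :: 'a) : null_sets lborel" by (subst AE_iff_null_sets) auto
 then have "negligible (box (- One) (One :: 'a))" unfolding negligible_iff_null_sets by (rule null_sets_completionI)
 moreover have "0 : box (- One) (One :: 'a)" by (simp add: mem_box)
 ultimately show False using open_not_negligible[OF open_box] by blast
qed
moreover have "0 <= m" unfolding m_def using b0(2) by (intro integral_nonneg_AE) simp
ultimately have m: "0 < m" by simp
define b where "b x = (1 / m) * b0 x" for x
have b: "smooth b" "!!x. 0 <= b x" "!!x. x ~: box (- One) One ==> b x = 0" "ilb b" "(LB x. b x) = 1"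
proof -
 show "smooth b" unfolding b_def[abs_def] by (rule smooth_mult[OF smooth_const b0(1)])
qed (use b0 m b0i in "auto simp: b_def[abs_def] m_def[symmetric]")
have bsupp: "compact (supp b)" by (rule cl_supp_in_box(2)) (rule b(3))
have bc: "cont UNIV b" by (rule smooth_cont[OF b(1)])
have Dbc: "cont UNIV (%z. fd b z h)" for h by (rule smooth_cont[OF smooth_frechet[OF b(1)]])
have [measurable]: "d : BM" "b : BM" "!!h. (%z. fd b z h) : BM" using bmc_onI[OF dc] bmc_onI[OF bc] bmc_onI[OF Dbc] by auto
obtain D0 where D0: "0 < D0" "ALL z:box (- One) (One :: 'a). norm z <= D0" using bounded_box[of "- One" "One :: 'a"] unfolding bounded_pos by blast
obtain e where e: "0 < e" "(\<Union>x\<in>K. cball x e) <= U" using compact_subset_open_imp_cball_epsilon_subset[OF K(1) U] by blast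
define c0 where "c0 = e / D0"
have c0: "0 < c0" using e D0 by (simp add: c0_def)
define c where "c n = c0 / real (Suc n)" for n
have c: "0 < c n" "c n <= c0" for n using c0 by (simp_all add: c_def divide_le_eq mult_le_cancel_left1)
obtain p where p: "K <= cbox (- p) p" using bounded_subset_cbox_symmetric[OF compact_imp_bounded[OF K(1)]] by blast
have dp: "d x = 0" if "x ~: cbox (- p) p" for x using that p K(2) by blast
let ?i = "%n. 1 / c n ^ DIM('a)"
define kn where "kn n z = ?i n * b (z /\<^sub>R c n)" for n z
have kn: "smooth (kn n)" for n
proof -
 have "smooth (%z. b (z /\<^sub>R c n + 0))" by (rule smooth_affine[OF bounded_linear_scaleR_right b(1)])
 then show ?thesis unfolding kn_def[abs_def] by (intro smooth_mult smooth_const) simp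
qed
define g where "g n = box_conv p d (kn n)" for n
let ?f = "%x n z. x + (- c n) *r z"
have gs: "smooth (g n)" for n unfolding g_def by (rule smooth_box_conv[OF dc kn])
let ?a = "%x n z. d (?f x n z)"
have geq: "g n x = (LB z. ?a x n z * b z)" for n x
 unfolding g_def kn_def[abs_def] using box_conv_scaled[OF dc dp bc c(1)[of n], where s = "?i n" and x = x] c(1)[of n] by simp
have Dkn: "fd (kn n) z h = (1 / c n ^ Suc DIM('a)) * fd b (z /\<^sub>R c n) h" for n z h
proof -
 have 1: "((%y. y /\<^sub>R c n) hder (%h. h /\<^sub>R c n)) (at z)"
  by (intro bounded_linear_imp_has_derivative bounded_linear_scaleR_right)
 let ?d = "%h. fd b (z /\<^sub>R c n) (h /\<^sub>R c n)"
 have "(kn n hder (%h. ?i n * ?d h)) (at z)"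
  unfolding kn_def[abs_def] by (rule has_derivative_mult_right[OF has_derivative_compose[OF 1 smooth_deriv[OF b(1)]]])
 from fun_cong[OF frechet_derivative_at[OF this], of h]
 have "fd (kn n) z h = ?i n * ?d h" by simp
 also have "?d h = inverse (c n) * fd b (z /\<^sub>R c n) h"
  using linear_scale[OF has_derivative_linear[OF smooth_deriv[OF b(1)]], of _ "inverse (c n)" h] by simp
 finally show ?thesis by (simp add: field_simps)
qed
have Dint: "ilb (%z. f z * fd b z h)" if "cont UNIV f" for f :: "'a => real" and h
 by (rule intbl_cont_bdd_supp[OF _ compact_imp_bounded[OF bsupp]]) (auto intro!: continuous_on_mult that Dbc simp: fd_off_supp)
have Dzero: "(LB z. fd b z h) = 0" for h
proof -
 have "0-lip UNIV (%x :: 'a. 1 :: real)" by (simp add: lipschitz_on_def)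
 from ibp_dir(1)[OF this b(1) bsupp, of "%_. 0" h] show ?thesis by simp
qed
have dsc: "cont UNIV (%z. ?a x n z)" for x n by (intro continuous_on_compose2[OF dc]) (auto intro!: continuous_intros)
let ?b = "%x n z h. ((?a x n z - d x) / c n) * fd b z h"
have Dg: "fd (g n) x h = (LB z. ?b x n z h)" for n x h
proof -
 let ?g = "LB z. ?a x n z * fd b z h"
 have "fd (g n) x h = box_conv p d (%z. fd (kn n) z h) x"
  unfolding g_def using fun_cong[OF frechet_derivative_at[OF box_conv_deriv[OF dc kn[of n], of p x]], of h] by simp
 also have "... = (1 / c n ^ Suc DIM('a)) * c n ^ DIM('a) * ?g" unfolding Dkn by (rule box_conv_scaled[OF dc dp Dbc c(1)])
 also have "(1 / c n ^ Suc DIM('a)) * c n ^ DIM('a) = 1 / c n" using c(1)[of n] by simp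
 also have "1 / c n * ?g =
  1 / c n * (?g - (LB z. d x * fd b z h))" using Dzero[of h] by simp
 also have "... = 1 / c n * (LB z. ?a x n z * fd b z h - d x * fd b z h)"
  by (subst integral_diff[OF Dint[OF dsc] Dint[OF continuous_on_const]]) simp
 also have "... = (LB z. 1 / c n * (?a x n z * fd b z h - d x * fd b z h))" by simp
 also have "... = (LB z. ?b x n z h)" by (intro integral_cong refl) (simp add: left_diff_distrib[symmetric])
 finally show ?thesis .
qed
let ?c = "%z h. (C * norm z) * abs (fd b z h)"
define Bd where "Bd h = (LB z. ?c z h)" for h
have Bdi: "ilb (%z. ?c z h)" for h by (rule intbl_cont_bdd_supp[OF _ compact_imp_bounded[OF bsupp]])
   (auto intro!: continuous_on_mult continuous_on_rabs Dbc continuous_on_norm continuous_on_id continuous_on_const simp: fd_off_supp)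
have qb: "abs (((?a x n z - d x) / c n) * fd b z h) <= ?c z h" for n x z h
proof -
 have "abs (d (?f x n z) - d x) <= C * norm ((- c n) *r z)" using lipschitz_onD[OF lip, of "?f x n z" x] by (simp add: dist_norm)
 then have "abs ((?a x n z - d x) / c n) <= C * norm z" using c(1)[of n] by (simp add: divide_le_eq mult_ac)
 then show ?thesis unfolding abs_mult by (rule mult_right_mono) simp
qed
let ?h = "borel_measurable lborel"
have qm: "(%z. ?b x n z h) : ?h" for n x h by measurable
have Dgb: "abs (fd (g n) x h) <= Bd h" for n x h unfolding Dg Bd_def
proof (rule integral_abs_bound_integral[OF integrable_bound[OF Bdi qm] Bdi])
 show "AEL z. norm (?b x n z h) <= norm (?c z h)" by (intro AE_I2) (metis qb abs_ge_self order_trans real_norm_def)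
qed (rule qb)
have lim1: "(%n. fd (g n) x h) ----> D h" if D: "(d hder D) (at x)" for x D h
proof -
 have blD: "bounded_linear D" by (rule has_derivative_bounded_linear[OF D])
 have linD: "linear D" by (rule bounded_linear.linear[OF blD])
 obtain L where L: "!!x. norm (D x) <= norm x * L" "0 < L" using bounded_linear.pos_bounded[OF blD] by blast
 have "L-lip UNIV D"
 proof (rule lipschitz_onI)
  fix u v show "dist (D u) (D v) <= L * dist u v"
   using L(1)[of "u - v"] by (simp add: dist_norm linear_diff[OF linD] mult.commute)
 qed (use L in simp)
 have Dcont: "cont UNIV D" using blD by (rule linear_continuous_on)
 have "(%n. real (Suc n) *r (D (x + (1 / real (Suc n)) *r h) - D x)) ----> D h" for x
  by (rule dq_LIMSEQ[OF bounded_linear_imp_has_derivative[OF blD]])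
 then have "(LB z. b z * D h) = - (LB z. fd b z h * D z)"
  using ibp_dir(1)[OF `L-lipschitz_on UNIV D` b(1) bsupp, of "%_. D h" h] by simp
 then have Dh: "(LB z. (- D z) * fd b z h) = D h" using b(5) by (simp add: mult.commute)
 have "(%n. (LB z. ?b x n z h)) ----> (LB z. (- D z) * fd b z h)"
 proof (rule integral_dominated_convergence[OF _ _ Bdi[of h]])
  have "(%n. (?a x n z - d x) / c n) ----> - D z" for z
  proof -
   let ?e = "%n. (1 / c0) * (real (Suc n) *r (d (x + (1 / real (Suc n)) *r (- c0 *r z)) - d x))"
   have "(%n. ?e n) ----> (1 / c0) * D (- c0 *r z)" by (intro tendsto_mult_left dq_LIMSEQ[OF D])
   moreover have "(1 / c0) * D (- c0 *r z) = - D z" using c0 linear_scale[OF linD, of "- c0" z] by simp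
   moreover have "?e n = (?a x n z - d x) / c n" for n using c0 by (simp add: c_def del: of_nat_Suc)
   ultimately show ?thesis by simp
  qed
  then show "AEL z. (%n. ?b x n z h) ----> (- D z) * fd b z h" by (intro AE_I2 tendsto_mult tendsto_const)
  show "AEL z. norm (?b x n z h) <= ?c z h" for n unfolding real_norm_def by (rule AE_I2) (rule qb)
  show "(%z. (- D z) * fd b z h) : ?h" using bmc_onI[OF Dcont] by measurable
 qed (rule qm)
 then show ?thesis unfolding Dg Dh .
qed
have bK: "bounded (d ` K)" by (rule compact_imp_bounded[OF compact_continuous_image[OF continuous_on_subset[OF dc] K(1)]]) simp
then obtain B' where B': "ALL x:K. abs (d x) <= B'" unfolding bounded_iff by auto
define B where "B = max 0 B'"
have B: "abs (d x) <= B" for x using B' K(2)[of x] by (cases "x : K") (auto simp: B_def)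
have pb: "abs (d (?f x n z) * b z) <= B * b z" for n x z
 using B[of "?f x n z"] b(2)[of z] unfolding abs_mult by (simp add: mult_right_mono)
have Bi: "ilb (%z. B * b z)" using b(4) by simp
have pm: "(%z. ?a x n z * b z) : ?h" for x n by measurable
have gb: "abs (g n x) <= B" for n x
proof -
 have "abs (g n x) <= (LB z. B * b z)" unfolding geq
 proof (rule integral_abs_bound_integral[OF integrable_bound[OF Bi pm] Bi])
  show "AEL z. norm (?a x n z * b z) <= norm (B * b z)"
   using pb[of x n] by (intro AE_I2) (metis abs_ge_self order_trans real_norm_def)
 qed (rule pb)
 then show ?thesis using b(5) by simp
qed
have glim: "(%n. g n x) ----> d x" for x
proof -
 have "(%n. (LB z. ?a x n z * b z)) ----> (LB z. d x * b z)"
 proof (rule integral_dominated_convergence[OF _ pm Bi])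
  have c_lim: "c ----> 0" unfolding c_def[abs_def]
   using tendsto_mult_left[OF LIMSEQ_inverse_real_of_nat, of c0] by (simp add: divide_inverse)
  have "(%n. ?a x n z) ----> d x" for z
  proof -
   have "(%n. ?f x n z) ----> x + (- 0) *r z" by (intro tendsto_intros c_lim)
   then have "(%n. ?f x n z) ----> x" by simp
   then show ?thesis using dc by (intro isCont_tendsto_compose[of x d]) (simp_all add: continuous_on_eq_continuous_at)
  qed
  then show "AEL z. (%n. ?a x n z * b z) ----> d x * b z" by (intro AE_I2 tendsto_mult tendsto_const)
  show "AEL z. norm (?a x n z * b z) <= B * b z" for n unfolding real_norm_def by (rule AE_I2) (rule pb)
 qed measurable
 then show ?thesis unfolding geq using b(5) by simp
qed
define T where "T = {x + y | x y. x : K & y : cball 0 e}"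
have Tc: "compact T" unfolding T_def by (rule compact_sums[OF K(1) compact_cball])
have TU: "T <= U"
proof
 fix t assume "t : T"
 then obtain x y where t: "t = x + y" "x : K" "norm y <= e" unfolding T_def by auto
 then have "t : cball x e" by (simp add: dist_norm)
 then show "t : U" using e(2) t(2) by blast
qed
have supp: "{x. g n x ~= 0} <= T" for n
proof
 fix x assume x: "x : {x. g n x ~= 0}"
 have "EX z. ?a x n z * b z ~= 0"
 proof (rule ccontr)
  assume "\<not> ?thesis"
  then have "(%z. ?a x n z * b z) = (%z. 0)" by blast
  then have "g n x = 0" unfolding geq by (simp only: integral_zero)
  with x show False by simp
 qed
 then obtain z where z: "?a x n z ~= 0" "b z ~= 0" by auto
 have "?f x n z : K" using z(1) K(2) by blast
 moreover have "norm (c n *r z) <= e"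
 proof -
  have "norm z <= D0" using z(2) b(3) D0(2) by blast
  then have "c n * norm z <= c0 * D0" using c[of n] by (intro mult_mono) auto
  then show ?thesis using c(1)[of n] D0(1) by (simp add: c0_def)
 qed
 moreover have "x = ?f x n z + c n *r z" by simp
 ultimately show "x : T" unfolding T_def by (metis (mono_tags, lifting) mem_Collect_eq mem_cball_0)
qed
have clo: "supp (g n) <= T" for n by (rule closure_minimal[OF supp compact_imp_closed[OF Tc]])
have clc: "compact (supp (g n))" for n
 using bounded_subset[OF compact_imp_bounded[OF Tc] clo[of n]] by (simp add: compact_eq_bounded_closed)
show thesis by (rule that[of g B Bd]) (use gs clc clo TU gb glim Dgb lim1 in "blast+")
qed

lemma bdd_grad_lip_on_compact: fixes f :: "'a::euclidean_space => real"
assumes U: "open U" and K: "compact K" "K <= U"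
 and f: "!!x. x : U ==> (f hder (%h. inner (g x) h)) (at x)" and M: "!!x. x : U ==> norm (g x) <= M"
obtains L where "L-lip K f"
proof (cases "K = {}")
case True
then show thesis using that[of 0] by (simp add: lipschitz_on_def)
next
case False
obtain e where e: "0 < e" "(\<Union>x\<in>K. cball x e) <= U" using compact_subset_open_imp_cball_epsilon_subset[OF K(1) U K(2)] by blast
have fc: "cont K f"
 by (rule has_derivative_continuous_on[of K f "%x h. inner (g x) h"]) (use f K(2) has_derivative_at_withinI in blast)
obtain B where B: "ALL x:K. abs (f x) <= B" using compact_imp_bounded[OF compact_continuous_image[OF fc K(1)]] unfolding bounded_iff by auto
have M0: "0 <= M" using False K(2) M norm_ge_zero order_trans by blast
have B0: "0 <= B" using False B by force
define L where "L = M + 2 * B / e"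
have L: "M <= L" "2 * B / e <= L" using M0 B0 e by (auto simp: L_def)
show thesis
proof (rule that[of L], rule lipschitz_onI)
 show "0 <= L" using L(1) M0 by simp
 fix x y assume xy: "x : K" "y : K"
 show "dist (f x) (f y) <= L * dist x y"
 proof (cases "dist x y <= e")
  case True
  have sub: "cball x e <= U" using e(2) xy(1) by blast
  have "M-lip (cball x e) f"
  proof (rule bounded_derivative_imp_lipschitz[OF _ convex_cball _ M0])
   show "(f hder (%h. inner (g z) h)) (at z within cball x e)" if "z : cball x e" for z
    using f[of z] that sub has_derivative_at_withinI by blast
   show "onorm (%h. inner (g z) h) <= M" if "z : cball x e" for z
   proof (rule onorm_le)
    fix h
    have "norm (inner (g z) h) <= norm (g z) * norm h" by (simp add: Cauchy_Schwarz_ineq2)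
    also have "... <= M * norm h" using M[of z] that sub by (intro mult_right_mono) auto
    finally show "norm (inner (g z) h) <= M * norm h" .
   qed
  qed
  then have "dist (f x) (f y) <= M * dist x y" using True e(1) by (auto intro!: lipschitz_onD)
  also have "... <= L * dist x y" using L(1) by (intro mult_right_mono) auto
  finally show ?thesis .
 next
  case False
  have "dist (f x) (f y) <= abs (f x) + abs (f y)" by (simp add: dist_real_def)
  also have "... <= 2 * B" using B[rule_format, OF xy(1)] B[rule_format, OF xy(2)] by linarith
  also have "... = 2 * B / e * e" using e by simp
  also have "... <= L * dist x y" using False L B0 e M0 by (intro mult_mono) auto
  finally show ?thesis .
 qed
qed
qed

lemma lip_cutoff_mult: fixes b f :: "'a::metric_space => real"
assumes b: "Lc-lip UNIV b" "!!x. 0 <= b x" "!!x. b x <= 1" "!!x. x ~: K ==> b x = 0"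
 and f: "Lf-lip K f" "!!x. x : K ==> \<bar>f x\<bar> <= B" and B: "0 <= B"
shows "(Lc * B + Lf)-lip UNIV (%x. b x * f x)"
proof (rule lipschitz_onI)
have L: "0 <= Lc" "0 <= Lf" using b(1) f(1) lipschitz_on_nonneg by auto
then show "0 <= Lc * B + Lf" using B by simp
have one: "abs (b x * f x) <= (Lc * B + Lf) * dist x y" if "x : K" "y ~: K" for x y
proof -
 have "abs (b x) <= Lc * dist x y" using lipschitz_onD[OF b(1), of x y] b(4)[OF that(2)] by (simp add: dist_real_def)
 then have "abs (b x) * abs (f x) <= (Lc * dist x y) * B" using f(2)[OF that(1)] L B by (intro mult_mono) auto
 also have "... <= (Lc * B + Lf) * dist x y" using L by (simp add: algebra_simps)
 finally show ?thesis by (simp add: abs_mult)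
qed
fix x y
consider "x : K" "y : K" | "x : K" "y ~: K" | "x ~: K" "y : K" | "x ~: K" "y ~: K" by blast
then show "dist (b x * f x) (b y * f y) <= (Lc * B + Lf) * dist x y"
proof cases
 case 1
 have "b x * f x - b y * f y = (b x - b y) * f x + b y * (f x - f y)" by (simp add: algebra_simps)
 then have "abs (b x * f x - b y * f y) <= abs (b x - b y) * abs (f x) + abs (b y) * abs (f x - f y)"
  by (metis abs_mult abs_triangle_ineq)
 also have "... <= (Lc * dist x y) * B + 1 * (Lf * dist x y)"
  using lipschitz_onD[OF b(1), of x y] lipschitz_onD[OF f(1) 1] f(2)[OF 1(1)] b(2,3)[of y] B L
  by (intro add_mono mult_mono) (auto simp: dist_real_def)
 finally show ?thesis by (simp add: dist_real_def algebra_simps)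
next
 case 2 then show ?thesis using one[of x y] b(4)[of y] by (simp add: dist_real_def)
next
 case 3 then show ?thesis using one[of y x] b(4)[of x] by (simp add: dist_real_def dist_commute)
next
 case 4 then show ?thesis using b(4) L B by simp
qed
qed

context star_domain
begin

definition weak_div :: "('a => 'a => 'b::euclidean_space) => ('a => 'b) => bool" where
"weak_div F w \<longleftrightarrow> (ALL c :: 'a => real. smooth c --> compact (supp c) --> supp c <= Y -->
  (LINT x:Y|lborel. (\<Sum>i\<in>Basis. fd c x i *r F i x)) = - (LINT x:Y|lborel. c x *r w x))"

lemma cont_cl_bdd: fixes A :: "'a => 'b::real_normed_vector"
assumes "cc A"
obtains M where "0 <= M" "!!x. x : closure Y ==> norm (A x) <= M"
proof -
obtain M where M: "ALL x:closure Y. norm (A x) <= M"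
 using compact_imp_bounded[OF compact_continuous_image[OF assms compact_cl_dom]] unfolding bounded_iff by blast
moreover have "0 : closure Y" using rho_0 by (simp add: closure_eq)
ultimately have "0 <= M" using norm_ge_zero order_trans by blast
then show thesis using M that by blast
qed

lemma set_intbl_dom_bdd: fixes f :: "'a => 'b::euclidean_space"
assumes [measurable]: "f : BM" and f: "AEL x. x : Y --> norm (f x) <= M"
shows "set_integrable lborel Y f" unfolding set_integrable_def
proof (rule integrable_bound)
show "ilb (%x. indr Y x *r M)" using emeas_dom by (intro integrable_scaleR_left integrable_real_indicator) auto
show "AEL x. norm (indr Y x *r f x) <= norm (indr Y x *r M)" using f
proof eventually_elim
 case (elim x)
 then show ?case using abs_ge_self[of M] by (cases "x : Y") auto
qed
qed measurable

lemma weak_div_lip: fixes F :: "'a => 'a => 'b::euclidean_space" and d :: "'a => real"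
assumes wd: "weak_div F w" and Fc: "!!i. cc (F i)" and Fm[measurable]: "!!i. F i : BM"
 and wm[measurable]: "w : BM" and wi: "set_integrable lborel Y w"
 and lip: "C-lip UNIV d" and K: "compact K" "!!x. x ~: K ==> d x = 0" "K <= Y" and gm[measurable]: "g : BM"
 and g: "AEL x. (d hder (%h. inner (g x) h)) (at x)"
shows "(LINT x:Y|lborel. (\<Sum>i\<in>Basis. inner (g x) i *r F i x)) = - (LINT x:Y|lborel. d x *r w x)"
proof -
obtain c :: "nat => 'a => real" and B :: real and Bd :: "'a => real"
where c: "!!n. smooth (c n)" "!!n. compact (supp (c n))" "!!n. supp (c n) <= Y"
 "!!n x. abs (c n x) <= B" "!!x. (%n. c n x) ----> d x"
 "!!n x h. abs (fd (c n) x h) <= Bd h"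
 "!!x D h. (d hder D) (at x) ==> (%n. fd (c n) x h) ----> D h" using mollification[OF lip K(1,2) open_domain K(3)] by blast
have [measurable]: "d : BM" "!!n. c n : BM" "!!n i. (%x. fd (c n) x i) : BM"
 using bmc_onI[OF lipschitz_on_continuous_on[OF lip]] bmc_onI[OF smooth_cont[OF c(1)]]
  bmc_onI[OF smooth_cont[OF smooth_frechet[OF c(1)]]] by auto
have "EX M. 0 <= M & (ALL x:closure Y. norm (F i x) <= M)" for i using cont_cl_bdd[OF Fc[of i]] by metis
then obtain M where M: "!!i. 0 <= M i" "!!i x. x : closure Y ==> norm (F i x) <= M i" by metis
let ?a = "%n x. \<Sum>i\<in>Basis. fd (c n) x i *r F i x"
let ?c = "%x. \<Sum>i\<in>Basis. inner (g x) i *r F i x"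
have l1: "(%n. LINT x:Y|lborel. ?a n x) ----> (LINT x:Y|lborel. ?c x)" unfolding set_lint_def
proof (rule integral_dominated_convergence)
 let ?b = "\<Sum>i\<in>Basis. Bd i * M i"
 show "ilb (%x. indr Y x *r ?b)" using emeas_dom by (intro integrable_scaleR_left integrable_real_indicator) auto
 show "AEL x. (%n. indr Y x *r ?a n x) ---->
   indr Y x *r ?c x" using g by eventually_elim (intro tendsto_intros c(7))
 fix n
 have "norm (indr Y x *r ?a n x) <= indr Y x *r ?b" for x
 proof (cases "x : Y")
  case True
  have "norm (?a n x) <= ?b"
  proof (rule sum_norm_le)
   fix i :: 'a
   have "0 <= Bd i" using c(6)[of n x i] by linarith
   moreover have "norm (F i x) <= M i" using True closure_subset[of Y] by (intro M(2)) blast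
   ultimately show "norm (fd (c n) x i *r F i x) <= Bd i * M i" unfolding norm_scaleR real_norm_def by (intro mult_mono c(6)) auto
  qed
  then show ?thesis using True by simp
 qed simp
 then show "AEL x. norm (indr Y x *r ?a n x) <= indr Y x *r ?b" by (rule AE_I2)
qed measurable
let ?d = "%n. LINT x:Y|lborel. c n x *r w x"
have l2: "(%n. ?d n) ----> (LINT x:Y|lborel. d x *r w x)" unfolding set_lint_def
proof (rule integral_dominated_convergence)
 let ?e = "%x. B * norm (indr Y x *r w x)"
 show "ilb (%x. ?e x)" using wi unfolding set_integrable_def by (intro integrable_mult_right integrable_norm)
 show "AEL x. (%n. indr Y x *r c n x *r w x) ----> indr Y x *r d x *r w x" by (intro AE_I2 tendsto_intros c(5))
 fix n
 have "norm (indr Y x *r c n x *r w x) <= ?e x" for x using c(4)[of n x] by (cases "x : Y") (auto intro: mult_right_mono)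
 then show "AEL x. norm (indr Y x *r c n x *r w x) <= ?e x" by (rule AE_I2)
qed measurable
have "(LINT x:Y|lborel. ?a n x) = - ?d n" for n using wd c(1-3) unfolding weak_div_def by blast
then have "(%n. - ?d n) ----> (LINT x:Y|lborel. ?c x)" using l1 by simp
from LIMSEQ_unique[OF this tendsto_minus[OF l2]] show ?thesis .
qed

lemma AE_rho_neq: "0 < a ==> AEL x. rho x ~= a"
proof -
assume a: "0 < a"
have "negligible {x. rho x = a}"
proof (rule starlike_negligible[of _ 0])
 show "closed {x. rho x = a}" by (intro closed_Collect_eq cont_on_rho continuous_on_const)
 show "c = 1" if "0 + c *r x : {x. rho x = a}" "0 <= c" "0 + x : {x. rho x = a}" for c and x :: 'a
  using that a by (simp add: rho_scale)
qed
then have "AE x in lebesgue. x ~: {x. rho x = a}" unfolding negligible_iff_null_sets by (rule AE_not_in)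
then show ?thesis by (simp add: AE_completion_iff)
qed

end

context star_domain
begin

lemma green_identity: fixes F :: "'a => 'a => 'b::euclidean_space" and f :: "'a => real"
assumes wd: "weak_div F w" and Fc: "!!i. cc (F i)" and Fm[measurable]: "!!i. F i : BM"
 and wm[measurable]: "w : BM" and wi: "set_integrable lborel Y w" and fc: "cc f" and fm[measurable]: "f : BM"
 and gc: "cc g" and gm[measurable]: "g : BM" and g: "!!x. x : Y ==> (f hder (%h. inner (g x) h)) (at x)"
shows "(LINT x:Y|lborel. (\<Sum>i\<in>Basis. inner (g x) i *r F i x) + f x *r w x) =
  (LINT x|cmeas. (\<Sum>i\<in>Basis. inner (grho x) i *r f x *r F i x))"
proof -
obtain B where B: "0 <= B" "!!x. x : closure Y ==> norm (f x) <= B" using cont_cl_bdd[OF fc] by blast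
obtain G where G: "0 <= G" "!!x. x : closure Y ==> norm (g x) <= G" using cont_cl_bdd[OF gc] by blast
have "EX M. 0 <= M & (ALL x:closure Y. norm (F i x) <= M)" for i using cont_cl_bdd[OF Fc[of i]] by metis
then obtain M where M: "!!i. 0 <= M i" "!!i x. x : closure Y ==> norm (F i x) <= M i" by metis
have cl: "x : closure Y" if "x : Y" for x using that closure_subset[of Y] by blast
define a b where "a n = 1 - 2 / real (n + 3)" and "b n = 1 - 1 / real (n + 3)" for n
have ab: "0 < a n" "a n < b n" "b n < 1" for n by (simp_all add: a_def b_def field_simps)
have lim0: "(%n. c / real (n + 3)) ----> 0" for c using LIMSEQ_ignore_initial_segment[OF lim_const_over_n[of c], of 3] by simp
have alim: "a ----> 1" unfolding a_def[abs_def] using tendsto_diff[OF tendsto_const lim0[of 2], of 1] by simp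
let ?d = "%n. b n - a n"
define d where "d n x = max 0 (min 1 ((b n - rho x) / ?d n))" for n x
define S where "S n = {x. a n <= rho x & rho x < b n}" for n
define K where "K n = {x. rho x <= b n}" for n
have [measurable]: "d n : BM" "S n : sets borel" for n unfolding d_def[abs_def] S_def by measurable
have Ksub: "K n <= Y" for n using ab(3)[of n] by (auto simp: K_def mem_domain)
have Kc: "compact (K n)" for n unfolding compact_eq_bounded_closed K_def
 using bounded_subset[OF bounded_domain Ksub[of n]] by (auto simp: K_def intro!: closed_Collect_le cont_on_rho)
have d: "0 <= d n x" "d n x <= 1" "x ~: K n ==> d n x = 0" for n x using ab(2)[of n] by (auto simp: d_def K_def divide_nonpos_pos)
have dlip: "(1 / ?d n * (1 / r))-lip UNIV (d n)" for n
proof (rule lipschitz_onI)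
 show "0 <= 1 / ?d n * (1 / r)" using ab(2)[of n] r_pos by simp
 fix x y
 have "dist (d n x) (d n y) <= abs ((b n - rho x) / ?d n - (b n - rho y) / (?d n))" unfolding d_def dist_real_def by linarith
 also have "... = abs (rho x - rho y) / ?d n" using ab(2)[of n] by (simp add: diff_divide_distrib[symmetric] abs_minus_commute)
 also have "... <= (1 / r * dist x y) / ?d n"
  using ab(2)[of n] lipschitz_onD[OF rho_lip, of x y] by (intro divide_right_mono) (auto simp: dist_real_def)
 finally show "dist (d n x) (d n y) <= 1 / ?d n * (1 / r) * dist x y" by (simp add: mult.commute)
qed
define j where "j n x = d n x * f x" for n x
define gp where "gp n x = d n x *r g x - (ind (S n) x / ?d n) *r (f x *r grho x)" for n x
have jK: "j n x = 0" if "x ~: K n" for n x using d(3)[OF that] by (simp add: j_def)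
have jlip: "EX C. C-lip UNIV (j n)" for n
proof -
 obtain L where L: "L-lip (K n) f" using bdd_grad_lip_on_compact[OF open_domain Kc[of n] Ksub g, where M = G] G(2) cl by blast
 have "abs (f x) <= B" if "x : K n" for x using B(2)[of x] that Ksub cl by auto
 from lip_cutoff_mult[OF dlip d(1,2,3) L this B(1)] show ?thesis unfolding j_def[abs_def] by blast
qed
have deriv: "AEL x. (j n hder (%h. inner (gp n x) h)) (at x)" for n
 using AE_diff_set AE_rho_neq[OF ab(1)[of n]] lip_diffble_ae[OF dlip[of n]]
proof eventually_elim
 case (elim x)
 let ?h = "%x. (b n - rho x) / ?d n"
 show ?case
 proof (cases "x : Y")
  case True
  obtain E where E: "(d n hder E) (at x)" using elim(3) by (auto simp: differentiable_def)
  have D: "(?h hder (%h. (0 - inner (grho x) h) / ?d n)) (at x)"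
   by (intro bounded_linear.has_derivative[OF bounded_linear_divide] has_derivative_diff has_derivative_const rho_deriv elim)
  have "cont UNIV ?h" using ab(2)[of n] by (intro continuous_intros cont_on_rho) simp
  moreover have "(0 < ?h x & ?h x < 1) = (x : S n)" using elim(2) ab(2)[of n] by (auto simp: S_def divide_less_eq zero_less_divide_iff)
  ultimately have E': "E = (%h. - (ind (S n) x / ?d n) * inner (grho x) h)"
   using clamp_deriv[OF E[unfolded d_def[abs_def]] D] by (auto simp: fun_eq_iff)
  let ?m = "%h. d n x * inner (g x) h + E h * f x"
  have "(j n hder ?m) (at x)" unfolding j_def[abs_def] by (rule has_derivative_mult[OF E g[OF True]])
  moreover have "?m = (%h. inner (gp n x) h)" by (simp add: fun_eq_iff gp_def E' inner_diff_left)
  ultimately show ?thesis by simp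
 next
  case False
  have x: "b n < rho x" using False ab(3)[of n] by (simp add: mem_domain)
  have o: "open {x. b n < rho x}" by (intro open_Collect_less cont_on_rho continuous_on_const)
  have "(j n hder (%h. 0)) (at x)"
   by (rule has_derivative_transform_within_open[OF has_derivative_const o]) (use x jK in "auto simp: K_def")
  moreover have "gp n x = 0" using x d(3)[of x n] by (simp add: gp_def S_def K_def)
  ultimately show ?thesis by simp
 qed
qed
have gpm[measurable]: "gp n : BM" for n unfolding gp_def[abs_def] by measurable
let ?b = "%n x. \<Sum>i\<in>Basis. inner (gp n x) i *r F i x"
have id: "(LINT x:Y|lborel. ?b n x) = - (LINT x:Y|lborel. j n x *r w x)" for n
proof -
 obtain C where "C-lip UNIV (j n)" using jlip by blast
 from weak_div_lip[OF wd Fc Fm wm wi this Kc[of n] jK Ksub gpm deriv] show ?thesis .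
qed
let ?a = "%x. \<Sum>i\<in>Basis. inner (g x) i *r F i x"
define H where "H x = ?a x + f x *r w x" for x
let ?c = "%x i. inner (grho x) i *r f x *r F i x"
define P where "P x = (\<Sum>i\<in>Basis. ?c x i)" for x
have [measurable]: "H : BM" "P : BM" unfolding H_def[abs_def] P_def[abs_def] by measurable
have bndP: "norm (inner v i *r F i x) <= norm v * M i" if "x : Y" "i : Basis" for v i x unfolding norm_scaleR real_norm_def
 by (intro mult_mono M(1) M(2)[OF cl[OF that(1)]] Basis_le_norm[OF that(2)]) auto
have iF: "set_integrable lborel Y (%x. ?a x)"
proof (rule set_intbl_dom_bdd)
 have "norm (?a x) <= (\<Sum>i\<in>Basis. G * M i)" if x: "x : Y" for x
 proof (rule sum_norm_le)
  fix i :: 'a assume "i : Basis"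
  from bndP[OF x this, of "g x"] show "norm (inner (g x) i *r F i x) <= G * M i"
   using mult_right_mono[OF G(2)[OF cl[OF x]] M(1)[of i]] by linarith
 qed
 then show "AEL x. x : Y --> norm (?a x) <= (\<Sum>i\<in>Basis. G * M i)" by simp
qed measurable
let ?k = "%x. norm (indr Y x *r f x *r w x)"
have iw: "set_integrable lborel Y (%x. f x *r w x)" unfolding set_integrable_def
proof (rule integrable_bound)
 let ?q = "%x. B * norm (indr Y x *r w x)"
 show "ilb (%x. ?q x)" using wi unfolding set_integrable_def by (intro integrable_mult_right integrable_norm)
 have "?k x <= norm (?q x)" for x using B cl by (cases "x : Y") (auto intro!: mult_right_mono simp: abs_mult)
 then show "AEL x. ?k x <= norm (?q x)" by simp
qed measurable
have iH: "set_integrable lborel Y H" unfolding H_def[abs_def] by (rule set_integral_add(1)[OF iF iw])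
let ?g = "%x n. indr Y x *r d n x *r H x"
let ?n = "%n. LINT x:Y|lborel. d n x *r H x"
have l1: "(%n. ?n n) ----> (LINT x:Y|lborel. H x)" unfolding set_lint_def
proof (rule integral_dominated_convergence)
 let ?o = "%x. indr Y x *r H x"
 show "ilb (%x. norm (?o x))" using iH unfolding set_integrable_def by (rule integrable_norm)
 have "(%n. ?g x n) ----> ?o x" for x
 proof (cases "x : Y")
  case True
  then have "rho x < 1" by (simp add: mem_domain)
  then have "eventually (%n. rho x < a n) sequentially" using alim by (auto simp: order_tendsto_iff)
  then have "eventually (%n. ?g x n = ?o x) sequentially"
  proof eventually_elim
   case (elim n)
   then have "d n x = 1" using ab(2)[of n] by (simp add: d_def)
   then show ?case by simp
  qed
  then show ?thesis by (rule tendsto_eventually)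
 qed simp
 then show "AEL x. (%n. ?g x n) ----> ?o x" by simp
 have "norm (?g x n) <= norm (?o x)" for n x using d(1,2)[of n x] by (cases "x : Y") (auto simp: mult_left_le_one_le)
 then show "AEL x. norm (?g x n) <= norm (?o x)" for n by simp
qed measurable
have grhoC: "AEL x. abs (inner (grho (hat x)) i) <= (1 / r) * norm i" for i using AE_nonzero AE_diff_set
proof eventually_elim
 case (elim x)
 have "abs (inner (grho (hat x)) i) <= norm (grho (hat x)) * norm i" by (rule Cauchy_Schwarz_ineq2)
 also have "... <= (1 / r) * norm i" using grho_hat[OF elim(2,1)] norm_grho_le[OF elim(2)] by (intro mult_right_mono) auto
 finally show ?case .
qed
let ?e = "%n i. LINT x:S n|lborel. inner (grho (hat x)) i *r f x *r F i x"
let ?l = "%n. 1 / ?d n"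
have ll: "(%n. ?l n *r ?e n i) ----> (LINT x|cmeas. ?c x i)"
 "integrable cmeas (%x. ?c x i)" for i
 using layer_limit[OF ab(1) ab(2) less_imp_le[OF ab(3)] alim, of "%x. f x *r F i x" "%x. inner (grho x) i" "(1 / r) * norm i"] grhoC[of i]
 by (simp_all add: S_def fc Fc continuous_on_scaleR)
have iS: "set_integrable lborel (S n) (%x. ?c x i)" if i: "i : Basis" for n i
proof (rule set_integrable_subset)
 show "set_integrable lborel Y (%x. ?c x i)"
 proof (rule set_intbl_dom_bdd)
  show "AEL x. x : Y --> norm (?c x i) <= (1 / r) * (B * M i)" using AE_diff_set
  proof eventually_elim
   case (elim x)
   show ?case
   proof
    assume x: "x : Y"
    have "abs (inner (grho x) i) <= 1 / r" using Basis_le_norm[OF i, of "grho x"] norm_grho_le[OF elim] by linarith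
    moreover have "norm (f x *r F i x) <= B * M i" unfolding norm_scaleR using B(2)[OF cl[OF x]] M(2)[OF cl[OF x], of i] B(1) by (intro mult_mono) auto
    ultimately show "norm (?c x i) <= (1 / r) * (B * M i)"
     unfolding norm_scaleR[of "inner (grho x) i"] real_norm_def using r_pos by (intro mult_mono) auto
   qed
  qed
 qed measurable
 show "S n <= Y" using ab(3)[of n] by (auto simp: S_def mem_domain)
qed measurable
have iSP: "set_integrable lborel (S n) P" for n unfolding P_def[abs_def] set_integrable_def scaleR_sum_right
 by (rule integrable_sum) (use iS in "simp add: set_integrable_def")
let ?j = "%n. LINT x:S n|lborel. P x"
have SP: "?j n = (\<Sum>i\<in>Basis. ?e n i)" for n
proof -
 have "?j n = (\<Sum>i\<in>Basis. LINT x:S n|lborel. ?c x i)" unfolding P_def set_lint_def scaleR_sum_right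
  by (rule integral_sum) (use iS in "simp add: set_integrable_def")
 also have "... = (\<Sum>i\<in>Basis. ?e n i)"
 proof (rule sum.cong[OF refl])
  fix i :: 'a
  have "AEL x. indr (S n) x *r inner (grho x) i *r f x *r F i x = indr (S n) x *r inner (grho (hat x)) i *r f x *r F i x"
   using AE_nonzero AE_diff_set by eventually_elim (simp add: grho_hat)
  then show "(LINT x:S n|lborel. ?c x i) = ?e n i" unfolding set_lint_def by (intro integral_cong_AE) auto
 qed
 finally show ?thesis .
qed
have eq: "?n n = ?l n *r ?j n" for n
proof -
 let ?f = "%x. indr (S n) x *r P x"
 have idF: "set_integrable lborel Y (%x. ?b n x)"
 proof -
  have SO: "S n <= Y" using ab(3)[of n] by (auto simp: S_def mem_domain)
  from iSP[of n] have 1: "set_integrable lborel Y (%x. ?l n *r ?f x)" unfolding set_integrable_def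
  proof -
   assume "ilb (%x. ?f x)"
   then have "ilb (%x. ?l n *r ?f x)" by (rule integrable_scaleR_right)
   moreover have "indr Y x *r ?l n *r ?f x = ?l n *r ?f x" for x using SO by (cases "x : S n") auto
   ultimately show "ilb (%x. indr Y x *r ?l n *r ?f x)" by (simp only:)
  qed
  have 2: "set_integrable lborel Y (%x. d n x *r ?a x)" unfolding set_integrable_def
  proof (rule integrable_bound)
   show "ilb (%x. indr Y x *r ?a x)" using iF unfolding set_integrable_def .
   have "norm (indr Y x *r d n x *r ?a x) <= norm (indr Y x *r ?a x)" for x
    using d(1,2)[of n x] by (cases "x : Y") (auto simp: mult_left_le_one_le)
   then show "AEL x. norm (indr Y x *r d n x *r ?a x) <= norm (indr Y x *r ?a x)" by simp
  qed measurable
  have gpF: "?b n x = d n x *r ?a x - ?l n *r ?f x" for x unfolding gp_def P_def inner_diff_left scaleR_diff_left sum_subtractf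
   by (simp add: scaleR_sum_right mult_ac)
  show ?thesis unfolding gpF by (rule set_integral_diff(1)[OF 2 1])
 qed
 have ij: "set_integrable lborel Y (%x. j n x *r w x)" unfolding set_integrable_def
 proof (rule integrable_bound)
  show "ilb (%x. indr Y x *r f x *r w x)" using iw unfolding set_integrable_def .
  have "norm (indr Y x *r j n x *r w x) <= ?k x" for x
   using d(1,2)[of n x] by (cases "x : Y") (auto simp: j_def abs_mult mult.assoc mult_left_le_one_le)
  then show "AEL x. norm (indr Y x *r j n x *r w x) <= ?k x" by simp
 qed (unfold j_def, measurable)
 let ?i = "LINT x:Y|lborel. ?b n x + j n x *r w x"
 have "0 = (LINT x:Y|lborel. ?b n x) + (LINT x:Y|lborel. j n x *r w x)" using id[of n] by simp
 also have "... = ?i" by (rule set_integral_add(2)[OF idF ij, symmetric])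
 finally have z: "?i = 0" by simp
 have SO: "S n <= Y" using ab(3)[of n] by (auto simp: S_def mem_domain)
 have ptw: "?g x n = indr Y x *r (?b n x + j n x *r w x) + ?l n *r ?f x" for x
 proof -
  have "?b n x = d n x *r ?a x - (indr (S n) x / ?d n) *r P x"
   unfolding gp_def P_def inner_diff_left scaleR_diff_left sum_subtractf by (simp add: scaleR_sum_right mult_ac)
  then show ?thesis using SO by (cases "x : Y"; cases "x : S n") (auto simp: H_def j_def scaleR_add_right)
 qed
 have "?n n = ?i + ?l n *r ?j n" unfolding set_lint_def ptw
  using integral_add[OF set_integral_add(1)[OF idF ij, unfolded set_integrable_def]
    integrable_scaleR_right[OF iSP[of n, unfolded set_integrable_def], of "1 / ?d n"]] by (simp only: integral_scaleR_right)
 then show ?thesis using z by simp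
qed
let ?p = "(\<Sum>i\<in>Basis. (LINT x|cmeas. ?c x i))"
have l2: "(%n. ?l n *r ?j n) ----> ?p" unfolding SP scaleR_sum_right by (intro tendsto_sum ll(1))
have "(LINT x:Y|lborel. H x) = ?p" using LIMSEQ_unique[OF l1] l2 unfolding eq by blast
also have "... = (LINT x|cmeas. P x)" unfolding P_def by (rule integral_sum[symmetric]) (rule ll(2))
finally show ?thesis unfolding H_def P_def .
qed

end

section \<open>Surface measure\<close>

lemma nn_int_slab_disint: fixes k :: "'a::euclidean_space => ennreal"
assumes [measurable]: "k : BM" and e: "norm e = 1"
shows "(\<integral>\<^sup>+y. k y \<partial>lborel) = (\<integral>\<^sup>+y. ind {y. 0 <= inner y e & inner y e < 1} y * (\<integral>\<^sup>+s. k (y + s *r e) \<partial>(lborel :: real measure)) \<partial>lborel)"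
proof -
let ?Z = "{y :: 'a. 0 <= inner y e & inner y e < 1}"
have ee: "inner e e = 1" using e by (simp add: dot_square_norm)
have "(\<integral>\<^sup>+y. ind ?Z y * (\<integral>\<^sup>+s. k (y + s *r e) \<partial>(lborel :: real measure)) \<partial>lborel) =
  (\<integral>\<^sup>+y. (\<integral>\<^sup>+s. ind ?Z y * k (y + s *r e) \<partial>(lborel :: real measure)) \<partial>lborel)"
 by (intro nn_integral_cong nn_integral_cmult[symmetric]) auto
also have "... = (\<integral>\<^sup>+s. (\<integral>\<^sup>+y. ind ?Z y * k (y + s *r e) \<partial>lborel) \<partial>(lborel :: real measure))"
 by (rule lborel_pair.Fubini'[symmetric, of "%y s. ind ?Z y * k (y + s *r e)"]) simp
also have "... = (\<integral>\<^sup>+s. (\<integral>\<^sup>+y. ind {s..<s+1} (inner y e) * k y \<partial>lborel) \<partial>(lborel :: real measure))"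
proof (rule nn_integral_cong)
 fix s :: real
 have "(\<integral>\<^sup>+y. ind {s..<s+1} (inner y e) * k y \<partial>lborel) = (\<integral>\<^sup>+y. ind {s..<s+1} (inner y e) * k y \<partial>distr lborel borel ((+) (s *r e)))"
  by (simp add: lborel_distr_plus)
 also have "... = (\<integral>\<^sup>+y. ind {s..<s+1} (inner (s *r e + y) e) * k (s *r e + y) \<partial>lborel)"
  by (rule nn_integral_distr) auto
 also have "... = (\<integral>\<^sup>+y. ind ?Z y * k (y + s *r e) \<partial>lborel)"
  by (intro nn_integral_cong) (auto simp: inner_add_left ee add.commute indicator_def)
 finally show "(\<integral>\<^sup>+y. ind ?Z y * k (y + s *r e) \<partial>lborel) = (\<integral>\<^sup>+y. ind {s..<s+1} (inner y e) * k y \<partial>lborel)" by simp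
qed
also have "... = (\<integral>\<^sup>+y. (\<integral>\<^sup>+s. ind {s..<s+1} (inner y e) * k y \<partial>(lborel :: real measure)) \<partial>lborel)"
 by (rule lborel_pair.Fubini'[of "%y s. ind {s..<s+1} (inner y e) * k y"]) (simp add: indicator_def, measurable)
also have "... = (\<integral>\<^sup>+y. k y \<partial>lborel)"
proof (rule nn_integral_cong)
 fix y :: 'a
 have "(\<integral>\<^sup>+s. ind {s..<s+1} (inner y e) * k y \<partial>(lborel :: real measure)) = (\<integral>\<^sup>+s. k y * ind {inner y e - 1<..inner y e} s \<partial>(lborel :: real measure))"
  by (intro nn_integral_cong) (auto simp: indicator_def)
 also have "... = k y" by (subst nn_integral_cmult_indicator) auto
 finally show "(\<integral>\<^sup>+s. ind {s..<s+1} (inner y e) * k y \<partial>(lborel :: real measure)) = k y" .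
qed
finally show ?thesis by simp
qed

lemma int_slab_disint: fixes k :: "'a::euclidean_space => real"
assumes k: "ilb k" and km[measurable]: "k : BM" and e: "norm e = 1"
shows "(LB y. k y) = (LB y. ind {y. 0 <= inner y e & inner y e < 1} y * (\<integral>s. k (y + s *r e) \<partial>(lborel :: real measure)))"
proof -
let ?Z = "{y :: 'a. 0 <= inner y e & inner y e < 1}"
have ee: "inner e e = 1" using e by (simp add: dot_square_norm)
have int: "integrable (lborel \<Otimes>\<^sub>M lborel) (%(y, s :: real). ind ?Z y * k (y + s *r e))"
proof (rule integrableI_bounded)
 have "(\<integral>\<^sup>+p. ennreal (norm (case p of (y, s :: real) => ind ?Z y * k (y + s *r e))) \<partial>(lborel \<Otimes>\<^sub>M lborel)) =
  (\<integral>\<^sup>+y. (\<integral>\<^sup>+s. ennreal (norm (ind ?Z y * k (y + s *r e))) \<partial>(lborel :: real measure)) \<partial>lborel)"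
  by (subst lborel.nn_integral_fst[symmetric]) auto
 also have "... = (\<integral>\<^sup>+y. ind ?Z y * (\<integral>\<^sup>+s. ennreal (norm (k (y + s *r e))) \<partial>(lborel :: real measure)) \<partial>lborel)"
  by (intro nn_integral_cong) (auto simp: indicator_def)
 also have "... = (\<integral>\<^sup>+y. ennreal (norm (k y)) \<partial>lborel)"
  by (rule nn_int_slab_disint[OF _ e, symmetric]) simp
 also have "... < \<infinity>" using k by (simp add: integrable_iff_bounded)
 finally show "(\<integral>\<^sup>+p. ennreal (norm (case p of (y, s :: real) => ind ?Z y * k (y + s *r e))) \<partial>(lborel \<Otimes>\<^sub>M lborel)) < \<infinity>" .
qed measurable
have int2: "integrable (lborel \<Otimes>\<^sub>M lborel) (%(y, s :: real). ind {s..<s+1} (inner y e) * k y)"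
proof (rule integrableI_bounded)
 show "(%(y, s :: real). ind {s..<s+1} (inner y e) * k y) : borel_measurable (lborel \<Otimes>\<^sub>M lborel)"
  by (simp add: indicator_def case_prod_beta) measurable
 have "(\<integral>\<^sup>+p. ennreal (norm (case p of (y, s :: real) => ind {s..<s+1} (inner y e) * k y)) \<partial>(lborel \<Otimes>\<^sub>M lborel)) =
  (\<integral>\<^sup>+y. (\<integral>\<^sup>+s. ennreal (norm (ind {s..<s+1} (inner y e) * k y)) \<partial>(lborel :: real measure)) \<partial>lborel)"
  by (subst lborel.nn_integral_fst[symmetric]) (simp_all add: indicator_def case_prod_beta, measurable)
 also have "... = (\<integral>\<^sup>+y. ennreal (norm (k y)) \<partial>lborel)"
 proof (rule nn_integral_cong)
  fix y :: 'a
  have "(\<integral>\<^sup>+s. ennreal (norm (ind {s..<s+1} (inner y e) * k y)) \<partial>(lborel :: real measure)) = (\<integral>\<^sup>+s. ennreal (norm (k y)) * ind {inner y e - 1<..inner y e} s \<partial>(lborel :: real measure))"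
   by (intro nn_integral_cong) (auto simp: indicator_def)
  also have "... = ennreal (norm (k y))" by (subst nn_integral_cmult_indicator) auto
  finally show "(\<integral>\<^sup>+s. ennreal (norm (ind {s..<s+1} (inner y e) * k y)) \<partial>(lborel :: real measure)) = ennreal (norm (k y))" .
 qed
 also have "... < \<infinity>" using k by (simp add: integrable_iff_bounded)
 finally show "(\<integral>\<^sup>+p. ennreal (norm (case p of (y, s :: real) => ind {s..<s+1} (inner y e) * k y)) \<partial>(lborel \<Otimes>\<^sub>M lborel)) < \<infinity>" .
qed
have "(LB y. ind ?Z y * (\<integral>s. k (y + s *r e) \<partial>(lborel :: real measure))) =
  (LB y. (\<integral>s. ind ?Z y * k (y + s *r e) \<partial>(lborel :: real measure)))" by simp
also have "... = (\<integral>s. (LB y. ind ?Z y * k (y + s *r e)) \<partial>(lborel :: real measure))"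
 by (rule lborel_pair.Fubini_integral[OF int, symmetric])
also have "... = (\<integral>s. (LB y. ind {s..<s+1} (inner y e) * k y) \<partial>(lborel :: real measure))"
proof (rule integral_cong[OF refl])
 fix s :: real
 have "(LB y. ind {s..<s+1} (inner y e) * k y) = (LB y. ind {s..<s+1} (inner (s *r e + y) e) * k (s *r e + y))"
  using lb_int_affine[of "%y. ind {s..<s+1} (inner y e) * k y" 1 "s *r e"] by simp
 also have "... = (LB y. ind ?Z y * k (y + s *r e))"
  by (intro integral_cong) (auto simp: inner_add_left ee add.commute indicator_def)
 finally show "(LB y. ind ?Z y * k (y + s *r e)) = (LB y. ind {s..<s+1} (inner y e) * k y)" by simp
qed
also have "... = (LB y. (\<integral>s. ind {s..<s+1} (inner y e) * k y \<partial>(lborel :: real measure)))"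
 by (rule lborel_pair.Fubini_integral[OF int2])
also have "... = (LB y. k y)"
proof (rule integral_cong[OF refl])
 fix y :: 'a
 have "(\<integral>s. ind {s..<s+1} (inner y e) * k y \<partial>(lborel :: real measure)) = (\<integral>s. ind {inner y e - 1<..inner y e} s * k y \<partial>(lborel :: real measure))"
  by (intro integral_cong) (auto simp: indicator_def)
 then show "(\<integral>s. ind {s..<s+1} (inner y e) * k y \<partial>(lborel :: real measure)) = k y" by simp
qed
finally show ?thesis by simp
qed

lemma left_average_tendsto: fixes f :: "real => real"
assumes f: "cont UNIV f"
shows "(%n. real (Suc n) * (LB s. ind {t - 1 / real (Suc n)<..<t} s * f s)) ----> f t"
proof (rule LIMSEQ_I)
fix a :: real assume a: "0 < a"
have "isCont f t" using f by (simp add: continuous_on_eq_continuous_at)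
then obtain d where d: "0 < d" "!!s. abs (s - t) < d ==> \<bar>f s - f t\<bar> < a / 2"
 using a unfolding continuous_at_eps_delta dist_real_def by (metis half_gt_zero)
obtain N where N: "1 / real (Suc N) < d" using nat_approx_posE[OF d(1)] by blast
have [measurable]: "f : BM" by (rule bmc_onI[OF f])
let ?b = "%n. real (Suc n)"
show "EX no. \<forall>n\<ge>no. norm (?b n * (LB s. ind {t - 1 / real (Suc n)<..<t} s * f s) - f t) < a"
proof (intro exI[of _ N] allI impI)
 fix n assume n: "N <= n"
 let ?I = "{t - 1 / real (Suc n)<..<t}"
 have "1 / ?b n <= 1 / real (Suc N)" using n by (intro divide_left_mono) auto
 then have near: "abs (f s - f t) < a / 2" if "s : ?I" for s using that N by (intro d(2)) auto
 have m: "measure lborel ?I = 1 / ?b n" by simp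
 have i1: "ilb (%s. indr ?I s * f t)" by simp
 have i2: "ilb (%s. indr ?I s * (f s - f t))"
 proof (rule integrable_bound)
  show "ilb (%s. indr ?I s * (a / 2))" by simp
  show "AEL s. norm (indr ?I s * (f s - f t)) <= norm (indr ?I s * (a / 2))"
   using near a by (intro AE_I2) (auto simp: indicator_def less_imp_le)
 qed measurable
 let ?a = "LB s. ind ?I s * (f s - f t)"
 let ?c = "LB s. ind ?I s * f s"
 have "?c = (LB s. ind ?I s * f t + ind ?I s * (f s - f t))" by (intro integral_cong) (auto simp: algebra_simps)
 also have "... = (1 / ?b n) * f t + ?a" using integral_add[OF i1 i2] by simp
 finally have eq: "?b n * ?c - f t = ?b n * ?a" by (simp add: distrib_left del: of_nat_Suc)
 have "norm (LINT s:?I|lborel. f s - f t) <= (a / 2) * measure lborel ?I"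
  using near a by (intro set_int_norm_le) (auto simp: less_imp_le)
 then have "abs (?a) <= (a / 2) * (1 / ?b n)" unfolding m set_lint_def by simp
 then have "?b n * abs (?a) <= ?b n * ((a / 2) * (1 / ?b n))" by (intro mult_left_mono) auto
 also have "... = a / 2" by (simp del: of_nat_Suc)
 finally show "norm (?b n * ?c - f t) < a" unfolding eq using a by (simp add: abs_mult del: of_nat_Suc)
qed
qed

locale star_chart = star_domain Y r for Y :: "(real ^ 'n::finite) set" and r +
fixes U :: "(real ^ 'n) set" and e :: "real ^ 'n" and ze :: "real ^ 'n => real" and L :: real
assumes openU: "open U" and norm_e: "norm e = 1" and lipze: "L-lip UNIV ze"
 and ze_shift: "!!y t. ze (y + t *r e) = ze y" and below: "Y \<inter> U = {y : U. inner y e < ze y}"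
begin

abbreviation "gp == graph_point e ze"
abbreviation "gz == lip_grad ze"
definition jac :: "real ^ 'n => real" where "jac y = inner (gp y) (e - gz y)"

lemma mem_chart: "x : U ==> x : Y \<longleftrightarrow> inner x e < ze x" using below by blast

lemma ee: "inner e e = 1" using norm_e by (simp add: dot_square_norm)

lemma ze_cont: "cont S ze" using lipschitz_on_continuous_on[OF lipze] continuous_on_subset by blast

lemma ze_borel[measurable]: "ze : BM" by (rule bmc_onI[OF ze_cont])

lemma gz_borel[measurable]: "gz : BM" by (rule lip_grad_borel[OF ze_cont])

lemma gp_cont: "cont S gp" unfolding graph_point_def[abs_def] by (intro continuous_intros ze_cont)

lemma gp_borel[measurable]: "gp : BM" by (rule bmc_onI[OF gp_cont])

lemma jac_borel[measurable]: "jac : BM" unfolding jac_def[abs_def] by measurable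

lemma gp_inner: "inner (gp y) e = ze y" by (simp add: graph_point_def inner_add_left ee)

lemma ze_gp: "ze (gp y) = ze y" by (simp add: graph_point_def ze_shift)

lemma gp_eq: "gp y = y + (ze y - inner y e) *r e" by (simp add: graph_point_def)

lemma rho_on_graph:
assumes x: "x : U" "inner x e = ze x"
shows "rho x = 1"
proof (rule antisym)
have "x ~: Y" using mem_chart[OF x(1)] x(2) by simp
then show "1 <= rho x" by (simp add: mem_domain)
let ?a = "%n. x + (- (1 / real (Suc n))) *r e"
have "(%n. ?a n) ----> x + (- 0) *r e" using LIMSEQ_inverse_real_of_nat by (intro tendsto_intros) (simp add: inverse_eq_divide)
then have lim: "(%n. ?a n) ----> x" by simp
then have "eventually (%n. ?a n : U) sequentially" using openU x(1) by (rule topological_tendstoD)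
then have "eventually (%n. rho (?a n) <= 1) sequentially"
proof eventually_elim
 case (elim n)
 have "inner (?a n) e < ze (?a n)" unfolding ze_shift inner_add_left inner_scaleR_left ee by (simp add: x(2))
 then have "?a n : Y" using mem_chart[OF elim] by blast
 then show ?case by (simp add: mem_domain)
qed
moreover have "(%n. rho (?a n)) ----> rho x"
 using lim cont_on_rho[of UNIV] by (intro isCont_tendsto_compose[of x rho]) (simp_all add: continuous_on_eq_continuous_at)
ultimately show "rho x <= 1" by (intro tendsto_upperbound) auto
qed

lemma graph_of_rho:
assumes x: "x : U" "rho x = 1"
shows "inner x e = ze x"
proof (rule ccontr)
assume ne: "inner x e ~= ze x"
have "x ~: Y" using x by (simp add: mem_domain)
then have "ze x < inner x e" using mem_chart[OF x(1)] ne by linarith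
define W where "W = U \<inter> {y. ze y < inner y e}"
have "open W" unfolding W_def by (intro open_Int openU open_Collect_less ze_cont continuous_intros)
moreover have "x : W" using x `ze x < inner x e` by (simp add: W_def)
moreover have "W \<inter> Y = {}" unfolding W_def using mem_chart by fastforce
ultimately have "x ~: closure Y" using open_Int_closure_eq_empty[of W Y] by blast
then show False using x by (simp add: closure_eq)
qed

lemma ze_derivative_shift:
assumes "ze differentiable (at y)"
shows "(ze hder (%h. inner (gz y) h)) (at (y + s *r e))" "inner (gz y) e = 0"
 "ze differentiable (at (y + s *r e))" "gz (y + s *r e) = gz y"
proof -
let ?a = "y + s *r e"
have 1: "((%z. z + (- s) *r e) hder (%h. h)) (at ?a)" by (auto intro!: derivative_eq_intros)
let ?b = "ze hder (%h. inner (gz y) h)"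
have "?b (at (?a + (- s) *r e))" using lip_grad_deriv[OF assms] by simp
from has_derivative_compose[OF 1 this] show D: "?b (at ?a)" by (simp only: ze_shift)
show "ze differentiable (at ?a)" using D differentiable_def by blast
show "gz ?a = gz y" by (rule lip_grad_unique[OF D])
have "(%n. real (Suc n) *r (ze (y + (1 / real (Suc n)) *r e) - ze y)) ----> inner (gz y) e"
 by (rule dq_LIMSEQ[OF lip_grad_deriv[OF assms]])
then have "(%n. 0) ----> inner (gz y) e" by (simp add: ze_shift)
then show "inner (gz y) e = 0" by (simp add: LIMSEQ_const_iff)
qed

lemma AE_ze_differentiable: "AEL y. ze differentiable (at y)" by (rule lip_diffble_ae[OF lipze])

lemma rho_deriv_on_graph:
assumes d: "ze differentiable (at y)" and yU: "gp y : U" and j: "jac y ~= 0"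
shows "(rho hder (%h. inner ((1 / jac y) *r (e - gz y)) h)) (at (gp y))"
proof -
define x where "x = gp y"
define g where "g = gz y"
define c where "c = jac y"
have c: "c = inner x (e - g)" "c ~= 0" using j by (simp_all add: c_def jac_def x_def g_def)
have xe: "inner x e = ze x" by (simp add: x_def gp_inner ze_gp)
have rx: "rho x = 1" by (rule rho_on_graph) (use yU xe x_def in auto)
have Dz: "(ze hder (%h. inner g h)) (at x)"
 using ze_derivative_shift(1)[OF d, of "ze y - inner y e"] by (simp add: x_def g_def gp_eq)
define N where "N = norm x + 1"
define C where "C = 2 * N / r + 2"
have N: "1 <= N" by (simp add: N_def)
have C: "2 <= C" using N r_pos by (simp add: C_def)
let ?a = "%z. norm (z - x)"
let ?b = "%z. rho z - rho x - inner ((1 / c) *r (e - g)) (z - x)"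
have "EX d>0. ALL z. ?a z < d --> norm (?b z) <= a * ?a z" if a: "0 < a" for a
proof -
 define a' where "a' = a * abs c / (2 * C)"
 have a': "0 < a'" using a c C by (simp add: a'_def)
 obtain d1 where d1: "0 < d1" "!!w. norm (w - x) < d1 ==> norm (ze w - ze x - inner g (w - x)) <= a' * norm (w - x)"
  using Dz a' unfolding has_derivative_at_alt by blast
 obtain d2 where d2: "0 < d2" "ball x d2 <= U" using openU yU open_contains_ball x_def by blast
 define d where "d = min (min (r / 2) 1) (min (d1 / C) (d2 / C))"
 have d0: "0 < d" using r_pos d1 d2 C by (simp add: d_def)
 show ?thesis
 proof (intro exI[of _ d] conjI allI impI d0)
  fix z assume z: "?a z < d"
  define t where "t = rho z"
  have tx: "abs (t - 1) <= ?a z / r"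
   using rho_triangle[of z x] rho_triangle[of x z] rx by (simp add: t_def norm_minus_commute abs_le_iff)
  also have "... <= 1 / 2" using z r_pos by (simp add: d_def divide_le_eq)
  finally have t: "1 / 2 <= t" "t <= 2" by linarith+
  have nz: "norm z <= N" using z norm_triangle_ineq[of "z - x" x] by (simp add: d_def N_def)
  define w where "w = z /\<^sub>R t"
  have "z ~= 0" using t rho_0 by (auto simp: t_def)
  have w: "rho w = 1" using rho_hat[OF `z \<noteq> 0`] by (simp add: w_def t_def hat_def)
  have zt: "z = t *r w" using t by (simp add: w_def)
  let ?c = "(1 / t) *r ((1 - t) *r z)"
  have "w - x = (1 / t) *r ((1 - t) *r z) + (z - x)"
  proof -
   have "(1 / t) * (1 - t) = 1 / t - 1" using t by (simp add: field_simps)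
   then have "?c = (1 / t - 1) *r z" by (simp only: scaleR_scaleR)
   also have "... = w - z" by (simp add: w_def scaleR_diff_left inverse_eq_divide)
   finally have "?c = w - z" .
   then show ?thesis by simp
  qed
  then have "norm (w - x) <= norm ?c + ?a z" by (metis norm_triangle_ineq)
  also have "norm ?c = (1 / t) * (abs (t - 1) * norm z)" using t by (simp add: abs_minus_commute)
  also have "... <= 2 * ((?a z / r) * N)" using t tx nz r_pos by (intro mult_mono) (auto simp: divide_le_eq)
  also have "... + ?a z = (2 * N / r + 1) * ?a z" by (simp add: algebra_simps)
  also have "... <= C * ?a z" by (intro mult_right_mono) (simp_all add: C_def)
  finally have wx: "norm (w - x) <= C * ?a z" by simp
  also have "C * ?a z < min d1 d2" using z C by (simp add: d_def less_divide_eq mult.commute)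
  finally have "norm (w - x) < d1" "w : U" using d2(2) by (auto simp: dist_norm norm_minus_commute)
  have we: "inner w e = ze w" by (rule graph_of_rho[OF `w \<in> U` w])
  have key: "abs (inner (w - x) (e - g)) <= a' * norm (w - x)"
   using d1(2)[OF `norm (w - x) < d1`] we xe by (simp add: inner_diff_right inner_diff_left inner_commute)
  let ?d = "inner (z - x) (e - g)"
  have "t * inner (w - x) (e - g) = ?d - (t - 1) * c" by (simp add: zt c inner_diff_left algebra_simps)
  then have "(t - 1) * c - ?d = - (t * inner (w - x) (e - g))" by simp
  then have "abs ((t - 1) * c - inner (z - x) (e - g)) = t * abs (inner (w - x) (e - g))" using t by (simp add: abs_mult)
  also have "... <= 2 * (a' * (C * ?a z))"
   using t order_trans[OF key mult_left_mono[OF wx less_imp_le[OF a']]] by (intro mult_mono) auto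
  also have "... = abs c * (a * ?a z)" using C by (simp add: a'_def)
  finally have "abs ((t - 1) * c - inner (z - x) (e - g)) / abs c <= a * ?a z" using c by (simp add: divide_le_eq mult.commute)
  moreover have "?b z = ((t - 1) * c - ?d) / c" using c(2) by (simp add: rx t_def inner_commute[of "e - g"] diff_divide_distrib)
  ultimately show "norm (?b z) <= a * ?a z" by (simp add: abs_divide)
 qed
qed
then show ?thesis unfolding has_derivative_at_alt x_def[symmetric] c_def[symmetric] g_def[symmetric]
 using bounded_linear_inner_right by blast
qed

lemma grho_on_graph:
assumes "ze differentiable (at y)" "gp y : U" "jac y ~= 0"
shows "grho (gp y) = (1 / jac y) *r (e - gz y)" by (rule grho_unique(2)[OF rho_deriv_on_graph[OF assms]])

end

context star_domain
begin

lemma weak_div_position: "weak_div (%i x. inner x i) (%x. real DIM('a))" unfolding weak_div_def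
proof (intro allI impI)
fix b :: "'a => real"
assume b: "smooth b" "compact (supp b)" "supp b <= Y"
have out: "b x = 0" "fd b x h = 0" if "x ~: Y" for x h
proof -
 have n: "x ~: supp b" using that b(3) by blast
 then show "b x = 0" using closure_subset[of "{x. b x ~= 0}"] by blast
 show "fd b x h = 0" by (rule fd_off_supp[OF n])
qed
let ?b = "%x i. fd b x i * inner x i"
have ibp: "(LB x. b x * inner i i) = - (LB x. ?b x i)" if "i : Basis" for i :: 'a
proof -
 have "(norm i)-lip UNIV (%x. inner x i)"
 proof (rule lipschitz_onI)
  fix x y :: 'a
  show "dist (inner x i) (inner y i) <= norm i * dist x y"
   using Cauchy_Schwarz_ineq2[of "x - y" i] by (simp add: dist_norm inner_diff_left mult.commute)
 qed simp
 moreover have "(%n. real (Suc n) *r (inner (x + (1 / real (Suc n)) *r i) i - inner x i)) ----> inner i i" for x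
  by (simp add: inner_add_left del: of_nat_Suc)
 ultimately show ?thesis using ibp_dir(1)[OF _ b(1,2), of "norm i" "%x. inner x i" "%x. inner i i" i] by simp
qed
have D: "ilb (%x. ?b x i)" for i by (rule intbl_cont_bdd_supp[OF _ compact_imp_bounded[OF b(2)]])
   (auto intro!: continuous_on_mult smooth_cont[OF smooth_frechet[OF b(1)]] continuous_intros simp: fd_off_supp)
let ?a = "(LINT x:Y|lborel. (\<Sum>i\<in>Basis. fd b x i *r inner x i))"
have "?a = (LB x. (\<Sum>i\<in>Basis. ?b x i))" unfolding set_lint_def by (intro integral_cong) (auto simp: indicator_def out)
also have "... = (\<Sum>i\<in>Basis. (LB x. ?b x i))" by (rule integral_sum) (rule D)
also have "... = (\<Sum>i\<in>(Basis :: 'a set). - (LB x. b x))"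
proof (rule sum.cong[OF refl])
 fix i :: 'a assume i: "i : Basis"
 have "inner i i = 1" using inner_same_Basis[OF i] .
 then show "(LB x. ?b x i) = - (LB x. b x)" using ibp[OF i] by simp
qed
also have "... = - (real DIM('a) * (LB x. b x))" by simp
also have "(LB x. b x) = (LINT x:Y|lborel. b x)" unfolding set_lint_def by (intro integral_cong) (auto simp: indicator_def out)
finally show "?a = - (LINT x:Y|lborel. b x *r real DIM('a))" by (simp add: mult.commute)
qed

lemma cone_int_eq_div: fixes b :: "'a => real"
assumes bc: "cc b" and bm[measurable]: "b : BM" and gc: "cc g" and gm[measurable]: "g : BM"
 and g: "!!x. x : Y ==> (b hder (%h. inner (g x) h)) (at x)"
shows "(LINT x|cmeas. b x) = (LINT x:Y|lborel. inner (g x) x + b x * real DIM('a))"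
proof -
let ?a = "%x. \<Sum>i\<in>Basis. inner (grho x) i *r b x *r inner x i"
have "(LINT x:Y|lborel. (\<Sum>i\<in>Basis. inner (g x) i *r inner x i) + b x *r real DIM('a)) =
  (LINT x|cmeas. ?a x)" by (rule green_identity[OF weak_div_position _ _ _ _ bc bm gc gm g])
   (auto intro!: continuous_intros set_intbl_dom_bdd[where M = "real DIM('a)"])
also have "... = (LINT x|cmeas. b x)"
proof (rule integral_cong_AE)
 show "AE x in cmeas. ?a x = b x" using AE_cone(2)
 proof eventually_elim
  case (elim x)
  have "?a x = b x * inner (grho x) x" unfolding euclidean_inner[of "grho x" x] sum_distrib_left by (intro sum.cong) auto
  then show ?case using elim by simp
 qed
qed measurable
finally show ?thesis unfolding euclidean_inner[symmetric] real_scaleR_def by (rule sym)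
qed

end

context star_chart
begin

definition cut :: "nat => real ^ 'n => real" where
"cut n y = max 0 (min 1 (real (Suc n) * (ze y - inner y e)))"

definition strip :: "nat => (real ^ 'n) set" where
"strip n = {y. 0 < ze y - inner y e & ze y - inner y e < 1 / real (Suc n)}"

lemma strip_borel[measurable]: "strip n : sets borel" unfolding strip_def by measurable

lemma cut_lip: "(real (Suc n) * (L + 1))-lip UNIV (cut n)"
proof (rule lipschitz_onI)
have L: "0 <= L" using lipze lipschitz_on_nonneg by blast
let ?c = "real (Suc n)"
show "0 <= ?c * (L + 1)" using L by simp
fix x y :: "real ^ 'n"
let ?a = "ze x - inner x e" and ?b = "ze y - inner y e"
let ?d = "abs (real (Suc n) * ?a - ?c * ?b)"
have "abs (ze x - ze y) <= L * dist x y" using lipschitz_onD[OF lipze, of x y] by (simp add: dist_real_def)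
moreover have "abs (inner x e - inner y e) <= dist x y"
 using Cauchy_Schwarz_ineq2[of "x - y" e] norm_e by (simp add: dist_norm inner_diff_left)
ultimately have "abs (?a - ?b) <= (L + 1) * dist x y" by (simp add: distrib_right)
then have "?c * abs (?a - ?b) <= ?c * ((L + 1) * dist x y)" by (intro mult_left_mono) auto
moreover have "abs (cut n x - cut n y) <= ?d" unfolding cut_def by linarith
moreover have "?d = ?c * abs (?a - ?b)" by (simp only: right_diff_distrib[symmetric] abs_mult abs_of_nat)
ultimately show "dist (cut n x) (cut n y) <= ?c * (L + 1) * dist x y" unfolding dist_real_def mult.assoc by linarith
qed

lemma AE_level: "AEL y. ze y ~= inner y e"
proof -
have "AEL y. y ~: {y. ze y = inner y e}"
proof (rule null_if_null_along_dir[where v = e])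
 fix x :: "real ^ 'n"
 let ?a = "{s. x + s *r e : {y. ze y = inner y e}}"
 have "?a <= {ze x - inner x e}" by (auto simp: ze_shift inner_add_left ee)
 then have "AEL s. s ~: ?a"
  using finite_imp_null_set_lborel[of "{ze x - inner x e}"] by (intro AE_not_in) (blast intro: null_sets_subset[rotated] finite_subset finite_imp_null_set_lborel)
 then show "AEL s. x + s *r e ~: {y. ze y = inner y e}" by simp
qed measurable
then show ?thesis by simp
qed

lemma cut_deriv:
assumes d: "ze differentiable (at y)" "cut n differentiable (at y)"
shows "(cut n hder (%h. ind (strip n) y * (real (Suc n) * inner (gz y - e) h))) (at y)"
proof -
let ?h = "%y. real (Suc n) * (ze y - inner y e)"
have D: "(?h hder (%h. real (Suc n) * inner (gz y - e) h)) (at y)"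
 by (auto intro!: derivative_eq_intros lip_grad_deriv[OF d(1)] simp: inner_diff_left inner_commute[of e])
obtain C where C: "(cut n hder C) (at y)" using d(2) by (auto simp: differentiable_def)
have "(0 < ?h y & ?h y < 1) = (y : strip n)" by (simp add: strip_def zero_less_mult_iff less_divide_eq mult.commute del: of_nat_Suc)
then have "C = (%h. ind (strip n) y * (real (Suc n) * inner (gz y - e) h))"
 using clamp_deriv[OF C[unfolded cut_def[abs_def]] D] by (simp add: continuous_intros ze_cont)
with C show ?thesis by simp
qed

lemma cut_tendsto: "ze y ~= inner y e ==> (%n. cut n y) ----> ind {y. inner y e < ze y} y"
proof (cases "inner y e < ze y")
case True
then obtain N where N: "1 / real (Suc N) < ze y - inner y e" using nat_approx_posE[of "ze y - inner y e"] by auto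
have "cut n y = 1" if "N <= n" for n
proof -
 have "1 / real (Suc n) <= 1 / real (Suc N)" using that by (intro divide_left_mono) auto
 then have "1 / real (Suc n) <= ze y - inner y e" using N by linarith
 then have "1 <= real (Suc n) * (ze y - inner y e)" by (simp add: pos_divide_le_eq mult.commute del: of_nat_Suc)
 then show ?thesis unfolding cut_def by linarith
qed
then have "eventually (%n. cut n y = 1) sequentially" by (auto simp: eventually_sequentially)
then show ?thesis using True by (simp add: tendsto_eventually)
next
case False
have "cut n y = 0" for n
proof -
 have "real (Suc n) * (ze y - inner y e) <= 0" using False by (intro mult_nonneg_nonpos) auto
 then show ?thesis unfolding cut_def by linarith
qed
then show ?thesis using False by simp
qed

lemma cone_chart_int:
assumes a: "smooth a" "compact (supp a)" "supp a <= U"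
shows "(LINT x|cmeas. a x) = (LB y. ind {y. 0 <= inner y e & inner y e < 1} y * (a (gp y) * jac y))"
 and "ilb (%y. ind {y. 0 <= inner y e & inner y e < 1} y * (a (gp y) * jac y))"
proof -
define S where "S = supp a"
let ?Z = "{y. 0 <= inner y e & inner y e < 1}"
have L: "0 <= L" using lipze lipschitz_on_nonneg by blast
have a0: "a x = 0" if "x ~: S" for x using that closure_subset[of "{x. a x ~= 0}"] unfolding S_def by blast
have ac: "cont A a" for A using smooth_cont[OF a(1)] .
have [measurable]: "a : BM" by (rule bmc_onI[OF ac])
obtain R where R: "!!x. x : S ==> norm x <= R" "0 <= R"
 using compact_imp_bounded[OF a(2)] unfolding S_def bounded_iff by (metis norm_ge_zero order_trans)
obtain M0 where M0: "!!x. x : S ==> norm (a x) <= M0"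
 using compact_imp_bounded[OF compact_continuous_image[OF ac a(2)]] unfolding S_def bounded_iff by auto
define M where "M = max M0 0"
have M: "abs (a x) <= M" for x using M0[of x] a0[of x] by (cases "x : S") (auto simp: M_def)
have M_nonneg: "0 <= M" by (simp add: M_def)
define P where "P i x = a x * inner x i" for i x
define D where "D i x = a x * inner i i + fd a x i * inner x i" for i x
define q where "q x = (\<Sum>i\<in>Basis. D i x)" for x
have fd0: "fd a x h = 0" if "x ~: S" for x h using fd_off_supp[of x a] that unfolding S_def by blast
have P_smooth: "smooth (P i)" for i unfolding P_def[abs_def] by (intro smooth_mult a(1) smooth_linear bounded_linear_inner_left)
have P_supp: "{x. P i x ~= 0} <= S" for i using a0 by (auto simp: P_def)
have P_compact: "compact (closure {x. P i x ~= 0})" for i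
proof -
 have "closure {x. P i x ~= 0} <= S" unfolding S_def by (intro closure_minimal closed_closure P_supp[unfolded S_def])
 then show ?thesis using compact_Int_closed[OF a(2) closed_closure[of "{x. P i x ~= 0}"]] unfolding S_def by (simp add: Int_absorb1)
qed
have P_fd: "fd (P i) x i = D i x" for i x
proof -
 have "(P i hder (%h. a x * inner h i + fd a x h * inner x i)) (at x)"
  unfolding P_def[abs_def] by (intro has_derivative_mult smooth_deriv[OF a(1)] bounded_linear_imp_has_derivative bounded_linear_inner_left)
 from frechet_derivative_at[OF this] show ?thesis by (simp add: D_def fun_eq_iff)
qed
have Dc: "cont A (D i)" for A i unfolding D_def[abs_def] by (intro continuous_intros ac smooth_cont[OF smooth_frechet[OF a(1)]])
have D0: "D i x = 0" if "x ~: S" for i x using a0[OF that] fd0[OF that] by (simp add: D_def)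
have Dint: "ilb (D i)" for i by (rule intbl_cont_bdd_supp[OF Dc compact_imp_bounded[OF a(2), folded S_def] D0])
have [measurable]: "D i : BM" for i by (rule bmc_onI[OF Dc])
have [measurable]: "q : BM" unfolding q_def[abs_def] by measurable
have qint: "ilb q" unfolding q_def[abs_def] by (intro integrable_sum Dint)
have q0: "q x = 0" if "x ~: S" for x using D0[OF that] by (simp add: q_def)
have cutc: "cont A (cut n)" for A n using lipschitz_on_continuous_on[OF cut_lip] continuous_on_subset by blast
have [measurable]: "cut n : BM" for n by (rule bmc_onI[OF cutc])
have cut01: "abs (cut n x) <= 1" for n x unfolding cut_def by linarith
let ?a = "%x. \<Sum>i\<in>Basis. fd a x i *r i"
let ?c = "%x. ind {y. inner y e < ze y} x * q x"
have "(LINT x|cmeas. a x) = (LINT x:Y|lborel. inner (?a x) x + a x * real DIM(real ^ 'n))"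
proof (rule cone_int_eq_div[OF ac])
 show gc: "cont A (%x. ?a x)" for A by (intro continuous_intros smooth_cont[OF smooth_frechet[OF a(1)]])
 show "(%x. ?a x) : BM" by (rule bmc_onI[OF gc])
 fix x
 have "fd a x = (%h. inner (?a x) h)"
  by (rule ext) (rule inner_representation[OF has_derivative_linear[OF smooth_deriv[OF a(1)]]])
 then show "(a hder (%h. inner (?a x) h)) (at x)" using smooth_deriv[OF a(1)] by metis
qed measurable
also have "... = (LINT x:Y|lborel. q x)"
proof -
 have "inner (?a x) x + a x * real DIM(real ^ 'n) = q x" for x
 proof -
  have "q x = (\<Sum>i\<in>Basis. a x * 1 + fd a x i * inner i x)"
   unfolding q_def D_def by (rule sum.cong[OF refl]) (simp add: inner_same_Basis inner_commute)
  then show ?thesis by (simp add: sum.distrib inner_sum_left mult.commute)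
 qed
 then show ?thesis by simp
qed
also have "... = (LB x. ?c x)"
proof -
 have "ind Y x *r q x = ?c x" for x
 proof (cases "x : S")
  case True
  then have "x : U" using a(3) by (auto simp: S_def)
  then show ?thesis using mem_chart[of x] by (simp add: indicator_def)
 qed (simp add: q0)
 then show ?thesis unfolding set_lint_def by (simp only:)
qed
finally have lhs: "(LINT x|cmeas. a x) = (LB x. ?c x)" .
have lim1: "(%n. (LB x. cut n x * q x)) ----> (LB x. ?c x)"
proof (rule integral_dominated_convergence[where w = "%x. norm (q x)"])
 show "AEL x. (%n. cut n x * q x) ----> ?c x" using AE_level
 proof eventually_elim
  case (elim x)
  from tendsto_mult_right[OF cut_tendsto[OF elim]] show ?case .
 qed
 show "AEL x. norm (cut n x * q x) <= norm (q x)" for n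
  using cut01[of n] by (intro AE_I2) (simp add: abs_mult mult_left_le_one_le)
qed (use qint in simp_all)
define f where "f y s = a (y + s *r e) * inner (y + s *r e) (e - gz y)" for y s
let ?b = "%y n s. ind {(ze y - inner y e) - 1 / real (Suc n)<..<ze y - inner y e} s * f y s"
let ?f = "%n. real (Suc n)"
define J where "J n y = ind ?Z y * (?f n * (LB s. ?b y n s))" for n y
let ?g = "borel_measurable lborel"
have Jm: "J n : ?g" for n unfolding J_def[abs_def] f_def greaterThanLessThan_iff indicator_def[of "{_<..<_}"] by measurable
have step: "(LB x. cut n x * q x) = (LB y. J n y)" for n
proof -
 define G where "G i x = ind (strip n) x * (?f n * inner (gz x - e) i)" for i x
 have Gm[measurable]: "G i : BM" for i unfolding G_def[abs_def] by measurable
 let ?j = "%x i. LB x. P i x *r G i x"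
 have ibp: "?j x i = - (LB x. fd (P i) x i *r cut n x)"
  "ilb (%x. P i x *r G i x)" for i
 proof -
  have "AEL x. (%m. real (Suc m) *r (cut n (x + (1 / real (Suc m)) *r i) - cut n x)) ----> G i x"
   using AE_ze_differentiable lip_diffble_ae[OF cut_lip[of n]]
  proof eventually_elim
   case (elim x)
   from dq_LIMSEQ[OF cut_deriv[OF elim]] show ?case unfolding G_def .
  qed
  from ibp_dir[OF cut_lip P_smooth P_compact Gm this]
  show "?j x i = - (LB x. fd (P i) x i *r cut n x)"
   "ilb (%x. P i x *r G i x)" .
 qed
 have Dcut: "ilb (%x. D i x * cut n x)" for i by (rule intbl_cont_bdd_supp[OF _ compact_imp_bounded[OF a(2), folded S_def]])
    (auto intro!: continuous_on_mult Dc cutc simp: D0)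
 define k where "k x = ind (strip n) x * (?f n * (a x * inner x (e - gz x)))" for x
 have km[measurable]: "k : BM" unfolding k_def[abs_def] by measurable
 let ?h = "%x. \<Sum>i\<in>Basis. P i x *r G i x"
 have PG: "- ?h x = k x" for x
 proof -
  have "?h x = ind (strip n) x * (?f n * (a x * (\<Sum>i\<in>Basis. inner x i * inner (gz x - e) i)))"
   unfolding P_def G_def sum_distrib_left by (rule sum.cong[OF refl]) simp
  then show ?thesis unfolding euclidean_inner[symmetric] k_def by (simp add: inner_diff_right algebra_simps)
 qed
 have kint: "ilb k" unfolding PG[symmetric, abs_def] by (intro integrable_minus integrable_sum ibp(2))
 let ?i = "%y s. ind ?Z y * (LB s. k (y + s *r e))"
 have "(LB x. cut n x * q x) = (LB x. (\<Sum>i\<in>Basis. D i x * cut n x))" by (simp add: q_def sum_distrib_left mult.commute)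
 also have "... = (\<Sum>i\<in>Basis. (LB x. D i x * cut n x))" by (rule integral_sum) (rule Dcut)
 also have "... = (\<Sum>i\<in>Basis. - ?j x i)"
 proof (rule sum.cong[OF refl])
  fix i :: "real ^ 'n"
  show "(LB x. D i x * cut n x) = - ?j x i" using ibp(1)[of i] by (simp add: P_fd)
 qed
 also have "... = - (LB x. ?h x)" unfolding sum_negf by (subst integral_sum) (simp_all only: ibp(2))
 also have "... = (LB x. k x)" unfolding PG[symmetric] by simp
 also have "... = (LB y. ?i y s)" by (rule int_slab_disint[OF kint km norm_e])
 also have "... = (LB y. J n y)"
 proof (rule integral_cong_AE)
  show "AEL y. ?i y s = J n y" using AE_ze_differentiable
  proof eventually_elim
   case (elim y)
   have "k (y + s *r e) = ?f n * ?b y n s" for s unfolding k_def f_def strip_def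
    by (auto simp: indicator_def ze_derivative_shift(4)[OF elim] ze_shift inner_add_left[of _ _ e] ee simp del: of_nat_Suc)
   then show ?case unfolding J_def by simp
  qed
  show "J n : ?g" by (rule Jm)
  show "(%y. ?i y s) : ?g" by measurable
 qed
 finally show ?thesis .
qed
define K where "K = M * (R * (1 + L))"
have K: "0 <= K" using M_nonneg R L by (simp add: K_def)
let ?d = "ball 0 (2 * R + 2)"
have fK: "abs (f y s) <= K" and f0: "y : ?Z ==> y ~: ?d ==> f y s = 0" if d: "ze differentiable (at y)" for y s
proof -
 let ?x = "y + s *r e"
 have "norm (e - gz y) <= 1 + L" using norm_triangle_ineq4[of e "gz y"] norm_lip_grad_le[OF lipze d] norm_e by linarith
 then have "abs (inner ?x (e - gz y)) <= R * (1 + L)" if "?x : S"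
  using Cauchy_Schwarz_ineq2[of ?x "e - gz y"] mult_mono[OF R(1)[OF that] _ R(2) norm_ge_zero] order_trans by blast
 then have "abs (f y s) <= M * (R * (1 + L))" if "?x : S"
  unfolding f_def abs_mult using that M[of ?x] M_nonneg by (intro mult_mono) auto
 then show "abs (f y s) <= K" using K a0[of ?x] by (cases "?x : S") (auto simp: K_def f_def)
 assume y: "y : ?Z" "y ~: ?d"
 have "?x ~: S"
 proof
  assume "?x : S"
  then have n: "norm ?x <= R" by (rule R)
  have "abs (inner ?x e) <= R" using Cauchy_Schwarz_ineq2[of ?x e] n norm_e by simp
  then have "abs (inner y e + s) <= R" by (simp add: inner_add_left ee)
  moreover have "0 <= inner y e" "inner y e < 1" using y(1) by simp_all
  ultimately have "abs s <= R + 1" by linarith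
  moreover have "norm y <= norm ?x + abs s" using norm_triangle_ineq4[of ?x "s *r e"] norm_e by simp
  ultimately show False using y(2) n by simp
 qed
 then show "f y s = 0" using a0 by (simp add: f_def)
qed
have Jdom: "norm (J n y) <= K * ind ?d y" if d: "ze differentiable (at y)" for n y
proof (cases "y : ?Z & y : ?d")
 case False
 have "J n y = 0"
 proof (cases "y : ?Z")
  case True
  then have "f y s = 0" for s using f0[OF d] False by blast
  then show ?thesis by (simp add: J_def)
 qed (simp add: J_def)
 then show ?thesis using K by simp
next
 case True
 let ?I = "{(ze y - inner y e) - 1 / real (Suc n)<..<ze y - inner y e}"
 have m: "measure lborel ?I = 1 / ?f n" by simp
 have "norm (LINT s:?I|lborel. f y s) <= K * measure lborel ?I" using fK[OF d] K by (intro set_int_norm_le) auto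
 then have "abs ((LB s. ind ?I s * f y s)) <= K * (1 / ?f n)" unfolding m set_lint_def by simp
 then have "?f n * abs ((LB s. ind ?I s * f y s)) <= ?f n * (K * (1 / ?f n))" by (intro mult_left_mono) auto
 also have "... = K" by (simp del: of_nat_Suc)
 finally show ?thesis using True by (simp add: J_def abs_mult del: of_nat_Suc)
qed
let ?e = "%y. ind ?Z y * (a (gp y) * jac y)"
have Jlim: "(%n. J n y) ----> ?e y" for y
proof -
 have "cont UNIV (f y)" unfolding f_def[abs_def] by (intro continuous_intros continuous_on_compose2[OF ac[of UNIV]]) auto
 from left_average_tendsto[OF this, of "ze y - inner y e"]
 have "(%n. ?f n * (LB s. ?b y n s)) ----> a (gp y) * jac y" by (simp only: f_def gp_eq[symmetric] jac_def)
 then show ?thesis unfolding J_def by (rule tendsto_mult_left)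
qed
have dom: "ilb (%y. K * ind ?d y :: real)"
 using emeasure_bounded_finite[OF bounded_ball, of 0 "2 * R + 2"] by (intro integrable_mult_right integrable_real_indicator) auto
have Jdom': "AEL y. norm (J n y) <= K * ind ?d y" for n using AE_ze_differentiable by eventually_elim (rule Jdom)
have Rm: "(%y. ?e y) : ?g" by measurable
have lim2: "(%n. (LB y. J n y)) ----> (LB y. ?e y)" by (rule integral_dominated_convergence[OF Rm Jm dom AE_I2[OF Jlim] Jdom'])
show "(LINT x|cmeas. a x) = (LB y. ?e y)" unfolding lhs by (rule LIMSEQ_unique[OF lim1]) (simp only: step lim2)
show "ilb (%y. ?e y)" by (rule integrable_dominated_convergence[OF Rm Jm dom AE_I2[OF Jlim] Jdom'])
qed

end

lemma meas_eqI_on_boxes: fixes M N :: "'a::euclidean_space measure"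
assumes eq: "!!a b. emeasure M (box a b) = emeasure N (box a b)"
 and sets: "sets M = sets borel" "sets N = sets borel" and fin: "!!a b. emeasure M (box a b) ~= \<infinity>"
shows "M = N"
proof (rule measure_eqI_generator_eq)
let ?E = "range (%(a, b). box a b::'a set)"
show "Int_stable ?E" by (auto simp: Int_stable_def box_Int_box)
show "?E <= Pow UNIV" "sets M = sigma_sets UNIV ?E" "sets N = sigma_sets UNIV ?E" by (simp_all add: borel_eq_box sets)
let ?A = "%n::nat. box (- (real n *r One)) (real n *r One) :: 'a set"
show "range ?A <= ?E" "(\<Union>i. ?A i) = UNIV" unfolding UN_box_eq_UNIV by auto
show "emeasure M (?A i) ~= \<infinity>" for i by (rule fin)
show "emeasure M X = emeasure N X" if "X : ?E" for X using that eq by auto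
qed

lemma real_grad_eq_lip_grad: fixes f :: "real ^ 'n::finite => real"
assumes "f differentiable (at x)"
shows "grad f x = lip_grad f x"
proof -
have "fd f x = (%h. inner (lip_grad f x) h)" by (rule frechet_derivative_at[OF lip_grad_deriv[OF assms], symmetric])
then show ?thesis by (simp add: grad_def partial_def inner_axis Finite_Cartesian_Product.vec_eq_iff)
qed

context star_chart
begin

lemma gz_perp: "ze differentiable (at y) ==> inner (gz y) e = 0" by (rule ze_derivative_shift(2))

lemma normal_nonzero: "ze differentiable (at y) ==> 1 <= norm (e - gz y)"
proof -
assume "ze differentiable (at y)"
then have "inner (e - gz y) e = 1" by (simp add: inner_diff_left gz_perp ee)
then show ?thesis using Cauchy_Schwarz_ineq2[of "e - gz y" e] norm_e by simp
qed

lemma gp_frontier: "gp y : U ==> gp y : frontier Y" using rho_on_graph[of "gp y"] by (simp add: frontier_eq gp_inner ze_gp)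

lemma jac_bound:
assumes d: "ze differentiable (at y)" and R: "norm (gp y) <= R"
shows "abs (jac y) <= R * (1 + L)"
proof -
have L: "0 <= L" using lipze lipschitz_on_nonneg by blast
have "norm (e - gz y) <= 1 + L" using norm_triangle_ineq4[of e "gz y"] norm_lip_grad_le[OF lipze d] norm_e by linarith
moreover have "0 <= R" using R norm_ge_zero order_trans by blast
ultimately show ?thesis unfolding jac_def
 using Cauchy_Schwarz_ineq2[of "gp y" "e - gz y"] mult_mono[OF R _ _ norm_ge_zero] order_trans by blast
qed

lemma local_graph: "local_graph Y U e ze" unfolding local_graph_def using openU norm_e lipze ze_shift below by blast

abbreviation "slab == {y. 0 <= inner y e & inner y e < 1}"

lemma jac_positive:
assumes sg: "surface_measure Y sg" and nu: "outward_normal Y nu" and pos: "0 < c" "AE x in sg. c <= inner x (nu x)"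
shows "AEL y. y : slab --> gp y : U --> 0 < jac y"
proof -
have [measurable]: "nu : BM" using nu by (simp add: outward_normal_def)
have sets: "sets sg = sets borel" using sg by (simp add: surface_measure_def)
have [measurable]: "U : sets borel" using openU by simp
have [measurable]: "frontier Y : sets borel" by (simp add: frontier_closed borel_closed)
define B where "B = {x. inner x (nu x) < c} \<inter> (U \<inter> frontier Y)"
let ?b = "%y. ind slab y * ind B (gp y) * ennreal (norm (e - gz y))"
have [measurable]: "B : sets borel" unfolding B_def by measurable
let ?a = "\<integral>\<^sup>+y. ?b y \<partial>lborel"
have "AE x in sg. x ~: B" using pos(2) by eventually_elim (auto simp: B_def)
then have "emeasure sg B = 0" using AE_iff_measurable[of B sg "%x. x ~: B"] sets sets_eq_imp_space_eq[OF sets] by simp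
moreover have "emeasure sg B = (\<integral>\<^sup>+y. ind slab y * ind B (gp y) * ennreal (norm (e - grad ze y)) \<partial>lborel)"
proof -
 have "B <= U \<inter> frontier Y" by (auto simp: B_def)
 then show ?thesis using sg local_graph `B \<in> sets borel` unfolding surface_measure_def by blast
qed
moreover have "... = ?a" using AE_ze_differentiable by (intro nn_integral_cong_AE) (auto elim!: AE_mp simp: real_grad_eq_lip_grad)
ultimately have "?a = 0" by simp
then have "AEL y. ?b y = 0" by (subst (asm) nn_integral_0_iff_AE) simp_all
moreover have "AEL y. gp y : U --> nu (gp y) = (e - grad ze y) /\<^sub>R norm (e - grad ze y)"
 using nu local_graph unfolding outward_normal_def by blast
ultimately show ?thesis using AE_ze_differentiable
proof eventually_elim
 case (elim y)
 show ?case
 proof (intro impI)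
  assume y: "y : slab" "gp y : U"
  have n: "1 <= norm (e - gz y)" by (rule normal_nonzero[OF elim(3)])
  have "e - gz y ~= 0" using n by auto
  then have "gp y ~: B" using elim(1) y(1) by (simp add: indicator_def split: if_splits)
  then have "c <= inner (gp y) (nu (gp y))" using y(2) gp_frontier[OF y(2)] by (simp add: B_def)
  also have "... = jac y / norm (e - gz y)"
   using elim(2) y(2) by (simp add: real_grad_eq_lip_grad[OF elim(3)] jac_def divide_inverse mult.commute)
  finally have "0 < jac y / norm (e - gz y)" using pos(1) by linarith
  then show "0 < jac y" using n by (simp add: zero_less_divide_iff)
 qed
qed
qed

lemma cone_meas_on_box:
assumes J: "AEL y. y : slab --> gp y : U --> 0 < jac y" and box: "cbox a b <= U"
shows "density cmeas (ind (box a b)) =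
  distr (density lborel (%y. ennreal (ind slab y * ind (box a b) (gp y) * jac y))) borel gp"
proof (rule meas_eqI_on_boxes)
interpret finite_measure cmeas by (rule finite_cone)
fix a' b' :: "real ^ 'n"
obtain p q where pq: "box a b \<inter> box a' b' = box p q" unfolding box_Int_box by blast
let ?P = "box p q"
let ?c = "emeasure (density cmeas (ind (box a b))) (box a' b')"
have m1: "?c = emeasure cmeas ?P" by (simp add: emeasure_density pq[symmetric] indicator_inter_arith[symmetric] sets_cone)
then show "?c ~= \<infinity>" by simp
obtain c :: "nat => real ^ 'n => real" where c: "!!j. smooth (c j)" "!!j x. 0 <= c j x" "!!j x. c j x <= 1"
 "!!j x. x ~: ?P ==> c j x = 0" "!!x. (%j. c j x) ----> ind ?P x" using smooth_box_approx[of p q] by metis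
have supp: "x ~: box a b ==> c j x = 0" for j x using c(4)[of x j] pq by blast
have [measurable]: "c j : BM" for j by (rule bmc_onI[OF smooth_cont[OF c(1)]])
let ?d = "%y j. ind slab y * (c j (gp y) * jac y)"
have id: "(LINT x|cmeas. c j x) = (LB y. ?d y j)" for j
 by (rule cone_chart_int(1)[OF c(1) cl_supp_in_box(2)[OF supp] order_trans[OF cl_supp_in_box(1)[OF supp] box]])
have lim1: "(%j. (LINT x|cmeas. c j x)) ----> (LINT x|cmeas. ind ?P x)"
 by (rule integral_dominated_convergence[where w = "%x. 1"]) (use c in "auto simp: measurable_cong_sets[OF sets_cone refl]")
obtain R where R: "!!x. x : ?P ==> norm x <= R" "0 <= R"
 using bounded_box[of p q] unfolding bounded_iff by (metis norm_ge_zero order_trans linear)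
have L: "0 <= L" using lipze lipschitz_on_nonneg by blast
define K where "K = R * (1 + L)"
let ?e = "ball 0 (2 * R + 2)"
have dom: "ilb (%y. K * ind ?e y :: real)"
 using emeasure_bounded_finite[OF bounded_ball, of 0 "2 * R + 2"] by (intro integrable_mult_right integrable_real_indicator) auto
have bound: "norm (ind slab y * (t * jac y)) <= K * ind ?e y"
 if d: "ze differentiable (at y)" and t: "0 <= t" "t <= 1" "gp y ~: ?P ==> t = 0" for y t
proof (cases "y : slab & gp y : ?P")
 case True
 then have n: "norm (gp y) <= R" using R by blast
 have "abs (ze y) <= R" using Cauchy_Schwarz_ineq2[of "gp y" e] n norm_e by (simp add: gp_inner)
 moreover have "0 <= inner y e" "inner y e < 1" using True by simp_all
 ultimately have "abs (ze y - inner y e) <= R + 1" by linarith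
 moreover have "norm y <= norm (gp y) + abs (ze y - inner y e)"
  using norm_triangle_ineq4[of "gp y" "(ze y - inner y e) *r e"] norm_e by (simp add: gp_eq)
 ultimately have "y : ?e" using n by simp
 moreover have "t * abs (jac y) <= 1 * K" using t jac_bound[OF d n] by (intro mult_mono) (simp_all add: K_def)
 ultimately show ?thesis using True t by (simp add: abs_mult)
next
 case False
 then have "ind slab y * (t * jac y) = 0" using t(3) by (cases "y : slab") auto
 moreover have "0 <= K * ind ?e y" using R(2) L by (simp add: K_def)
 ultimately show ?thesis by (simp only: norm_zero)
qed
let ?a = "%y. ind slab y * (ind ?P (gp y) * jac y)"
have bm: "(%y. ?a y) : borel_measurable lborel" by measurable
have bm': "(%y. ?d y j) : borel_measurable lborel" for j by measurable
have lim: "(%j. ?d y j) ----> ?a y" for y by (intro tendsto_intros c(5))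
have bd: "AEL y. norm (?d y j) <= K * ind ?e y" for j using AE_ze_differentiable by eventually_elim (rule bound, use c in auto)
have lim2: "(%j. (LB y. ?d y j)) ----> (LB y. ?a y)" by (rule integral_dominated_convergence[OF bm bm' dom AE_I2[OF lim] bd])
have int: "ilb (%y. ?a y)" by (rule integrable_dominated_convergence[OF bm bm' dom AE_I2[OF lim] bd])
let ?f = "%y. ennreal (ind slab y * ind (box a b) (gp y) * jac y)"
have eq: "measure cmeas ?P = (LB y. ?a y)" using LIMSEQ_unique[OF lim1] lim2 unfolding id by simp
let ?b = "emeasure (distr (density lborel (%y. ?f y)) borel gp) (box a' b')"
have "?b
  = (\<integral>\<^sup>+y. ?f y * ind (gp -` box a' b') y \<partial>lborel)"
 by (simp add: emeasure_distr emeasure_density measurable_sets_borel[OF gp_borel])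
also have "... = (\<integral>\<^sup>+y. ennreal (?a y) \<partial>lborel)"
 by (intro nn_integral_cong) (auto simp: indicator_def pq[symmetric])
also have "... = ennreal (LB y. ?a y)"
proof (rule nn_integral_eq_integral[OF int])
 show "AEL y. 0 <= ?a y" using J
 proof eventually_elim
  case (elim y)
  have "?P <= U" using pq box box_subset_cbox[of a b] by blast
  then show ?case using elim by (auto simp: indicator_def)
 qed
qed
also have "... = emeasure cmeas ?P" by (simp add: eq[symmetric] emeasure_eq_measure)
finally show "?c =
  ?b" using m1 by simp
qed simp_all

lemma surface_meas_on_box:
assumes sg: "surface_measure Y sg" and nu: "outward_normal Y nu"
 and pos: "0 < c" "AE x in sg. c <= inner x (nu x)" and box: "cbox a b <= U"
shows "B : sets borel ==> B <= box a b \<inter> frontier Y ==> emeasure sg B = emeasure (density cmeas (%x. ennreal (norm (grho x)))) B"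
 and "AE x in cmeas. x : box a b --> nu x = (1 / norm (grho x)) *r grho x"
proof -
note J = jac_positive[OF sg nu pos]
note eq = cone_meas_on_box[OF J box]
have [measurable]: "nu : BM" using nu by (simp add: outward_normal_def)
let ?a = "%y. ennreal (ind slab y * ind (box a b) (gp y) * jac y)"
let ?b = "%y. norm (grho (gp y))"
have UB: "box a b <= U" using box box_subset_cbox[of a b] by blast
{
 assume B[measurable]: "B : sets borel" and sub: "B <= box a b \<inter> frontier Y"
 let ?c = "%x. ennreal (norm (grho x))"
 let ?d = "%y. ind slab y * ind B (gp y) * ennreal (norm (e - grad ze y))"
 let ?e = "emeasure (density cmeas (%x. ?c x)) B"
 have "emeasure sg B = (\<integral>\<^sup>+y. ?d y \<partial>lborel)"
  using sg local_graph B sub UB unfolding surface_measure_def by blast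
 also have "... = (\<integral>\<^sup>+y. ?a y * (ind B (gp y) * ennreal (?b y)) \<partial>lborel)"
 proof (rule nn_integral_cong_AE)
  show "AEL y. ?d y =
    ?a y * (ind B (gp y) * ennreal (?b y))" using J AE_ze_differentiable
  proof eventually_elim
   case (elim y)
   show ?case
   proof (cases "y : slab & gp y : B")
    case True
    then have y: "gp y : U" "0 < jac y" "gp y : box a b" using elim(1) sub UB by blast+
    have "?b y = norm (e - gz y) / jac y" using grho_on_graph[OF elim(2) y(1)] y(2) by simp
    then have "jac y * ?b y = norm (e - gz y)" using y(2) by simp
    then show ?thesis using True y by (simp add: real_grad_eq_lip_grad[OF elim(2)] ennreal_mult[symmetric])
   next
    case False
    then show ?thesis by (cases "y : slab") simp_all
   qed
  qed
 qed
 also have "... = (\<integral>\<^sup>+x. ind B x * ?c x \<partial>distr (density lborel (%y. ?a y)) borel gp)"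
  by (subst nn_integral_distr) (simp_all add: nn_integral_density)
 also have "... = (\<integral>\<^sup>+x. ind (box a b) x * (ind B x * ?c x) \<partial>cmeas)"
  unfolding eq[symmetric] by (subst nn_integral_density) simp_all
 also have "... = (\<integral>\<^sup>+x. ?c x * ind B x \<partial>cmeas)"
  using sub by (intro nn_integral_cong) (auto simp: indicator_def)
 also have "... = ?e" by (simp add: emeasure_density)
 finally show "emeasure sg B = ?e" .
}
let ?f = "%x. (1 / norm (grho x)) *r grho x"
have "AE x in distr (density lborel (%y. ?a y)) borel gp. nu x = ?f x"
proof (subst AE_distr_iff)
 have "AEL y. gp y : U --> nu (gp y) = (e - grad ze y) /\<^sub>R norm (e - grad ze y)"
  using nu local_graph unfolding outward_normal_def by blast
 then have "AEL y. 0 < ?a y --> nu (gp y) = (1 / ?b y) *r grho (gp y)" using J AE_ze_differentiable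
 proof eventually_elim
  case (elim y)
  show ?case
  proof
   assume "0 < ?a y"
   then have y: "y : slab" "gp y : box a b" by (cases "y : slab"; cases "gp y : box a b"; simp)+
   then have yU: "gp y : U" using UB by blast
   then have j: "0 < jac y" using elim(2) y by blast
   have "?b y = norm (e - gz y) / jac y" using grho_on_graph[OF elim(3) yU] j by simp
   then show "nu (gp y) = (1 / ?b y) *r grho (gp y)"
    using elim(1) yU j by (simp add: real_grad_eq_lip_grad[OF elim(3)] grho_on_graph[OF elim(3) yU] inverse_eq_divide)
  qed
 qed
 then show "AE y in density lborel (%y. ?a y). nu (gp y) = (1 / ?b y) *r grho (gp y)" by (subst AE_density) simp_all
qed simp_all
then have "AE x in density cmeas (ind (box a b)). nu x = ?f x" unfolding eq .
then show "AE x in cmeas. x : box a b --> nu x = ?f x" by (subst (asm) AE_density) (auto elim!: AE_mp)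
qed

end

lemma emeas_cover_cong:
assumes sets: "sets M = sets borel" "sets N = sets borel" and null: "emeasure M (- F) = 0" "emeasure N (- F) = 0"
 and F[measurable]: "F : sets borel" and W[measurable]: "!!n :: nat. W n : sets borel" and cover: "F <= (\<Union>n. W n)"
 and eq: "!!n B. B : sets borel ==> B <= W n \<inter> F ==> emeasure M B = emeasure N B"
shows "M = N"
proof (rule measure_eqI)
show "sets M = sets N" by (simp add: sets)
fix B assume "B : sets M"
then have B[measurable]: "B : sets borel" by (simp add: sets)
let ?D = "%n. B \<inter> F \<inter> disjointed W n"
have Dm: "?D n : sets borel" for n
proof -
 have "range W <= sets borel" using W by blast
 then have "disjointed W n : sets borel" using sets.range_disjointed_sets[of W borel] by blast
 then show ?thesis by (intro sets.Int B F)
qed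
have split: "emeasure K B = (\<Sum>n. emeasure K (?D n))" if K: "sets K = sets borel" "emeasure K (- F) = 0" for K
proof -
 have "(\<Union>n. ?D n) = B \<inter> F" using cover UN_disjointed_eq[of W] by blast
 moreover have "(\<Sum>n. emeasure K (?D n)) = emeasure K (\<Union>n. ?D n)"
  using Dm disjoint_family_disjointed[of W] by (intro suminf_emeasure) (auto simp: K disjoint_family_on_def)
 moreover have "emeasure K B = emeasure K (B \<inter> F)"
 proof (rule emeasure_eq_AE)
  have "- F : null_sets K" using K by (simp add: null_sets_def)
  from AE_not_in[OF this] show "AE x in K. x : B \<longleftrightarrow> x : B \<inter> F" by eventually_elim auto
 qed (simp_all add: K)
 ultimately show ?thesis by simp
qed
have "emeasure M (?D n) = emeasure N (?D n)" for n by (rule eq[OF Dm, of n]) (use disjointed_subset[of W n] in blast)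
then show "emeasure M B = emeasure N B" using split sets null by simp
qed

lemma surface_meas_cone: fixes Y :: "(real ^ 'n::finite) set"
assumes sd: "star_domain Y r" and lip: "lipschitz_domain Y" and sg: "surface_measure Y sg" and nu: "outward_normal Y nu"
 and pos: "0 < c" "AE x in sg. c <= inner x (nu x)"
shows "sg = density (star_domain.cmeas Y) (%x. ennreal (norm (star_domain.grho Y x)))"
 and "AE x in star_domain.cmeas Y. nu x = (1 / norm (star_domain.grho Y x)) *r star_domain.grho Y x"
proof -
interpret star_domain Y r by (rule sd)
let ?a = "density cmeas (%x. ennreal (norm (grho x)))"
let ?b = "frontier Y"
let ?c = "%x. (1 / norm (grho x)) *r grho x"
define good where "good W \<longleftrightarrow> open W &
 (ALL B:sets borel. B <= W \<inter> ?b --> emeasure sg B = emeasure ?a B) &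
 (AE x in cmeas. x : W --> nu x = ?c x)" for W
have "EX W. good W & x : W" if x: "x : ?b" for x
proof -
 obtain U e ze where U: "x : U" and g: "local_graph Y U e ze" using lip x unfolding lipschitz_domain_def by blast
 obtain K where "K-lip UNIV ze" using g unfolding local_graph_def by blast
 moreover have "open U" "norm e = 1" "!!y t. ze (y + t *r e) = ze y" "Y \<inter> U = {y : U. inner y e < ze y}"
  using g unfolding local_graph_def by simp_all
 ultimately interpret ch: star_chart Y r U e ze K by unfold_locales
 obtain a b where ab: "x : box a b" "cbox a b <= U" using ch.openU U by (metis open_contains_cbox)
 have "good (box a b)" unfolding good_def by (intro conjI ballI impI open_box ch.surface_meas_on_box[OF sg nu pos ab(2)])
 with ab show ?thesis by blast
qed
then have "?b <= \<Union> {W. good W}" by blast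
moreover have "!!W. W : {W. good W} ==> open W" by (simp add: good_def)
ultimately obtain \<F> where \<F>: "\<F> <= {W. good W}" "finite \<F>" "?b <= \<Union> \<F>"
 using compactE[of "?b" "{W. good W}"] compact_frontier_bounded[OF bounded_domain] by metis
define W where "W = from_nat_into (insert {} \<F>)"
have Wgood: "good (W n)" for n
proof -
 have e: "good {}" unfolding good_def by simp
 have "insert {} \<F> ~= {}" by simp
 from from_nat_into[OF this, of n] have "W n = {} \<or> W n : \<F>" unfolding W_def by simp
 then show ?thesis
 proof
  assume "W n : \<F>"
  then show ?thesis using subsetD[OF \<F>(1)] by simp
 qed (simp add: e)
qed
have "range W = insert {} \<F>" unfolding W_def using \<F>(2) by (intro range_from_nat_into) (auto intro: countable_finite)
then have cover: "?b <= (\<Union>n. W n)" using \<F>(3) by auto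
have [measurable]: "?b : sets borel" by (simp add: frontier_closed borel_closed)
have AEf: "AE x in cmeas. x : ?b" using AE_cone(1) by (simp add: frontier_eq)
show "sg = ?a"
proof (rule emeas_cover_cong[where F = "?b" and W = W])
 show "sets sg = sets borel" "emeasure sg (- ?b) = 0" using sg by (simp_all add: surface_measure_def)
 show "emeasure ?a (- ?b) = 0"
 proof -
  have "emeasure ?a (- ?b) = (\<integral>\<^sup>+x. ennreal (norm (grho x)) * ind (- ?b) x \<partial>cmeas)"
   by (simp add: emeasure_density)
  also have "... = (\<integral>\<^sup>+x. 0 \<partial>cmeas)" using AEf by (intro nn_integral_cong_AE) (auto elim!: AE_mp)
  finally show ?thesis by simp
 qed
 show "W n : sets borel" for n using Wgood[of n] by (simp add: good_def)
 show "emeasure sg B = emeasure ?a B"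
  if "B : sets borel" "B <= W n \<inter> ?b" for n B using Wgood[of n] that unfolding good_def by blast
qed (simp_all add: cover)
have "AE x in cmeas. x : W n --> nu x = ?c x" for n using Wgood[of n] unfolding good_def by blast
then have "AE x in cmeas. ALL n. x : W n --> nu x = ?c x" unfolding AE_all_countable by blast
then show "AE x in cmeas. nu x = ?c x" using AEf by eventually_elim (use cover in blast)
qed

section \<open>Weak derivatives and the Rellich inequality\<close>

abbreviation "xdot x == cdot (complexify x)"

lemma sum_Basis_vec: fixes f :: "real ^ 'n::finite => 'b::comm_monoid_add"
shows "(\<Sum>b\<in>Basis. f b) = (\<Sum>i\<in>UNIV. f (axis i 1))"
proof -
have "(Basis :: (real ^ 'n) set) = range (%i. axis i 1)" by (auto simp: Basis_vec_def)
moreover have "inj (%i :: 'n. axis i (1 :: real))" by (auto simp: inj_on_def axis_eq_axis)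
ultimately show ?thesis using sum.reindex[of "%i. axis i 1" UNIV f] by simp
qed

lemma vec_nth_borel[measurable]: fixes F :: "'a => 'b::euclidean_space ^ 'n::finite"
assumes "F : borel_measurable M"
shows "(%x. F x $ i) : borel_measurable M" by (rule measurable_compose[OF assms bmc_onI]) (intro continuous_intros)

lemma vec_lambda_borel[measurable (raw)]: fixes f :: "'n::finite => 'a => 'b::euclidean_space"
assumes "!!i. f i : borel_measurable M"
shows "(%x. \<chi> i. f i x) : borel_measurable M"
proof (rule borel_measurable_euclidean_space[THEN iffD2], rule ballI)
fix b :: "'b ^ 'n" assume "b : Basis"
then obtain i u where "b = axis i u" by (auto simp: Basis_vec_def)
then have "(%x. inner (\<chi> i. f i x) b) = (%x. inner (f i x) u)" by (simp add: inner_axis)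
then show "(%x. inner (\<chi> i. f i x) b) : borel_measurable M" using assms[of i] by simp
qed

lemma borel_leb: "f : BM ==> f : borel_measurable (lebesgue_on S)"
by (intro measurable_restrict_space1 measurable_completion) simp

lemma cdot_borel[measurable]:
assumes "F : borel_measurable M" "G : borel_measurable M"
shows "(%x. cdot (F x) (G x)) : borel_measurable M" unfolding cdot_def using assms by measurable

lemma cplx_cont: "cont S cplx" unfolding complexify_def[abs_def] by (intro continuous_intros)

lemma cplx_borel[measurable]: "cplx : BM" by (rule bmc_onI[OF cplx_cont])

lemma cdot_commute: "cdot a b = cdot b a" by (simp add: cdot_def mult.commute)

lemma cdot_cplx_scaleR: "cdot (cplx (c *r a)) b = c *r cdot (cplx a) b"
by (simp add: cdot_def complexify_def scaleR_conv_of_real[of c "_ :: complex"] sum_distrib_left mult.assoc)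

lemma leb_borel: fixes f :: "'a::euclidean_space => 'b::{banach, second_countable_topology}"
assumes f: "f : BM" and S[measurable]: "S : sets borel"
shows "(LINT x|lebesgue_on S. f x) = (LINT x:S|lborel. f x)"
 and "integrable (lebesgue_on S) f \<longleftrightarrow> set_integrable lborel S f"
proof -
have [measurable]: "(%x. ind S x *r f x) : borel_measurable lborel" using f by measurable
have S': "S \<inter> space lebesgue : sets lebesgue" using S by simp
show "(LINT x|lebesgue_on S. f x) = (LINT x:S|lborel. f x)"
 unfolding integral_restrict_space[OF S'] set_lint_def by (rule integral_completion) measurable
show "integrable (lebesgue_on S) f \<longleftrightarrow> set_integrable lborel S f"
 unfolding integrable_restrict_space[OF S'] set_integrable_def by (rule integrable_completion) measurable
qed

locale boundary_domain = star_domain Y r for Y :: "(real ^ 'n::finite) set" and r +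
fixes sg :: "(real ^ 'n) measure" and nu :: "real ^ 'n => real ^ 'n"
assumes sigma_density: "sg = density cmeas (%x. ennreal (norm (grho x)))"
 and normal_cone: "AE x in cmeas. nu x = (1 / norm (grho x)) *r grho x" and normal_borel[measurable]: "nu : BM"
begin

abbreviation "ndot x == cdot (complexify (nu x))"

lemma sets_sigma[simp, measurable_cong]: "sets sg = sets borel" by (simp add: sigma_density)

lemma space_sigma[simp]: "space sg = UNIV" by (simp add: sigma_density)

lemma AE_sigma: "AE x in cmeas. P x ==> AE x in sg. P x" unfolding sigma_density by (subst AE_density) (auto elim!: AE_mp)

lemma int_sigma: fixes f :: "real ^ 'n => 'b::euclidean_space"
assumes "f : BM"
shows "(LINT x|sg. f x) = (LINT x|cmeas. norm (grho x) *r f x)"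
 and "integrable sg f \<longleftrightarrow> integrable cmeas (%x. norm (grho x) *r f x)"
using assms unfolding sigma_density by (simp_all add: integral_density integrable_density)

lemma AE_normal: shows "AE x in sg. rho x = 1" "AE x in sg. norm (nu x) = 1" "AE x in sg. 0 < inner x (nu x)"
 "AE x in sg. norm (grho x) * inner x (nu x) = 1"
 "AE x in sg. grho x = norm (grho x) *r nu x"
proof -
have *: "AE x in cmeas. rho x = 1 & norm (nu x) = 1 & 0 < inner x (nu x) & norm (grho x) * inner x (nu x) = 1 & grho x = norm (grho x) *r nu x"
 using AE_cone(1,2) normal_cone
proof eventually_elim
 case (elim x)
 then have "grho x ~= 0" by auto
 moreover from this have "inner x (nu x) = 1 / norm (grho x)" using elim by (simp add: inner_commute)
 ultimately show ?case using elim by simp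
qed
show "AE x in sg. rho x = 1" "AE x in sg. norm (nu x) = 1" "AE x in sg. 0 < inner x (nu x)"
 "AE x in sg. norm (grho x) * inner x (nu x) = 1" "AE x in sg. grho x = norm (grho x) *r nu x"
 using AE_sigma[OF *] by (auto elim!: AE_mp)
qed

lemma finite_sigma: "finite_measure sg"
proof
interpret finite_measure cmeas by (rule finite_cone)
have "emeasure sg (space sg) = (\<integral>\<^sup>+x. ennreal (norm (grho x)) \<partial>cmeas)"
 by (simp add: sigma_density emeasure_density)
also have "... <= (\<integral>\<^sup>+x. ennreal (1 / r) \<partial>cmeas)"
 using AE_cone(3) by (intro nn_integral_mono_AE) (auto elim!: AE_mp intro: ennreal_leI)
also have "... < \<infinity>" by (simp add: emeasure_eq_measure ennreal_mult_less_top)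
finally show "emeasure sg (space sg) ~= \<infinity>" by simp
qed

definition C1 :: "(real ^ 'n => complex) => (real ^ 'n => complex ^ 'n) => bool" where
"C1 v W \<longleftrightarrow> v : BM & W : BM &
  cc v & cc W &
  (ALL x:Y. (v hder (%h. cdot (W x) (cplx h))) (at x))"

definition wdiv :: "(real ^ 'n => complex ^ 'n) => (real ^ 'n => complex) => bool" where
"wdiv F w \<longleftrightarrow> F : BM & cc F & integrable (vol) w &
  (ALL a :: real ^ 'n => real. smooth a --> compact (supp a) --> supp a <= Y -->
  (LV x. (\<Sum>i\<in>UNIV. partial i a x *r F x $ i)) = - (LV x. a x *r w x))"

lemma intbl_dom_cont: fixes f :: "real ^ 'n => 'b::euclidean_space"
assumes f: "f : BM" and c: "cc f"
shows "integrable (vol) f" "integrable sg f"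
proof -
obtain M where M: "0 <= M" "!!x. x : closure Y ==> norm (f x) <= M" using cont_cl_bdd[OF c] by metis
have "set_integrable lborel Y f" using M(2) closure_subset[of Y] by (intro set_intbl_dom_bdd[OF f, of M]) auto
then show "integrable (vol) f" using leb_borel(2)[OF f] by simp
interpret finite_measure sg by (rule finite_sigma)
show "integrable sg f"
proof (rule integrable_const_bound[where B = M])
 show "AE x in sg. norm (f x) <= M" using AE_normal(1) by eventually_elim (rule M(2), simp add: closure_eq)
 show "f : borel_measurable sg" using f by measurable
qed
qed

lemma int_sigma_normal:
assumes [measurable]: "F : BM" "f : BM"
shows "(LINT x|sg. ndot x (F x) * f x) = (LINT x|cmeas. cdot (cplx (grho x)) (F x) * f x)"
proof -
let ?a = "%x. cdot (cplx (grho x)) (F x)"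
have "(LINT x|sg. ndot x (F x) * f x) = (LINT x|cmeas. norm (grho x) *r (ndot x (F x) * f x))" by (rule int_sigma) measurable
also have "... = (LINT x|cmeas. ?a x * f x)"
proof (rule integral_cong_AE)
 show "AE x in cmeas. norm (grho x) *r (ndot x (F x) * f x) = ?a x * f x" using normal_cone AE_cone(2)
 proof eventually_elim
  case (elim x)
  then have "grho x ~= 0" by auto
  then have "grho x = norm (grho x) *r nu x" using elim by simp
  then have "?a x = norm (grho x) *r ndot x (F x)" by (metis cdot_cplx_scaleR)
  then show ?case by simp
 qed
qed measurable
finally show ?thesis .
qed

lemma green_real: fixes c :: "real ^ 'n => real"
assumes F: "wdiv F w" and w'[measurable]: "w' : BM" and ww: "AE x in vol. w x = w' x" and c: "cc c" "c : BM"
 and g: "cc g" "g : BM"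
  "!!x. x : Y ==> (c hder (%h. inner (g x) h)) (at x)"
shows "(LV x. cdot (cplx (g x)) (F x) + w x * cr (c x)) = (LINT x|sg. ndot x (F x) * cr (c x))"
proof -
note [measurable] = c(2) g(2)
have Fm[measurable]: "F : BM" and Fc: "cc F" and wi: "integrable (vol) w" using F by (simp_all add: wdiv_def)
define G where "G b x = (\<Sum>i\<in>UNIV. (b $ i) *r (F x $ i))" for b :: "real ^ 'n" and x
have G_axis: "G (axis i 1) x = F x $ i" for i x
proof -
 have "G (axis i 1) x = (\<Sum>j\<in>UNIV. if j = i then F x $ j else 0)" unfolding G_def by (rule sum.cong) (auto simp: axis_def)
 then show ?thesis by simp
qed
have Gm[measurable]: "G b : BM" for b unfolding G_def[abs_def] by measurable
have Gc: "cc (G b)" for b unfolding G_def[abs_def] by (intro continuous_intros Fc)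
let ?a = "borel_measurable (vol)"
have wm: "w : ?a" using wi by simp
have w'm: "w' : ?a" by (rule borel_leb) measurable
have w'i: "set_integrable lborel Y w'" using wi integrable_cong_AE[OF wm w'm ww] leb_borel(2)[OF w' dom_borel] by simp
have wd: "weak_div G w'" unfolding weak_div_def
proof (intro allI impI)
 fix d :: "real ^ 'n => real"
 assume d: "smooth d" "compact (supp d)" "supp d <= Y"
 have m[measurable]: "d : BM" "(%x. fd d x h) : BM" for h using d(1) by (auto intro!: bmc_onI smooth_cont smooth_frechet)
 let ?d = "%x. \<Sum>i\<in>UNIV. partial i d x *r F x $ i"
 let ?e = "(LINT x:Y|lborel. (\<Sum>i\<in>Basis. fd d x i *r G i x))"
 have "(LV x. ?d x) = - (LV x. d x *r w x)" using F d unfolding wdiv_def by blast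
 also have "(LV x. d x *r w x) = (LV x. d x *r w' x)"
 proof (rule integral_cong_AE)
  show "AE x in vol. d x *r w x = d x *r w' x" using ww by eventually_elim simp
  have "d : ?a" by (rule borel_leb) measurable
  then show "(%x. d x *r w x) : ?a" "(%x. d x *r w' x) : ?a" using wm w'm by measurable
 qed
 also have "... = (LINT x:Y|lborel. d x *r w' x)" by (rule leb_borel(1)) measurable
 also have "(LV x. ?d x) = (LINT x:Y|lborel. ?d x)" by (rule leb_borel(1)) (unfold partial_def, measurable)
 also have "... = ?e" by (simp add: sum_Basis_vec G_axis partial_def)
 finally show "?e = - (LINT x:Y|lborel. d x *r w' x)" .
qed
have cG: "(\<Sum>i\<in>Basis. inner (a x) i *r G i x) = cdot (cplx (a x)) (F x)" for a :: "real ^ 'n => real ^ 'n" and x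
 by (simp add: sum_Basis_vec G_axis inner_axis cdot_def complexify_def scaleR_conv_of_real)
let ?b = "%x. cdot (cplx (g x)) (F x)"
let ?c = "%x. \<Sum>i\<in>Basis. inner (grho x) i *r c x *r G i x"
let ?f = "%x. ?b x + w' x * cr (c x)"
have "(LV x. ?b x + w x * cr (c x)) = (LV x. ?f x)"
proof (rule integral_cong_AE)
 show "AE x in vol. ?b x + w x * cr (c x) = ?f x" using ww by eventually_elim simp
 have "(%x. cr (c x)) : ?a" "(%x. ?b x) : ?a" by (intro borel_leb; measurable)+
 then show "(%x. ?b x + w x * cr (c x)) : ?a"
  "(%x. ?f x) : ?a" using wm w'm by measurable
qed
also have "... = (LINT x:Y|lborel. ?f x)" by (rule leb_borel(1)) measurable
also have "... = (LINT x:Y|lborel. (\<Sum>i\<in>Basis. inner (g x) i *r G i x) + c x *r w' x)"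
 unfolding cG by (simp add: scaleR_conv_of_real mult.commute)
also have "... = (LINT x|cmeas. ?c x)" by (rule green_identity[OF wd Gc Gm w' w'i c g])
also have "... = (LINT x|cmeas. cdot (cplx (grho x)) (F x) * cr (c x))"
proof (rule integral_cong[OF refl])
 fix x
 have "?c x = c x *r (\<Sum>i\<in>Basis. inner (grho x) i *r G i x)"
  unfolding scaleR_sum_right by (rule sum.cong[OF refl]) (simp add: mult.commute)
 then show "?c x = cdot (cplx (grho x)) (F x) * cr (c x)" unfolding cG by (simp add: scaleR_conv_of_real mult.commute)
qed
also have "... = (LINT x|sg. ndot x (F x) * cr (c x))" by (rule int_sigma_normal[symmetric]) measurable
finally show ?thesis .
qed

lemma C1_parts:
assumes u: "C1 u Z" and x: "x : Y"
shows "((%x. Re (u x)) hder (%h. inner (\<chi> i. Re (Z x $ i)) h)) (at x)"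
 "((%x. Im (u x)) hder (%h. inner (\<chi> i. Im (Z x $ i)) h)) (at x)"
proof -
have d: "(u hder (%h. cdot (Z x) (cplx h))) (at x)" using u x by (simp add: C1_def)
show "((%x. Re (u x)) hder (%h. inner (\<chi> i. Re (Z x $ i)) h)) (at x)"
 using has_derivative_Re[OF d] by (simp add: cdot_def complexify_def inner_vec_def)
show "((%x. Im (u x)) hder (%h. inner (\<chi> i. Im (Z x $ i)) h)) (at x)"
 using has_derivative_Im[OF d] by (simp add: cdot_def complexify_def inner_vec_def)
qed

lemma C1_borel: "C1 u Z ==> u : BM" "C1 u Z ==> Z : BM" by (simp_all add: C1_def)

lemma C1_cont: "C1 u Z ==> cc u" "C1 u Z ==> cc Z" by (simp_all add: C1_def)

lemma wdiv_bdd_mult_intbl: fixes f :: "real ^ 'n => complex"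
assumes f: "f : BM" "cc f" and w: "integrable (vol) w"
shows "integrable (vol) (%x. w x * f x)"
proof -
obtain M where M: "0 <= M" "!!x. x : closure Y ==> norm (f x) <= M" using cont_cl_bdd[OF f(2)] by metis
let ?a = "borel_measurable (vol)"
have fm: "f : ?a" by (rule borel_leb[OF f(1)])
have wm: "w : ?a" using w by simp
show ?thesis
proof (rule integrable_bound)
 show "integrable (vol) (%x. M *r w x)" using w by simp
 show "(%x. w x * f x) : ?a" using fm wm by measurable
 show "AE x in vol. norm (w x * f x) <= norm (M *r w x)"
 proof (rule AE_I2)
  fix x assume "x : space (vol)"
  then have "norm (f x) <= M" using M closure_subset[of Y] by auto
  then have "norm (w x) * norm (f x) <= norm (w x) * M" by (intro mult_left_mono) auto
  then show "norm (w x * f x) <= norm (M *r w x)" using M(1) by (simp add: norm_mult mult.commute)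
 qed
qed
qed

lemma green:
assumes u: "C1 u Z" and F: "wdiv F w"
shows "(LV x. cdot (Z x) (F x) + w x * u x) = (LINT x|sg. ndot x (F x) * u x)"
proof -
note [measurable] = C1_borel[OF u]
note c = C1_cont[OF u]
have Fm[measurable]: "F : BM" and Fc: "cc F" and wi: "integrable (vol) w" using F by (simp_all add: wdiv_def)
have "Y \<inter> space lebesgue : sets lebesgue" using open_domain by simp
from borel_measurable_integrable[OF integrable_restrict_space[OF this, THEN iffD1, OF wi]]
obtain w' where w'[measurable]: "w' : BM" and ae: "AEL x. ind Y x *r w x = w' x" by (rule compl_borel_version)
from ae have "AE x in lebesgue. ind Y x *r w x = w' x" by (rule AE_completion)
then have ww: "AE x in vol. w x = w' x" using open_domain by (subst AE_restrict_space_iff) (auto elim!: AE_mp)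
let ?a = "%x. \<chi> i. Re (Z x $ i)" and ?b = "%x. \<chi> i. Im (Z x $ i)"
have am[measurable]: "?a : BM" "?b : BM" by measurable
have ac: "cc ?a" "cc ?b" by (intro continuous_intros c)+
have uc: "cc (%x. Re (u x))" "cc (%x. Im (u x))" by (intro continuous_intros c)+
have um[measurable]: "(%x. Re (u x)) : BM" "(%x. Im (u x)) : BM" by measurable
let ?c = "%x. cdot (cplx (?a x)) (F x) + w x * cr (Re (u x))"
let ?e = "%x. ndot x (F x)"
have R: "(LV x. ?c x) = (LINT x|sg. ?e x * cr (Re (u x)))"
 by (rule green_real[OF F w' ww uc(1) um(1) ac(1) am(1) C1_parts(1)[OF u]])
let ?d = "%x. cdot (cplx (?b x)) (F x) + w x * cr (Im (u x))"
have I: "(LV x. ?d x) = (LINT x|sg. ?e x * cr (Im (u x)))"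
 by (rule green_real[OF F w' ww uc(2) um(2) ac(2) am(2) C1_parts(2)[OF u]])
have i1: "integrable (vol) (%x. ?c x)"
 "integrable (vol) (%x. ?d x)" unfolding cdot_def complexify_def vec_lambda_beta
 by (intro integrable_add wdiv_bdd_mult_intbl wi intbl_dom_cont(1) continuous_intros Fc c; measurable)+
have "norm (nu x) = 1 ==> \<bar>nu x $ i\<bar> <= 1" for x i using component_le_norm_cart[of "nu x" i] by simp
then have nub: "AE x in sg. norm (cr (nu x $ i)) <= norm (1 :: complex)" for i using AE_normal(2) by (auto elim!: AE_mp)
have i2: "integrable sg (%x. ?e x * f x)" if f: "f : BM" "cc f" for f
proof -
 note [measurable] = f(1)
 have "integrable sg (%x. cr (nu x $ i) * (F x $ i * f x))" for i
 proof (rule integrable_bound)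
  show "integrable sg (%x. F x $ i * f x)" by (rule intbl_dom_cont(2)) (measurable, intro continuous_intros Fc f(2))
  show "AE x in sg. norm (cr (nu x $ i) * (F x $ i * f x)) <= norm (F x $ i * f x)"
   using nub[of i] by eventually_elim (simp add: norm_mult mult_left_le_one_le)
 qed measurable
 then show ?thesis unfolding cdot_def sum_distrib_right by (simp add: complexify_def mult.assoc)
qed
have iR: "integrable sg (%x. ?e x * cr (Re (u x)))"
 "integrable sg (%x. ?e x * cr (Im (u x)))" by (intro i2; measurable; intro continuous_intros c)+
have split1: "cdot (Z x) (F x) + w x * u x = ?c x + \<i> * ?d x" for x
proof -
 have "cdot (Z x) (F x) = cdot (cplx (?a x)) (F x) + \<i> * cdot (cplx (?b x)) (F x)"
  unfolding cdot_def sum_distrib_left sum.distrib[symmetric]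
  by (rule sum.cong[OF refl]) (simp add: complexify_def complex_eq_iff algebra_simps)
 moreover have "w x * u x = w x * cr (Re (u x)) + \<i> * (w x * cr (Im (u x)))" by (simp add: complex_eq_iff algebra_simps)
 ultimately show ?thesis by (simp add: algebra_simps)
qed
have split2: "?e x * u x = ?e x * cr (Re (u x)) + \<i> * (?e x * cr (Im (u x)))" for x by (simp add: complex_eq_iff algebra_simps)
have "(LV x. cdot (Z x) (F x) + w x * u x) =
  (LV x. ?c x)
  + \<i> * (LV x. ?d x)" unfolding split1 by (subst integral_add[OF i1(1) integrable_mult_right[OF i1(2)]]) simp
also have "... = (LINT x|sg. ?e x * u x)"
 unfolding R I split2 by (subst integral_add[OF iR(1) integrable_mult_right[OF iR(2)]]) simp
finally show ?thesis .
qed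

end

lemma am_gm_optimal: fixes x a b :: real
assumes le: "!!t. 0 < t ==> 2 * x <= t * a + b / t" and nn: "0 <= a" "0 <= b"
shows "x <= sqrt a * sqrt b"
proof (rule ccontr)
let ?a = "sqrt a * sqrt b"
assume "\<not> x <= ?a"
then have gt: "?a < x" by simp
have s0: "0 <= ?a" using nn by simp
show False
proof (cases "a = 0")
 case True
 have "0 < x" using gt s0 by linarith
 define t where "t = (b + 1) / x"
 have "0 < t" using `0 < x` nn by (simp add: t_def)
 from le[OF this] have "2 * x <= b / (b + 1) * x" using True by (simp add: t_def)
 also have "... <= 1 * x" using nn `0 < x` by (intro mult_right_mono) simp_all
 finally show False using `0 < x` by simp
next
 case False
 then have a: "0 < a" using nn by simp
 show False
 proof (cases "b = 0")
  case True
  have "0 < x" using gt s0 by linarith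
  then have "2 * x <= (x / a) * a + b / (x / a)" using a by (intro le) simp
  then show False using `0 < x` True a by simp
 next
  case False
  then have b: "0 < b" using nn by simp
  let ?b = "sqrt b / sqrt a"
  have t: "0 < ?b" using a b by simp
  have aa: "sqrt a * sqrt a = a" "sqrt b * sqrt b = b" using nn by simp_all
  have "?b * (sqrt a * sqrt a) = ?a" using a by (simp del: real_sqrt_mult_self)
  moreover have "(sqrt b * sqrt b) / ?b = ?a" using b by (simp del: real_sqrt_mult_self)
  ultimately have "?b * a = ?a" "b / ?b = ?a" unfolding aa by simp_all
  then show False using le[OF t] gt by linarith
 qed
qed
qed

lemma L2_borel: "L2 M f ==> f : borel_measurable M" and L2_norm_integrable: "L2 M f ==> integrable M (%x. nsq (f x))"
by (simp_all add: L2_def)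

lemma norm_mult_le_squares: "0 < t ==> 2 * (a * b) <= t * a^2 + b^2 / t" for a b t :: real
proof -
assume t: "0 < t"
have "0 <= (t * a - b)^2 / t" using t by simp
also have "... = t * a^2 + b^2 / t - 2 * (a * b)" using t by (simp add: field_simps power2_eq_square)
finally show ?thesis by simp
qed

lemma norm_prod_intbl:
assumes f: "L2 M f" and g: "L2 M g"
shows "integrable M (%x. norm (f x) * norm (g x))"
proof (rule integrable_bound)
let ?b = "%x. nsq (f x) + nsq (g x)"
show "integrable M (%x. ?b x)" using L2_norm_integrable[OF f] L2_norm_integrable[OF g] by simp
let ?a = "%x. norm (f x) * norm (g x)"
show "(%x. ?a x) : borel_measurable M" using L2_borel[OF f] L2_borel[OF g] by measurable
show "AE x in M. norm (?a x) <= norm (?b x)"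
proof (rule AE_I2)
 fix x
 have "0 <= ?a x" "0 <= ?b x" by simp_all
 moreover have "2 * ?a x <= ?b x" using norm_mult_le_squares[of 1 "norm (f x)" "norm (g x)"] by simp
 ultimately show "norm (?a x) <= norm (?b x)" unfolding real_norm_def by linarith
qed
qed

lemma Cauchy_Schwarz_L2:
assumes f: "L2 M f" and g: "L2 M g"
shows "(LINT x|M. norm (f x) * norm (g x)) <= sqrt (LINT x|M. nsq (f x)) * sqrt (LINT x|M. nsq (g x))"
proof (rule am_gm_optimal)
note i = L2_norm_integrable[OF f] L2_norm_integrable[OF g]
fix t :: real assume t: "0 < t"
let ?a = "t * (LINT x|M. nsq (f x)) + (LINT x|M. nsq (g x)) / t"
let ?b = "2 * (LINT x|M. norm (f x) * norm (g x))"
have "?b = (LINT x|M. 2 * (norm (f x) * norm (g x)))" by simp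
also have "... <= (LINT x|M. t * nsq (f x) + nsq (g x) / t)"
 using i norm_prod_intbl[OF f g] norm_mult_le_squares[OF t] by (intro integral_mono) simp_all
also have "... = ?a" using i by simp
finally show "?b <= ?a" .
qed simp_all

lemma L2_dominated:
assumes f: "L2 M f" and h: "h : borel_measurable M" and le: "AE x in M. norm (h x) <= c * norm (f x)"
shows "L2 M h" unfolding L2_def
proof (intro conjI h)
show "integrable M (%x. nsq (h x))"
proof (rule integrable_bound)
 show "integrable M (%x. c^2 * nsq (f x))" using L2_norm_integrable[OF f] by simp
 show "AE x in M. norm (nsq (h x)) <= norm (c^2 * nsq (f x))" using le
 proof eventually_elim
  case (elim x)
  from power_mono[OF elim norm_ge_zero, of 2] show ?case by (simp add: power_mult_distrib)
 qed
qed (use h in measurable)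
qed

lemma L2_scaleR: "L2 M f ==> L2 M (%x. c *r f x)" by (rule L2_dominated[where c = "abs c"], assumption) (auto dest: L2_borel)

lemma L2_add:
assumes f: "L2 M f" and g: "L2 M g"
shows "L2 M (%x. f x + g x)" unfolding L2_def
proof (intro conjI)
show m: "(%x. f x + g x) : borel_measurable M" using L2_borel[OF f] L2_borel[OF g] by measurable
show "integrable M (%x. nsq (f x + g x))"
proof (rule integrable_bound)
 let ?a = "%x. 2 * nsq (f x) + 2 * nsq (g x)"
 show "integrable M (%x. ?a x)" using L2_norm_integrable[OF f] L2_norm_integrable[OF g] by simp
 show "AE x in M. norm (nsq (f x + g x)) <= norm (?a x)"
 proof (rule AE_I2)
  fix x
  have "nsq (f x + g x) <= (norm (f x) + norm (g x))^2" by (intro power_mono norm_triangle_ineq) simp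
  also have "... <= ?a x" using norm_mult_le_squares[of 1 "norm (f x)" "norm (g x)"] by (simp add: power2_sum)
  finally show "norm (nsq (f x + g x)) <= norm (?a x)" by simp
 qed
qed (use m in measurable)
qed

lemma L2_diff: "L2 M f ==> L2 M g ==> L2 M (%x. f x - g x)" using L2_add[OF _ L2_scaleR[of M g "-1"]] by simp

lemma L2_prod_intbl: fixes f g :: "'a => complex"
assumes f: "L2 M f" and g: "L2 M g"
shows "integrable M (%x. f x * g x)" using norm_prod_intbl[OF f g]
by (rule integrable_bound) (use L2_borel[OF f] L2_borel[OF g] in "auto simp: norm_mult")

lemma L2_intbl:
assumes "finite_measure M" and f: "L2 M f"
shows "integrable M f"
proof -
interpret finite_measure M by fact
have "L2 M (%x. 1 :: real)" by (simp add: L2_def)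
from norm_prod_intbl[OF f this] have "integrable M (%x. norm (f x))" by simp
then show ?thesis using L2_borel[OF f] integrable_norm_cancel by blast
qed

lemma L2_bounded:
assumes "finite_measure M" and f: "f : borel_measurable M" "AE x in M. norm (f x) <= B"
shows "L2 M f"
proof -
interpret finite_measure M by fact
have "L2 M (%x. 1 :: real)" by (simp add: L2_def)
then show ?thesis by (rule L2_dominated[OF _ f(1), where c = B]) (use f(2) in simp)
qed

lemma L2_vec_nth: fixes f :: "'a => complex ^ 'n::finite"
assumes f: "L2 M f"
shows "L2 M (%x. f x $ i)"
by (rule L2_dominated[OF f vec_nth_borel[OF L2_borel[OF f]], where c = 1]) (simp add: Finite_Cartesian_Product.norm_nth_le)

lemma L2_cnj: "L2 M f ==> L2 M (%x. cnj (f x))"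
using measurable_compose[of f M borel cnj borel] bmc_onI[OF continuous_on_cnj[OF continuous_on_id]] by (simp add: L2_def)

lemma L2_zero: "L2 M (%x. 0)" by (simp add: L2_def)

lemma L2_sum: "(!!i. i : I ==> L2 M (f i)) ==> L2 M (%x. \<Sum>i\<in>I. f i x)"
proof (induction I rule: infinite_finite_induct)
case (insert i I)
then show ?case using L2_add[of M "f i" "%x. \<Sum>i\<in>I. f i x"] by simp
qed (simp_all add: L2_zero)

lemma L2_mult_left: "L2 M f ==> L2 M (%x. c * f x :: complex)"
by (rule L2_dominated[where c = "norm c"], assumption) (auto dest: L2_borel simp: norm_mult)

lemma L2_limD:
assumes "L2_lim M F f"
shows "L2 M (F j)" "L2 M f" "(%j. (LINT x|M. nsq (F j x - f x))) ----> 0" using assms by (simp_all add: L2_lim_def)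

lemma L2_lim_prod: fixes f g :: "'a => complex"
assumes lim: "L2_lim M F f" and g: "L2 M g"
shows "(%j. (LINT x|M. F j x * g x)) ----> (LINT x|M. f x * g x)"
proof -
note F = L2_limD[OF lim]
let ?b = "%j. (LINT x|M. F j x * g x) - (LINT x|M. f x * g x)"
have "(%j. ?b j) ----> 0"
proof (rule Lim_null_comparison)
 let ?a = "%j. sqrt (LINT x|M. nsq (F j x - f x)) * sqrt (LINT x|M. nsq (g x))"
 show "(%j. ?a j) ----> 0" using tendsto_mult_left_zero[OF tendsto_real_sqrt[OF F(3), unfolded real_sqrt_zero]] .
 show "\<forall>\<^sub>F j in sequentially. norm (?b j) <= ?a j"
 proof (rule always_eventually, rule allI)
  fix j
  have "?b j = (LINT x|M. (F j x - f x) * g x)"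
   by (subst integral_diff[symmetric]) (simp_all add: L2_prod_intbl F g left_diff_distrib)
  also have "norm ... <= (LINT x|M. norm ((F j x - f x) * g x))" by (rule integral_norm_bound)
  also have "... = (LINT x|M. norm (F j x - f x) * norm (g x))" by (simp add: norm_mult)
  also have "... <= ?a j" by (rule Cauchy_Schwarz_L2[OF L2_diff[OF F(1,2)] g])
  finally show "norm (?b j) <= ?a j" .
 qed
qed
then show ?thesis by (rule LIM_zero_cancel)
qed

lemma L2_lim_vec_nth: fixes F :: "nat => 'a => complex ^ 'n::finite"
assumes lim: "L2_lim M F f"
shows "L2_lim M (%j x. F j x $ i) (%x. f x $ i)" unfolding L2_lim_def
proof (intro conjI allI)
note F = L2_limD[OF lim]
show "L2 M (%x. F j x $ i)" for j by (rule L2_vec_nth[OF F(1)])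
show "L2 M (%x. f x $ i)" by (rule L2_vec_nth[OF F(2)])
let ?a = "%j x. nsq (F j x $ i - f x $ i)"
show "(%j. (LINT x|M. ?a j x)) ----> 0"
proof (rule tendsto_sandwich[OF _ _ tendsto_const F(3)])
 show "\<forall>\<^sub>F j in sequentially. (LINT x|M. ?a j x) <= (LINT x|M. nsq (F j x - f x))"
 proof (rule always_eventually, rule allI, rule integral_mono)
  fix j x
  note d = L2_diff[OF F(1)[of j] F(2)]
  show "integrable M (%x. ?a j x)" using L2_norm_integrable[OF L2_vec_nth[OF d, of i]] by simp
  show "integrable M (%x. nsq (F j x - f x))" by (rule L2_norm_integrable[OF d])
  show "?a j x <= nsq (F j x - f x)" using Finite_Cartesian_Product.norm_nth_le[of "F j x - f x" i] by (intro power_mono) simp_all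
 qed
qed simp
qed

lemma partial_of_real: fixes a :: "real ^ 'n::finite => real"
assumes "smooth a"
shows "partial i (%x. cr (a x)) x = cr (partial i a x)"
proof -
have "((%x. cr (a x)) hder (%h. cr (fd a x h))) (at x)"
 by (rule bounded_linear.has_derivative[OF bounded_linear_of_real smooth_deriv[OF assms]])
from frechet_derivative_at[OF this] show ?thesis unfolding partial_def by metis
qed

lemma tf_of_real:
assumes "smooth a" "compact (supp a)" "supp a <= Y"
shows "test_function Y (%x. cr (a x))"
unfolding test_function_def using assms smooth_bdd_linear[OF bounded_linear_of_real assms(1)] by simp

lemma smooth_partial: "smooth a ==> smooth (partial i a)" unfolding partial_def[abs_def] by (rule smooth_frechet)

lemma partial_off_supp:
assumes "x ~: supp a"
shows "partial i a x = 0" unfolding partial_def by (rule fd_off_supp[OF assms])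

lemma tf_partial:
assumes "test_function Y a"
shows "test_function Y (partial i a)"
proof -
have a: "smooth a" "compact (supp a)" "supp a <= Y" using assms by (simp_all add: test_function_def)
let ?a = "closure {x. partial i a x ~= 0}"
have "{x. partial i a x ~= 0} <= supp a" using partial_off_supp[of _ a i] by blast
then have c: "?a <= supp a" by (rule closure_minimal) simp
have "compact ?a" using compact_Int_closed[OF a(2) closed_closure[of "{x. partial i a x ~= 0}"]] c by (simp add: Int_absorb1)
then show ?thesis using smooth_partial[OF a(1)] c a(3) by (auto simp: test_function_def)
qed

lemma smooth_borel: "smooth f ==> f : BM" by (rule bmc_onI[OF smooth_cont])

lemma cdot_axis: "cdot a (axis i 1) = a $ i" unfolding cdot_def axis_def by (simp add: if_distrib cong: if_cong)

lemma smooth_has_grad: fixes a :: "real ^ 'n::finite => complex"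
assumes "smooth a"
shows "(a hder (%h. cdot (grad a x) (cplx h))) (at x)"
proof -
note d = smooth_deriv[OF assms, of x]
have "fd a x h = cdot (grad a x) (cplx h)" for h
proof -
 have "fd a x h = fd a x (\<Sum>i\<in>UNIV. h $ i *r axis i 1)" using basis_expansion[of h] by (simp add: scalar_mult_eq_scaleR)
 also have "... = (\<Sum>i\<in>UNIV. h $ i *r fd a x (axis i 1))"
  using has_derivative_linear[OF d] by (simp add: linear_sum linear_scale)
 finally show ?thesis by (simp add: cdot_def grad_def partial_def complexify_def scaleR_conv_of_real mult.commute)
qed
then show ?thesis using d by presburger
qed

lemma smooth_grad_cont: fixes a :: "real ^ 'n::finite => complex"
assumes "smooth a" shows "cont S (grad a)"
unfolding grad_def[abs_def] by (intro continuous_intros smooth_cont smooth_partial assms)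

context boundary_domain
begin

lemma finite_leb: "finite_measure (vol)"
by (rule finite_measure_lebesgue_on) (simp add: lmeasurable_open bounded_domain open_domain)

lemma space_leb: "space (vol) = Y" by (simp add: space_restrict_space)

lemma L2_cont: fixes f :: "real ^ 'n => 'b::euclidean_space"
assumes f: "f : BM" "cc f"
shows "L2 (vol) f" "L2 sg f"
proof -
obtain M where M: "!!x. x : closure Y ==> norm (f x) <= M" using cont_cl_bdd[OF f(2)] by metis
show "L2 (vol) f"
proof (rule L2_bounded[OF finite_leb borel_leb[OF f(1)]])
 show "AE x in vol. norm (f x) <= M" using M closure_subset[of Y] by (intro AE_I2) (auto simp: space_leb)
qed
show "L2 sg f"
proof (rule L2_bounded[OF finite_sigma])
 show "AE x in sg. norm (f x) <= M" using AE_normal(1) by eventually_elim (rule M, simp add: closure_eq)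
 show "f : borel_measurable sg" using f(1) by measurable
qed
qed

lemma C1_smooth: "smooth a ==> C1 a (grad a)" unfolding C1_def
by (intro conjI ballI smooth_borel smooth_cont smooth_grad_cont smooth_has_grad
  bmc_onI[OF smooth_grad_cont])

lemma C1_mult:
assumes "C1 u Z" "C1 v W"
shows "C1 (%x. u x * v x) (%x. \<chi> i. u x * W x $ i + Z x $ i * v x)"
proof -
note [measurable] = C1_borel[OF assms(1)] C1_borel[OF assms(2)]
have "((%x. u x * v x) hder (%h. cdot (\<chi> i. u x * W x $ i + Z x $ i * v x) (cplx h))) (at x)" if "x : Y" for x
proof -
 have "((%x. u x * v x) hder (%h. u x * cdot (W x) (cplx h) + cdot (Z x) (cplx h) * v x)) (at x)"
  using assms that by (intro has_derivative_mult) (simp_all add: C1_def)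
 then show ?thesis by (simp add: cdot_def sum_distrib_left sum_distrib_right sum.distrib algebra_simps)
qed
then show ?thesis unfolding C1_def by (intro conjI ballI continuous_intros C1_cont[OF assms(1)] C1_cont[OF assms(2)]; measurable)
qed

lemma wdiv_const: "wdiv (%x. axis i 1) (%x. 0)" unfolding wdiv_def
proof (intro conjI allI impI)
fix a :: "real ^ 'n => real"
assume a: "smooth a" "compact (supp a)" "supp a <= Y"
have [measurable]: "partial i a : BM" by (rule smooth_borel[OF smooth_partial[OF a(1)]])
let ?a = "%x. partial i a x"
have "(LB x. a x *r (0 :: real)) = - (LB x. fd a x (axis i 1) *r (1 :: real))"
 by (rule ibp_dir(1)[OF lipschitz_on_constant a(1,2)]) simp_all
then have 0: "(LB x. ?a x) = 0" by (simp add: partial_def)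
have "(\<Sum>j\<in>UNIV. partial j a x *r (axis i 1 :: complex ^ 'n) $ j) = cr (?a x)" for x
 unfolding axis_def by (simp add: if_distrib scaleR_conv_of_real cong: if_cong)
then have "(LV x. (\<Sum>j\<in>UNIV. partial j a x *r (axis i 1 :: complex ^ 'n) $ j)) = cr (LV x. ?a x)" by simp
also have "(LV x. ?a x) = (LINT x:Y|lborel. ?a x)" by (rule leb_borel(1)) measurable
also have "... = (LB x. ?a x)" unfolding set_lint_def
proof (rule integral_cong[OF refl])
 fix x show "ind Y x *r ?a x = ?a x" using partial_off_supp[of x a i] a(3) by (cases "x : Y") auto
qed
finally show "(LV x. (\<Sum>j\<in>UNIV. partial j a x *r (axis i 1 :: complex ^ 'n) $ j)) = - (LV x. a x *r 0)" using 0 by simp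
qed simp_all

lemma div_theorem:
assumes u: "C1 u Z"
shows "(LV x. Z x $ i) = (LINT x|sg. cr (nu x $ i) * u x)"
using green[OF u wdiv_const[of i]] by (simp add: cdot_axis) (simp add: complexify_def)

lemma prod_rule_div:
assumes u: "C1 u Z" and v: "C1 v W"
shows "(LV x. u x * W x $ i + Z x $ i * v x) = (LINT x|sg. cr (nu x $ i) * (u x * v x))"
using div_theorem[OF C1_mult[OF u v], of i] by simp

lemma C1_prod_intbl: fixes Z W :: "real ^ 'n => complex ^ 'n"
assumes u: "C1 u Z" and v: "C1 v W"
shows "integrable (vol) (%x. u x * W x $ i)"
proof -
note [measurable] = C1_borel[OF u] C1_borel[OF v]
show ?thesis by (intro intbl_dom_cont continuous_intros C1_cont[OF u] C1_cont[OF v]) measurable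
qed

lemma C1_weak_grad:
assumes v: "C1 v W"
shows "weak_grad_of Y v W" unfolding weak_grad_of_def
proof (intro conjI allI impI)
show "L2 (vol) W" by (rule L2_cont[OF C1_borel(2)[OF v] C1_cont(2)[OF v]])
fix a i assume t: "test_function Y a"
then have a: "smooth a" by (simp add: test_function_def)
have "a x = 0" if "rho x = 1" for x
proof -
 have "x ~: Y" using that by (simp add: mem_domain)
 then have "x ~: supp a" using t by (auto simp: test_function_def)
 then show ?thesis using closure_subset[of "{x. a x ~= 0}"] by blast
qed
then have "AE x in sg. cr (nu x $ i) * (v x * a x) = 0" using AE_normal(1) by (auto elim!: AE_mp)
then have "(LINT x|sg. cr (nu x $ i) * (v x * a x)) = 0" by (rule integral_eq_zero_AE)
then have "(LV x. v x * grad a x $ i + W x $ i * a x) = 0" using prod_rule_div[OF v C1_smooth[OF a], of i] by simp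
moreover have "(LV x. v x * grad a x $ i + W x $ i * a x) = (LV x. v x * grad a x $ i) + (LV x. W x $ i * a x)"
 using C1_prod_intbl[OF v C1_smooth[OF a], of i] C1_prod_intbl[OF C1_smooth[OF a] v, of i]
 by (intro integral_add) (simp_all add: mult.commute)
ultimately show "(LV x. v x * partial i a x) = - (LV x. W x $ i * a x)" by (simp add: grad_def eq_neg_iff_add_eq_0)
qed

lemma tf_L2:
assumes "smooth (a :: real ^ 'n => complex)"
shows "L2 (vol) a" by (rule L2_cont(1)[OF smooth_borel[OF assms] smooth_cont[OF assms]])

lemma L2_lebesgue_eqI: fixes f g :: "real ^ 'n => complex"
assumes f: "L2 (vol) f" and g: "L2 (vol) g" and eq: "!!a. test_function Y a ==> (LV x. f x * a x) = (LV x. g x * a x)"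
shows "AE x in vol. f x = g x"
proof -
have "AE x in vol. f x - g x = 0"
proof (rule flemma_leb[OF open_domain])
 show "integrable (vol) (%x. f x - g x)" by (rule L2_intbl[OF finite_leb L2_diff[OF f g]])
 fix a :: "real ^ 'n => real"
 assume a: "smooth a" "compact (supp a)" "supp a <= Y"
 let ?p = "%x. cr (a x)"
 note t = tf_of_real[OF a]
 have p: "L2 (vol) ?p" using t by (intro tf_L2) (simp add: test_function_def)
 have "(LV x. a x *r (f x - g x)) = (LV x. f x * ?p x - g x * ?p x)" by (simp add: scaleR_conv_of_real algebra_simps)
 also have "... = 0" using eq[OF t] L2_prod_intbl[OF f p] L2_prod_intbl[OF g p] by simp
 finally show "(LV x. a x *r (f x - g x)) = 0" .
qed
then show ?thesis by simp
qed

lemma weak_grad_unique: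
assumes "weak_grad_of Y v W1" "weak_grad_of Y v W2"
shows "AE x in vol. W1 x = W2 x"
proof -
have "AE x in vol. W1 x $ i = W2 x $ i" for i
proof (rule L2_lebesgue_eqI)
 fix a assume t: "test_function Y a"
 have "(LV x. v x * partial i a x) = - (LV x. W1 x $ i * a x)"
  "(LV x. v x * partial i a x) = - (LV x. W2 x $ i * a x)" using assms t unfolding weak_grad_of_def by blast+
 then show "(LV x. W1 x $ i * a x) = (LV x. W2 x $ i * a x)" by simp
qed (use assms in "auto intro: L2_vec_nth simp: weak_grad_of_def")
then have "AE x in vol. ALL i. W1 x $ i = W2 x $ i" by (intro AE_finite_allI[of UNIV, simplified]) auto
then show ?thesis by (simp add: Finite_Cartesian_Product.vec_eq_iff)
qed

lemma weak_lapl_unique: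
assumes "weak_laplacian_of Y v w1" "weak_laplacian_of Y v w2"
shows "AE x in vol. w1 x = w2 x"
proof (rule L2_lebesgue_eqI)
fix a assume t: "test_function Y a"
have "(LV x. v x * laplacian a x) = (LV x. w1 x * a x)"
 "(LV x. v x * laplacian a x) = (LV x. w2 x * a x)" using assms t unfolding weak_laplacian_of_def by blast+
then show "(LV x. w1 x * a x) = (LV x. w2 x * a x)" by simp
qed (use assms in "simp_all add: weak_laplacian_of_def")

lemma wgrad_C1:
assumes v: "C1 v W"
shows "weak_grad_of Y v (wgrad Y v)" "AE x in vol. wgrad Y v x = W x"
proof -
show w: "weak_grad_of Y v (wgrad Y v)" unfolding wgrad_def by (rule someI[of "weak_grad_of Y v", OF C1_weak_grad[OF v]])
show "AE x in vol. wgrad Y v x = W x" by (rule weak_grad_unique[OF w C1_weak_grad[OF v]])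
qed

lemma wdiv_lapl:
assumes v: "C1 v W" and w: "weak_laplacian_of Y v w"
shows "wdiv W w" unfolding wdiv_def
proof (intro conjI allI impI C1_borel(2)[OF v] C1_cont(2)[OF v])
have wL: "L2 (vol) w" using w by (simp add: weak_laplacian_of_def)
show "integrable (vol) w" by (rule L2_intbl[OF finite_leb wL])
fix a :: "real ^ 'n => real"
assume a: "smooth a" "compact (supp a)" "supp a <= Y"
let ?p = "%x. cr (a x)"
note t = tf_of_real[OF a]
have sp: "smooth ?p" using t by (simp add: test_function_def)
have VL: "L2 (vol) v" by (rule L2_cont[OF C1_borel(1)[OF v] C1_cont(1)[OF v]])
have WL: "L2 (vol) (%x. W x $ i)" for i by (rule L2_vec_nth[OF L2_cont(1)[OF C1_borel(2)[OF v] C1_cont(2)[OF v]]])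
have "(LV x. a x *r w x) = (LV x. v x * laplacian ?p x)"
 using w t by (simp add: weak_laplacian_of_def scaleR_conv_of_real mult.commute)
also have "... = (LV x. (\<Sum>i\<in>UNIV. v x * partial i (partial i ?p) x))" by (simp add: laplacian_def sum_distrib_left)
also have "... = (\<Sum>i\<in>UNIV. (LV x. v x * partial i (partial i ?p) x))"
 by (intro integral_sum L2_prod_intbl[OF VL] tf_L2 smooth_partial sp)
also have "... = (\<Sum>i\<in>UNIV. - (LV x. W x $ i * partial i ?p x))"
 using C1_weak_grad[OF v] tf_partial[OF t] unfolding weak_grad_of_def by (intro sum.cong) auto
also have "... = - (LV x. (\<Sum>i\<in>UNIV. W x $ i * partial i ?p x))"
 unfolding sum_negf by (subst integral_sum) (auto intro!: L2_prod_intbl[OF WL] tf_L2 smooth_partial sp)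
finally show "(LV x. (\<Sum>i\<in>UNIV. partial i a x *r W x $ i)) = - (LV x. a x *r w x)"
 by (simp add: partial_of_real[OF a(1)] scaleR_conv_of_real mult.commute)
qed

lemma L2_sigma_eqI: fixes f g :: "real ^ 'n => complex"
assumes f: "L2 sg f" and g: "L2 sg g"
 and eq: "!!a :: real ^ 'n => complex. smooth a ==> (LINT x|sg. f x * a x) = (LINT x|sg. g x * a x)"
shows "AE x in sg. f x = g x"
proof -
have "AE x in sg. x : UNIV --> f x - g x = 0"
proof (rule flemma[OF sets_sigma])
 show "integrable sg (%x. f x - g x)" by (rule L2_intbl[OF finite_sigma L2_diff[OF f g]])
 fix a :: "real ^ 'n => real"
 assume a: "smooth a"
 let ?p = "%x. cr (a x)"
 have sp: "smooth ?p" by (rule smooth_bdd_linear[OF bounded_linear_of_real a])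
 have p: "L2 sg ?p" by (rule L2_cont(2)[OF smooth_borel[OF sp] smooth_cont[OF sp]])
 have "(LINT x|sg. a x *r (f x - g x)) = (LINT x|sg. f x * ?p x - g x * ?p x)" by (simp add: scaleR_conv_of_real algebra_simps)
 also have "... = 0" using eq[OF sp] L2_prod_intbl[OF f p] L2_prod_intbl[OF g p] by simp
 finally show "(LINT x|sg. a x *r (f x - g x)) = 0" .
qed simp
then show ?thesis by simp
qed

lemma L2_nmult: fixes f :: "real ^ 'n => complex"
assumes "L2 sg f"
shows "L2 sg (%x. cr (nu x $ i) * f x)"
proof (rule L2_dominated[OF assms, where c = 1])
have [measurable]: "f : borel_measurable sg" by (rule L2_borel[OF assms])
show "(%x. cr (nu x $ i) * f x) : borel_measurable sg" by measurable
show "AE x in sg. norm (cr (nu x $ i) * f x) <= 1 * norm (f x)" using AE_normal(2)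
proof eventually_elim
 case (elim x)
 then have "abs (nu x $ i) <= 1" using component_le_norm_cart[of "nu x" i] by simp
 then show ?case by (simp add: norm_mult mult_left_le_one_le)
qed
qed

lemma trace_C1:
assumes v: "C1 v W" and t: "trace_of Y sg v t"
shows "AE x in sg. t x = v x"
proof -
obtain b where b: "!!j::nat. smooth (b j)" and lv: "L2_lim (vol) b v"
 and lg: "L2_lim (vol) (%j. grad (b j)) (wgrad Y v)" and lt: "L2_lim sg b t" using t unfolding trace_of_def by blast
have tL: "L2 sg t" by (rule L2_limD(2)[OF lt])
have vL: "L2 sg v" by (rule L2_cont[OF C1_borel(1)[OF v] C1_cont(1)[OF v]])
have wg: "L2 (vol) (%x. wgrad Y v x $ i)" for i by (rule L2_vec_nth[OF L2_limD(2)[OF lg]])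
have Wb: "(%x. W x $ i) : borel_measurable (vol)" for i by (rule borel_leb[OF vec_nth_borel[OF C1_borel(2)[OF v]]])
let ?a = "%x i. cr (nu x $ i)"
have "AE x in sg. ?a x i * t x = ?a x i * v x" for i
proof (rule L2_sigma_eqI[OF L2_nmult[OF tL] L2_nmult[OF vL]])
 fix a :: "real ^ 'n => complex" assume a: "smooth a"
 have pL: "L2 (vol) a" "L2 sg a" by (rule L2_cont[OF smooth_borel[OF a] smooth_cont[OF a]])+
 have dL: "L2 (vol) (%x. grad a x $ i)" using tf_L2[OF smooth_partial[OF a], of i] by (simp add: grad_def)
 let ?c = "%x j. (LV x. b j x * grad a x $ i) + (LV x. grad (b j) x $ i * a x)"
 have step: "?c x j = (LINT x|sg. b j x * (?a x i * a x))" for j using prod_rule_div[OF C1_smooth[OF b] C1_smooth[OF a], of j i]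
   L2_prod_intbl[OF L2_limD(1)[OF lv] dL] L2_prod_intbl[OF L2_limD(1)[OF L2_lim_vec_nth[OF lg]] pL(1), of j i]
  by (simp add: mult.left_commute)
 let ?b = "%x. (LV x. v x * grad a x $ i) + (LV x. wgrad Y v x $ i * a x)"
 have l1: "(%j. ?c x j) ---->
   ?b x" by (intro tendsto_add L2_lim_prod[OF lv dL] L2_lim_prod[OF L2_lim_vec_nth[OF lg] pL(1)])
 have l2: "(%j. (LINT x|sg. b j x * (?a x i * a x))) ----> (LINT x|sg. t x * (?a x i * a x))"
  by (rule L2_lim_prod[OF lt L2_nmult[OF pL(2)]])
 have "(LINT x|sg. t x * (?a x i * a x)) = ?b x" using LIMSEQ_unique[OF l1] l2 unfolding step by simp
 also have "(LV x. wgrad Y v x $ i * a x) = (LV x. W x $ i * a x)"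
 proof (rule integral_cong_AE)
  show "AE x in vol. wgrad Y v x $ i * a x = W x $ i * a x" using wgrad_C1(2)[OF v] by eventually_elim simp
 qed (use L2_borel[OF wg[of i]] L2_borel[OF pL(1)] Wb[of i] in measurable)
 also have "(LV x. v x * grad a x $ i) + (LV x. W x $ i * a x) = (LINT x|sg. ?a x i * (v x * a x))"
  using prod_rule_div[OF v C1_smooth[OF a], of i]
   C1_prod_intbl[OF v C1_smooth[OF a], of i] C1_prod_intbl[OF C1_smooth[OF a] v, of i] by (simp add: mult.commute)
 finally show "(LINT x|sg. ?a x i * t x * a x) = (LINT x|sg. ?a x i * v x * a x)" by (simp add: algebra_simps)
qed
then have "AE x in sg. ALL i. ?a x i * t x = ?a x i * v x" by (intro AE_finite_allI[of UNIV, simplified]) auto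
then show ?thesis using AE_normal(2)
proof eventually_elim
 case (elim x)
 then have "nu x ~= 0" by auto
 then obtain i where "nu x $ i ~= 0" by (auto simp: Finite_Cartesian_Product.vec_eq_iff)
 then show ?case using spec[OF elim(1), of i] by simp
qed
qed

lemma normal_deriv_C1:
assumes v: "C1 v W" and w: "weak_laplacian_of Y v (wlap Y v)" and m: "normal_deriv_of Y sg v m"
shows "AE x in sg. m x = ndot x (W x)"
proof (rule L2_sigma_eqI)
show mL: "L2 sg m" using m by (simp add: normal_deriv_of_def)
have WL: "L2 sg (%x. W x $ i)" for i by (rule L2_vec_nth[OF L2_cont(2)[OF C1_borel(2)[OF v] C1_cont(2)[OF v]]])
show "L2 sg (%x. ndot x (W x))" unfolding cdot_def complexify_def vec_lambda_beta by (intro L2_sum L2_nmult WL)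
fix a :: "real ^ 'n => complex" assume a: "smooth a"
let ?a = "borel_measurable (vol)"
have pm: "a : ?a" "grad a : ?a" "W : ?a" using C1_borel[OF C1_smooth[OF a]] C1_borel(2)[OF v] by (auto intro: borel_leb)
have wm: "wgrad Y v : ?a" "wlap Y v : ?a"
 using wgrad_C1(1)[OF v] w by (auto simp: weak_grad_of_def weak_laplacian_of_def dest: L2_borel)
let ?b = "%x. cdot (wgrad Y v x) (grad a x) + wlap Y v x * a x"
have "(LINT x|sg. m x * a x) = (LV x. ?b x)" using m a by (simp add: normal_deriv_of_def)
also have "... = (LV x. cdot (grad a x) (W x) + wlap Y v x * a x)"
proof (rule integral_cong_AE)
 show "AE x in vol. ?b x = cdot (grad a x) (W x) + wlap Y v x * a x"
  using wgrad_C1(2)[OF v] by eventually_elim (simp add: cdot_commute)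
qed (use pm wm in measurable)
also have "... = (LINT x|sg. ndot x (W x) * a x)" by (rule green[OF C1_smooth[OF a] wdiv_lapl[OF v w]])
finally show "(LINT x|sg. m x * a x) = (LINT x|sg. ndot x (W x) * a x)" .
qed

end

lemma smooth_line_deriv: fixes f :: "'a::real_normed_vector => real"
assumes "smooth f"
shows "((%s. f (a + s *r u)) has_real_derivative fd f (a + s *r u) u) (at s)"
proof -
have "((%s. a + s *r u) hder (%t. t *r u)) (at s)" by (auto intro!: derivative_eq_intros)
from has_derivative_compose[OF this smooth_deriv[OF assms]]
have "((%s. f (a + s *r u)) hder (%t. fd f (a + s *r u) (t *r u))) (at s)" .
moreover have "(%t. fd f (a + s *r u) (t *r u)) = (*) (fd f (a + s *r u) u)"
 using linear_scale[OF has_derivative_linear[OF smooth_deriv[OF assms]]] by (auto simp: mult.commute)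
ultimately show ?thesis by (simp add: has_field_derivative_def)
qed

lemma mixed_difference: fixes f :: "'a::real_normed_vector => real"
assumes f: "smooth f" and h: "0 < h"
obtains s t where "0 < s" "s < h" "0 < t" "t < h"
 "f (x + h *r u + h *r v) - f (x + h *r u) - f (x + h *r v) + f x
  = h^2 * fd (%y. fd f y u) (x + s *r u + t *r v) v"
proof -
let ?Du = "%y. fd f y u"
let ?a = "x + h *r v"
let ?b = "(f (?a + h *r u) - f (x + h *r u)) - (f ?a - f x)"
let ?c = "%s. x + s *r u"
have "((%s. f (?a + s *r u) - f (?c s)) has_real_derivative ?Du (?a + s *r u) - ?Du (?c s)) (at s)" for s
 by (intro DERIV_diff smooth_line_deriv f)
from MVT2[OF h this] obtain s where s: "0 < s" "s < h"
 "?b = h * (?Du (?a + s *r u) - ?Du (?c s))" by auto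
have "((%t. ?Du (?c s + t *r v)) has_real_derivative fd ?Du (?c s + t *r v) v) (at t)" for t
 by (rule smooth_line_deriv[OF smooth_frechet[OF f]])
from MVT2[OF h this] obtain t where t: "0 < t" "t < h"
 "?Du (?c s + h *r v) - ?Du (?c s) = h * fd ?Du (x + s *r u + t *r v) v" by auto
have "?b = h * (h * fd ?Du (x + s *r u + t *r v) v)" using s(3) t(3) by (simp add: add.commute add.left_commute)
then show thesis using that[OF s(1,2) t(1,2)] by (simp add: power2_eq_square add.commute add.left_commute)
qed

lemma mixed_difference_LIMSEQ: fixes f :: "'a::real_normed_vector => real"
assumes f: "smooth f"
defines "h == (%n. 1 / real (Suc n))"
shows "(%n. (f (x + h n *r u + h n *r v) - f (x + h n *r u) - f (x + h n *r v) + f x) / (h n)^2)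
 ----> fd (%y. fd f y u) x v"
proof -
let ?G = "%z. fd (%y. fd f y u) z v"
have hp: "0 < h n" for n by (simp add: h_def)
have h0: "h ----> 0" unfolding h_def using LIMSEQ_inverse_real_of_nat by (simp add: inverse_eq_divide)
let ?a = "%n. f (x + h n *r u + h n *r v) - f (x + h n *r u) - f (x + h n *r v) + f x"
have "EX s t. 0 < s & s < h n & 0 < t & t < h n & ?a n / (h n)^2 = ?G (x + s *r u + t *r v)" for n
proof -
 obtain s t where "0 < s" "s < h n" "0 < t" "t < h n"
  "?a n = (h n)^2 * ?G (x + s *r u + t *r v)" by (rule mixed_difference[OF f hp])
 then show ?thesis using hp[of n] by (intro exI[of _ s] exI[of _ t]) simp
qed
then obtain s t where st: "!!n. 0 < s n" "!!n. s n < h n" "!!n. 0 < t n" "!!n. t n < h n"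
 "!!n. ?a n / (h n)^2 = ?G (x + s n *r u + t n *r v)" by metis
have s0: "s ----> 0" "t ----> 0"
 by (rule tendsto_sandwich[OF _ _ tendsto_const h0]; use st in "auto intro!: always_eventually less_imp_le")+
let ?b = "%n. x + s n *r u + t n *r v"
have "?b ----> x + 0 *r u + 0 *r v" by (intro tendsto_intros s0)
then have "?b ----> x" by simp
moreover have "isCont ?G x"
 using smooth_cont[OF smooth_frechet[OF smooth_frechet[OF f]], of UNIV] by (simp add: continuous_on_eq_continuous_at)
ultimately have "(%n. ?G (x + s n *r u + t n *r v)) ----> ?G x" by (rule isCont_tendsto_compose[rotated])
then show ?thesis unfolding st(5) .
qed

lemma smooth_second_deriv_sym: fixes f :: "'a::real_normed_vector => real"
assumes f: "smooth f"
shows "fd (%y. fd f y u) x v = fd (%y. fd f y v) x u"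
proof (rule LIMSEQ_unique[OF mixed_difference_LIMSEQ[OF f]])
let ?a = "%n. 1 / real (Suc n)"
show "(%n. (f (x + ?a n *r u + ?a n *r v) - f (x + ?a n *r u) - f (x + ?a n *r v) + f x) / (?a n)^2)
  ----> fd (%y. fd f y v) x u"
 using mixed_difference_LIMSEQ[OF f, of x v u] by (simp only: add.commute add.left_commute diff_diff_eq)
qed

lemma sum_mult_delta_diff: fixes a :: "'n::finite => complex"
shows "(\<Sum>k\<in>UNIV. a k * ((if k = i then x else 0) - (if k = j then y else 0))) = a i * x - a j * y"
proof -
have "(\<Sum>k\<in>UNIV. a k * (if k = i then x else 0)) = a i * x" for i x by (simp add: if_distrib cong: if_cong)
then show ?thesis unfolding right_diff_distrib sum_subtractf by simp
qed

context boundary_domain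
begin

text \<open>The weak divergence of \<open>Z\<^sub>j e\<^sub>i - Z\<^sub>i e\<^sub>j\<close> vanishes because second derivatives of test functions
commute.\<close>

lemma wdiv_rotated_grad:
assumes u: "C1 u Z"
shows "wdiv (%x. \<chi> k. (if k = i then Z x $ j else 0) - (if k = j then Z x $ i else 0)) (%x. 0)" unfolding wdiv_def
proof (intro conjI allI impI)
note [measurable] = C1_borel(2)[OF u]
let ?a = "%i x j. \<chi> k. (if k = i then Z x $ j else 0) - (if k = j then Z x $ i else 0)"
show "(%x. ?a i x j) : BM" by measurable
have "cc (%x. if k = i then Z x $ j else 0)" for k i j by (cases "k = i") (auto intro!: continuous_intros C1_cont(2)[OF u])
then show "cc (%x. ?a i x j)" by (intro continuous_intros)
fix a :: "real ^ 'n => real"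
assume a: "smooth a" "compact (supp a)" "supp a <= Y"
let ?p = "%x. cr (a x)"
note t = tf_of_real[OF a]
have sp: "smooth ?p" using t by (simp add: test_function_def)
have ZL: "L2 (vol) (%x. Z x $ i)" for i by (rule L2_vec_nth[OF L2_cont(1)[OF C1_borel(2)[OF u] C1_cont(2)[OF u]]])
have int: "integrable (vol) (%x. Z x $ i * partial j ?p x)" for i j by (intro L2_prod_intbl ZL tf_L2 smooth_partial sp)
have wk: "(LV x. u x * partial j (partial i ?p) x) = - (LV x. Z x $ j * partial i ?p x)" for i j
 using C1_weak_grad[OF u] tf_partial[OF t] unfolding weak_grad_of_def by blast
have sym: "partial i (partial j ?p) x = partial j (partial i ?p) x" for x
proof -
 have "partial i (partial j ?p) x = cr (partial i (partial j a) x)" for i j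
  unfolding partial_of_real[OF a(1), abs_def] by (rule partial_of_real[OF smooth_partial[OF a(1)]])
 moreover have "partial i (partial j a) x = partial j (partial i a) x"
  unfolding partial_def[abs_def] by (rule smooth_second_deriv_sym[OF a(1)])
 ultimately show ?thesis by simp
qed
have "(\<Sum>k\<in>UNIV. partial k a x *r (?a i x j :: complex ^ 'n) $ k)
  = Z x $ j * partial i ?p x - Z x $ i * partial j ?p x" for x
 unfolding partial_of_real[OF a(1)] scaleR_conv_of_real vec_lambda_beta sum_mult_delta_diff by (simp add: mult.commute)
then have "(LV x. (\<Sum>k\<in>UNIV. partial k a x *r (?a i x j :: complex ^ 'n) $ k))
  = (LV x. Z x $ j * partial i ?p x) - (LV x. Z x $ i * partial j ?p x)" using int by simp
also have "... = 0" using wk[of j i] wk[of i j] sym by simp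
finally show "(LV x. (\<Sum>k\<in>UNIV. partial k a x *r (?a i x j :: complex ^ 'n) $ k))
  = - (LV x. a x *r 0)" by simp
qed simp

lemma tang_int_zero:
assumes u: "C1 u Z"
shows "(LINT x|sg. cr (nu x $ i) * Z x $ j - cr (nu x $ j) * Z x $ i) = 0"
proof -
have one: "C1 (%x. 1) (%x. 0)" by (auto simp: C1_def cdot_def)
have "ndot x (\<chi> k. (if k = i then Z x $ j else 0) - (if k = j then Z x $ i else 0)) = cr (nu x $ i) * Z x $ j - cr (nu x $ j) * Z x $ i" for x
 unfolding cdot_def complexify_def vec_lambda_beta sum_mult_delta_diff ..
then show ?thesis using green[OF one wdiv_rotated_grad[OF u, of i j]] by (simp add: cdot_def)
qed

lemma tang_ibp:
assumes u: "C1 u Z" and v: "C1 v W"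
shows "(LINT x|sg. (cr (nu x $ i) * Z x $ j - cr (nu x $ j) * Z x $ i) * v x)
 = - (LINT x|sg. u x * (cr (nu x $ i) * W x $ j - cr (nu x $ j) * W x $ i))"
proof -
let ?a = "%x i Z. cr (nu x $ i) * Z x $ j - cr (nu x $ j) * Z x $ i"
have L2u: "L2 sg (%x. Z x $ i)" "L2 sg u" if "C1 u Z" for u and Z :: "real ^ 'n => complex ^ 'n" and i
 using L2_vec_nth[OF L2_cont(2)[OF C1_borel(2)[OF that] C1_cont(2)[OF that]]]
  L2_cont(2)[OF C1_borel(1)[OF that] C1_cont(1)[OF that]] .
have T: "L2 sg (%x. ?a x i Z)" if "C1 u Z" for u and Z :: "real ^ 'n => complex ^ 'n" by (intro L2_diff L2_nmult L2u[OF that])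
let ?b = "%x. cr (nu x $ i) * W x $ j - cr (nu x $ j) * W x $ i"
have "0 = (LINT x|sg. ?a x i Z * v x
  + u x * ?b x)" unfolding tang_int_zero[OF C1_mult[OF u v], of i j, symmetric]
 by (rule integral_cong[OF refl]) (simp add: algebra_simps)
also have "... = (LINT x|sg. ?a x i Z * v x)
  + (LINT x|sg. u x * ?b x)" by (intro integral_add L2_prod_intbl T[OF u] T[OF v] L2u(2)[OF u] L2u(2)[OF v])
finally show ?thesis by (simp add: eq_neg_iff_add_eq_0)
qed

lemma tang_grad_nth:
"tangential_grad nu a x $ j = grad a x $ j - ndot x (grad a x) * cr (nu x $ j)" by (simp add: tangential_grad_def complexify_def)

lemma tang_grad_normal:
assumes "norm (nu x) = 1"
shows "ndot x (tangential_grad nu a x) = 0"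
proof -
let ?a = "\<Sum>i\<in>UNIV. cr (nu x $ i) * cr (nu x $ i)"
have "inner (nu x) (nu x) = 1" using assms by (simp add: dot_square_norm)
then have nn: "?a = 1" by (simp add: inner_vec_def flip: of_real_mult of_real_sum)
have "ndot x (tangential_grad nu a x) = ndot x (grad a x) - ndot x (grad a x) * ?a"
 unfolding sum_distrib_left cdot_def[of _ "tangential_grad nu a x"] cdot_def[of _ "grad a x"] tang_grad_nth sum_subtractf[symmetric]
 by (rule sum.cong[OF refl]) (simp add: complexify_def cdot_def algebra_simps)
then show ?thesis by (simp add: nn)
qed

lemma surface_grad_C1:
assumes v: "C1 v W" and t: "AE x in sg. t x = v x" and q: "surface_grad_of sg nu t q"
shows "AE x in sg. q x = W x - ndot x (W x) *s cplx (nu x)"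
proof -
obtain b where b: "!!j::nat. smooth (b j)" and lt: "L2_lim sg b t" and lq: "L2_lim sg (%j. tangential_grad nu (b j)) q"
 using q unfolding surface_grad_of_def by blast
have qL: "L2 sg (%x. q x $ i)" for i by (rule L2_vec_nth[OF L2_limD(2)[OF lq]])
have WL: "L2 sg (%x. W x $ i)" for i by (rule L2_vec_nth[OF L2_cont(2)[OF C1_borel(2)[OF v] C1_cont(2)[OF v]]])
have vL: "L2 sg v" by (rule L2_cont(2)[OF C1_borel(1)[OF v] C1_cont(1)[OF v]])
have smL: "L2 sg a" if "smooth a" for a :: "real ^ 'n => complex" by (rule L2_cont(2)[OF smooth_borel[OF that] smooth_cont[OF that]])
let ?b = "%x i. cr (nu x $ i)"
have grL: "L2 sg (%x. grad a x $ i)" if "smooth a" for a :: "real ^ 'n => complex" and i using smL[OF smooth_partial[OF that]] by (simp add: grad_def)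
let ?T = "%Z x i j. ?b x i * Z x $ j - cr (nu x $ j) * Z x $ i"
have TL: "L2 sg (%x. ?T Z x i j)" if "!!i. L2 sg (%x. Z x $ i)" for Z :: "real ^ 'n => complex ^ 'n" and i j
 by (intro L2_diff L2_nmult that)
let ?c = "%n x. tangential_grad nu (b n) x"
have Tq: "AE x in sg. ?T q x i j = ?T W x i j" for i j
proof (rule L2_sigma_eqI[OF TL[OF qL] TL[OF WL]])
 fix a :: "real ^ 'n => complex" assume a: "smooth a"
 let ?h = "%x. cr (nu x $ j) * a x"
 note pL = smL[OF a]
 let ?a = "%n. (LINT x|sg. ?c n x $ j * (?b x i * a x)) - (LINT x|sg. ?c n x $ i * ?h x)"
 let ?d = "%x. ?T (grad a) x i j"
 let ?j = "%n. - (LINT x|sg. b n x * ?d x)"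
 have step: "?a n
   = ?j n" for n
 proof -
  have "?a n
    = (LINT x|sg. ?c n x $ j * (?b x i * a x) - ?c n x $ i * ?h x)"
   by (intro integral_diff[symmetric] L2_prod_intbl L2_limD(1)[OF L2_lim_vec_nth[OF lq]] L2_nmult pL)
  also have "... = (LINT x|sg. ?T (grad (b n)) x i j * a x)"
   by (rule integral_cong[OF refl]) (simp add: tang_grad_nth algebra_simps)
  also have "... = ?j n" by (rule tang_ibp[OF C1_smooth[OF b] C1_smooth[OF a]])
  finally show ?thesis .
 qed
 let ?e = "(LINT x|sg. q x $ j * (?b x i * a x)) - (LINT x|sg. q x $ i * ?h x)"
 have l1: "(%n. ?a n)
   ----> ?e" by (intro tendsto_diff L2_lim_prod L2_lim_vec_nth[OF lq] L2_nmult pL)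
 let ?i = "LINT x|sg. t x * ?d x"
 have l2: "(%n. ?j n) ----> - ?i" by (intro tendsto_minus L2_lim_prod[OF lt] TL grL a)
 have "(LINT x|sg. ?T q x i j * a x) = (LINT x|sg. q x $ j * (?b x i * a x) - q x $ i * ?h x)"
  by (rule integral_cong[OF refl]) (simp add: algebra_simps)
 also have "... = ?e" by (intro integral_diff L2_prod_intbl qL L2_nmult pL)
 also have "... = - ?i" using LIMSEQ_unique[OF l1] l2 unfolding step by blast
 also have "?i = (LINT x|sg. v x * ?d x)"
 proof (rule integral_cong_AE)
  show "AE x in sg. t x * ?d x = v x * ?d x" using t by eventually_elim simp
 qed (use L2_borel[OF L2_limD(2)[OF lt]] L2_borel[OF vL] L2_borel[OF TL[OF grL[OF a], of i j]] in measurable)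
 also have "- ... = (LINT x|sg. ?T W x i j * a x)" by (rule tang_ibp[OF v C1_smooth[OF a], symmetric])
 finally show "(LINT x|sg. ?T q x i j * a x) = (LINT x|sg. ?T W x i j * a x)" .
qed
have nq: "AE x in sg. ndot x (q x) = 0"
proof (rule L2_sigma_eqI)
 show "L2 sg (%x. ndot x (q x))" unfolding cdot_def complexify_def vec_lambda_beta by (intro L2_sum L2_nmult qL)
 show "L2 sg (%x. 0 :: complex)" by (rule L2_zero)
 fix a :: "real ^ 'n => complex" assume a: "smooth a"
 have split: "(LINT x|sg. ndot x (Z x) * a x) = (\<Sum>i\<in>UNIV. (LINT x|sg. Z x $ i * (?b x i * a x)))"
  if "!!i. L2 sg (%x. Z x $ i)" for Z :: "real ^ 'n => complex ^ 'n"
  unfolding cdot_def sum_distrib_right complexify_def vec_lambda_beta by (subst integral_sum[symmetric])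
    (auto intro!: L2_prod_intbl[OF that L2_nmult[OF smL[OF a]]] integral_cong sum.cong)
 let ?f = "(\<Sum>i\<in>UNIV. (LINT x|sg. q x $ i * (?b x i * a x)))"
 let ?g = "%n. \<Sum>i\<in>UNIV. (LINT x|sg. ?c n x $ i * (?b x i * a x))"
 have "(%n. ?g n) ----> ?f" by (intro tendsto_sum L2_lim_prod L2_lim_vec_nth[OF lq] L2_nmult smL a)
 moreover have "?g n = 0" for n
 proof -
  have "AE x in sg. ndot x (?c n x) * a x = 0" using AE_normal(2) by eventually_elim (simp add: tang_grad_normal)
  then show ?thesis unfolding split[OF L2_limD(1)[OF L2_lim_vec_nth[OF lq]], symmetric] by (rule integral_eq_zero_AE)
 qed
 ultimately have "(%n. 0) ----> ?f" by simp
 then show "(LINT x|sg. ndot x (q x) * a x) = (LINT x|sg. 0 * a x)" unfolding split[OF qL] by (simp add: LIMSEQ_const_iff)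
qed
have "AE x in sg. ALL i j. ?T q x i j = ?T W x i j" using Tq by (intro AE_finite_allI[of UNIV, simplified]) auto
then show ?thesis using nq AE_normal(2)
proof eventually_elim
 case (elim x)
 have "inner (nu x) (nu x) = 1" using elim(3) by (simp add: dot_square_norm)
 then have nn: "(\<Sum>i\<in>UNIV. ?b x i * ?b x i) = 1" by (simp add: inner_vec_def flip: of_real_mult of_real_sum)
 have recover: "(\<Sum>i\<in>UNIV. ?b x i * ?T Z x i j) = Z x $ j - ndot x (Z x) * cr (nu x $ j)" for Z :: "real ^ 'n => complex ^ 'n" and j
 proof -
  have "(\<Sum>i\<in>UNIV. ?b x i * ?T Z x i j) = (\<Sum>i\<in>UNIV. ?b x i * ?b x i) * Z x $ j - ndot x (Z x) * cr (nu x $ j)"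
   unfolding cdot_def complexify_def vec_lambda_beta sum_distrib_right sum_subtractf[symmetric] by (rule sum.cong[OF refl]) (simp add: algebra_simps)
  then show ?thesis by (simp add: nn)
 qed
 have "q x $ j = W x $ j - ndot x (W x) * cr (nu x $ j)" for j
 proof -
  have "(\<Sum>i\<in>UNIV. ?b x i * ?T q x i j) = (\<Sum>i\<in>UNIV. ?b x i * ?T W x i j)" using elim(1) by (intro sum.cong) auto
  then show ?thesis unfolding recover elim(2) by simp
 qed
 then show ?case by (simp add: Finite_Cartesian_Product.vec_eq_iff complexify_def)
qed
qed

end

lemma norm_cplx: "norm (cplx x) = norm x" by (simp add: complexify_def norm_vec_def)

lemma norm_cdot_le: "norm (cdot a b) <= norm a * norm b"
proof -
have "norm (cdot a b) <= (\<Sum>i\<in>UNIV. abs (norm (a $ i)) * abs (norm (b $ i)))"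
 unfolding cdot_def by (rule order_trans[OF norm_sum]) (simp add: norm_mult)
also have "... <= norm a * norm b" unfolding norm_vec_def by (rule L2_set_mult_ineq)
finally show ?thesis .
qed

lemma cdot_scaleR: "cdot (c *r a) b = c *r cdot a b" "cdot a (c *r b) = c *r cdot a b"
unfolding cdot_def scaleR_sum_right by simp_all

lemma cdot_cont[continuous_intros]:
"cont S f ==> cont S g ==> cont S (%x. cdot (f x) (g x))" unfolding cdot_def by (intro continuous_intros)

lemma cdot_tendsto[tendsto_intros]:
"(f ---> a) F ==> (g ---> b) F ==> ((%x. cdot (f x) (g x)) ---> cdot a b) F" unfolding cdot_def by (intro tendsto_intros)

lemma cplx_tendsto[tendsto_intros]: "(f ---> a) F ==> ((%x. cplx (f x)) ---> cplx a) F"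
unfolding complexify_def by (intro tendsto_intros)

definition conjv :: "complex ^ 'n::finite => complex ^ 'n" where
"conjv a = (\<chi> i. cnj (a $ i))"

lemma cdot_conjv: "cdot a (conjv b) = hdot a b" by (simp add: cdot_def hdot_def conjv_def)

lemma hdot_self: "hdot a a = cr (nsq a)"
proof -
have "nsq a = (\<Sum>i\<in>UNIV. nsq (a $ i))" by (simp add: norm_vec_def L2_set_def sum_nonneg)
moreover have "a $ i * cnj (a $ i) = cr (nsq (a $ i))" for i by (simp only: complex_norm_square)
ultimately show ?thesis by (simp add: hdot_def)
qed

lemma hdot_diff_left: "hdot (a - b) c = hdot a c - hdot b c" and hdot_diff_right: "hdot c (a - b) = hdot c a - hdot c b"
by (simp_all add: hdot_def sum_subtractf algebra_simps)

lemma cnj_hdot: "cnj (hdot a b) = hdot b a" by (simp add: hdot_def mult.commute)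

lemma norm_diff_square_hdot: "nsq a - nsq b = nsq (a - b) + 2 * Re (hdot b (a - b))"
proof -
have "Re (hdot a b) = Re (hdot b a)" by (metis cnj.simps(1) cnj_hdot)
moreover have "Re (hdot (a - b) (a - b)) = nsq (a - b)" "Re (hdot a a) = nsq a" "Re (hdot b b) = nsq b"
 by (simp_all only: hdot_self Re_complex_of_real)
ultimately show ?thesis by (simp add: hdot_diff_left hdot_diff_right)
qed

lemma cnj_borel[measurable]: "f : borel_measurable M ==> (%x. cnj (f x)) : borel_measurable M"
by (rule measurable_compose[OF _ bmc_onI]) (auto intro!: continuous_intros)

lemma conjv_borel[measurable]: "f : borel_measurable M ==> (%x. conjv (f x)) : borel_measurable M"
unfolding conjv_def by measurable

lemma conjv_cont[continuous_intros]: "cont S f ==> cont S (%x. conjv (f x))" unfolding conjv_def by (intro continuous_intros)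

context boundary_domain
begin

lemma C1_cnj:
assumes v: "C1 v W" shows "C1 (%x. cnj (v x)) (%x. conjv (W x))"
proof -
note [measurable] = C1_borel[OF v]
have "((%x. cnj (v x)) hder (%h. cdot (conjv (W x)) (cplx h))) (at x)" if "x : Y" for x
proof -
 have "((%x. cnj (v x)) hder (%h. cnj (cdot (W x) (cplx h)))) (at x)"
  using v that by (intro has_derivative_cnj) (simp add: C1_def)
 then show ?thesis by (simp add: cdot_def conjv_def complexify_def)
qed
then show ?thesis unfolding C1_def by (intro conjI ballI continuous_intros C1_cont[OF v]; measurable)
qed

lemma C1_diff:
assumes u: "C1 u Z" and v: "C1 v W" shows "C1 (%x. u x - v x) (%x. Z x - W x)"
proof -
note [measurable] = C1_borel[OF u] C1_borel[OF v]
have "((%x. u x - v x) hder (%h. cdot (Z x - W x) (cplx h))) (at x)" if "x : Y" for x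
proof -
 have "((%x. u x - v x) hder (%h. cdot (Z x) (cplx h) - cdot (W x) (cplx h))) (at x)"
  using u v that by (intro has_derivative_diff) (simp_all add: C1_def)
 then show ?thesis by (simp add: cdot_def sum_subtractf left_diff_distrib)
qed
then show ?thesis unfolding C1_def by (intro conjI ballI continuous_intros C1_cont[OF u] C1_cont[OF v]; measurable)
qed

lemma scale_cl: "x : closure Y ==> 0 <= c ==> c <= 1 ==> c *r x : closure Y"
using mult_le_one[of c "rho x"] rho_nonneg[of x] by (simp add: closure_eq rho_scale)

lemma scale_cl_less: "x : closure Y ==> 0 <= c ==> c < 1 ==> c *r x : Y"
proof -
assume a: "x : closure Y" "0 <= c" "c < 1"
then have "c * rho x <= c * 1" by (intro mult_left_mono) (simp_all add: closure_eq)
then show ?thesis using a by (simp add: mem_domain rho_scale)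
qed

lemma C1_dilate:
assumes v: "C1 v W" and c: "0 < c" "c <= 1"
shows "C1 (%x. v (c *r x)) (%x. c *r W (c *r x))"
proof -
note [measurable] = C1_borel[OF v]
have sub: "(%x. c *r x) ` closure Y <= closure Y" using scale_cl c by auto
have "((%x. v (c *r x)) hder (%h. cdot (c *r W (c *r x)) (cplx h))) (at x)" if x: "x : Y" for x
proof -
 have "c *r x : Y"
 proof (cases "c = 1")
  case False
  then show ?thesis using scale_cl_less[of x c] x c closure_subset[of Y] by auto
 qed (simp add: x)
 then have "(v hder (%h. cdot (W (c *r x)) (cplx h))) (at (c *r x))" using v by (simp add: C1_def)
 moreover have "((%x. c *r x) hder (%h. c *r h)) (at x)" by (auto intro!: derivative_eq_intros)
 ultimately have "((%x. v (c *r x)) hder (%h. cdot (W (c *r x)) (cplx (c *r h)))) (at x)"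
  by (rule has_derivative_compose[rotated])
 then show ?thesis by (simp add: cdot_scaleR cdot_commute[of _ "cplx _"] cdot_cplx_scaleR)
qed
then show ?thesis unfolding C1_def
 by (intro conjI ballI continuous_intros continuous_on_compose2[OF C1_cont(1)[OF v] _ sub] continuous_on_compose2[OF C1_cont(2)[OF v] _ sub]; measurable)
qed

lemma wdiv_dilate:
assumes F: "wdiv W w" and wm[measurable]: "w : BM" and c: "0 < c" "c <= 1"
shows "wdiv (%x. c *r W (c *r x)) (%x. c^2 *r w (c *r x))" unfolding wdiv_def
proof (intro conjI allI impI)
have Wm[measurable]: "W : BM" and Wc: "cc W" using F by (simp_all add: wdiv_def)
have sub: "(%x. c *r x) ` closure Y <= closure Y" using scale_cl c by auto
show "(%x. c *r W (c *r x)) : BM" by measurable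
show "cc (%x. c *r W (c *r x))" by (intro continuous_intros continuous_on_compose2[OF Wc _ sub])
have wi: "ilb (%x. ind Y x *r w x)" using F leb_borel(2)[OF wm dom_borel] by (simp add: wdiv_def set_integrable_def)
have "ilb (%x. ind Y (0 + c *r x) *r w (0 + c *r x))" using lb_intbl_affine[of "%x. ind Y x *r w x" c 0] wi c by simp
then have "set_integrable lborel Y (%x. c^2 *r w (c *r x))" unfolding set_integrable_def
proof (rule integrable_bound[OF integrable_scaleR_right])
 show "AEL x. norm (ind Y x *r c\<^sup>2 *r w (c *r x)) <= norm (c^2 *r (ind Y (0 + c *r x) *r w (0 + c *r x)))"
  using scale_in_dom[of _ c] c by (intro AE_I2) (auto simp: indicator_def)
qed measurable
then show "integrable (vol) (%x. c^2 *r w (c *r x))" by (subst leb_borel(2)) simp_all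
fix a :: "real ^ 'n => real"
assume a: "smooth a" "compact (supp a)" "supp a <= Y"
define b where "b y = a ((1 / c) *r y)" for y
have bl: "bounded_linear (%y :: real ^ 'n. (1 / c) *r y)" by (rule bounded_linear_scaleR_right)
have bs: "smooth b" using smooth_affine[OF bl a(1), of 0] by (simp add: b_def[abs_def])
have supp: "{y. b y ~= 0} = (%x. c *r x) ` {x. a x ~= 0}"
proof (rule Set.set_eqI, rule HOL.iffI)
 fix y assume "y : {y. b y ~= 0}"
 then show "y : (%x. c *r x) ` {x. a x ~= 0}" using c by (intro image_eqI[of _ _ "(1 / c) *r y"]) (auto simp: b_def)
qed (use c in "auto simp: b_def")
have clo: "closure {y. b y ~= 0} = (%x. c *r x) ` supp a" unfolding supp by (rule closure_scaleR[symmetric])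
have bc: "compact (closure {y. b y ~= 0})" unfolding clo by (rule compact_scaling[OF a(2)])
have bin: "closure {y. b y ~= 0} <= Y" unfolding clo using a(3) scale_in_dom c by auto
have bfd: "partial i b (c *r x) = (1 / c) * partial i a x" for i x
proof -
 have "(b hder (%h. fd a ((1 / c) *r (c *r x)) ((1 / c) *r h))) (at (c *r x))" unfolding b_def[abs_def]
  by (rule has_derivative_compose[OF bounded_linear_imp_has_derivative[OF bl] smooth_deriv[OF a(1)]])
 from frechet_derivative_at[OF this] show ?thesis
  using linear_scale[OF has_derivative_linear[OF smooth_deriv[OF a(1)]]] c by (simp add: partial_def fun_eq_iff)
qed
have pm[measurable]: "a : BM" "b : BM" "partial i a : BM" "partial i b : BM" for i
 using a(1) bs by (auto intro: smooth_borel smooth_partial)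
let ?d = "CARD('n)"
have whole: "(LV x. f x) = (LB x. f x)"
 if "f : BM" "!!x. x ~: Y ==> f x = 0" for f :: "real ^ 'n => complex" unfolding leb_borel(1)[OF that(1) dom_borel] set_lint_def
 by (rule integral_cong[OF refl]) (use that(2) in "auto simp: indicator_def")
have out: "a x = 0" "partial i a x = 0" "b x = 0" "partial i b x = 0" if "x ~: Y" for x i
proof -
 have 1: "x ~: supp a" "x ~: supp b" using that a(3) bin by blast+
 show "partial i a x = 0" by (rule partial_off_supp[OF 1(1)])
 show "partial i b x = 0" by (rule partial_off_supp[OF 1(2)])
 show "a x = 0" "b x = 0" using 1 closure_subset[of "{x. a x ~= 0}"] closure_subset[of "{x. b x ~= 0}"] by blast+
qed
have "(LV x. (\<Sum>i\<in>UNIV. partial i b x *r W x $ i)) = - (LV x. b x *r w x)" using F bs bc bin unfolding wdiv_def by blast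
then have "(LB x. (\<Sum>i\<in>UNIV. partial i b x *r W x $ i)) = - (LB x. b x *r w x)"
 by (subst (asm) (1 2) whole) (simp_all add: out)
moreover have "(LB x. (\<Sum>i\<in>UNIV. partial i b x *r W x $ i)) = c ^ ?d *r (LB x. (1 / c) *r (\<Sum>i\<in>UNIV. partial i a x *r W (c *r x) $ i))"
 using lb_int_affine[of "%x. \<Sum>i\<in>UNIV. partial i b x *r W x $ i" c 0] c by (simp add: bfd scaleR_sum_right)
moreover have "(LB x. b x *r w x) = c ^ ?d *r (LB x. a x *r w (c *r x))"
 using lb_int_affine[of "%x. b x *r w x" c 0] c by (simp add: b_def)
ultimately have "c ^ ?d *r ((1 / c) *r (LB x. (\<Sum>i\<in>UNIV. partial i a x *r W (c *r x) $ i))) = c ^ ?d *r (- (LB x. a x *r w (c *r x)))"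
 by simp
then have "(1 / c) *r (LB x. (\<Sum>i\<in>UNIV. partial i a x *r W (c *r x) $ i)) = - (LB x. a x *r w (c *r x))"
 using c by (simp only: scaleR_cancel_left) simp
then have "c^2 *r ((1 / c) *r (LB x. (\<Sum>i\<in>UNIV. partial i a x *r W (c *r x) $ i))) = c^2 *r (- (LB x. a x *r w (c *r x)))"
 by (rule arg_cong)
then have key: "c *r (LB x. (\<Sum>i\<in>UNIV. partial i a x *r W (c *r x) $ i)) = - (c^2 *r (LB x. a x *r w (c *r x)))"
 using c by (simp add: power2_eq_square)
have "(LV x. (\<Sum>i\<in>UNIV. partial i a x *r (c *r W (c *r x)) $ i)) = (LB x. (\<Sum>i\<in>UNIV. partial i a x *r (c *r W (c *r x)) $ i))"
 by (rule whole) (simp_all add: out)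
also have "... = (LB x. c *r (\<Sum>i\<in>UNIV. partial i a x *r W (c *r x) $ i))"
 by (rule integral_cong[OF refl]) (simp add: scaleR_sum_right mult.commute)
also have "... = - (LB x. a x *r c\<^sup>2 *r w (c *r x))"
 unfolding scaleR_left_commute[of "a _" "c^2"] integral_scaleR_right by (rule key)
also have "(LB x. a x *r c\<^sup>2 *r w (c *r x)) = (LV x. a x *r c\<^sup>2 *r w (c *r x))"
 by (rule whole[symmetric]) (simp_all add: out)
finally show "(LV x. (\<Sum>i\<in>UNIV. partial i a x *r (c *r W (c *r x)) $ i)) = - (LV x. a x *r c\<^sup>2 *r w (c *r x))" .
qed

end

context boundary_domain
begin

lemma radial_mean_value: fixes p :: "complex => real"
assumes v: "C1 v W" and p: "bounded_linear p" and x: "x : closure Y" and c: "0 < c" "c < 1"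
shows "EX s. c < s & s < 1 & p (v x - v (c *r x)) = (1 - c) * p (xdot x (W (s *r x)))"
proof -
let ?a = "%s. xdot x (W (s *r x))"
obtain s where "c < s" "s < 1" "p (v (1 *r x)) - p (v (c *r x)) = p ((1 - c) *r ?a s)"
proof (rule mvt[OF c(2), where f = "%s. p (v (s *r x))" and f' = "%s t. p (t *r ?a s)"])
 have "(%s. s *r x) ` {c..1} <= closure Y" using scale_cl[OF x] c by auto
 then show "cont {c..1} (%s. p (v (s *r x)))"
  by (intro bounded_linear.continuous_on[OF p] continuous_on_compose2[OF C1_cont(1)[OF v]] continuous_intros)
 fix s assume s: "c < s" "s < 1"
 then have sx: "s *r x : Y" using scale_cl_less[OF x, of s] c by simp
 have d: "(v hder (%h. cdot (W (s *r x)) (cplx h))) (at (s *r x))" using v sx by (simp add: C1_def)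
 have "((%s. s *r x) hder (%t. t *r x)) (at s)" by (auto intro!: derivative_eq_intros)
 from has_derivative_compose[OF this d]
 have "((%s. v (s *r x)) hder (%t. t *r ?a s)) (at s)" by (simp only: cdot_commute[of "W (s *r x)"] cdot_cplx_scaleR)
 from bounded_linear.has_derivative[OF p this]
 show "((%s. p (v (s *r x))) hder (%t. p (t *r ?a s))) (at s)" .
qed auto
then show ?thesis
 by (intro exI[of _ s]) (simp add: linear_diff[OF bounded_linear.linear[OF p]] linear_scale[OF bounded_linear.linear[OF p]])
qed

definition rquot :: "(real ^ 'n => complex) => real => real ^ 'n => complex" where
"rquot v c x = (1 / (1 - c)) *r (v x - v (c *r x))"

lemma rquot_values:
assumes v: "C1 v W" and x: "x : closure Y" and c: "0 < c" "c < 1"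
obtains s t where "c < s" "s < 1" "c < t" "t < 1"
 "rquot v c x = Complex (Re (xdot x (W (s *r x)))) (Im (xdot x (W (t *r x))))"
proof -
obtain s t where st: "c < s" "s < 1" "Re (v x - v (c *r x)) = (1 - c) * Re (xdot x (W (s *r x)))"
 "c < t" "t < 1" "Im (v x - v (c *r x)) = (1 - c) * Im (xdot x (W (t *r x)))"
 using radial_mean_value[OF v bounded_linear_Re x c] radial_mean_value[OF v bounded_linear_Im x c] by metis
have "rquot v c x = Complex (Re (xdot x (W (s *r x)))) (Im (xdot x (W (t *r x))))"
 using st(3,6) c by (simp add: rquot_def complex_eq_iff)
with st show thesis using that by blast
qed

lemma rquot_bdd:
assumes v: "C1 v W"
obtains K where "0 <= K" "!!x c. x : closure Y ==> 0 < c ==> c < 1 ==> norm (rquot v c x) <= K"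
proof -
obtain M where M: "0 <= M" "!!x. x : closure Y ==> norm (W x) <= M" using cont_cl_bdd[OF C1_cont(2)[OF v]] by metis
obtain R where R: "0 <= R" "!!x. x : closure Y ==> norm x <= R" using cont_cl_bdd[OF continuous_on_id] by metis
show thesis
proof (rule that[of "2 * (R * M)"])
 show "0 <= 2 * (R * M)" using M R by simp
 fix x and c :: real assume x: "x : closure Y" and c: "0 < c" "c < 1"
 let ?a = "%s. xdot x (W (s *r x))"
 have b: "norm (?a s) <= R * M" if "c < s" "s < 1" for s
 proof -
  have "norm (?a s) <= norm x * norm (W (s *r x))" using norm_cdot_le[of "cplx x" "W (s *r x)"] by (simp add: norm_cplx)
  also have "... <= R * M" using R(2)[OF x] M(2)[OF scale_cl[OF x, of s]] R(1) that c by (intro mult_mono) auto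
  finally show ?thesis .
 qed
 obtain s t where st: "c < s" "s < 1" "c < t" "t < 1"
  "rquot v c x = Complex (Re (?a s)) (Im (xdot x (W (t *r x))))" by (rule rquot_values[OF v x c])
 have "norm (rquot v c x) <= abs (Re (?a s)) + abs (Im (xdot x (W (t *r x))))"
  unfolding st(5) using cmod_le[of "Complex (Re (?a s)) (Im (xdot x (W (t *r x))))"] by simp
 also have "... <= R * M + R * M"
  using order_trans[OF abs_Re_le_cmod b[OF st(1,2)]] order_trans[OF abs_Im_le_cmod b[OF st(3,4)]] by linarith
 finally show "norm (rquot v c x) <= 2 * (R * M)" unfolding mult_2 .
qed
qed

lemma rquot_tendsto:
assumes v: "C1 v W" and x: "x : closure Y" and X: "X ----> x" "\<forall>\<^sub>F n in sequentially. X n : closure Y"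
 and c: "!!n. 0 < c n" "!!n. c n < 1" "c ----> 1"
shows "(%n. rquot v (c n) (X n)) ----> xdot x (W x)"
proof -
let ?a = "%n s t. Complex (Re (cdot (cplx (X n)) (W (s n *r X n)))) (Im (cdot (cplx (X n)) (W (t n *r X n))))"
have "EX s t. c n < s & s < 1 & c n < t & t < 1 & (X n : closure Y --> rquot v (c n) (X n) =
  Complex (Re (cdot (cplx (X n)) (W (s *r X n)))) (Im (cdot (cplx (X n)) (W (t *r X n)))))" for n
proof (cases "X n : closure Y")
 case True
 from rquot_values[OF v True c(1,2)] show ?thesis by metis
next
 case False
 then show ?thesis using dense[OF c(2)[of n]] by blast
qed
then obtain s t where st: "!!n. c n < s n" "!!n. s n < 1" "!!n. c n < t n" "!!n. t n < 1"
 and eq: "!!n. X n : closure Y ==> rquot v (c n) (X n) = ?a n s t" by metis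
have lim: "(%n. cdot (cplx (X n)) (W (s n *r X n))) ----> xdot x (W x)"
 if s: "!!n. c n < s n" "!!n. s n < 1" for s
proof -
 have "s ----> 1" by (rule tendsto_sandwich[OF _ _ c(3) tendsto_const]) (use s in "auto intro!: always_eventually less_imp_le")
 then have "(%n. s n *r X n) ----> 1 *r x" by (intro tendsto_intros X(1))
 then have "(%n. s n *r X n) ----> x" by simp
 moreover have "\<forall>\<^sub>F n in sequentially. s n *r X n : closure Y" using X(2)
 proof eventually_elim
  case (elim n)
  show ?case using scale_cl[OF elim, of "s n"] s[of n] c(1)[of n] by simp
 qed
 ultimately have "(%n. W (s n *r X n)) ----> W x" by (rule continuous_on_tendsto_compose[OF C1_cont(2)[OF v] _ x])
 then show ?thesis by (intro tendsto_intros X(1))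
qed
have "(%n. ?a n s t)
  ----> Complex (Re (xdot x (W x))) (Im (xdot x (W x)))" by (intro tendsto_Complex tendsto_Re tendsto_Im lim st)
then have "(%n. ?a n s t)
  ----> xdot x (W x)" by simp
then show ?thesis by (rule Lim_transform_eventually) (use X(2) in eventually_elim, simp add: eq)
qed

definition dil :: "nat => real" where "dil n = 1 - 1 / real (Suc (Suc n))"

lemma dil: "0 < dil n" "dil n < 1" "dil ----> 1"
proof -
show "0 < dil n" "dil n < 1" by (simp_all add: dil_def field_simps)
have "(%n. 1 / real (Suc n)) ----> 0" using LIMSEQ_inverse_real_of_nat by (simp add: inverse_eq_divide)
then have "(%n. 1 / real (Suc (Suc n))) ----> 0" by (rule LIMSEQ_Suc)
from tendsto_diff[OF tendsto_const[of 1] this] show "dil ----> 1" by (simp add: dil_def[abs_def] del: of_nat_Suc)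
qed

lemma bdry_quotient_limit:
assumes v: "C1 v W"
shows "(%n. (LINT x|sg. ndot x (dil n *r W (dil n *r x)) * cnj (rquot v (dil n) x)))
 ----> (LINT x|sg. ndot x (W x) * cnj (xdot x (W x)))"
proof -
note [measurable] = C1_borel[OF v]
interpret finite_measure sg by (rule finite_sigma)
obtain M where M: "0 <= M" "!!x. x : closure Y ==> norm (W x) <= M" using cont_cl_bdd[OF C1_cont(2)[OF v]] by metis
obtain K where K: "0 <= K" "!!x c. x : closure Y ==> 0 < c ==> c < 1 ==> norm (rquot v c x) <= K" using rquot_bdd[OF v] by metis
show ?thesis
proof (rule integral_dominated_convergence[where w = "%x. M * K"])
 let ?a = "%x n. ndot x (dil n *r W (dil n *r x))"
 let ?b = "%x n. ?a x n * cnj (rquot v (dil n) x)"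
 show "AE x in sg. (%n. ?b x n)
   ----> ndot x (W x) * cnj (xdot x (W x))" using AE_normal(1)
 proof eventually_elim
  case (elim x)
  then have x: "x : closure Y" by (simp add: closure_eq)
  have "(%n. dil n *r x) ----> 1 *r x" by (intro tendsto_intros dil(3))
  moreover have "\<forall>\<^sub>F n in sequentially. dil n *r x : closure Y"
   using scale_cl[OF x] dil(1,2) by (intro always_eventually) (simp add: less_imp_le)
  ultimately have "(%n. W (dil n *r x)) ----> W x"
   using continuous_on_tendsto_compose[OF C1_cont(2)[OF v] _ x, of "%n. dil n *r x"] by simp
  then have "(%n. ?b x n)
   ----> ndot x (1 *r W x) * cnj (xdot x (W x))"
   by (intro tendsto_intros tendsto_cnj dil(3) rquot_tendsto[OF v x _ _ dil] always_eventually allI x)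
  then show ?case by simp
 qed
 show "AE x in sg. norm (?b x n) <= M * K" for n using AE_normal(1,2)
 proof eventually_elim
  case (elim x)
  then have x: "x : closure Y" by (simp add: closure_eq)
  have "norm (?a x n) <= 1 * (dil n * norm (W (dil n *r x)))"
   using norm_cdot_le[of "cplx (nu x)" "dil n *r W (dil n *r x)"] dil(1)[of n] by (simp add: norm_cplx elim(2))
  also have "... <= 1 * (1 * M)" using M(2)[OF scale_cl[OF x, of "dil n"]] M(1) dil(1,2)[of n] by (intro mult_mono) auto
  finally have "norm (?a x n) <= M" by simp
  then show ?case using K(2)[OF x dil(1,2), of n] M(1) K(1) unfolding norm_mult by (intro mult_mono) auto
 qed
qed (simp_all add: rquot_def)
qed

lemma interior_quotient_limit:
assumes v: "C1 v W" and wm[measurable]: "w : BM" and wi: "integrable (vol) w"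
shows "(%n. (LV x. ((dil n)^2 *r w (dil n *r x)) * cnj (rquot v (dil n) x)))
 ----> (LV x. w x * cnj (xdot x (W x)))"
proof -
note [measurable] = C1_borel[OF v]
let ?d = "CARD('n)"
obtain K where K: "0 <= K" "!!x c. x : closure Y ==> 0 < c ==> c < 1 ==> norm (rquot v c x) <= K" using rquot_bdd[OF v] by metis
let ?e = "%n. 1 / dil n"
have wi': "ilb (%x. ind Y x *r w x)" using wi leb_borel(2)[OF wm dom_borel] by (simp add: set_integrable_def)
let ?c = "%n y. ((dil n)^2 *r w y) * cnj (rquot v (dil n) (?e n *r y))"
define g where "g n y = ind Y (?e n *r y) *r ?c n y" for n y
have gm[measurable]: "g n : BM" for n unfolding g_def[abs_def] rquot_def by measurable
have d0: "dil n ~= 0" for n using dil(1)[of n] by simp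
let ?a = "%n x. ((dil n)^2 *r w (dil n *r x)) * cnj (rquot v (dil n) x)"
have eq: "(LV x. ?a n x) = (1 / dil n ^ ?d) *r (LB y. g n y)" for n
proof -
 have "(LV x. ?a n x) = (LB x. g n (0 + dil n *r x))"
 proof -
  have "(LV x. ?a n x) = (LINT x:Y|lborel. ?a n x)" by (rule leb_borel(1)) (unfold rquot_def, measurable)
  moreover have "g n (0 + dil n *r x) = ind Y x *r ?a n x" for x using d0[of n] by (simp add: g_def)
  ultimately show ?thesis unfolding set_lint_def by simp
 qed
 moreover have "(LB y. g n y) = dil n ^ ?d *r (LB x. g n (0 + dil n *r x))"
  using lb_int_affine[OF gm d0, of n n 0] dil(1)[of n] by simp
 ultimately show ?thesis using d0 by simp
qed
let ?b = "%y. ind Y y *r (w y * cnj (cdot (cplx y) (W y)))"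
let ?f = "%y. K * norm (ind Y y *r w y)"
have lim: "(%n. (LB y. g n y)) ----> (LB y. ?b y)"
proof (rule integral_dominated_convergence[where w = "%y. ?f y"])
 show "ilb (%y. ?f y)" by (intro integrable_mult_right integrable_norm wi')
 show "AEL y. (%n. g n y) ----> ?b y"
 proof (rule AE_I2)
  fix y :: "real ^ 'n"
  have X: "(%n. ?e n *r y) ----> y"
  proof -
   have "(%n. ?e n *r y) ----> (1 / 1) *r y" by (intro tendsto_scaleR tendsto_divide tendsto_const dil(3)) simp
   then show ?thesis by simp
  qed
  show "(%n. g n y) ----> ?b y"
  proof (cases "y : Y")
   case True
   have ev: "\<forall>\<^sub>F n in sequentially. ?e n *r y : Y" by (rule topological_tendstoD[OF X open_domain True])
   have ev': "\<forall>\<^sub>F n in sequentially. ?e n *r y : closure Y" using ev by eventually_elim (use closure_subset in blast)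
   have yc: "y : closure Y" using True closure_subset by blast
   have "(%n. ?c n y) ----> (1^2 *r w y) * cnj (cdot (cplx y) (W y))"
    by (intro tendsto_intros tendsto_cnj dil(3) rquot_tendsto[OF v yc X ev' dil])
   then have "(%n. ?c n y) ----> ?b y" using True by simp
   then show ?thesis by (rule Lim_transform_eventually) (use ev in eventually_elim, simp add: g_def)
  next
   case False
   have "?e n *r y ~: Y" for n
   proof
    assume "?e n *r y : Y"
    from scale_in_dom[OF this, of "dil n"] have "y : Y" using dil(1,2)[of n] by simp
    then show False using False by simp
   qed
   then show ?thesis using False by (simp add: g_def)
  qed
 qed
 show "AEL y. norm (g n y) <= ?f y" for n
 proof (rule AE_I2)
  fix y :: "real ^ 'n"
  show "norm (g n y) <= ?f y"
  proof (cases "?e n *r y : Y")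
   case True
   from scale_in_dom[OF this, of "dil n"] have y: "y : Y" using dil(1,2)[of n] by simp
   have "norm (g n y) = ((dil n)^2 * norm (w y)) * norm (rquot v (dil n) (?e n *r y))" using True by (simp add: g_def norm_mult)
   also have "... <= (1 * norm (w y)) * K" using K(2)[of "?e n *r y" "dil n"] True closure_subset[of Y] dil(1,2)[of n] K(1)
    by (intro mult_mono) (auto simp: power_le_one)
   finally show ?thesis using y by (simp add: mult.commute)
  qed (use K(1) in "simp add: g_def")
 qed
qed measurable
have "(%n. (1 / dil n ^ ?d) *r (LB y. g n y)) ----> (1 / 1 ^ ?d) *r (LB y. ?b y)" by (intro tendsto_intros lim dil(3)) simp
then show ?thesis unfolding eq by (subst leb_borel(1)) (simp_all add: set_lint_def)
qed

end

context boundary_domain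
begin

lemma power_ratio_tendsto:
assumes a: "!!n. 0 < a n" "!!n. a n < 1" "a ----> (1 :: real)"
shows "(%n. (1 - (a n)\<^sup>2 / a n ^ d) / (1 - a n)) ----> 2 - real d"
proof -
let ?a = "%n. ((1 ^ 2 - a n ^ 2) / (1 - a n) - (1 ^ d - a n ^ d) / (1 - a n)) / a n ^ d"
have e: "(1 - (a n)\<^sup>2 / a n ^ d) / (1 - a n) = ?a n" for n
proof -
 have "a n ^ d ~= 0" using a(1)[of n] by simp
 then have "a n ^ d / a n ^ d = 1" by (rule divide_self)
 then have "1 - (a n)\<^sup>2 / a n ^ d = ((1 - (a n)\<^sup>2) - (1 - a n ^ d)) / a n ^ d" unfolding diff_divide_distrib by linarith
 then show ?thesis by (simp only: power_one diff_divide_distrib[symmetric] divide_divide_eq_left mult.commute)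
qed
have "(%n. ?a n) ----> (real 2 - real d) / 1 ^ d" by (intro tendsto_intros power_quotient_tendsto[of a "%n. 1"] a) simp
then show ?thesis unfolding e by simp
qed

lemma energy_dilation_quotient:
assumes v: "C1 v W"
shows "(%n. ((LV x. nsq (W x)) - (LV x. nsq (dil n *r W (dil n *r x)))) / (1 - dil n))
 ----> (2 - real CARD('n)) * (LV x. nsq (W x)) + (LINT x|cmeas. nsq (W x))"
proof -
note [measurable] = C1_borel[OF v]
let ?d = "CARD('n)"
define e where "e x = nsq (W x)" for x
have em[measurable]: "e : BM" unfolding e_def[abs_def] by measurable
have ec: "cc e" unfolding e_def[abs_def] by (intro continuous_intros C1_cont[OF v])
define E where "E = (LV x. e x)"
define S where "S n = (LINT x:{x. rho x < dil n}|lborel. e x)" for n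
define B where "B n = (LINT x:{x. dil n <= rho x & rho x < 1}|lborel. e x)" for n
have ei: "set_integrable lborel Y e" using intbl_dom_cont(1)[OF em ec] leb_borel(2)[OF em dom_borel] by simp
have Om: "Y = {x. rho x < dil n} \<union> {x. dil n <= rho x & rho x < 1}" for n using dil(2)[of n] by (auto simp: mem_domain)
have sub: "set_integrable lborel {x. rho x < dil n} e" "set_integrable lborel {x. dil n <= rho x & rho x < 1} e" for n
 using Om[of n] by (intro set_integrable_subset[OF ei]; auto)+
have "E = (LINT x:Y|lborel. e x)" unfolding E_def by (rule leb_borel(1)) measurable
also have "... = S n + B n" for n unfolding S_def B_def by (subst Om[of n]) (rule set_integral_Un[OF _ sub], auto)
finally have ESB: "E = S n + B n" for n .
have dis: "(LV x. nsq (dil n *r W (dil n *r x))) = (dil n)^2 / dil n ^ ?d * S n" for n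
proof -
 have d0: "dil n ~= 0" "0 < dil n" using dil(1)[of n] by simp_all
 have "S n = abs (dil n) ^ DIM(real ^ 'n) *r (LB x. ind {x. rho x < dil n} (0 + dil n *r x) *r e (0 + dil n *r x))"
  unfolding S_def set_lint_def by (rule lb_int_affine) (use d0 in auto)
 moreover have "ind {x. rho x < dil n} (0 + dil n *r x) = (ind Y x :: real)" for x
  using d0 by (simp add: rho_scale mem_domain indicator_def)
 ultimately have "S n = dil n ^ ?d * (LINT x:Y|lborel. e (dil n *r x))" using d0 by (simp add: set_lint_def)
 moreover have "(LV x. nsq (dil n *r W (dil n *r x))) = (LINT x:Y|lborel. (dil n)^2 * e (dil n *r x))"
  using d0 by (subst leb_borel(1)) (simp_all add: e_def power_mult_distrib)
 ultimately show ?thesis using d0 by simp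
qed
let ?b = "%n. 1 - dil n"
have Bq: "(%n. B n / ?b n) ----> (LINT x|cmeas. e x)" using layer_limit(1)[of dil "%n. 1" e "%x. 1" 1] dil ec by (simp add: B_def)
have S_lim: "S ----> E"
proof -
 have "(%n. E - ?b n * (B n / ?b n)) ----> E - (1 - 1) * (LINT x|cmeas. e x)" by (intro tendsto_intros Bq dil(3))
 moreover have "E - ?b n * (B n / ?b n) = S n" for n using ESB[of n] dil(2)[of n] by simp
 ultimately show ?thesis by simp
qed
let ?a = "%n. S n * ((1 - (dil n)\<^sup>2 / dil n ^ ?d) / ?b n) + B n / ?b n"
have "(%n. ?a n) ----> E * (2 - real ?d) + (LINT x|cmeas. e x)" by (intro tendsto_intros S_lim Bq power_ratio_tendsto dil)
moreover have "?a n = (E - (dil n)\<^sup>2 / dil n ^ ?d * S n) / ?b n" for n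
 unfolding ESB[of n] by (simp add: add_divide_distrib diff_divide_distrib algebra_simps)
ultimately show ?thesis unfolding dis E_def e_def by (simp add: mult.commute)
qed

lemma rellich_ineq_borel:
assumes v: "C1 v W" and wm[measurable]: "w : BM" and F: "wdiv W w"
shows "2 * Re ((LINT x|sg. ndot x (W x) * cnj (xdot x (W x)))
   - (LV x. w x * cnj (xdot x (W x))))
 <= (2 - real CARD('n)) * (LV x. nsq (W x)) + (LINT x|cmeas. nsq (W x))"
proof (rule LIMSEQ_le[OF _ energy_dilation_quotient[OF v]])
note [measurable] = C1_borel[OF v]
have wi: "integrable (vol) w" using F by (simp add: wdiv_def)
let ?B = "%n. (LINT x|sg. ndot x (dil n *r W (dil n *r x)) * cnj (rquot v (dil n) x))"
let ?I = "%n. (LV x. ((dil n)^2 *r w (dil n *r x)) * cnj (rquot v (dil n) x))"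
let ?f = "%n. 2 * Re (?B n - ?I n)"
show "(%n. ?f n) ----> 2 * Re ((LINT x|sg. ndot x (W x) * cnj (xdot x (W x)))
   - (LV x. w x * cnj (xdot x (W x))))"
 by (intro tendsto_intros tendsto_Re bdry_quotient_limit[OF v] interior_quotient_limit[OF v wm wi])
let ?e = "%x n. ((LV x. nsq (W x)) - (LV x. nsq (dil n *r W (dil n *r x)))) / (1 - dil n)"
show "EX N. \<forall>n\<ge>N. ?f n <= ?e x n"
proof (intro exI[of _ 0] allI impI)
 fix n
 define a where "a = dil n"
 have a: "0 < a" "a < 1" "a <= 1" using dil(1,2)[of n] by (simp_all add: a_def)
 define Z where "Z x = a *r W (a *r x)" for x
 define u where "u x = cnj (v x - v (a *r x))" for x
 have Zc: "C1 (%x. v (a *r x)) Z" unfolding Z_def[abs_def] by (rule C1_dilate[OF v a(1,3)])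
 note [measurable] = C1_borel[OF Zc]
 have uc: "C1 u (%x. conjv (W x - Z x))" unfolding u_def[abs_def] by (rule C1_cnj[OF C1_diff[OF v Zc]])
 let ?a = "%x. a^2 *r w (a *r x)"
 have Fz: "wdiv Z (%x. ?a x)" unfolding Z_def[abs_def] by (rule wdiv_dilate[OF F wm a(1,3)])
 have wzi: "integrable (vol) (%x. ?a x)" using Fz unfolding wdiv_def by blast
 let ?b = "%x. hdot (Z x) (W x - Z x)"
 have hi: "integrable (vol) (%x. ?b x)" unfolding cdot_conjv[symmetric]
  by (rule intbl_dom_cont(1)) (measurable, intro continuous_intros C1_cont[OF v] C1_cont[OF Zc])
 have uqi: "integrable (vol) (%x. ?a x * u x)" by (rule wdiv_bdd_mult_intbl[OF C1_borel(1)[OF uc] C1_cont(1)[OF uc] wzi])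
 let ?c = "LINT x|sg. ndot x (Z x) * u x"
 have "(LV x. cdot (conjv (W x - Z x)) (Z x) + ?a x * u x) = ?c" by (rule green[OF uc Fz])
 moreover have "cdot (conjv (W x - Z x)) (Z x) = ?b x" for x by (simp only: cdot_commute[of "conjv _"] cdot_conjv)
 moreover note integral_add[OF hi uqi]
 ultimately have H: "(LV x. ?b x) = ?c - (LV x. ?a x * u x)" by (simp only: eq_diff_eq)
 have ni: "integrable (vol) (%x. nsq (f x))" if "f : BM" "cc f" for f :: "real ^ 'n => complex ^ 'n"
  by (rule L2_norm_integrable[OF L2_cont(1)[OF that]])
 note niW = ni[OF C1_borel(2)[OF v] C1_cont(2)[OF v]] and niZ = ni[OF C1_borel(2)[OF Zc] C1_cont(2)[OF Zc]]
 let ?d = "%x. (LV x. nsq (W x)) - (LV x. nsq (Z x))"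
 have "?d x = (LV x. nsq (W x) - nsq (Z x))" by (rule integral_diff[symmetric, OF niW niZ])
 also have "... \<ge> (LV x. 2 * Re (?b x))"
 proof (rule integral_mono)
  show "integrable (vol) (%x. 2 * Re (?b x))" using hi by (intro integrable_mult_right integrable_Re)
  show "integrable (vol) (%x. nsq (W x) - nsq (Z x))" by (rule integrable_diff[OF niW niZ])
  show "2 * Re (?b x) <= nsq (W x) - nsq (Z x)" for x using norm_diff_square_hdot[of "W x" "Z x"] by simp
 qed
 also have "(LV x. 2 * Re (?b x)) = 2 * Re (LV x. ?b x)" using hi by simp
 finally have ineq: "2 * Re (?c - (LV x. ?a x * u x))
   <= ?d x" unfolding H .
 have uq: "u x = (1 - a) *r cnj (rquot v a x)" for x using a by (simp add: rquot_def u_def)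
 have b1: "?c = (1 - a) *r (LINT x|sg. ndot x (Z x) * cnj (rquot v a x))"
  unfolding uq mult_scaleR_right by (rule integral_scaleR_right)
 have b2: "(LV x. ?a x * u x) = (1 - a) *r (LV x. ?a x * cnj (rquot v a x))"
  unfolding uq mult_scaleR_right by (rule integral_scaleR_right)
 have "(1 - a) * ?f n <= ?d x"
  using ineq[unfolded b1 b2] unfolding Z_def a_def[symmetric] scaleR_diff_right[symmetric] by (simp add: mult.left_commute[of 2])
 then show "?f n <= ?e x n" using a by (simp add: Z_def a_def pos_le_divide_eq mult.commute)
qed
qed

lemma cone_int_sigma: fixes f :: "real ^ 'n => real"
assumes [measurable]: "f : BM"
shows "(LINT x|cmeas. f x) = (LINT x|sg. inner x (nu x) * f x)"
proof -
have "(LINT x|sg. inner x (nu x) * f x) = (LINT x|cmeas. norm (grho x) *r (inner x (nu x) * f x))" by (rule int_sigma) measurable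
also have "... = (LINT x|cmeas. f x)"
proof (rule integral_cong_AE)
 show "AE x in cmeas. norm (grho x) *r (inner x (nu x) * f x) = f x" using normal_cone AE_cone(2)
 proof eventually_elim
  case (elim x)
  then have "grho x ~= 0" by auto
  then have "norm (grho x) * inner x (nu x) = 1" using elim by (simp add: inner_commute)
  then show ?case by (simp add: mult.assoc[symmetric])
 qed
qed measurable
finally show ?thesis by simp
qed

lemma dom_borel_version: fixes w :: "real ^ 'n => 'b::euclidean_space"
assumes "integrable (vol) w"
obtains w' where "w' : BM" "AE x in vol. w x = w' x"
proof -
have "Y \<inter> space lebesgue : sets lebesgue" using open_domain by simp
from borel_measurable_integrable[OF integrable_restrict_space[OF this, THEN iffD1, OF assms]]
obtain w' where w': "w' : BM" and ae: "AEL x. ind Y x *r w x = w' x" by (rule compl_borel_version)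
note AE_completion[OF ae]
then have "AE x in vol. w x = w' x" using open_domain by (subst AE_restrict_space_iff) (auto elim!: AE_mp)
with w' show thesis using that by blast
qed

lemma wdiv_cong_AE:
assumes F: "wdiv F w" and w': "w' : borel_measurable (vol)" and ae: "AE x in vol. w x = w' x"
shows "wdiv F w'"
proof -
let ?a = "borel_measurable (vol)"
have wm: "w : ?a" using F by (auto simp: wdiv_def)
have "(LV x. a x *r w x) = (LV x. a x *r w' x)" if "smooth a" for a :: "real ^ 'n => real"
proof (rule integral_cong_AE)
 show "AE x in vol. a x *r w x = a x *r w' x" using ae by eventually_elim simp
 have "a : ?a" by (rule borel_leb[OF smooth_borel[OF that]])
 then show "(%x. a x *r w x) : ?a" "(%x. a x *r w' x) : ?a" using wm w' by measurable
qed
moreover have "integrable (vol) w'" using integrable_cong_AE[OF wm w' ae] F by (simp add: wdiv_def)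
ultimately show ?thesis using F by (simp add: wdiv_def)
qed

lemma rellich_ineq:
assumes v: "C1 v W" and F: "wdiv W w"
shows "2 * Re (LINT x|sg. ndot x (W x) * cnj (xdot x (W x))) - (LINT x|sg. inner x (nu x) * nsq (W x))
 <= 2 * Re (LV x. w x * cnj (xdot x (W x))) + (2 - real CARD('n)) * (LV x. nsq (W x))"
proof -
note [measurable] = C1_borel[OF v]
have wi: "integrable (vol) w" using F by (simp add: wdiv_def)
obtain w' where w'[measurable]: "w' : BM" and ae: "AE x in vol. w x = w' x" by (rule dom_borel_version[OF wi])
let ?a = "%x. cnj (xdot x (W x))"
have "(LV x. w x * ?a x) = (LV x. w' x * ?a x)"
proof (rule integral_cong_AE)
 show "AE x in vol. w x * ?a x = w' x * ?a x" using ae by eventually_elim simp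
 let ?b = "borel_measurable (vol)"
 have "(%x. ?a x) : ?b" by (rule borel_leb) measurable
 then show "(%x. w x * ?a x) : ?b" "(%x. w' x * ?a x) : ?b" using wi borel_leb[OF w', of Y] by measurable
qed
moreover have "(LINT x|cmeas. nsq (W x)) = (LINT x|sg. inner x (nu x) * nsq (W x))" by (rule cone_int_sigma) measurable
ultimately show ?thesis using rellich_ineq_borel[OF v w' wdiv_cong_AE[OF F borel_leb[OF w'] ae]] by simp
qed

end

section \<open>Coercivity and continuity of the form\<close>

type_synonym 'n profile = "complex \<times> (complex ^ 'n) \<times> complex"

text \<open>The two norms of the profiles below, in \<open>Y\<close> and on \<open>\<Gamma>\<close>, make up \<open>norm_V2\<close>, and the integrands of
\<open>form_b\<close> (for \<open>A = k\<^sup>2\<close>) are sesquilinear forms in them, with \<open>a = (d - 1) / (2 k)\<close>.\<close>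

definition dom_profile :: "(real ^ 'n::finite) set => real => (real ^ 'n => complex) => real ^ 'n => 'n profile" where
"dom_profile Y k v x = (helm Y k v x, wgrad Y v x, k *r v x)"

definition bdry_profile ::
 "(real ^ 'n::finite) set => (real ^ 'n) measure => (real ^ 'n => real ^ 'n) => real => (real ^ 'n => complex) => real ^ 'n => 'n profile" where
"bdry_profile Y sg nu k v x = (nderiv Y sg v x, sgrad Y sg nu v x, k *r bdry_trace Y sg v x)"

definition dom_form :: "complex => real ^ 'n::finite => 'n profile => 'n profile => complex" where
"dom_form a x p p' = hdot (fst (snd p)) (fst (snd p')) + snd (snd p) * cnj (snd (snd p'))
  + (xdot x (fst (snd p)) + a * snd (snd p) + fst p) * cnj (fst p')"

definition bdry_form :: "complex => real ^ 'n::finite => real => 'n profile => 'n profile => complex" where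
"bdry_form a x t p p' =
  \<i> * snd (snd p) * cnj (xdot x (fst (snd p')) + a * snd (snd p') + cr t * fst p')
  + (xdot x (fst (snd p)) + a * snd (snd p)) * cnj (fst p')
  + cr t * (snd (snd p) * cnj (snd (snd p')) - hdot (fst (snd p)) (fst (snd p')))"

definition multiplier_coeff :: "nat => real => real => complex" where
"multiplier_coeff d k a = cr ((real d - 1) / (2 * k)) - \<i> * cr a"

lemma form_b_prof: fixes Y :: "(real ^ 'n::finite) set"
assumes k: "0 < k"
shows "form_b Y sg nu k c (k^2) u v =
 (LINT x|lebesgue_on Y. dom_form (multiplier_coeff CARD('n) k c) x (dom_profile Y k u x) (dom_profile Y k v x))
 - (LINT x|sg. bdry_form (multiplier_coeff CARD('n) k c) x (inner x (nu x)) (bdry_profile Y sg nu k u x) (bdry_profile Y sg nu k v x))"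
proof -
let ?a = "real CARD('n) - 1"
have m: "multiplier_coeff CARD('n) k c * (k *r z) = - \<i> * cr (k * c) * z + cr (?a / 2) * z" for z
proof -
 have "?a / (2 * k) * k = ?a / 2" using k by simp
 then have "cr (?a / (2 * k)) * cr k = cr (?a / 2)" by (simp only: of_real_mult[symmetric])
 then show ?thesis unfolding multiplier_coeff_def scaleR_conv_of_real left_diff_distrib mult.assoc[symmetric] by (simp add: mult.commute mult.left_commute)
qed
have kk: "(k *r a) * cnj (k *r b) = (cr k)^2 * a * cnj b" for a b by (simp add: scaleR_conv_of_real power2_eq_square)
have A: "cr (k^2 / k^2) = 1" using k by simp
show ?thesis unfolding form_b_def dom_form_def bdry_form_def dom_profile_def bdry_profile_def fst_conv snd_conv m kk
  mult_dom_def mult_bdry_def mult_tan_def A by (intro arg_cong2[where f = "(-)"] integral_cong refl)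
   (simp_all add: scaleR_conv_of_real algebra_simps)
qed

lemma norm_hdot_le: "norm (hdot a b) <= norm a * norm b"
proof -
have "norm (conjv b) = norm b" by (simp add: conjv_def norm_vec_def)
then show ?thesis using norm_cdot_le[of a "conjv b"] by (simp add: cdot_conjv)
qed

lemma prof_norms: fixes p :: "'n::finite profile"
shows "norm (fst p) <= norm p" "norm (fst (snd p)) <= norm p" "norm (snd (snd p)) <= norm p"
proof -
have 1: "norm (fst p) <= norm p" "norm (snd p) <= norm p"
 using norm_fst_le[of "fst p" "snd p"] norm_snd_le[of "snd p" "fst p"] by simp_all
have 2: "norm (fst (snd p)) <= norm (snd p)" "norm (snd (snd p)) <= norm (snd p)"
 using norm_fst_le[of "fst (snd p)" "snd (snd p)"] norm_snd_le[of "snd (snd p)" "fst (snd p)"] by simp_all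
show "norm (fst p) <= norm p" "norm (fst (snd p)) <= norm p" "norm (snd (snd p)) <= norm p" using 1 2 by linarith+
qed

lemma norm_prof: "nsq p = nsq (fst p) + nsq (fst (snd p)) + nsq (snd (snd p))" by (simp add: norm_prod_def)

lemma dom_form_bound: fixes p p' :: "'n::finite profile"
assumes x: "norm x <= L" and a: "norm a <= m"
shows "norm (dom_form a x p p') <= (3 + L + m) * (norm p * norm p')"
proof -
note n = prof_norms[of p] and n' = prof_norms[of p']
have L: "0 <= L" "0 <= m" using x a norm_ge_zero order_trans by blast+
have 1: "norm (hdot (fst (snd p)) (fst (snd p'))) <= norm p * norm p'"
 by (rule order_trans[OF norm_hdot_le mult_mono[OF n(2) n'(2)]]) simp_all
have 2: "norm (snd (snd p) * cnj (snd (snd p'))) <= norm p * norm p'"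
 unfolding norm_mult complex_mod_cnj by (rule mult_mono[OF n(3) n'(3)]) simp_all
have X: "norm (xdot x (fst (snd p))) <= L * norm p"
 by (rule order_trans[OF norm_cdot_le]) (unfold norm_cplx, rule mult_mono[OF x n(2) L(1)], simp)
have M: "norm (a * snd (snd p)) <= m * norm p" unfolding norm_mult by (rule mult_mono[OF a n(3) L(2)]) simp
note norm_triangle_mono[OF norm_triangle_mono[OF X M] n(1)]
then have 3: "norm ((xdot x (fst (snd p)) + a * snd (snd p) + fst p) * cnj (fst p')) <= (L * norm p + m * norm p + norm p) * norm p'"
 unfolding norm_mult complex_mod_cnj by (rule mult_mono[OF _ n'(1)]) (use L in simp_all)
show ?thesis unfolding dom_form_def using norm_triangle_mono[OF norm_triangle_mono[OF 1 2] 3] by (simp add: algebra_simps)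
qed

lemma bdry_form_bound: fixes p p' :: "'n::finite profile"
assumes x: "norm x <= L" and c: "norm c <= m" and t: "abs t <= L"
shows "norm (bdry_form c x t p p') <= (5 * L + 2 * m) * (norm p * norm p')"
proof -
note n = prof_norms[of p] and n' = prof_norms[of p']
have L: "0 <= L" "0 <= m" using x c norm_ge_zero order_trans by blast+
have X: "norm (xdot x (fst (snd p))) <= L * norm p" for p :: "'n profile"
 by (rule order_trans[OF norm_cdot_le]) (unfold norm_cplx, rule mult_mono[OF x prof_norms(2) L(1)], simp)
let ?d = "%p. snd (snd p)"
have M: "norm (c * ?d p) <= m * norm p" for p :: "'n profile"
 unfolding norm_mult by (rule mult_mono[OF c prof_norms(3) L(2)]) simp
have T: "norm (cr t * z) <= L * norm z" for z unfolding norm_mult using t by (intro mult_right_mono) simp_all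
let ?e = "snd (snd p')"
have F: "norm (cr t * fst p') <= L * norm p'" by (rule order_trans[OF T mult_left_mono[OF n'(1) L(1)]])
let ?a = "xdot x (fst (snd p')) + c * ?e + cr t * fst p'"
let ?c = "L * norm p' + m * norm p' + L * norm p'"
have "norm ?a <= ?c" by (rule norm_triangle_mono[OF norm_triangle_mono[OF X M] F])
then have "norm (\<i> * ?d p) * norm ?a <= norm p * ?c" using n(3) by (intro mult_mono) (simp_all add: norm_mult)
then have 1: "norm (\<i> * ?d p * cnj ?a) <= norm p * ?c" by (simp only: norm_mult complex_mod_cnj)
have "norm (xdot x (fst (snd p)) + c * ?d p) <= L * norm p + m * norm p" by (rule norm_triangle_mono[OF X M])
then have 2: "norm ((xdot x (fst (snd p)) + c * ?d p) * cnj (fst p')) <= (L * norm p + m * norm p) * norm p'"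
 unfolding norm_mult complex_mod_cnj by (rule mult_mono[OF _ n'(1)]) (use L in simp_all)
let ?f = "norm p * norm p'"
have a: "norm (?d p * cnj ?e) <= ?f" unfolding norm_mult complex_mod_cnj by (rule mult_mono[OF n(3) n'(3)]) simp_all
let ?b = "hdot (fst (snd p)) (fst (snd p'))"
have b: "norm ?b <= ?f" by (rule order_trans[OF norm_hdot_le mult_mono[OF n(2) n'(2)]]) simp_all
have "norm (?d p * cnj ?e - ?b) <= 2 * ?f" using norm_triangle_ineq4[of "?d p * cnj ?e" "?b"] a b by linarith
then have 3: "norm (cr t * (?d p * cnj ?e - ?b)) <= L * (2 * ?f)" by (rule order_trans[OF T mult_left_mono[OF _ L(1)]])
show ?thesis unfolding bdry_form_def using norm_triangle_mono[OF norm_triangle_mono[OF 1 2] 3] by (simp add: algebra_simps)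
qed

lemma hdot_borel[measurable]:
assumes [measurable]: "F : borel_measurable M" "G : borel_measurable M"
shows "(%x. hdot (F x) (G x)) : borel_measurable M" unfolding cdot_conjv[symmetric] by measurable

lemma prof_borel: fixes P :: "'a => 'n::finite profile"
assumes "P : borel_measurable M"
shows "(%x. fst (P x)) : borel_measurable M" "(%x. fst (snd (P x))) : borel_measurable M" "(%x. snd (snd (P x))) : borel_measurable M"
proof -
have f: "(fst :: 'b::euclidean_space \<times> 'c::euclidean_space => 'b) : BM" by (intro bmc_onI continuous_intros)
have s: "(snd :: 'b::euclidean_space \<times> 'c::euclidean_space => 'c) : BM" by (intro bmc_onI continuous_intros)
show "(%x. fst (P x)) : borel_measurable M" by (rule measurable_compose[OF assms f])
show "(%x. fst (snd (P x))) : borel_measurable M" by (rule measurable_compose[OF measurable_compose[OF assms s] f])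
show "(%x. snd (snd (P x))) : borel_measurable M" by (rule measurable_compose[OF measurable_compose[OF assms s] s])
qed

lemma borel_Pair: fixes f :: "'a => 'b::euclidean_space" and g :: "'a => 'c::euclidean_space"
assumes "f : borel_measurable M" "g : borel_measurable M"
shows "(%x. (f x, g x)) : borel_measurable M" using assms by (rule borel_measurable_Pair)

lemma L2_Pair:
assumes f: "L2 M f" and g: "L2 M g"
shows "L2 M (%x. (f x, g x))" using L2_norm_integrable[OF f] L2_norm_integrable[OF g] borel_Pair[OF L2_borel[OF f] L2_borel[OF g]]
by (simp add: L2_def norm_Pair)

context boundary_domain
begin

abbreviation "dprof == dom_profile Y"
abbreviation "bprof == bdry_profile Y sg nu"
abbreviation "normV == norm_V2 Y sg nu"
abbreviation "bform k a == form_b Y sg nu k a (k^2)"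
abbreviation "Vsp == V_space Y sg nu"

lemma V_space_dom:
assumes "v : Vsp"
shows "L2 (vol) v" "weak_grad_of Y v (wgrad Y v)" "weak_laplacian_of Y v (wlap Y v)"
 "trace_of Y sg v (bdry_trace Y sg v)" "surface_grad_of sg nu (bdry_trace Y sg v) (sgrad Y sg nu v)"
 "normal_deriv_of Y sg v (nderiv Y sg v)"
proof -
have "(EX W. weak_grad_of Y v W)" "(EX w. weak_laplacian_of Y v w)" "(EX t. trace_of Y sg v t)"
 "(EX q. surface_grad_of sg nu (bdry_trace Y sg v) q)" "(EX w. normal_deriv_of Y sg v w)"
 and "L2 (vol) v" using assms by (simp_all add: V_space_def H1_def H1_boundary_def)
then show "L2 (vol) v" "weak_grad_of Y v (wgrad Y v)" "weak_laplacian_of Y v (wlap Y v)"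
 "trace_of Y sg v (bdry_trace Y sg v)" "surface_grad_of sg nu (bdry_trace Y sg v) (sgrad Y sg nu v)"
 "normal_deriv_of Y sg v (nderiv Y sg v)" unfolding wgrad_def wlap_def bdry_trace_def[of Y sg v] sgrad_def nderiv_def
 by (simp_all only: someI_ex)
qed

lemma V_space_L2:
assumes "v : Vsp"
shows "L2 (vol) (dprof k v)" "L2 sg (bprof k v)"
proof -
note V = V_space_dom[OF assms]
have "L2 (vol) (wgrad Y v)" using V(2) by (simp add: weak_grad_of_def)
moreover have "L2 (vol) (wlap Y v)" using V(3) by (simp add: weak_laplacian_of_def)
ultimately show "L2 (vol) (dprof k v)"
 unfolding dom_profile_def[abs_def] helm_def by (intro L2_Pair L2_add L2_mult_left L2_scaleR V(1))
have "L2 sg (bdry_trace Y sg v)" using V(4) by (auto simp: trace_of_def dest: L2_limD)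
moreover have "L2 sg (sgrad Y sg nu v)" using V(5) by (auto simp: surface_grad_of_def dest: L2_limD)
moreover have "L2 sg (nderiv Y sg v)" using V(6) by (simp add: normal_deriv_of_def)
ultimately show "L2 sg (bprof k v)" unfolding bdry_profile_def[abs_def] by (intro L2_Pair L2_scaleR)
qed

lemma norm_V2_prof:
assumes v: "v : Vsp"
shows "(normV k v)^2 = (LV x. nsq (dprof k v x)) + (LINT x|sg. nsq (bprof k v x))"
proof -
note V = V_space_dom[OF v]
have h: "L2 (vol) (helm Y k v)"
 using V(1,3) unfolding helm_def[abs_def] by (intro L2_add L2_mult_left) (simp_all add: weak_laplacian_of_def)
have g: "L2 (vol) (wgrad Y v)" using V(2) by (simp add: weak_grad_of_def)
have t: "L2 sg (bdry_trace Y sg v)" using V(4) by (auto simp: trace_of_def dest: L2_limD)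
have s: "L2 sg (sgrad Y sg nu v)" using V(5) by (auto simp: surface_grad_of_def dest: L2_limD)
have n: "L2 sg (nderiv Y sg v)" using V(6) by (simp add: normal_deriv_of_def)
note i = L2_norm_integrable
have "(LV x. nsq (dprof k v x)) = (LV x. nsq (helm Y k v x)) + (LV x. nsq (wgrad Y v x)) + k^2 * (LV x. nsq (v x))"
 unfolding norm_prof dom_profile_def fst_conv snd_conv norm_scaleR power_mult_distrib power2_abs
 using i[OF h] i[OF g] i[OF V(1)] by simp
moreover have "(LINT x|sg. nsq (bprof k v x)) = (LINT x|sg. nsq (nderiv Y sg v x)) + (LINT x|sg. nsq (sgrad Y sg nu v x)) + k^2 * (LINT x|sg. nsq (bdry_trace Y sg v x))"
 unfolding norm_prof bdry_profile_def fst_conv snd_conv norm_scaleR power_mult_distrib power2_abs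
 using i[OF n] i[OF s] i[OF t] by simp
ultimately show ?thesis unfolding norm_V2_def by (subst real_sqrt_pow2) (simp_all add: integral_nonneg_AE)
qed

lemma norm_V2_nonneg: "0 <= normV k v"
unfolding norm_V2_def by (intro real_sqrt_ge_zero add_nonneg_nonneg mult_nonneg_nonneg integral_nonneg_AE) simp_all

lemma dom_norm_le: "x : closure Y ==> norm x <= diameter Y"
proof -
assume x: "x : closure Y"
have "0 : closure Y" using rho_0 by (simp add: closure_eq)
from diameter_bounded_bound[OF _ x this] show ?thesis using bounded_domain by (simp add: bounded_closure diameter_closure)
qed

lemma AE_sigma_bounds: "AE x in sg. norm x <= diameter Y & abs (inner x (nu x)) <= diameter Y" using AE_normal(1,2)
proof eventually_elim
case (elim x)
then have "norm x <= diameter Y" by (intro dom_norm_le) (simp add: closure_eq)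
then show ?case using Cauchy_Schwarz_ineq2[of x "nu x"] elim(2) by simp
qed

lemma id_borel_leb: "(%x. x) : borel_measurable (vol)" by (rule borel_leb) simp

lemma dom_form_intbl:
assumes P: "L2 (vol) P" and Q: "L2 (vol) Q"
shows "integrable (vol) (%x. dom_form a x (P x) (Q x))"
 and "norm (LV x. dom_form a x (P x) (Q x)) <= (3 + diameter Y + norm a) * (LV x. norm (P x) * norm (Q x))"
proof -
note [measurable] = prof_borel[OF L2_borel[OF P]] prof_borel[OF L2_borel[OF Q]] id_borel_leb
let ?K = "3 + diameter Y + norm a"
have K: "0 <= ?K" using diameter_ge_0[OF bounded_domain] by simp
let ?a = "%x. dom_form a x (P x) (Q x)"
let ?b = "%x. norm (P x) * norm (Q x)"
have b: "norm (?a x) <= ?K * ?b x" if "x : space (vol)" for x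
 using that dom_norm_le[of x] closure_subset[of Y] by (intro dom_form_bound) (auto simp: space_leb)
have ki: "integrable (vol) (%x. ?K * ?b x)" by (rule integrable_mult_right[OF norm_prod_intbl[OF P Q]])
have m: "(%x. ?a x) : borel_measurable (vol)" unfolding dom_form_def by measurable
show i: "integrable (vol) (%x. ?a x)" by (rule integrable_bound[OF ki m AE_I2]) (use b K in "fastforce intro: order_trans")
have "norm (LV x. ?a x) <= (LV x. norm (?a x))" by (rule integral_norm_bound)
also have "... <= (LV x. ?K * ?b x)" by (rule integral_mono[OF integrable_norm[OF i] ki b])
finally show "norm (LV x. ?a x) <= ?K * (LV x. ?b x)" by simp
qed

lemma bdry_form_intbl:
assumes P: "L2 sg P" and Q: "L2 sg Q"
shows "integrable sg (%x. bdry_form a x (inner x (nu x)) (P x) (Q x))"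
 and "norm (LINT x|sg. bdry_form a x (inner x (nu x)) (P x) (Q x)) <= (5 * diameter Y + 2 * norm a) * (LINT x|sg. norm (P x) * norm (Q x))"
proof -
note [measurable] = prof_borel[OF L2_borel[OF P]] prof_borel[OF L2_borel[OF Q]]
let ?K = "5 * diameter Y + 2 * norm a"
have K: "0 <= ?K" using diameter_ge_0[OF bounded_domain] by simp
let ?a = "%x. bdry_form a x (inner x (nu x)) (P x) (Q x)"
let ?b = "%x. norm (P x) * norm (Q x)"
have b: "AE x in sg. norm (?a x) <= ?K * ?b x" using AE_sigma_bounds by eventually_elim (intro bdry_form_bound; simp)
have ki: "integrable sg (%x. ?K * ?b x)" by (rule integrable_mult_right[OF norm_prod_intbl[OF P Q]])
have m: "(%x. ?a x) : borel_measurable sg" unfolding bdry_form_def by measurable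
have b': "AE x in sg. norm (?a x) <= norm (?K * ?b x)" using b by eventually_elim simp
show i: "integrable sg (%x. ?a x)" by (rule integrable_bound[OF ki m b'])
have "norm (LINT x|sg. ?a x) <= (LINT x|sg. norm (?a x))" by (rule integral_norm_bound)
also have "... <= (LINT x|sg. ?K * ?b x)" by (rule integral_mono_AE[OF integrable_norm[OF i] ki b])
finally show "norm (LINT x|sg. ?a x) <= ?K * (LINT x|sg. ?b x)" by simp
qed

lemma form_b_cont:
assumes k: "0 < k" and u: "u : Vsp" and v: "v : Vsp" and K: "3 + 5 * diameter Y + 2 * norm (multiplier_coeff CARD('n) k c) <= K"
shows "cmod (bform k c u v) <= K * normV k u * normV k v"
proof -
let ?m = "multiplier_coeff CARD('n) k c"
define a a' b b' where "a = (LV x. nsq (dprof k u x))" and "a' = (LV x. nsq (dprof k v x))"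
 and "b = (LINT x|sg. nsq (bprof k u x))" and "b' = (LINT x|sg. nsq (bprof k v x))"
have nn: "0 <= a" "0 <= a'" "0 <= b" "0 <= b'" unfolding a_def a'_def b_def b'_def by (simp_all add: integral_nonneg_AE)
have N: "normV k u = sqrt (a + b)" "normV k v = sqrt (a' + b')"
 using norm_V2_prof[OF u, of k] norm_V2_prof[OF v, of k] norm_V2_nonneg unfolding a_def a'_def b_def b'_def
 by (metis real_sqrt_unique)+
have d: "0 <= diameter Y" by (rule diameter_ge_0[OF bounded_domain])
have K0: "0 <= K" using K d norm_ge_zero[of ?m] by linarith
note U = V_space_L2[OF u, of k] and V = V_space_L2[OF v, of k]
have 1: "norm (LV x. dom_form ?m x (dprof k u x) (dprof k v x)) <= K * (sqrt a * sqrt a')"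
proof (rule order_trans[OF dom_form_intbl(2)[OF U(1) V(1)]], rule mult_mono)
 show "(LV x. norm (dprof k u x) * norm (dprof k v x)) <= sqrt a * sqrt a'"
  unfolding a_def a'_def by (rule Cauchy_Schwarz_L2[OF U(1) V(1)])
 show "3 + diameter Y + norm ?m <= K" using K d norm_ge_zero[of ?m] by linarith
qed (use K0 in "simp_all add: integral_nonneg_AE")
have 2: "norm (LINT x|sg. bdry_form ?m x (inner x (nu x)) (bprof k u x) (bprof k v x)) <= K * (sqrt b * sqrt b')"
proof (rule order_trans[OF bdry_form_intbl(2)[OF U(2) V(2)]], rule mult_mono)
 show "(LINT x|sg. norm (bprof k u x) * norm (bprof k v x)) <= sqrt b * sqrt b'"
  unfolding b_def b'_def by (rule Cauchy_Schwarz_L2[OF U(2) V(2)])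
 show "5 * diameter Y + 2 * norm ?m <= K" using K by linarith
qed (use K0 in "simp_all add: integral_nonneg_AE")
have 3: "sqrt a * sqrt a' + sqrt b * sqrt b' <= sqrt (a + b) * sqrt (a' + b')"
proof -
 have "abs (inner (sqrt a, sqrt b) (sqrt a', sqrt b')) <= norm (sqrt a, sqrt b) * norm (sqrt a', sqrt b')" by (rule Cauchy_Schwarz_ineq2)
 then show ?thesis using nn by (simp add: norm_Pair)
qed
have "cmod (bform k c u v) <= K * (sqrt a * sqrt a') + K * (sqrt b * sqrt b')"
 unfolding form_b_prof[OF k] by (rule order_trans[OF norm_triangle_ineq4 add_mono[OF 1 2]])
also have "... <= K * (sqrt (a + b) * sqrt (a' + b'))" using mult_left_mono[OF 3 K0] by (simp add: distrib_left)
finally show ?thesis unfolding N by (simp add: mult.assoc)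
qed

end

lemma normal_split: fixes n :: "real ^ 'n::finite" and W :: "complex ^ 'n"
assumes n: "norm n = 1"
defines "m == cdot (cplx n) W"
shows "nsq (W - m *s cplx n) = nsq W - nsq m" and "xdot x (W - m *s cplx n) = xdot x W - cr (inner x n) * m"
proof -
let ?q = "W - m *s cplx n"
let ?a = "\<Sum>i\<in>UNIV. cr (n $ i) * cr (n $ i)"
have "inner n n = 1" using n by (simp add: dot_square_norm)
then have nn: "?a = 1" by (simp add: inner_vec_def flip: of_real_mult of_real_sum)
let ?b = "\<Sum>i\<in>UNIV. cr (n $ i) * W $ i"
have ms: "m = ?b" by (simp add: m_def cdot_def complexify_def)
let ?c = "\<Sum>i\<in>UNIV. cr (n $ i) * cnj (W $ i)"
have cm: "cnj m = ?c" unfolding ms by simp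
have "hdot ?q ?q = (\<Sum>i\<in>UNIV. W $ i * cnj (W $ i)) - cnj m * ?b
  - m * ?c + m * cnj m * ?a" unfolding hdot_def sum_distrib_left sum_subtractf[symmetric] sum.distrib[symmetric]
 by (rule sum.cong[OF refl]) (simp add: complexify_def algebra_simps)
also have "... = hdot W W - m * cnj m" unfolding nn ms[symmetric] cm[symmetric] by (simp add: hdot_def)
finally have "cr (nsq ?q) = cr (nsq W - nsq m)" unfolding hdot_self complex_norm_square[of m, symmetric] by simp
then show "nsq ?q = nsq W - nsq m" using of_real_eq_iff by blast
have xn: "cr (inner x n) * m = (\<Sum>i\<in>UNIV. cr (x $ i) * (cr (n $ i) * m))"
 by (simp add: inner_vec_def sum_distrib_right mult.assoc)
show "xdot x ?q = xdot x W - cr (inner x n) * m" unfolding xn cdot_def sum_subtractf[symmetric]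
 by (rule sum.cong[OF refl]) (simp add: complexify_def algebra_simps)
qed

lemma coercive_pointwise: fixes v X :: complex
assumes t: "d * L <= t" "t <= L" and g: "0 < d" "0 < L" and f: "L / 2 * (1 + 4 / d + d / 2) <= f" and k: "0 < k"
 and X: "norm X <= L * a" and a: "0 <= a"
shows "min (1 / 2) (min (d * L / 4) (L / d)) * (a^2 + k^2 * nsq v)
 <= (1 / 2) * t * a^2 - (1 / 2) * k^2 * t * nsq v + k^2 * f * nsq v - Re (\<i> * k * v * cnj X)"
proof -
define c where "c = min (1 / 2) (min (d * L / 4) (L / d))"
define b where "b = k * norm v"
have b: "0 <= b" "b^2 = k^2 * nsq v" using k by (simp_all add: b_def power_mult_distrib)
let ?a = "\<i> * k * v * cnj X"
have "Re ?a <= norm ?a" by (rule complex_Re_le_cmod)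
also have "... = b * norm X" using k by (simp add: norm_mult b_def)
also have "... <= b * (L * a)" by (rule mult_left_mono[OF X b(1)])
also have "... = L * (a * b)" by simp
also have "... <= L * (d / 4 * a^2 + b^2 / d)" using norm_mult_le_squares[of "d / 2" a b] g by (intro mult_left_mono) simp_all
finally have R: "Re ?a <= d * L / 4 * a^2 + L / d * b^2" by (simp add: algebra_simps)
have 1: "d * L / 2 * a^2 <= (1 / 2) * t * a^2" using t(1) by (intro mult_right_mono) simp_all
have 2: "(1 / 2) * t * b^2 <= L / 2 * b^2" using t(2) by (intro mult_right_mono) simp_all
have "L / 2 * (1 + 4 / d + d / 2) = L / 2 + 2 * (L / d) + d * L / 4" by (simp add: algebra_simps)
then have "L / 2 + 2 * (L / d) <= f" using f mult_pos_pos[OF g] by linarith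
then have 3: "(L / 2 + 2 * (L / d)) * b^2 <= f * b^2" by (rule mult_right_mono) simp
have "c <= d * L / 4" "c <= L / d" unfolding c_def by linarith+
then have 4: "c * a^2 <= d * L / 4 * a^2" "c * b^2 <= L / d * b^2" by (intro mult_right_mono; simp)+
have "c * (a^2 + b^2) <= (1 / 2) * t * a^2 - (1 / 2) * t * b^2 + f * b^2 - Re ?a"
 using R 1 2 3 4 by (simp add: distrib_left distrib_right)
then show ?thesis unfolding c_def b(2) by (simp add: mult.commute mult.left_commute)
qed

lemma int_eqI_AE:
assumes "integrable M g" "has_bochner_integral M f I" "AE x in M. g x = f x"
shows "integral\<^sup>L M g = I"
using integral_cong_AE[OF borel_measurable_integrable[OF assms(1)] borel_measurable_has_bochner_integral[OF assms(2)] assms(3)]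
 has_bochner_integral_integral_eq[OF assms(2)] by simp

lemma int_leI_AE: fixes g :: "'a => real"
assumes "integrable M g" "has_bochner_integral M f I" "AE x in M. g x <= f x"
shows "integral\<^sup>L M g <= I"
using integral_mono_AE[OF assms(1) integrable.intros[OF assms(2)] assms(3)] has_bochner_integral_integral_eq[OF assms(2)] by simp

lemma Re_int_eqI:
assumes "integrable M D" "has_bochner_integral M f I" "AE x in M. Re (D x) = f x"
shows "Re (integral\<^sup>L M D) = I" using int_eqI_AE[OF integrable_Re[OF assms(1)] assms(2,3)] integral_Re[OF assms(1)] by simp

context boundary_domain
begin

lemma position_flux_identity:
assumes v: "C1 v W"
shows "2 * Re (LV x. xdot x (W x) * cnj (v x)) + real CARD('n) * (LV x. nsq (v x))
 = (LINT x|sg. inner x (nu x) * nsq (v x))"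
proof -
note [measurable] = C1_borel[OF v]
define g where "g x = (\<chi> i. 2 * Re (W x $ i * cnj (v x)))" for x
have gm[measurable]: "g : BM" unfolding g_def[abs_def] by measurable
have gc: "cc g" unfolding g_def[abs_def] by (intro continuous_intros C1_cont[OF v])
let ?a = "%x. nsq (v x)"
have c: "cc ?a" by (intro continuous_intros C1_cont[OF v])
have ig: "inner (g x) x = 2 * Re (xdot x (W x) * cnj (v x))" for x
 unfolding inner_vec_def cdot_def sum_distrib_right Re_sum sum_distrib_left
 by (rule sum.cong[OF refl]) (simp add: g_def complexify_def algebra_simps)
have d: "(?a hder (%h. inner (g x) h)) (at x)" if x: "x : Y" for x
proof -
 have "g x = (\<chi> i. Re ((\<chi> i. v x * conjv (W x) $ i + W x $ i * cnj (v x)) $ i))"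
  by (simp add: g_def conjv_def Finite_Cartesian_Product.vec_eq_iff)
 moreover have "Re (v y * cnj (v y)) = nsq (v y)" for y by (simp add: complex_norm_square[symmetric] flip: of_real_power)
 ultimately show ?thesis using C1_parts(1)[OF C1_mult[OF v C1_cnj[OF v]] x] by simp
qed
have i: "integrable (vol) (%x. xdot x (W x) * cnj (v x))"
 by (rule intbl_dom_cont(1)) (measurable, intro continuous_intros cplx_cont C1_cont[OF v])
have i': "integrable (vol) ?a" by (rule intbl_dom_cont(1)[OF _ c]) measurable
let ?b = "%x. inner (g x) x + nsq (v x) * real DIM(real ^ 'n)"
have "(LINT x|sg. inner x (nu x) * nsq (v x)) = (LINT x|cmeas. nsq (v x))" by (rule cone_int_sigma[symmetric]) measurable
also have "... = (LINT x:Y|lborel. ?b x)" by (rule cone_int_eq_div[OF c _ gc gm d]) measurable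
also have "... = (LV x. ?b x)" by (rule leb_borel(1)[symmetric]) measurable
also have "... = 2 * Re (LV x. xdot x (W x) * cnj (v x)) + real CARD('n) * (LV x. nsq (v x))"
 unfolding ig integral_add[OF integrable_mult_right[OF integrable_Re[OF i]] integrable_mult_left[OF i']]
 by (simp only: integral_mult_right_zero integral_mult_left_zero integral_Re[OF i] DIM_cart DIM_real mult_1_right)
   (simp only: mult.commute[of "real CARD('n)"])
finally show ?thesis by simp
qed

lemma AE_normal_L2: "L2 sg f ==> integrable sg (%x. inner x (nu x) * nsq (f x))"
proof -
assume f: "L2 sg f"
show ?thesis
proof (rule integrable_bound)
 show "integrable sg (%x. diameter Y * nsq (f x))" by (rule integrable_mult_right[OF L2_norm_integrable[OF f]])
 show "(%x. inner x (nu x) * nsq (f x)) : borel_measurable sg" using L2_borel[OF f] by measurable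
 show "AE x in sg. norm (inner x (nu x) * nsq (f x)) <= norm (diameter Y * nsq (f x))" using AE_sigma_bounds
 proof eventually_elim
  case (elim x)
  then have "abs (inner x (nu x)) <= abs (diameter Y)" by linarith
  then have "abs (inner x (nu x)) * nsq (f x) <= abs (diameter Y) * nsq (f x)" by (rule mult_right_mono) simp
  then show ?case by (simp add: abs_mult)
 qed
qed
qed

lemma profile_C1:
assumes vV: "v : Vsp" and v: "C1 v W"
shows "AE x in vol. dprof k v x = (helm Y k v x, W x, k *r v x)" and "AE x in sg. bprof k v x =
  (ndot x (W x), W x - ndot x (W x) *s cplx (nu x), k *r v x)"
proof -
note V = V_space_dom[OF vV]
show "AE x in vol. dprof k v x = (helm Y k v x, W x, k *r v x)"
 using wgrad_C1(2)[OF v] by eventually_elim (simp add: dom_profile_def)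
note t = trace_C1[OF v V(4)]
show "AE x in sg. bprof k v x =
  (ndot x (W x), W x - ndot x (W x) *s cplx (nu x), k *r v x)"
 using t normal_deriv_C1[OF v V(3) V(6)] surface_grad_C1[OF v t V(5)] by eventually_elim (simp add: bdry_profile_def)
qed

lemma form_b_coercive:
assumes vV: "v : Vsp" and v: "C1 v W" and k: "0 < k" and g: "0 < j" and L: "0 < diameter Y"
 and star: "AE x in sg. j * diameter Y <= inner x (nu x)" and h: "diameter Y / 2 * (1 + 4 / j + j / 2) <= h"
shows "min (1 / 2) (min (j * diameter Y / 4) (diameter Y / j)) * (normV k v)^2 <= Re (bform k h v v)"
proof -
note [measurable] = C1_borel[OF v]
note V = V_space_dom[OF vV] and VL = V_space_L2[OF vV, of k]
let ?e = "diameter Y"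
define c where "c = min (1 / 2) (min (j * ?e / 4) (?e / j))"
have "0 <= j * ?e / 4" "0 <= ?e / j" using g L by simp_all
then have c: "0 <= c" "c <= 1 / 2" "c <= 1" unfolding c_def by linarith+
let ?d = "real CARD('n)" and ?t = "%x. inner x (nu x)"
define b where "b = multiplier_coeff CARD('n) k h"
define w where "w = wlap Y v"
define l where "l x = helm Y k v x" for x
define X where "X x = xdot x (W x)" for x
define m where "m x = ndot x (W x)" for x
define q where "q x = W x - m x *s cplx (nu x)" for x
let ?W = "%x. nsq (W x)" and ?v = "%x. nsq (v x)"
have Reb: "Re (b * cr k) = (?d - 1) / 2" "Re (\<i> * cnj b) = - h" using k by (simp_all add: b_def multiplier_coeff_def)
have wL: "L2 vol w" using V(3) by (simp add: weak_laplacian_of_def w_def)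
have WL: "L2 vol W" "L2 sg W" by (rule L2_cont[OF C1_borel(2)[OF v] C1_cont(2)[OF v]])+
have vL: "L2 vol v" "L2 sg v" by (rule L2_cont[OF C1_borel(1)[OF v] C1_cont(1)[OF v]])+
have Xc: "cc X" unfolding X_def by (intro continuous_intros cplx_cont C1_cont[OF v])
have Xm: "X : BM" unfolding X_def[abs_def] by measurable
have XL: "L2 vol X" "L2 sg X" by (rule L2_cont[OF Xm Xc])+
have mL: "L2 sg m" unfolding m_def[abs_def] cdot_def complexify_def vec_lambda_beta by (intro L2_sum L2_nmult L2_vec_nth WL)
have lL: "L2 vol l" unfolding l_def helm_def by (intro L2_add L2_mult_left vL wL[unfolded w_def])
have wd: "wdiv W w" unfolding w_def by (rule wdiv_lapl[OF v V(3)])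
define A1 A2 A3 where "A1 = (LV x. ?W x)" and "A2 = (LV x. ?v x)" and "A3 = (LV x. nsq (l x))"
let ?g = "%x. cnj (v x)"
define Xw Xv Vw where "Xw = (LV x. X x * cnj (w x))" and "Xv = (LV x. X x * ?g x)" and "Vw = (LV x. v x * cnj (w x))"
let ?c = "%x. v x * cnj (m x)"
let ?h = "%x. Re (\<i> * k * v x * cnj (X x))"
let ?j = "%x. m x * cnj (X x)"
define s1 s2 s3 s4 s5 s6 where "s1 = (LINT x|sg. Re (?j x))" and "s2 = (LINT x|sg. ?t x * ?W x)"
 and "s3 = (LINT x|sg. ?t x * ?v x)" and "s4 = (LINT x|sg. Re (b * k * ?c x))"
 and "s5 = (LINT x|sg. ?v x)" and "s6 = (LINT x|sg. ?h x)"
note mX = L2_prod_intbl[OF mL L2_cnj[OF XL(2)]] and vm = L2_prod_intbl[OF vL(2) L2_cnj[OF mL]]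
note hb = has_bochner_integral_integrable
note hD = hb[OF L2_norm_integrable[OF WL(1)]] hb[OF L2_norm_integrable[OF vL(1)]] hb[OF L2_norm_integrable[OF lL]]
 hb[OF L2_prod_intbl[OF XL(1) L2_cnj[OF wL]]] hb[OF L2_prod_intbl[OF XL(1) L2_cnj[OF vL(1)]]] hb[OF L2_prod_intbl[OF vL(1) L2_cnj[OF wL]]]
note hD = hD[folded A1_def A2_def A3_def Xw_def Xv_def Vw_def]
note hS = hb[OF integrable_Re[OF mX]] hb[OF AE_normal_L2[OF WL(2)]] hb[OF AE_normal_L2[OF vL(2)]] hb[OF integrable_Re[OF integrable_mult_right[OF vm]], of "b * k"]
 hb[OF L2_norm_integrable[OF vL(2)]] hb[OF integrable_Re[OF L2_prod_intbl[OF L2_mult_left[OF vL(2)] L2_cnj[OF XL(2)]]], of "\<i> * k"]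
note hS = hS[folded s1_def s2_def s3_def s4_def s5_def s6_def]
note hi = has_bochner_integral_add has_bochner_integral_diff has_bochner_integral_mult_right has_bochner_integral_Re
have I1: "2 * s1 - s2 <= 2 * Re Xw + (2 - ?d) * A1"
proof -
 have "(LV x. w x * cnj (X x)) = cnj Xw" unfolding Xw_def by (subst integral_cnj[symmetric]) (simp add: mult.commute)
 moreover have "Re (LINT x|sg. ?j x) = s1" unfolding s1_def by (rule integral_Re[OF mX, symmetric])
 ultimately show ?thesis using rellich_ineq[OF v wd] by (simp add: A1_def s2_def X_def m_def)
qed
have I2: "2 * Re Xv + ?d * A2 = s3" unfolding Xv_def A2_def s3_def X_def by (rule position_flux_identity[OF v])
have I3: "Vw = (LINT x|sg. ?c x) - cr A1"
proof -
 have e: "cdot (conjv (W x)) (W x) = cr (?W x)" for x by (simp only: cdot_commute[of "conjv _"] cdot_conjv hdot_self)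
 have "(LV x. cr (?W x) + w x * ?g x) = (LINT x|sg. m x * ?g x)" using green[OF C1_cnj[OF v] wd] unfolding e m_def .
 then have "cr A1 + (LV x. w x * ?g x) = (LINT x|sg. m x * ?g x)"
  unfolding integral_add[OF integrable_of_real[OF L2_norm_integrable[OF WL(1)]] L2_prod_intbl[OF wL L2_cnj[OF vL(1)]]] A1_def integral_complex_of_real .
 from arg_cong[OF this, of cnj] have "cr A1 + Vw = (LINT x|sg. ?c x)"
  unfolding Vw_def complex_cnj_add integral_cnj[symmetric] by (simp add: mult.commute)
 then show ?thesis by (simp add: eq_diff_eq add.commute)
qed
have I3': "Re (b * k * Vw) = s4 - (?d - 1) / 2 * A1"
proof -
 have "b * k * Vw = (LINT x|sg. b * k * ?c x) - cr A1 * (b * k)" unfolding I3 by (simp add: right_diff_distrib)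
 moreover have "Re (LINT x|sg. b * k * ?c x) = s4" unfolding s4_def by (rule integral_Re[OF integrable_mult_right[OF vm], symmetric])
 moreover have "Re (cr A1 * (b * k)) = A1 * Re (b * k)" by simp
 ultimately show ?thesis unfolding Reb(1) by simp
qed
have R: "Re (cr a * z) = a * Re z" for a z by simp
let ?D = "%x. dom_form b x (dprof k v x) (dprof k v x)" and ?B = "%x. bdry_form b x (?t x) (bprof k v x) (bprof k v x)"
let ?ID = "A1 + k^2 * A2 + A3 + Re Xw + k^2 * Re Xv + Re (b * k * Vw) + (?d - 1) / 2 * k^2 * A2"
let ?IB = "s6 - k\<^sup>2 * h * s5 + s1 - s2 + s4 + k^2 * s3"
have dom: "Re (LV x. ?D x) = ?ID"
proof (rule Re_int_eqI[OF dom_form_intbl(1)[OF VL(1) VL(1)]])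
 let ?f = "%x. ?W x + k^2 * ?v x + nsq (l x) + Re (X x * cnj (w x)) + k^2 * Re (X x * ?g x) + Re (b * k * (v x * cnj (w x))) + (?d - 1) / 2 * k^2 * ?v x"
 show "has_bochner_integral vol ?f ?ID" by (intro hi hD)
 show "AE x in vol. Re (?D x) = ?f x" using profile_C1(1)[OF vV v, of k]
 proof eventually_elim
  case (elim x)
  have lw: "cnj (l x) = cnj (w x) + k^2 * ?g x" by (simp add: l_def helm_def w_def)
  have "?D x = hdot (W x) (W x) + k^2 * (v x * ?g x) + l x * cnj (l x) + (X x + b * k * v x) * cnj (l x)"
   unfolding elim dom_form_def fst_conv snd_conv X_def[symmetric] l_def[symmetric]
   by (simp add: scaleR_conv_of_real power2_eq_square algebra_simps)
  also have "(X x + b * k * v x) * cnj (l x) = X x * cnj (w x) + k^2 * (X x * ?g x) + b * k * (v x * cnj (w x)) + b * k * (k^2 * (v x * ?g x))"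
   unfolding lw by (simp add: algebra_simps)
  finally have e: "?D x = cr (?W x) + cr (k^2 * ?v x) + cr (nsq (l x))
    + (X x * cnj (w x) + cr (k^2) * (X x * ?g x) + b * k * (v x * cnj (w x)) + cr (k^2 * ?v x) * (b * k))"
   unfolding hdot_self complex_norm_square[symmetric] by (simp add: mult.commute)
  show ?case unfolding e plus_complex.sel R Re_complex_of_real Reb(1) by (simp add: algebra_simps del: times_complex.sel)
 qed
qed
note prof = profile_C1(2)[OF vV v, of k, folded m_def, folded q_def]
have nu1: "AE x in sg. nsq (q x) = ?W x - nsq (m x) & xdot x (q x) = X x - cr (?t x) * m x"
 using AE_normal(2) by eventually_elim (simp add: q_def m_def X_def normal_split)
have bdry: "Re (LINT x|sg. ?B x) = ?IB"
proof (rule Re_int_eqI[OF bdry_form_intbl(1)[OF VL(2) VL(2)]])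
 let ?f = "%x. ?h x - k\<^sup>2 * h * ?v x + Re (?j x) - ?t x * ?W x + Re (b * k * ?c x) + k^2 * (?t x * ?v x)"
 show "has_bochner_integral sg ?f ?IB" by (intro hi hS)
 show "AE x in sg. Re (?B x) = ?f x" using prof nu1
 proof eventually_elim
  case (elim x)
  have qn: "nsq (q x) = ?W x - nsq (m x)" and qX: "xdot x (q x) = X x - cr (?t x) * m x" using elim(2) by blast+
  have "?B x = \<i> * k * v x * cnj (X x) + k^2 * (v x * ?g x) * (\<i> * cnj b) + cnj (?j x) - cr (?t x) * (m x * cnj (m x)) + b * k * ?c x
     + cr (?t x) * (k^2 * (v x * ?g x) - hdot (q x) (q x))" unfolding elim(1) bdry_form_def fst_conv snd_conv qX
   by (simp add: scaleR_conv_of_real power2_eq_square algebra_simps)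
  then have e: "?B x = \<i> * k * v x * cnj (X x) + cr (k^2 * ?v x) * (\<i> * cnj b) + cnj (?j x) - cr (?t x * nsq (m x)) + b * k * ?c x
     + cr (?t x * (k^2 * ?v x - nsq (q x)))" unfolding hdot_self complex_norm_square[symmetric] by simp
  show ?case unfolding e plus_complex.sel minus_complex.sel R Re_complex_of_real Reb(2) qn cnj.sel by (simp add: algebra_simps del: times_complex.sel)
 qed
qed
let ?a = "%x. ?W x + k^2 * ?v x"
have iN: "integrable sg (%x. ?a x)"
 by (intro integrable_add integrable_mult_right L2_norm_integrable[OF vL(2)] L2_norm_integrable[OF WL(2)])
let ?i = "A3 + A1 + k^2 * A2 + (LINT x|sg. ?a x)"
have N: "(normV k v)^2 = ?i"
proof -
 have 1: "(LV x. nsq (dprof k v x)) = A3 + A1 + k^2 * A2"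
 proof (rule int_eqI_AE[OF L2_norm_integrable[OF VL(1)]])
  show "has_bochner_integral vol (%x. nsq (l x) + ?W x + k^2 * ?v x) (A3 + A1 + k^2 * A2)" by (intro hi hD)
  show "AE x in vol. nsq (dprof k v x) = nsq (l x) + ?W x + k^2 * ?v x"
   using profile_C1(1)[OF vV v, of k] by eventually_elim (simp add: norm_prof l_def power_mult_distrib)
 qed
 have 2: "(LINT x|sg. nsq (bprof k v x)) = (LINT x|sg. ?a x)"
 proof (rule int_eqI_AE[OF L2_norm_integrable[OF VL(2)] hb[OF iN]])
  show "AE x in sg. nsq (bprof k v x) = ?a x" using prof nu1 by eventually_elim (simp add: norm_prof power_mult_distrib)
 qed
 show ?thesis unfolding norm_V2_prof[OF vV] 1 2 ..
qed
let ?b = "(1 / 2) * s2 - (1 / 2) * k^2 * s3 + k^2 * h * s5 - s6"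
have "(LINT x|sg. c * ?a x) <= ?b"
proof (rule int_leI_AE[OF integrable_mult_right[OF iN]])
 let ?f = "%x. (1 / 2) * (?t x * ?W x) - (1 / 2) * k^2 * (?t x * ?v x) + k^2 * h * ?v x - ?h x"
 show "has_bochner_integral sg ?f ?b" by (intro hi hS)
 show "AE x in sg. c * ?a x <= ?f x" using AE_sigma_bounds star
 proof eventually_elim
  case (elim x)
  have "norm (X x) <= norm x * norm (W x)" using norm_cdot_le[of "cplx x" "W x"] by (simp add: X_def norm_cplx)
  also have "... <= ?e * norm (W x)" using elim by (intro mult_right_mono) simp_all
  finally have X: "norm (X x) <= ?e * norm (W x)" .
  have "?t x <= ?e" using elim by linarith
  from coercive_pointwise[OF elim(2) this g L h k X norm_ge_zero, of "v x"]
  show ?case unfolding c_def mult.assoc[of "1 / 2"] mult.assoc[of "k^2" "?t x"] .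
 qed
qed
then have P: "c * (LINT x|sg. ?a x) <= ?b" unfolding integral_mult_right_zero .
have "0 <= A1" "0 <= k^2 * A2" "0 <= A3" by (simp_all add: A1_def A2_def A3_def integral_nonneg_AE)
then have "c * A1 <= (1 / 2) * A1" "c * (k^2 * A2) <= (1 / 2) * (k^2 * A2)" "c * A3 <= 1 * A3"
 using mult_right_mono[OF c(2)] mult_right_mono[OF c(3)] by blast+
moreover have "Re (bform k h v v) = ?ID - ?IB" unfolding form_b_prof[OF k] b_def[symmetric] minus_complex.sel dom bdry ..
moreover have "k^2 * Re Xv = k^2 * s3 / 2 - k\<^sup>2 * A2 * ?d / 2"
proof -
 have "Re Xv = s3 / 2 - ?d * A2 / 2" using I2 by simp
 then show ?thesis by (simp add: right_diff_distrib)
qed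
moreover have "Re Xw \<ge> s1 - s2 / 2 - A1 + ?d * A1 / 2" using I1 by (simp add: left_diff_distrib)
ultimately have "c * ?i <= Re (bform k h v v)" using P unfolding I3' distrib_left by (simp add: field_simps)
then show ?thesis unfolding N c_def .
qed

end

lemma pow_mat_Suc_left: fixes A :: "complex Matrix.mat"
assumes A: "A : carrier_mat n n"
shows "A ^\<^sub>m Suc j = A * A ^\<^sub>m j"
proof (induction j)
case 0
then show ?case using A by simp
next
case (Suc j)
have "A ^\<^sub>m Suc (Suc j) = (A * A ^\<^sub>m j) * A" by (simp only: pow_mat.simps(2)[of A "Suc j"] Suc)
also have "... = A * (A ^\<^sub>m j * A)" using A by (intro assoc_mult_mat[of _ n n _ n _ n]) simp_all
finally show ?case by simp
qed

lemma mat_inv_inverse: fixes D :: "complex Matrix.mat"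
assumes D: "D : carrier_mat n n" and inj: "!!c. c : cvec n ==> D *w c = 0\<^sub>v n ==> c = 0\<^sub>v n"
shows "mat_inv D : carrier_mat n n" "D * mat_inv D = 1\<^sub>m n" "mat_inv D * D = 1\<^sub>m n"
proof -
have "Determinant.det D ~= 0" using inj unfolding det_0_iff_vec_prod_zero[OF D] by blast
from det_non_zero_imp_unit[OF D this, of "()"] have "mat_inverse D ~= None" using mat_inverse(1)[OF D, of "()"] by blast
then have "mat_inverse D = Some (mat_inv D)" unfolding mat_inv_def by auto
from mat_inverse(2)[OF D this] show "mat_inv D : carrier_mat n n" "D * mat_inv D = 1\<^sub>m n" "mat_inv D * D = 1\<^sub>m n" by blast+
qed

definition kry_sum :: "nat => complex Matrix.mat => complex Matrix.vec => (nat => complex) => nat => complex Matrix.vec" where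
"kry_sum n M r e m = finsum_vec TYPE(complex) n (%j. e j \<cdot>\<^sub>v ((M ^\<^sub>m j) *w r)) {..<m}"

lemma pow_mat_vec_carrier:
"M : carrier_mat n n ==> r : cvec n ==> (M ^\<^sub>m j) *w r : cvec n" by (rule mult_mat_vec_carrier[OF pow_carrier_mat])

lemma kry_sum:
assumes M: "M : carrier_mat n n" and r: "r : cvec n"
shows "kry_sum n M r e m : cvec n"
 and "i < n ==> vec_index (kry_sum n M r e m) i = (\<Sum>j<m. e j * vec_index ((M ^\<^sub>m j) *w r) i)"
proof -
have c: "(%j. e j \<cdot>\<^sub>v ((M ^\<^sub>m j) *w r)) : {..<m} \<rightarrow> cvec n" by (intro Pi_I smult_carrier_vec[THEN iffD2] pow_mat_vec_carrier M r)
show "kry_sum n M r e m : cvec n" unfolding kry_sum_def by (rule finsum_vec_closed[OF c])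
assume i: "i < n"
show "vec_index (kry_sum n M r e m) i = (\<Sum>j<m. e j * vec_index ((M ^\<^sub>m j) *w r) i)"
 unfolding kry_sum_def index_finsum_vec[OF finite_lessThan i c] by (rule sum.cong) (use i carrier_vecD[OF pow_mat_vec_carrier[OF M r]] in auto)
qed

lemma kry_sum_mult:
assumes M: "M : carrier_mat n n" and r: "r : cvec n"
shows "M *w kry_sum n M r e m = kry_sum n M r (%j. if j = 0 then 0 else e (j - 1)) (Suc m)"
proof (rule eq_vecI)
let ?c = "%j. if j = 0 then 0 else e (j - 1)"
note k = kry_sum[OF M r]
let ?a = "kry_sum n M r (%j. ?c j) (Suc m)"
let ?d = "M *w kry_sum n M r e m"
show "dim_vec ?d = dim_vec ?a" using k(1)[of e m] k(1)[of "%j. ?c j" "Suc m"] M by simp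
fix i assume "i < dim_vec ?a"
then have i: "i < n" using k(1)[of "%j. ?c j" "Suc m"] by simp
have step: "vec_index (M *w v) i = (\<Sum>l<n. M $$ (i, l) * vec_index v l)" if "v : cvec n" for v
 using M i that by (simp add: scalar_prod_def atLeast0LessThan)
let ?b = "%j. (M ^\<^sub>m j) *w r"
have pw: "(M ^\<^sub>m Suc j) *w r = M *w ?b j" for j
 unfolding pow_mat_Suc_left[OF M] by (rule assoc_mult_mat_vec[OF M pow_carrier_mat[OF M] r])
have "vec_index ?d i = (\<Sum>l<n. M $$ (i, l) * (\<Sum>j<m. e j * vec_index (?b j) l))"
 unfolding step[OF k(1)] by (rule sum.cong) (simp_all add: k(2))
also have "... = (\<Sum>l<n. \<Sum>j<m. e j * (M $$ (i, l) * vec_index (?b j) l))"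
 unfolding sum_distrib_left by (intro sum.cong refl) (simp add: algebra_simps)
also have "... = (\<Sum>j<m. \<Sum>l<n. e j * (M $$ (i, l) * vec_index (?b j) l))" by (rule sum.swap)
also have "... = (\<Sum>j<m. e j * vec_index ((M ^\<^sub>m Suc j) *w r) i)"
 unfolding sum_distrib_left[symmetric] pw by (intro sum.cong refl) (simp add: step[OF pow_mat_vec_carrier[OF M r]])
also have "... = (\<Sum>j<Suc m. ?c j * vec_index (?b j) i)" by (subst sum.lessThan_Suc_shift) simp
also have "... = vec_index ?a i" by (rule k(2)[OF i, symmetric])
finally show "vec_index ?d i = vec_index ?a i" .
qed

lemma kry_sum_add:
assumes M: "M : carrier_mat n n" and r: "r : cvec n" and lm: "l <= m"
shows "kry_sum n M r e l + s \<cdot>\<^sub>v kry_sum n M r f m = kry_sum n M r (%j. (if j < l then e j else 0) + s * f j) m"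
proof (rule eq_vecI)
note k = kry_sum[OF M r]
let ?h = "%j. (if j < l then e j else 0) + s * f j"
let ?a = "kry_sum n M r e l + s \<cdot>\<^sub>v kry_sum n M r f m"
let ?b = "kry_sum n M r ?h m"
show "dim_vec ?a = dim_vec ?b" using k(1)[of f m] k(1)[of ?h m] by simp
fix i assume "i < dim_vec ?b"
then have i: "i < n" using k(1)[of ?h m] by simp
have "(\<Sum>j<m. (if j < l then e j else 0) * vec_index ((M ^\<^sub>m j) *w r) i) = (\<Sum>j<l. e j * vec_index ((M ^\<^sub>m j) *w r) i)"
 using lm by (intro sum.mono_neutral_cong_right) auto
then show "vec_index ?a i = vec_index ?b i"
 using k(1)[of e l] k(1)[of f m] i by (simp add: k(2) distrib_right sum.distrib sum_distrib_left mult.assoc)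
qed

lemma gmres_resid_bound: fixes D B :: "complex Matrix.mat"
assumes D: "D : carrier_mat n n" and B: "B : carrier_mat n n"
 and herm: "!!c d. c : cvec n ==> d : cvec n ==> (D *w c) \<bullet>c d = cnj ((D *w d) \<bullet>c c)"
 and pos: "!!c. c : cvec n ==> 0 <= Re ((D *w c) \<bullet>c c)"
 and inj: "!!c. c : cvec n ==> D *w c = 0\<^sub>v n ==> c = 0\<^sub>v n"
 and coer: "!!c. c : cvec n ==> a * (norm_P D c)^2 <= Re ((B *w c) \<bullet>c c)"
 and cont: "!!c d. c : cvec n ==> d : cvec n ==> cmod ((B *w c) \<bullet>c d) <= K * norm_P D c * norm_P D d"
 and a: "0 < a" "a <= K" and x0: "x0 : cvec n" and g: "g : cvec n" and x: "precond_gmres_iterate n D B g x0 m x"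
shows "x : cvec n"
 and "norm_P D (precond_residual D B g x) <= sqrt (1 - (a / K)\<^sup>2) ^ m * norm_P D (precond_residual D B g x0)"
proof -
let ?H = "%c d. (D *w c) \<bullet>c d"
note Di = mat_inv_inverse[OF D inj]
define M where "M = mat_inv D * B"
have M: "M : carrier_mat n n" using Di(1) B by (simp add: M_def)
have K: "0 < K" using a by linarith
let ?f = "%c. norm_P D c"
have nn: "(?f c)^2 = Re (?H c c)" if "c : cvec n" for c using pos[OF that] by (simp add: norm_P_def)
have n0: "0 <= ?f c" if "c : cvec n" for c unfolding norm_P_def using pos[OF that] by simp
let ?g = "%c. B *w c"
let ?j = "%c. M *w c"
have DM: "D *w ?j c = ?g c" if "c : cvec n" for c
proof -
 have "D *w ?j c = D *w (mat_inv D *w ?g c)" unfolding M_def using assoc_mult_mat_vec[OF Di(1) B that] by simp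
 also have "... = (D * mat_inv D) *w ?g c" using assoc_mult_mat_vec[OF D Di(1), of "?g c"] B that by simp
 finally show ?thesis using B that by (simp add: Di(2))
qed
let ?d = "%c. norm_P D (?j c)"
have Mb: "?d c <= K * ?f c" if c: "c : cvec n" for c
proof -
 have Mc: "?j c : cvec n" using M c by simp
 have "(?d c)^2 = Re (?g c \<bullet>c (?j c))" unfolding nn[OF Mc] DM[OF c] ..
 also have "... <= K * ?f c * ?d c" by (rule order_trans[OF complex_Re_le_cmod cont[OF c Mc]])
 finally have "?d c * ?d c <= ?d c * (K * ?f c)" by (simp add: power2_eq_square mult.commute)
 then show ?thesis using n0[OF Mc] n0[OF c] K by (cases "?d c = 0") (auto simp: mult_le_cancel_left)
qed
define b where "b = a / K^2"
let ?k = "1 - (a / K)\<^sup>2"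
define q where "q = sqrt ?k"
have "a / K <= 1" "0 <= a / K" using a K by simp_all
then have "(a / K)^2 <= 1" by (simp add: power_le_one)
then have q: "0 <= q" "q^2 = ?k" by (simp_all add: q_def)
have contraction: "norm_P D (c - cr b \<cdot>\<^sub>v (?j c)) <= q * ?f c" if c: "c : cvec n" for c
proof (rule power2_le_imp_le)
 let ?v = "M *w c" and ?t = "cr b"
 have v: "?v : cvec n" using M c by simp
 have tv: "?t \<cdot>\<^sub>v ?v : cvec n" using v by simp
 let ?a = "c - ?t \<cdot>\<^sub>v ?v"
 have w: "?a : cvec n" using c tv by simp
 have left: "?H ?a e = ?H c e - ?t * ?H ?v e" if e: "e : cvec n" for e
 proof -
  have Dv: "D *w c : cvec n" "D *w ?v : cvec n" using D c v by simp_all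
  have "D *w ?a = D *w c - ?t \<cdot>\<^sub>v (D *w ?v)" using mult_minus_distrib_mat_vec[OF D c tv] mult_mat_vec[OF D v] by simp
  then show ?thesis using minus_scalar_prod_distrib[of "D *w c" n "?t \<cdot>\<^sub>v (D *w ?v)" "conjugate e"] Dv e by simp
 qed
 have "?H ?a ?a = ?H c ?a - ?t * ?H ?v ?a" by (rule left[OF w])
 also have "?H c ?a = cnj (?H c c - ?t * ?H ?v c)" unfolding herm[OF c w] left[OF c] ..
 also have "?H ?v ?a = cnj (?H c ?v - ?t * ?H ?v ?v)" unfolding herm[OF v w] left[OF v] ..
 also have "?H c ?v = cnj (?H ?v c)" by (rule herm[OF c v])
 finally have "Re (?H ?a ?a) = Re (cnj (?H c c - ?t * ?H ?v c) - ?t * cnj (cnj (?H ?v c) - ?t * ?H ?v ?v))" by (rule arg_cong)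
 also have "... = Re (?H c c) - 2 * b * Re (?H ?v c) + b^2 * Re (?H ?v ?v)" by (simp add: power2_eq_square algebra_simps)
 finally have "(norm_P D ?a)^2 = (?f c)^2 - 2 * b * Re (?g c \<bullet>c c) + b^2 * (norm_P D ?v)^2"
  unfolding nn[OF w] nn[OF c] nn[OF v] DM[OF c] by simp
 also have "... <= (?f c)^2 - 2 * b * (a * (?f c)^2) + b^2 * (K * ?f c)^2"
 proof -
  have "(2 * b) * (a * (?f c)^2) <= (2 * b) * Re (?g c \<bullet>c c)" using coer[OF c] a by (intro mult_left_mono) (simp_all add: b_def)
  moreover have "b^2 * (norm_P D ?v)^2 <= b^2 * (K * ?f c)^2" using Mb[OF c] n0[OF v] by (intro mult_left_mono power_mono) simp_all
  ultimately show ?thesis by linarith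
 qed
 also have "... = (q * ?f c)^2" unfolding power_mult_distrib q(2) using K by (simp add: b_def field_simps power2_eq_square)
 finally show "(norm_P D ?a)^2 <= (q * ?f c)^2" .
 show "0 <= q * ?f c" using q(1) n0[OF c] by simp
qed
define d where "d = mat_inv D *w g"
have d: "d : cvec n" using Di(1) g by (simp add: d_def)
have res: "precond_residual D B g y = d - M *w y" if y: "y : cvec n" for y
 using mult_minus_distrib_mat_vec[OF Di(1) g, of "B *w y"] assoc_mult_mat_vec[OF Di(1) B y] B y
 by (simp add: precond_residual_def d_def M_def)
define r0 where "r0 = d - M *w x0"
have r0: "r0 : cvec n" using d M x0 by (simp add: r0_def)
note k = kry_sum(1)[OF M r0]
let ?e = "%e j. d - M *w (x0 + kry_sum n M r0 e j)"
let ?l = "norm_P D r0"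
have cand: "EX e f. ?e e j = kry_sum n M r0 f (Suc j) &
  norm_P D (?e e j) <= q ^ j * ?l" for j
proof (induction j)
 case 0
 have z: "kry_sum n M r0 e 0 = 0\<^sub>v n" for e using k[of e 0] by (intro eq_vecI) (simp_all add: kry_sum(2)[OF M r0])
 have "d - M *w (x0 + kry_sum n M r0 (%j. 0) 0) = r0" unfolding z right_zero_vec[OF x0] by (rule r0_def[symmetric])
 moreover have "r0 = kry_sum n M r0 (%j. 1) (Suc 0)"
  using k[of "%j. 1" "Suc 0"] r0 M by (intro eq_vecI) (simp_all add: kry_sum(2)[OF M r0])
 ultimately show ?case by (intro exI[of _ "%j. 0"] exI[of _ "%j. 1"]) simp
next
 case (Suc j)
 then obtain e f where ef: "?e e j = kry_sum n M r0 f (Suc j)"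
  "norm_P D (?e e j) <= q ^ j * ?l" by blast
 let ?t = "cr b"
 let ?z = "kry_sum n M r0 e j" and ?r = "kry_sum n M r0 f (Suc j)"
 define e' where "e' = (%i. (if i < j then e i else 0) + ?t * f i)"
 have z': "?z + ?t \<cdot>\<^sub>v ?r = kry_sum n M r0 e' (Suc j)" unfolding e'_def by (rule kry_sum_add[OF M r0]) simp
 let ?h = "M *w ?r"
 have Mr: "?h : cvec n" using M k by simp
 let ?b = "x0 + kry_sum n M r0 e' (Suc j)"
 let ?i = "d - M *w ?b"
 have "M *w ?b = M *w (x0 + ?z) + ?t \<cdot>\<^sub>v ?h"
 proof -
  have tr: "?t \<cdot>\<^sub>v ?r : cvec n" using k[of f "Suc j"] by simp
  have "?b = (x0 + ?z) + ?t \<cdot>\<^sub>v ?r" unfolding z'[symmetric] by (rule assoc_add_vec[OF x0 k tr, symmetric])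
  then show ?thesis using mult_add_distrib_mat_vec[OF M _ tr, of "x0 + ?z"] mult_mat_vec[OF M k[of f "Suc j"]] x0 k[of e j] by simp
 qed
 then have new: "?i = ?r - ?t \<cdot>\<^sub>v ?h"
  unfolding ef(1)[symmetric] using d M x0 k[of e j] Mr[unfolded ef(1)[symmetric]] by (intro eq_vecI) simp_all
 let ?c = "kry_sum n M r0 (%i. (if i < Suc j then f i else 0) + (- ?t) * (if i = 0 then 0 else f (i - 1))) (Suc (Suc j))"
 have "?r - ?t \<cdot>\<^sub>v ?h = ?r + (- ?t) \<cdot>\<^sub>v ?h" using k[of f "Suc j"] Mr by (intro eq_vecI) simp_all
 also have "... = ?c" unfolding kry_sum_mult[OF M r0] by (rule kry_sum_add[OF M r0]) simp
 finally have new2: "?i = ?c" using new by simp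
 have "norm_P D ?i <= q * norm_P D ?r" unfolding new by (rule contraction[OF k])
 also have "... <= q * (q ^ j * ?l)" using ef q(1) by (intro mult_left_mono) simp_all
 finally have "norm_P D ?i <= q ^ Suc j * ?l" by simp
 with new2 show ?case by blast
qed
let ?m = "krylov n M r0 m"
let ?n = "%e. kry_sum n M r0 e m"
have kr: "?n e : ?m" for e unfolding krylov_def kry_sum_def by blast
have kr': "EX e. z = ?n e" if "z : ?m" for z using that unfolding krylov_def kry_sum_def by blast
have xg: "is_arg_min (%y. norm_P D (d - M *w y)) (%y. EX z:?m. y = x0 + z) x"
 using x unfolding precond_gmres_iterate_def gmres_iterate_def r0_def d_def M_def .
then obtain z where "z : ?m" "x = x0 + z" unfolding is_arg_min_def by blast
with kr' k x0 show xc: "x : cvec n" by (metis add_carrier_vec)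
obtain e where e: "norm_P D (d - M *w (x0 + ?n e)) <= q ^ m * ?l" using cand by blast
have "\<not> norm_P D (d - M *w (x0 + ?n e)) < norm_P D (d - M *w x)" using xg kr[of e] unfolding is_arg_min_def by blast
then have "norm_P D (d - M *w x) <= q ^ m * ?l" using e by linarith
then show "norm_P D (precond_residual D B g x) <= sqrt ?k ^ m * norm_P D (precond_residual D B g x0)"
 unfolding res[OF xc] res[OF x0] r0_def q_def .
qed

lemma contr_power_le: fixes a :: real
assumes s: "0 < s" "s <= 1" and a: "0 < a" and m: "2 / s^2 * ln (12 / a) <= real m"
shows "sqrt (1 - s\<^sup>2) ^ m <= a"
proof -
have "1 - s\<^sup>2 <= exp (- s\<^sup>2)" using exp_ge_add_one_self[of "- s\<^sup>2"] by simp
then have "sqrt (1 - s\<^sup>2) <= sqrt (exp (- s\<^sup>2))" by simp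
also have "... = exp (- s\<^sup>2 / 2)" by (rule real_sqrt_unique) (simp_all add: power2_eq_square flip: exp_add)
finally have "sqrt (1 - s\<^sup>2) ^ m <= exp (- s\<^sup>2 / 2) ^ m" using s by (intro power_mono) (simp_all add: power_le_one)
also have "... = exp (real m * (- s\<^sup>2 / 2))" by (rule exp_of_nat_mult[symmetric])
also have "... <= exp (ln (a / 12))"
proof -
 let ?a = "s^2 / 2 * (2 / s^2 * ln (12 / a))"
 have "?a <= s^2 / 2 * real m" by (rule mult_left_mono[OF m]) simp
 moreover have "?a = ln (12 / a)" using s by simp
 ultimately have "ln (12 / a) <= real m * (s^2 / 2)" by (simp add: mult.commute)
 moreover have "ln (a / 12) = - ln (12 / a)" using a by (simp add: ln_div)
 ultimately show ?thesis by simp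
qed
also have "... = a / 12" using a by simp
also have "... <= a" using a by simp
finally show ?thesis .
qed

section \<open>The Galerkin matrices\<close>

definition csc :: "complex => 'n::finite profile => 'n profile" where
"csc c p = (c * fst p, c *s fst (snd p), c * snd (snd p))"

definition sesquilinear :: "('n::finite profile => 'n profile => complex) => bool" where
"sesquilinear B \<longleftrightarrow> (ALL p p' q. B (p + p') q = B p q + B p' q) & (ALL p q q'. B p (q + q') = B p q + B p q') &
  (ALL c p q. B (csc c p) q = c * B p q) & (ALL c p q. B p (csc c q) = cnj c * B p q)"

definition gram :: "'n::finite profile => 'n profile => complex" where
"gram p q = fst p * cnj (fst q) + hdot (fst (snd p)) (fst (snd q)) + snd (snd p) * cnj (snd (snd q))"

lemma hdot_add_left: "hdot (a + b) c = hdot a c + hdot b c" and hdot_add_right: "hdot c (a + b) = hdot c a + hdot c b"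
and hdot_scale_left: "hdot (z *s a) c = z * hdot a c" and hdot_scale_right: "hdot c (z *s a) = cnj z * hdot c a"
by (simp_all add: hdot_def sum.distrib sum_distrib_left algebra_simps)

lemma cdot_add_right: "cdot c (a + b) = cdot c a + cdot c b" and cdot_scale_right: "cdot c (z *s a) = z * cdot c a"
by (simp_all add: cdot_def sum.distrib sum_distrib_left algebra_simps)

lemma sesq_gram: "sesquilinear gram" unfolding sesquilinear_def gram_def csc_def
by (simp add: hdot_add_left hdot_add_right hdot_scale_left hdot_scale_right algebra_simps)

lemma sesq_dom_form: "sesquilinear (dom_form a x)" unfolding sesquilinear_def dom_form_def csc_def
by (simp add: hdot_add_left hdot_add_right hdot_scale_left hdot_scale_right cdot_add_right cdot_scale_right algebra_simps)

lemma sesq_bdry_form: "sesquilinear (bdry_form a x t)" unfolding sesquilinear_def bdry_form_def csc_def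
by (simp add: hdot_add_left hdot_add_right hdot_scale_left hdot_scale_right cdot_add_right cdot_scale_right algebra_simps)

lemma sesq_sum: fixes N M :: nat
assumes B: "sesquilinear B"
shows "B (\<Sum>j<N. csc (c j) (p j)) (\<Sum>i<M. csc (d i) (q i)) = (\<Sum>j<N. \<Sum>i<M. c j * cnj (d i) * B (p j) (q i))"
proof -
have add: "B (p + p') q = B p q + B p' q" "B p (q + q') = B p q + B p q'" and sc: "B (csc c p) q = c * B p q" "B p (csc c q) = cnj c * B p q" for p p' q q' c
 using B unfolding sesquilinear_def by blast+
have z: "B 0 q = 0" "B p 0 = 0" for p q using add(1)[of 0 0 q] add(2)[of p 0 0] by simp_all
let ?a = "\<Sum>i<M. csc (d i) (q i)"
have r: "B p ?a = (\<Sum>i<M. cnj (d i) * B p (q i))" for p by (induction M) (simp_all add: z add sc)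
have "B (\<Sum>j<N. csc (c j) (p j)) y = (\<Sum>j<N. c j * B (p j) y)" for y by (induction N) (simp_all add: z add sc)
then have "B (\<Sum>j<N. csc (c j) (p j)) ?a = (\<Sum>j<N. c j * B (p j) ?a)" .
also have "... = (\<Sum>j<N. \<Sum>i<M. c j * cnj (d i) * B (p j) (q i))" unfolding r by (simp add: sum_distrib_left mult.assoc)
finally show ?thesis .
qed

lemma gram_self: "gram p p = cr (nsq p)" unfolding norm_prof gram_def hdot_self by (simp add: complex_norm_square[symmetric])

lemma cnj_gram: "cnj (gram p q) = gram q p" by (simp add: gram_def cnj_hdot mult.commute)

lemma norm_gram_le: "norm (gram p q) <= norm p * norm q" for p q :: "'n::finite profile"
proof -
have "norm (gram p q) <= norm (fst p) * norm (fst q) + norm (fst (snd p)) * norm (fst (snd q)) + norm (snd (snd p)) * norm (snd (snd q))"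
 unfolding gram_def by (intro norm_triangle_mono norm_hdot_le) (simp_all add: norm_mult)
also have "... = inner (norm (fst p), norm (fst (snd p)), norm (snd (snd p))) (norm (fst q), norm (fst (snd q)), norm (snd (snd q)))" by simp
also have "... <= norm (norm (fst p), norm (fst (snd p)), norm (snd (snd p))) * norm (norm (fst q), norm (fst (snd q)), norm (snd (snd q)))"
 by (rule norm_cauchy_schwarz)
also have "... = norm p * norm q" by (simp add: norm_prod_def)
finally show ?thesis .
qed

lemma int_sesq: fixes p :: "nat => 'a => 'n::finite profile"
assumes B: "!!x. sesquilinear (B x)" and i: "!!j i. j < N ==> i < N ==> integrable M (%x. B x (p j x) (p i x))"
 and P: "AE x in M. P x = (\<Sum>j<N. csc (c j) (p j x))" and Q: "AE x in M. Q x = (\<Sum>j<N. csc (d j) (p j x))"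
 and m: "(%x. B x (P x) (Q x)) : borel_measurable M"
shows "(LINT x|M. B x (P x) (Q x)) = (\<Sum>j<N. \<Sum>i<N. c j * cnj (d i) * (LINT x|M. B x (p j x) (p i x)))"
proof -
let ?a = "%x. \<Sum>j<N. \<Sum>i<N. c j * cnj (d i) * B x (p j x) (p i x)"
let ?b = "\<Sum>j<N. \<Sum>i<N. c j * cnj (d i) * (LINT x|M. B x (p j x) (p i x))"
have h: "has_bochner_integral M (%x. ?a x) ?b"
 by (intro has_bochner_integral_sum has_bochner_integral_mult_right has_bochner_integral_integrable i) simp_all
have "(LINT x|M. B x (P x) (Q x)) = (LINT x|M. ?a x)"
proof (rule integral_cong_AE[OF m borel_measurable_has_bochner_integral[OF h]])
 show "AE x in M. B x (P x) (Q x) = ?a x" using P Q by eventually_elim (simp add: sesq_sum[OF B])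
qed
also have "... = ?b" by (rule has_bochner_integral_integral_eq[OF h])
finally show ?thesis .
qed

lemma mat_vec_cscalar_prod: fixes f :: "nat => nat => complex"
assumes c: "c : cvec N" and d: "d : cvec N"
shows "(Matrix.mat N N (%(i, j). f i j) *w c) \<bullet>c d = (\<Sum>j<N. \<Sum>i<N. vec_index c j * cnj (vec_index d i) * f i j)"
proof -
have "(Matrix.mat N N (%(i, j). f i j) *w c) \<bullet>c d = (\<Sum>i<N. (\<Sum>j<N. f i j * vec_index c j) * cnj (vec_index d i))"
 using c d by (simp add: scalar_prod_def atLeast0LessThan row_def)
also have "... = (\<Sum>i<N. \<Sum>j<N. vec_index c j * cnj (vec_index d i) * f i j)"
 unfolding sum_distrib_right by (intro sum.cong refl) (simp add: algebra_simps)
finally show ?thesis by (subst (asm) sum.swap)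
qed

context boundary_domain
begin

lemma dom_cong:
assumes eq: "!!x. x : Y ==> v x = v' x"
shows "L2 (vol) v = L2 (vol) v'" "weak_grad_of Y v = weak_grad_of Y v'" "weak_laplacian_of Y v = weak_laplacian_of Y v'"
 "wgrad Y v = wgrad Y v'" "wlap Y v = wlap Y v'" "trace_of Y sg v = trace_of Y sg v'" "bdry_trace Y sg v = bdry_trace Y sg v'"
 "sgrad Y sg nu v = sgrad Y sg nu v'" "normal_deriv_of Y sg v = normal_deriv_of Y sg v'" "nderiv Y sg v = nderiv Y sg v'"
 "v : Vsp \<longleftrightarrow> v' : Vsp"
 "bprof k v = bprof k v'" "!!x. x : Y ==> dprof k v x = dprof k v' x"
proof -
have eq': "x : space (vol) ==> v x = v' x" for x using eq by (simp add: space_leb)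
have L: "L2 (vol) (%x. f (v x) x) = L2 (vol) (%x. f (v' x) x)" for f :: "complex => real ^ 'n => complex"
 unfolding L2_def by (intro arg_cong2[where f = "(&)"] measurable_cong integrable_cong) (simp_all add: eq')
show L2: "L2 (vol) v = L2 (vol) v'" using L[of "%z x. z"] .
have I: "(LV x. f (v x) x) = (LV x. f (v' x) x)" for f :: "complex => real ^ 'n => 'b::{banach, second_countable_topology}"
 by (intro integral_cong) (simp_all add: eq')
show wg: "weak_grad_of Y v = weak_grad_of Y v'" unfolding weak_grad_of_def[abs_def] I[of "%z x. z * partial _ _ x"] ..
show wl: "weak_laplacian_of Y v = weak_laplacian_of Y v'" unfolding weak_laplacian_of_def[abs_def] I[of "%z x. z * laplacian _ x"] ..
show g: "wgrad Y v = wgrad Y v'" and l: "wlap Y v = wlap Y v'" unfolding wgrad_def wlap_def wg wl by (rule refl)+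
have Ll: "L2_lim (vol) a v = L2_lim (vol) a v'" for a unfolding L2_lim_def L2 I[of "%z x. nsq (a _ x - z)"] ..
show t: "trace_of Y sg v = trace_of Y sg v'" unfolding trace_of_def[abs_def] Ll g ..
show b: "bdry_trace Y sg v = bdry_trace Y sg v'" unfolding bdry_trace_def t ..
show s: "sgrad Y sg nu v = sgrad Y sg nu v'" unfolding sgrad_def b ..
show n: "normal_deriv_of Y sg v = normal_deriv_of Y sg v'" unfolding normal_deriv_of_def[abs_def] g l ..
show nd: "nderiv Y sg v = nderiv Y sg v'" unfolding nderiv_def n ..
show "v : Vsp \<longleftrightarrow> v' : Vsp" unfolding V_space_def H1_def mem_Collect_eq L2 wg wl t b n ..
show "bprof k v = bprof k v'" unfolding bdry_profile_def[abs_def] nd s b ..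
show "dprof k v x = dprof k v' x" if "x : Y" for x unfolding dom_profile_def helm_def g l eq[OF that] ..
qed

lemma norm_form_cong:
assumes eq: "!!x. x : Y ==> v x = v' x" and k: "0 < k" and v: "v : Vsp"
shows "normV k v = normV k v'" "bform k a v v = bform k a v' v'"
proof -
have c: "bprof k v = bprof k v'" "x : Y ==> dprof k v x = dprof k v' x" for x
 by (rule dom_cong(12), rule eq, assumption, rule dom_cong(13), rule eq)
have v': "v' : Vsp" using dom_cong(11)[of v v', OF eq] v by blast
have I: "(LV x. f x (dprof k v x)) = (LV x. f x (dprof k v' x))" for f :: "real ^ 'n => 'n profile => 'b::{banach, second_countable_topology}"
 by (intro integral_cong) (simp_all add: c space_leb)
have "(normV k v)^2 = (normV k v')^2" unfolding norm_V2_prof[OF v] norm_V2_prof[OF v'] c(1) I[of "%x p. nsq p"] ..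
then show "normV k v = normV k v'" using norm_V2_nonneg power2_eq_imp_eq by blast
show "bform k a v v = bform k a v' v'" unfolding form_b_prof[OF k] c(1) I[of "%x p. dom_form _ x p p"] ..
qed

lemma C1_zero: "C1 (%x. 0) (%x. 0)" by (auto simp: C1_def cdot_def)

lemma C1_add_scaled:
assumes u: "C1 u Z" and v: "C1 v W"
shows "C1 (%x. u x + c * v x) (%x. Z x + c *s W x)"
proof -
have "((%x. u x + c * v x) hder (%h. cdot (Z x + c *s W x) (cplx h))) (at x)" if "x : Y" for x
proof -
 have "((%x. u x + c * v x) hder (%h. cdot (Z x) (cplx h) + c * cdot (W x) (cplx h))) (at x)"
  using u v that by (intro has_derivative_add has_derivative_mult_right) (simp_all add: C1_def)
 then show ?thesis by (simp add: cdot_commute[of _ "cplx _"] cdot_add_right cdot_scale_right)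
qed
moreover have "cc (%x. c *s W x)" "(%x. c *s W x) : BM" unfolding vector_scalar_mult_def
 by (intro continuous_intros C1_cont(2)[OF v], rule vec_lambda_borel, rule borel_measurable_times[OF borel_measurable_const vec_nth_borel[OF C1_borel(2)[OF v]]])
ultimately show ?thesis unfolding C1_def
 by (intro conjI ballI continuous_on_add continuous_on_mult continuous_on_const borel_measurable_add borel_measurable_times borel_measurable_const
   C1_borel[OF u] C1_borel[OF v] C1_cont[OF u] C1_cont[OF v])
qed

lemma C1_sum:
assumes "!!j. j < (N :: nat) ==> C1 (u j) (Z j)"
shows "C1 (%x. \<Sum>j<N. c j * u j x) (%x. \<Sum>j<N. c j *s Z j x)"
using assms by (induction N) (simp_all add: C1_zero C1_add_scaled)

lemma C1_cl_borel_version: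
assumes d: "C1_closure Y d"
obtains a W where "C1 (cfun a) (%x. cplx (W x))" "!!x. x : closure Y ==> a x = d x"
proof -
obtain W where W: "cc W" "!!x. x : Y ==> (d hder (%h. inner (W x) h)) (at x)"
 and c: "cc d" using d unfolding C1_closure_def by blast
let ?a = "%x. if x : closure Y then d x else 0" and ?W = "%x. if x : closure Y then W x else 0"
have b: "?a : BM" "?W : BM"
 using borel_measurable_continuous_on_if[OF _ c, of "%x. 0"] borel_measurable_continuous_on_if[OF _ W(1), of "%x. 0"] by simp_all
have cc: "cc ?a" "cc ?W" using c W(1) by (simp_all cong: continuous_on_cong)
let ?b = "%x. cplx (?W x)"
have "C1 (cfun ?a) ?b" unfolding C1_def
proof (intro conjI ballI)
 note [measurable] = b
 show "cfun ?a : BM" "?b : BM" unfolding cfun_def[abs_def] by measurable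
 show "cc (cfun ?a)" unfolding cfun_def[abs_def] by (intro continuous_intros cc)
 show "cc ?b" by (rule continuous_on_compose2[OF cplx_cont[of UNIV] cc(2)]) simp
 fix x assume x: "x : Y"
 then have xc: "x : closure Y" using closure_subset by blast
 have "(?a hder (%h. inner (W x) h)) (at x)"
  by (rule has_derivative_transform_within_open[OF W(2)[OF x] open_domain x]) (use closure_subset in auto)
 from bounded_linear.has_derivative[OF bounded_linear_of_real this]
 show "(cfun ?a hder (%h. cdot (cplx (?W x)) (cplx h))) (at x)"
  unfolding cfun_def[abs_def] using xc by (simp add: cdot_def complexify_def inner_vec_def)
qed
with that show thesis by simp
qed

end

definition conjp :: "'n::finite profile => 'n profile" where
"conjp p = (cnj (fst p), conjv (fst (snd p)), cnj (snd (snd p)))"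

lemma cdot_gram:
assumes "conjp q = q"
shows "fst p * fst q + cdot (fst (snd p)) (fst (snd q)) + snd (snd p) * snd (snd q) = gram p q"
proof -
have "cnj (fst q) = fst q" "conjv (fst (snd q)) = fst (snd q)" "cnj (snd (snd q)) = snd (snd q)"
 using assms by (cases q; simp add: conjp_def)+
then show ?thesis unfolding gram_def cdot_conjv[symmetric] by simp
qed

lemma prof_sum:
"fst (\<Sum>j<N. csc (c j) (p j)) = (\<Sum>j<N. c j * fst (p j))"
"fst (snd (\<Sum>j<N. csc (c j) (p j))) = (\<Sum>j<N. c j *s fst (snd (p j)))"
"snd (snd (\<Sum>j<N. csc (c j) (p j))) = (\<Sum>j<N. c j * snd (snd (p j)))" for N :: nat
by (simp_all add: fst_sum snd_sum csc_def)

lemma conjv_cplx: "conjv (cplx x) = cplx x" by (simp add: conjv_def complexify_def)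

lemma cnj_cdot: "cnj (cdot a b) = cdot (conjv a) (conjv b)" by (simp add: cdot_def conjv_def)

lemma conjv_diff: "conjv (a - b) = conjv a - conjv b" and conjv_scale: "conjv (c *s a) = cnj c *s conjv a"
by (simp_all add: conjv_def Finite_Cartesian_Product.vec_eq_iff)

lemma smooth_cnj: "smooth ph ==> smooth (%x. cnj (ph x))" by (rule smooth_bdd_linear[OF bounded_linear_cnj])

lemma partial_cnj: "smooth ph ==> partial i (%x. cnj (ph x)) = (%x. cnj (partial i ph x))"
proof
fix x assume s: "smooth ph"
note bounded_linear.has_derivative[OF bounded_linear_cnj smooth_deriv[OF s]]
from frechet_derivative_at[OF this] show "partial i (%x. cnj (ph x)) x = cnj (partial i ph x)" unfolding partial_def by metis
qed

lemma tf_cnj: "test_function Y ph ==> test_function Y (%x. cnj (ph x))" by (simp add: test_function_def smooth_cnj)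

lemma lapl_cnj: "smooth ph ==> laplacian (%x. cnj (ph x)) x = cnj (laplacian ph x)"
by (simp add: laplacian_def partial_cnj smooth_partial)

locale galerkin = boundary_domain Y r sg nu for Y :: "(real ^ 'n::finite) set" and r sg nu +
fixes N :: nat and ph :: "nat => real ^ 'n => real" and k :: real
assumes basis: "galerkin_basis Y sg nu N ph" and k_pos: "0 < k"
begin

abbreviation "cf == coeff_fun N ph"
abbreviation "mD == mat_D Y sg nu k N ph"
abbreviation "mB a == mat_B Y sg nu k a (k^2) N ph"
abbreviation "mg a f g == vec_g Y sg nu k a (k^2) f g N ph"

abbreviation "bas j == cfun (ph j)"

lemma coeff_fun_V: "c : cvec N ==> cf c : Vsp" using basis by (auto simp: galerkin_basis_def galerkin_space_def)

lemma coeff_fun_unit: "j < N ==> cf (unit_vec N j) = bas j"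
proof
fix x assume j: "j < N"
have "cf (unit_vec N j) x = (\<Sum>i<N. if i = j then bas i x else 0)" unfolding coeff_fun_def by (rule sum.cong) (use j in auto)
then show "cf (unit_vec N j) x = bas j x" using j by simp
qed

lemma bas_V: "j < N ==> bas j : Vsp" using coeff_fun_V[OF unit_vec_carrier[of N j]] by (simp add: coeff_fun_unit)

lemma C1_data:
obtains a W where "ALL j<N. C1 (cfun (a j)) (%x. cplx (W j x)) & (ALL x:closure Y. a j x = ph j x)"
proof -
let ?a = "%j a W. j < N --> C1 (cfun a) (%x. cplx (W x)) & (ALL x:closure Y. a x = ph j x)"
have "ALL j. EX a W. ?a j a W"
proof
 fix j
 show "EX a W. ?a j a W"
 proof (cases "j < N")
  case True
  then have "C1_closure Y (ph j)" using basis by (simp add: galerkin_basis_def)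
  from C1_cl_borel_version[OF this] show ?thesis by metis
 qed simp
qed
then obtain a W where "ALL j. j < N --> C1 (cfun (a j)) (%x. cplx (W j x)) & (ALL x:closure Y. a j x = ph j x)" by metis
then show thesis using that by metis
qed

lemma coeff_profs:
assumes a: "ALL j<N. C1 (cfun (a j)) (%x. cplx (W j x)) & (ALL x:closure Y. a j x = ph j x)" and c: "c : cvec N"
defines "v == coeff_fun N a c" and "Z == (%x. \<Sum>j<N. vec_index c j *s cplx (W j x))"
shows "C1 v Z" "v : Vsp" "!!x. x : Y ==> cf c x = v x"
 "AE x in vol. dprof k (cf c) x = (helm Y k (cf c) x, Z x, k *r v x)"
 "AE x in sg. bprof k (cf c) x = (ndot x (Z x), Z x - ndot x (Z x) *s cplx (nu x), k *r v x)"
proof -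
show C: "C1 v Z" unfolding v_def Z_def coeff_fun_def[abs_def] by (rule C1_sum) (use a in blast)
show eq: "cf c x = v x" if "x : Y" for x
 unfolding v_def coeff_fun_def using that closure_subset[of Y] by (intro sum.cong refl) (use a in "auto simp: cfun_def")
show vV: "v : Vsp" using dom_cong(11)[of "cf c" v] eq coeff_fun_V[OF c] by blast
have d: "dprof k (cf c) x = dprof k v x" if "x : Y" for x by (rule dom_cong(13)[OF _ that]) (rule eq)
have b: "bprof k (cf c) = bprof k v" by (rule dom_cong(12)) (rule eq)
have sp: "AE x in vol. x : Y" by (rule AE_I2) (simp add: space_leb)
show "AE x in vol. dprof k (cf c) x = (helm Y k (cf c) x, Z x, k *r v x)" using sp profile_C1(1)[OF vV C, of k]
proof eventually_elim
 case (elim x)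
 then show ?case using d[OF elim(1)] by (simp add: dom_profile_def)
qed
show "AE x in sg. bprof k (cf c) x = (ndot x (Z x), Z x - ndot x (Z x) *s cplx (nu x), k *r v x)"
 unfolding b by (rule profile_C1(2)[OF vV C])
qed

lemma helm_linear:
assumes c: "c : cvec N"
shows "AE x in vol. helm Y k (cf c) x = (\<Sum>j<N. vec_index c j * helm Y k (bas j) x)"
proof -
let ?a = "%x. \<Sum>j<N. vec_index c j * wlap Y (bas j) x"
have bL: "L2 (vol) (bas j)" "weak_laplacian_of Y (bas j) (wlap Y (bas j))" if "j < N" for j
 using V_space_dom(1,3)[OF bas_V[OF that]] .
have "weak_laplacian_of Y (cf c) (%x. ?a x)" unfolding weak_laplacian_of_def
proof (intro conjI allI impI)
 have wL: "L2 (vol) (wlap Y (bas j))" if "j < N" for j using bL(2)[OF that] by (simp add: weak_laplacian_of_def)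
 show "L2 (vol) (%x. ?a x)" by (intro L2_sum L2_mult_left wL) simp
 fix t assume t: "test_function Y t"
 then have st: "smooth t" by (simp add: test_function_def)
 have tL: "L2 (vol) t" "L2 (vol) (laplacian t)"
  unfolding laplacian_def[abs_def] by (intro tf_L2 st, intro L2_sum tf_L2 smooth_partial st)
 have "(LV x. cf c x * laplacian t x) = (LV x. (\<Sum>j<N. vec_index c j * (bas j x * laplacian t x)))"
  by (simp add: coeff_fun_def sum_distrib_right mult.assoc)
 also have "... = (\<Sum>j<N. vec_index c j * (LV x. bas j x * laplacian t x))"
  by (subst integral_sum) (simp_all add: L2_prod_intbl[OF bL(1) tL(2)])
 also have "... = (\<Sum>j<N. vec_index c j * (LV x. wlap Y (bas j) x * t x))"
  using bL(2) t by (intro sum.cong) (auto simp: weak_laplacian_of_def)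
 also have "... = (LV x. (\<Sum>j<N. vec_index c j * (wlap Y (bas j) x * t x)))"
  by (subst integral_sum) (simp_all add: L2_prod_intbl[OF wL tL(1)])
 finally show "(LV x. cf c x * laplacian t x) = (LV x. ?a x * t x)" by (simp add: sum_distrib_right mult.assoc)
qed
from weak_lapl_unique[OF V_space_dom(3)[OF coeff_fun_V[OF c]] this] show ?thesis
proof eventually_elim
 case (elim x)
 show ?case unfolding helm_def elim coeff_fun_def by (simp add: sum_distrib_left sum.distrib algebra_simps)
qed
qed

lemma coeff_linear:
assumes c: "c : cvec N"
shows "AE x in vol. dprof k (cf c) x = (\<Sum>j<N. csc (vec_index c j) (dprof k (bas j) x))"
 and "AE x in sg. bprof k (cf c) x = (\<Sum>j<N. csc (vec_index c j) (bprof k (bas j) x))"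
proof -
obtain b W where b: "ALL j<N. C1 (cfun (b j)) (%x. cplx (W j x)) & (ALL x:closure Y. b j x = ph j x)" by (rule C1_data)
note P = coeff_profs[OF b c]
let ?a = "%j x. (\<Sum>i<N. vec_index (unit_vec N j) i *s cplx (W i x))"
have unit: "coeff_fun N b (unit_vec N j) x = cfun (b j) x" "?a j x = cplx (W j x)" if j: "j < N" for j x
proof -
 have "coeff_fun N b (unit_vec N j) x = (\<Sum>i<N. if i = j then cfun (b i) x else 0)"
  unfolding coeff_fun_def by (rule sum.cong) (use j in auto)
 then show "coeff_fun N b (unit_vec N j) x = cfun (b j) x" using j by simp
 have "?a j x = (\<Sum>i<N. if i = j then cplx (W i x) else 0)" by (rule sum.cong) (use j in "auto simp: vec_eq_iff")
 then show "?a j x = cplx (W j x)" using j by simp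
qed
let ?c = "%x j. (ndot x (cplx (W j x)), cplx (W j x) - ndot x (cplx (W j x)) *s cplx (nu x), k *r cfun (b j) x)"
have D: "AE x in vol. dprof k (bas j) x = (helm Y k (bas j) x, cplx (W j x), k *r cfun (b j) x)" if "j < N" for j
 using coeff_profs(4)[OF b unit_vec_carrier[of N j]] unfolding unit[OF that] coeff_fun_unit[OF that] .
have Bd: "AE x in sg. bprof k (bas j) x = ?c x j" if "j < N" for j
 using coeff_profs(5)[OF b unit_vec_carrier[of N j]] unfolding unit[OF that] coeff_fun_unit[OF that] .
have D': "AE x in vol. ALL j:{..<N}. dprof k (bas j) x = (helm Y k (bas j) x, cplx (W j x), k *r cfun (b j) x)"
 using D by (intro AE_finite_allI) auto
have Bd': "AE x in sg. ALL j:{..<N}. bprof k (bas j) x = ?c x j" using Bd by (intro AE_finite_allI) auto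
let ?b = "%j. vec_index c j"
show "AE x in vol. dprof k (cf c) x = (\<Sum>j<N. csc (?b j) (dprof k (bas j) x))" using P(4) D' helm_linear[OF c]
proof eventually_elim
 case (elim x)
 have e: "(\<Sum>j<N. csc (?b j) (dprof k (bas j) x)) = (\<Sum>j<N. csc (?b j) (helm Y k (bas j) x, cplx (W j x), k *r cfun (b j) x))"
  using elim(2) by (intro sum.cong) auto
 show ?case unfolding e elim(1)
  by (intro prod_eqI) (simp_all add: prof_sum elim(3) coeff_fun_def scaleR_conv_of_real sum_distrib_left mult.left_commute)
qed
show "AE x in sg. bprof k (cf c) x = (\<Sum>j<N. csc (?b j) (bprof k (bas j) x))" using P(5) Bd'
proof eventually_elim
 case (elim x)
 have e: "(\<Sum>j<N. csc (?b j) (bprof k (bas j) x)) = (\<Sum>j<N. csc (?b j) (ndot x (cplx (W j x)), cplx (W j x) - ndot x (cplx (W j x)) *s cplx (nu x), k *r cfun (b j) x))"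
  using elim(2) by (intro sum.cong) auto
 have cs: "cdot a (\<Sum>j<N. ?b j *s cplx (W j x)) = (\<Sum>j<N. ?b j * cdot a (cplx (W j x)))" for a
  by (induction N) (simp_all add: cdot_add_right cdot_scale_right, simp add: cdot_def)
 have sv: "(\<Sum>j<N. ?b j *s cplx (W j x)) - (\<Sum>j<N. ?b j * a j) *s z = (\<Sum>j<N. ?b j *s (cplx (W j x) - a j *s z))" for a z
  by (simp add: Finite_Cartesian_Product.vec_eq_iff sum_subtractf sum_distrib_right sum_distrib_left algebra_simps)
 show ?case unfolding e elim(1)
  by (intro prod_eqI) (simp_all add: prof_sum cs sv coeff_fun_def scaleR_conv_of_real sum_distrib_left mult.left_commute)
qed
qed

lemma wlap_real:
assumes j: "j < N"
shows "AE x in vol. cnj (wlap Y (bas j) x) = wlap Y (bas j) x"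
proof -
have w: "weak_laplacian_of Y (bas j) (wlap Y (bas j))" by (rule V_space_dom(3)[OF bas_V[OF j]])
let ?a = "%x. cnj (wlap Y (bas j) x)"
have "weak_laplacian_of Y (bas j) ?a" unfolding weak_laplacian_of_def
proof (intro conjI allI impI)
 show "L2 (vol) ?a" using w by (intro L2_cnj) (simp add: weak_laplacian_of_def)
 fix t assume t: "test_function Y t"
 then have st: "smooth t" by (simp add: test_function_def)
 have "(LV x. bas j x * laplacian (%x. cnj (t x)) x) = (LV x. wlap Y (bas j) x * cnj (t x))"
  using w tf_cnj[OF t] by (simp add: weak_laplacian_of_def)
 from arg_cong[OF this, of cnj] show "(LV x. bas j x * laplacian t x) = (LV x. cnj (wlap Y (bas j) x) * t x)"
  unfolding integral_cnj[symmetric] lapl_cnj[OF st] by (simp add: cfun_def)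
qed
from weak_lapl_unique[OF this w] show ?thesis .
qed

lemma bas_real:
assumes j: "j < N"
shows "AE x in vol. conjp (dprof k (bas j) x) = dprof k (bas j) x" and "AE x in sg. conjp (bprof k (bas j) x) = bprof k (bas j) x"
proof -
have "C1_closure Y (ph j)" using basis j by (simp add: galerkin_basis_def)
then obtain a W where C: "C1 (cfun a) (%x. cplx (W x))" and eq: "!!x. x : closure Y ==> a x = ph j x"
 by (rule C1_cl_borel_version) blast
have eq': "bas j x = cfun a x" if "x : Y" for x using eq[of x] that closure_subset[of Y] by (auto simp: cfun_def)
have V: "cfun a : Vsp" using dom_cong(11)[of "bas j" "cfun a"] eq' bas_V[OF j] by blast
have sp: "AE x in vol. x : Y" by (rule AE_I2) (simp add: space_leb)
show "AE x in vol. conjp (dprof k (bas j) x) = dprof k (bas j) x" using sp wlap_real[OF j] profile_C1(1)[OF V C, of k]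
proof eventually_elim
 case (elim x)
 have "dprof k (bas j) x = dprof k (cfun a) x" by (rule dom_cong(13)[OF _ elim(1)]) (rule eq')
 then have "wgrad Y (bas j) x = cplx (W x)" using elim(3) by (simp add: dom_profile_def)
 then show ?case using elim(2) by (simp add: dom_profile_def conjp_def conjv_cplx helm_def cfun_def)
qed
have b: "bprof k (bas j) = bprof k (cfun a)" by (rule dom_cong(12)) (rule eq')
show "AE x in sg. conjp (bprof k (bas j) x) = bprof k (bas j) x" unfolding b using profile_C1(2)[OF V C, of k]
proof eventually_elim
 case (elim x)
 show ?case unfolding elim by (simp add: conjp_def conjv_diff conjv_scale conjv_cplx cnj_cdot cfun_def)
qed
qed

end

context boundary_domain
begin

definition gram_V2 :: "real => (real ^ 'n => complex) => (real ^ 'n => complex) => complex" where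
"gram_V2 k u v = (LV x. gram (dprof k u x) (dprof k v x))
  + (LINT x|sg. gram (bprof k u x) (bprof k v x))"

lemma gram_intbl: fixes P Q :: "'a => 'n profile"
assumes P: "L2 M P" and Q: "L2 M Q"
shows "(%x. gram (P x) (Q x)) : borel_measurable M" "integrable M (%x. gram (P x) (Q x))"
 "norm (LINT x|M. gram (P x) (Q x)) <= (LINT x|M. norm (P x) * norm (Q x))"
proof -
note [measurable] = prof_borel[OF L2_borel[OF P]] prof_borel[OF L2_borel[OF Q]]
let ?a = "%x. gram (P x) (Q x)"
show m: "(%x. ?a x) : borel_measurable M" unfolding gram_def by measurable
show i: "integrable M (%x. ?a x)" by (rule integrable_bound[OF norm_prod_intbl[OF P Q] m]) (simp add: norm_gram_le)
have "norm (LINT x|M. ?a x) <= (LINT x|M. norm (?a x))" by (rule integral_norm_bound)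
also have "... <= (LINT x|M. norm (P x) * norm (Q x))"
 by (rule integral_mono[OF integrable_norm[OF i] norm_prod_intbl[OF P Q] norm_gram_le])
finally show "norm (LINT x|M. ?a x) <= (LINT x|M. norm (P x) * norm (Q x))" .
qed

lemma prof_prod_ints_le:
assumes u: "u : Vsp" and v: "v : Vsp"
shows "(LV x. norm (dprof k u x) * norm (dprof k v x))
  + (LINT x|sg. norm (bprof k u x) * norm (bprof k v x))
 <= normV k u * normV k v"
proof -
define a a' b b' where "a = (LV x. nsq (dprof k u x))" and "a' = (LV x. nsq (dprof k v x))"
 and "b = (LINT x|sg. nsq (bprof k u x))" and "b' = (LINT x|sg. nsq (bprof k v x))"
have nn: "0 <= a" "0 <= a'" "0 <= b" "0 <= b'" unfolding a_def a'_def b_def b'_def by (simp_all add: integral_nonneg_AE)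
have N: "normV k u = sqrt (a + b)" "normV k v = sqrt (a' + b')"
 using norm_V2_prof[OF u, of k] norm_V2_prof[OF v, of k] norm_V2_nonneg unfolding a_def a'_def b_def b'_def
 by (metis real_sqrt_unique)+
note U = V_space_L2[OF u, of k] and V = V_space_L2[OF v, of k]
have "abs (inner (sqrt a, sqrt b) (sqrt a', sqrt b')) <= norm (sqrt a, sqrt b) * norm (sqrt a', sqrt b')" by (rule Cauchy_Schwarz_ineq2)
then have "sqrt a * sqrt a' + sqrt b * sqrt b' <= sqrt (a + b) * sqrt (a' + b')" using nn by (simp add: norm_Pair)
then show ?thesis
 using Cauchy_Schwarz_L2[OF U(1) V(1)] Cauchy_Schwarz_L2[OF U(2) V(2)] unfolding N a_def a'_def b_def b'_def by linarith
qed

lemma gram_V2_le: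
assumes u: "u : Vsp" and v: "v : Vsp"
shows "cmod (gram_V2 k u v) <= normV k u * normV k v" unfolding gram_V2_def
by (rule order_trans[OF norm_triangle_mono[OF gram_intbl(3)[OF V_space_L2(1)[OF u] V_space_L2(1)[OF v]]
   gram_intbl(3)[OF V_space_L2(2)[OF u] V_space_L2(2)[OF v]]] prof_prod_ints_le[OF u v]])

lemma gram_V2_self:
assumes u: "u : Vsp"
shows "gram_V2 k u u = cr ((normV k u)^2)" unfolding gram_V2_def gram_self norm_V2_prof[OF u] integral_complex_of_real by simp

lemma cnj_gram_V2: "cnj (gram_V2 k u v) = gram_V2 k v u" unfolding gram_V2_def complex_cnj_add integral_cnj[symmetric] cnj_gram ..

lemma norm_V2_zero:
assumes v: "v : Vsp" and k: "0 < k" and z: "normV k v = 0"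
shows "AE x in vol. v x = 0"
proof -
note i = L2_norm_integrable[OF V_space_L2(1)[OF v, of k]]
let ?a = "%x. LV x. nsq (dprof k v x)"
have "0 <= ?a x" "0 <= (LINT x|sg. nsq (bprof k v x))" by (simp_all add: integral_nonneg_AE)
moreover have "?a x + (LINT x|sg. nsq (bprof k v x)) = 0" using norm_V2_prof[OF v, of k] unfolding z by simp
ultimately have "?a x = 0" by linarith
then have "AE x in vol. nsq (dprof k v x) = 0" using integral_nonneg_eq_0_iff_AE[OF i] by simp
then show ?thesis
proof eventually_elim
 case (elim x)
 then have "snd (snd (dprof k v x)) = 0" by simp
 then show ?case using k by (simp add: dom_profile_def)
qed
qed

end

context galerkin
begin

lemma intbl_bas:
assumes "i < N" "j < N"
shows "integrable (vol) (%x. gram (dprof k (bas i) x) (dprof k (bas j) x))"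
 "integrable sg (%x. gram (bprof k (bas i) x) (bprof k (bas j) x))" using assms by (auto intro!: gram_intbl(2) V_space_L2 bas_V)

lemma gram_V2_coeff:
assumes c: "c : cvec N" and d: "d : cvec N"
shows "gram_V2 k (cf c) (cf d) = (\<Sum>j<N. \<Sum>i<N. vec_index c j * cnj (vec_index d i) * gram_V2 k (bas j) (bas i))"
proof -
note U = V_space_L2[OF coeff_fun_V[OF c], of k] and V = V_space_L2[OF coeff_fun_V[OF d], of k]
have 1: "(LV x. gram (dprof k (cf c) x) (dprof k (cf d) x))
  = (\<Sum>j<N. \<Sum>i<N. vec_index c j * cnj (vec_index d i) * (LV x. gram (dprof k (bas j) x) (dprof k (bas i) x)))"
 by (rule int_sesq[OF sesq_gram _ coeff_linear(1)[OF c] coeff_linear(1)[OF d] gram_intbl(1)[OF U(1) V(1)]]) (rule intbl_bas)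
have 2: "(LINT x|sg. gram (bprof k (cf c) x) (bprof k (cf d) x))
  = (\<Sum>j<N. \<Sum>i<N. vec_index c j * cnj (vec_index d i) * (LINT x|sg. gram (bprof k (bas j) x) (bprof k (bas i) x)))"
 by (rule int_sesq[OF sesq_gram _ coeff_linear(2)[OF c] coeff_linear(2)[OF d] gram_intbl(1)[OF U(2) V(2)]]) (rule intbl_bas)
show ?thesis unfolding gram_V2_def 1 2 by (simp add: sum.distrib distrib_left)
qed

lemma form_b_coeff:
assumes c: "c : cvec N" and d: "d : cvec N"
shows "bform k b (cf c) (cf d) = (\<Sum>j<N. \<Sum>i<N. vec_index c j * cnj (vec_index d i) * bform k b (bas j) (bas i))"
proof -
note U = V_space_L2[OF coeff_fun_V[OF c], of k] and V = V_space_L2[OF coeff_fun_V[OF d], of k]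
have 1: "(LV x. dom_form a x (dprof k (cf c) x) (dprof k (cf d) x))
  = (\<Sum>j<N. \<Sum>i<N. vec_index c j * cnj (vec_index d i) * (LV x. dom_form a x (dprof k (bas j) x) (dprof k (bas i) x)))" for a
 by (rule int_sesq[OF sesq_dom_form _ coeff_linear(1)[OF c] coeff_linear(1)[OF d] borel_measurable_integrable[OF dom_form_intbl(1)[OF U(1) V(1)]]])
   (intro dom_form_intbl(1) V_space_L2 bas_V)
have 2: "(LINT x|sg. bdry_form a x (inner x (nu x)) (bprof k (cf c) x) (bprof k (cf d) x))
  = (\<Sum>j<N. \<Sum>i<N. vec_index c j * cnj (vec_index d i) * (LINT x|sg. bdry_form a x (inner x (nu x)) (bprof k (bas j) x) (bprof k (bas i) x)))" for a
 by (rule int_sesq[OF sesq_bdry_form _ coeff_linear(2)[OF c] coeff_linear(2)[OF d] borel_measurable_integrable[OF bdry_form_intbl(1)[OF U(2) V(2)]]])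
   (intro bdry_form_intbl(1) V_space_L2 bas_V)
show ?thesis unfolding form_b_prof[OF k_pos] 1 2 by (simp add: sum_subtractf right_diff_distrib)
qed

lemma mat_B_form:
assumes "c : cvec N" "d : cvec N"
shows "(mB a *w c) \<bullet>c d = bform k a (cf c) (cf d)"
unfolding form_b_coeff[OF assms] mat_B_def by (rule mat_vec_cscalar_prod[OF assms])

lemma mat_D_gram: "mD = Matrix.mat N N (%(i, j). gram_V2 k (bas j) (bas i))"
proof (rule eq_matI)
fix i j let ?c = "%(i, j). gram_V2 k (bas j) (bas i)" assume "i < dim_row (Matrix.mat N N ?c)" "j < dim_col (Matrix.mat N N ?c)"
then have ij: "i < N" "j < N" by simp_all
have kk: "(cr k)^2 * a * b = (k *r a) * (k *r b)" for a b by (simp add: scaleR_conv_of_real power2_eq_square)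
let ?b = "%x. helm Y k (bas i) x * helm Y k (bas j) x + cdot (wgrad Y (bas i) x) (wgrad Y (bas j) x) + (cr k)^2 * bas i x * bas j x"
have 1: "(LV x. ?b x)
  = (LV x. gram (dprof k (bas j) x) (dprof k (bas i) x))"
proof (rule integral_cong_AE)
 show ae: "AE x in vol. ?b x
   = gram (dprof k (bas j) x) (dprof k (bas i) x)" using bas_real(1)[OF ij(1)]
 proof eventually_elim
  case (elim x)
  show ?case using cdot_gram[OF elim, of "dprof k (bas j) x"] unfolding dom_profile_def fst_conv snd_conv kk
   by (simp add: mult.commute cdot_commute)
 qed
 note [measurable] = prof_borel[OF L2_borel[OF V_space_L2(1)[OF bas_V[OF ij(1)], of k]], unfolded dom_profile_def fst_conv snd_conv]
  prof_borel[OF L2_borel[OF V_space_L2(1)[OF bas_V[OF ij(2)], of k]], unfolded dom_profile_def fst_conv snd_conv]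
 show "(%x. ?b x) : borel_measurable (vol)" unfolding kk by measurable
qed (rule borel_measurable_integrable[OF intbl_bas(1)[OF ij(2,1)]])
let ?a = "%x. (cr k)^2 * bdry_trace Y sg (bas i) x * bdry_trace Y sg (bas j) x + cdot (sgrad Y sg nu (bas i) x) (sgrad Y sg nu (bas j) x) + nderiv Y sg (bas i) x * nderiv Y sg (bas j) x"
have 2: "(LINT x|sg. ?a x)
  = (LINT x|sg. gram (bprof k (bas j) x) (bprof k (bas i) x))"
proof (rule integral_cong_AE)
 show ae: "AE x in sg. ?a x
   = gram (bprof k (bas j) x) (bprof k (bas i) x)" using bas_real(2)[OF ij(1)]
 proof eventually_elim
  case (elim x)
  show ?case using cdot_gram[OF elim, of "bprof k (bas j) x"] unfolding bdry_profile_def fst_conv snd_conv kk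
   by (simp add: mult.commute cdot_commute add.commute add.left_commute)
 qed
 note [measurable] = prof_borel[OF L2_borel[OF V_space_L2(2)[OF bas_V[OF ij(1)], of k]], unfolded bdry_profile_def fst_conv snd_conv]
  prof_borel[OF L2_borel[OF V_space_L2(2)[OF bas_V[OF ij(2)], of k]], unfolded bdry_profile_def fst_conv snd_conv]
 show "(%x. ?a x) : borel_measurable sg" unfolding kk by measurable
qed (rule borel_measurable_integrable[OF intbl_bas(2)[OF ij(2,1)]])
show "mD $$ (i, j) = Matrix.mat N N ?c $$ (i, j)" using ij by (simp add: mat_D_def Let_def 1 2 gram_V2_def)
qed (simp_all add: mat_D_def)

lemma mat_D_form:
assumes "c \<in> cvec N" "d \<in> cvec N"
shows "(mD *\<^sub>v c) \<bullet>c d = gram_V2 k (cf c) (cf d)"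
unfolding gram_V2_coeff[OF assms] mat_D_gram by (rule mat_vec_cscalar_prod[OF assms])

lemma norm_mat_D:
assumes c: "c : cvec N"
shows "norm_P (mD) c = normV k (cf c)"
unfolding norm_P_def mat_D_form[OF c c] gram_V2_self[OF coeff_fun_V[OF c]] using norm_V2_nonneg by simp

lemma mat_carriers: "mD : carrier_mat N N" "mat_B Y sg nu k a A N ph : carrier_mat N N"
"vec_g Y sg nu k a A f g N ph : cvec N" by (simp_all add: mat_D_def mat_B_def vec_g_def)

lemma mat_D_injective:
assumes c: "c : cvec N" and z: "mD *w c = 0\<^sub>v N"
shows "c = 0\<^sub>v N"
proof -
have "norm_P (mD) c = 0" unfolding norm_P_def z using c by simp
then have "AE x in vol. cf c x = 0" unfolding norm_mat_D[OF c] by (rule norm_V2_zero[OF coeff_fun_V[OF c] k_pos])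
then show ?thesis using basis c by (simp add: galerkin_basis_def)
qed

lemma galerkin_system:
assumes u: "u : cvec N" and s: "galerkin_solution Y sg nu k a (k^2) f g N ph (cf u)"
shows "mB a *w u = mg a f g"
proof (rule eq_vecI)
fix i assume "i < dim_vec (mg a f g)"
then have i: "i < N" by (simp add: vec_g_def)
have "bas i : galerkin_space N ph" unfolding galerkin_space_def coeff_fun_unit[OF i, symmetric] by (rule imageI[OF unit_vec_carrier])
then have "bform k a (cf u) (bas i) = form_G Y sg nu k a (k^2) f g (bas i)" using s by (simp add: galerkin_solution_def)
moreover have "bform k a (cf u) (bas i) = (\<Sum>j<N. vec_index u j * bform k a (bas j) (bas i))"
proof -
 have "(\<Sum>l<N. vec_index u j * cnj (vec_index (unit_vec N i) l) * bform k a (bas j) (bas l)) = (\<Sum>l<N. if l = i then vec_index u j * bform k a (bas j) (bas l) else 0)" for j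
  by (rule sum.cong) (use i in auto)
 then show ?thesis using form_b_coeff[OF u unit_vec_carrier[of N i], of a] i by (simp add: coeff_fun_unit[OF i])
qed
ultimately show "vec_index (mB a *w u) i = vec_index (mg a f g) i"
 using i u by (simp add: mat_B_def vec_g_def scalar_prod_def row_def atLeast0LessThan mult.commute)
qed (simp add: mat_B_def vec_g_def)

end

lemma norm_multiplier_coeff:
assumes "1 <= d" "0 < k0" "k0 <= k"
shows "norm (multiplier_coeff d k a) <= (real d - 1) / (2 * k0) + abs a"
proof -
have "norm (multiplier_coeff d k a) <= norm (cr ((real d - 1) / (2 * k))) + norm (\<i> * cr a)"
 unfolding multiplier_coeff_def by (rule norm_triangle_ineq4)
also have "... = (real d - 1) / (2 * k) + abs a" unfolding norm_of_real norm_mult norm_ii using assms by simp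
also have "(real d - 1) / (2 * k) <= (real d - 1) / (2 * k0)" using assms by (intro divide_left_mono) simp_all
finally show ?thesis by simp
qed

context galerkin
begin

lemma coeff_fun_coercive:
assumes c: "c : cvec N" and g: "0 < b" and L: "0 < diameter Y" and star: "AE x in sg. b * diameter Y <= inner x (nu x)"
 and d: "diameter Y / 2 * (1 + 4 / b + b / 2) <= d"
shows "min (1 / 2) (min (b * diameter Y / 4) (diameter Y / b)) * (normV k (cf c))^2
 <= Re (bform k d (cf c) (cf c))"
proof -
obtain a W where a: "ALL j<N. C1 (cfun (a j)) (%x. cplx (W j x)) & (ALL x:closure Y. a j x = ph j x)" by (rule C1_data)
note P = coeff_profs[OF a c]
have eq: "normV k (cf c) = normV k (coeff_fun N a c)"
 "bform k d (cf c) (cf c) = bform k d (coeff_fun N a c) (coeff_fun N a c)"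
 by (rule norm_form_cong; (rule P(3) k_pos coeff_fun_V[OF c])?; assumption?)+
show ?thesis unfolding eq by (rule form_b_coercive[OF P(2,1) k_pos g L star d])
qed

lemma gmres_error_bounds: fixes b K a :: real
defines "D == mD" and "B == mB b"
assumes coer: "!!c. c : cvec N ==> a * (normV k (cf c))^2 <= Re (bform k b (cf c) (cf c))"
 and K: "3 + 5 * diameter Y + 2 * norm (multiplier_coeff CARD('n) k b) <= K" and a: "0 < a" "a <= K"
 and u0: "u0 : cvec N" and g: "g : cvec N" and um: "precond_gmres_iterate N D B g u0 m um"
shows "um : cvec N"
 and "norm_P D (precond_residual D B g um) <= sqrt (1 - (a / K)\<^sup>2) ^ m * norm_P D (precond_residual D B g u0)"
proof -
have D: "D : carrier_mat N N" and B: "B : carrier_mat N N" by (simp_all add: D_def B_def mat_carriers)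
have herm: "(D *w c) \<bullet>c d = cnj ((D *w d) \<bullet>c c)" if "c : cvec N" "d : cvec N" for c d
 unfolding D_def mat_D_form[OF that] mat_D_form[OF that(2,1)] cnj_gram_V2 ..
have pos: "0 <= Re ((D *w c) \<bullet>c c)" if "c : cvec N" for c
 unfolding D_def mat_D_form[OF that that] gram_V2_self[OF coeff_fun_V[OF that]] by simp
have inj: "c = 0\<^sub>v N" if "c : cvec N" "D *w c = 0\<^sub>v N" for c
 using mat_D_injective[OF that(1)] that(2) by (simp add: D_def)
have co: "a * (norm_P D c)^2 <= Re ((B *w c) \<bullet>c c)" if "c : cvec N" for c
 unfolding D_def B_def norm_mat_D[OF that] mat_B_form[OF that that] by (rule coer[OF that])
have ct: "cmod ((B *w c) \<bullet>c d) <= K * norm_P D c * norm_P D d" if "c : cvec N" "d : cvec N" for c d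
 unfolding D_def B_def norm_mat_D[OF that(1)] norm_mat_D[OF that(2)] mat_B_form[OF that]
 by (rule form_b_cont[OF k_pos coeff_fun_V[OF that(1)] coeff_fun_V[OF that(2)] K])
show "um : cvec N" by (rule gmres_resid_bound(1)[OF D B herm pos inj co ct a u0 g um])
show "norm_P D (precond_residual D B g um) <= sqrt (1 - (a / K)\<^sup>2) ^ m * norm_P D (precond_residual D B g u0)"
 by (rule gmres_resid_bound(2)[OF D B herm pos inj co ct a u0 g um])
qed

lemma resid_norm_nonneg:
"0 <= norm_P (mD) (precond_residual (mD) (mB a) (mg a f g) x)"
proof -
have "mat_inv (mD) : carrier_mat N N" using mat_inv_inverse(1)[OF mat_carriers(1)] mat_D_injective by blast
then have "precond_residual (mD) (mB a) (mg a f g) x : cvec N" unfolding precond_residual_def carrier_vec_def by simp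
then show ?thesis by (simp add: norm_mat_D norm_V2_nonneg)
qed

lemma galerkin_error: fixes d :: real and f g :: "real ^ 'n => complex"
defines "D == mD" and "B == mB d" and "b == mg d f g"
assumes cont: "continuity_constant Y sg nu k d (k^2) Ccont" and coer: "coercivity_constant Y sg nu k d (k^2) Ccoer"
 and u: "u : cvec N" and s: "galerkin_solution Y sg nu k d (k^2) f g N ph (cf u)" and um: "um : cvec N" and a: "0 < a"
 and red: "norm_P D (precond_residual D B b um) <= a * norm_P D (precond_residual D B b (0\<^sub>v N))"
shows "normV k (%x. cf u x - cf um x) / normV k (cf u) <= Ccont / Ccoer * a"
proof -
let ?n = "%c. normV k (cf c)"
have D: "D : carrier_mat N N" and B: "B : carrier_mat N N" and b: "b : cvec N" by (simp_all add: D_def B_def b_def mat_carriers)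
have Di: "mat_inv D : carrier_mat N N" "D * mat_inv D = 1\<^sub>m N"
 using mat_inv_inverse[OF D] mat_D_injective unfolding D_def by blast+
have Bu: "B *w u = b" unfolding B_def b_def by (rule galerkin_system[OF u s])
have Cc: "0 < Ccont" "0 < Ccoer" using cont coer by (simp_all add: continuity_constant_def coercivity_constant_def)
have Dinv: "D *w (mat_inv D *w z) = z" if z: "z : cvec N" for z using assoc_mult_mat_vec[OF D Di(1) z] z by (simp add: Di(2))
define e where "e = u - um"
have e: "e : cvec N" using u um by (simp add: e_def)
have fe: "(%x. cf u x - cf um x) = cf e"
proof
 fix x
 have "cf e x = (\<Sum>j<N. vec_index u j * bas j x - vec_index um j * bas j x)"
  unfolding coeff_fun_def by (rule sum.cong) (use u um in "auto simp: e_def left_diff_distrib")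
 then show "cf u x - cf um x = cf e x" by (simp add: coeff_fun_def sum_subtractf)
qed
define r where "r = precond_residual D B b um"
have Be: "b - B *w um = B *w e" unfolding e_def mult_minus_distrib_mat_vec[OF B u um] Bu ..
have r: "r : cvec N" "D *w r = B *w e" unfolding r_def precond_residual_def Be using Di(1) B e by (auto intro!: Dinv)
have "Ccoer * (?n e)^2 <= cmod (bform k d (cf e) (cf e))" using coer coeff_fun_V[OF e] by (simp add: coercivity_constant_def)
also have "bform k d (cf e) (cf e) = gram_V2 k (cf r) (cf e)"
 unfolding mat_B_form[OF e e, symmetric] mat_D_form[OF r(1) e, symmetric] B_def[symmetric] D_def[symmetric] r(2) ..
also have "cmod ... <= ?n r * ?n e" by (rule gram_V2_le[OF coeff_fun_V[OF r(1)] coeff_fun_V[OF e]])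
finally have "?n e * (Ccoer * ?n e) <= ?n e * ?n r" by (simp add: power2_eq_square algebra_simps)
then have 1: "Ccoer * ?n e <= ?n r" using norm_V2_nonneg[of k "cf e"] norm_V2_nonneg[of k "cf r"]
 by (cases "?n e = 0") (simp_all add: mult_le_cancel_left)
define r0 where "r0 = precond_residual D B b (0\<^sub>v N)"
have B0: "b - B *w 0\<^sub>v N = B *w u" unfolding Bu by (rule eq_vecI) (use B b in "auto simp: scalar_prod_def intro!: sum.neutral")
have r0: "r0 : cvec N" "D *w r0 = B *w u" unfolding r0_def precond_residual_def B0 using Di(1) B u by (auto intro!: Dinv)
have "(?n r0)^2 = cmod (gram_V2 k (cf r0) (cf r0))" unfolding gram_V2_self[OF coeff_fun_V[OF r0(1)]] norm_of_real by simp
also have "gram_V2 k (cf r0) (cf r0) = bform k d (cf u) (cf r0)"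
 unfolding mat_B_form[OF u r0(1), symmetric] mat_D_form[OF r0(1) r0(1), symmetric] B_def[symmetric] D_def[symmetric] r0(2) ..
also have "cmod ... <= Ccont * ?n u * ?n r0"
 using cont coeff_fun_V[OF u] coeff_fun_V[OF r0(1)] by (simp add: continuity_constant_def)
finally have "?n r0 * ?n r0 <= ?n r0 * (Ccont * ?n u)" by (simp add: power2_eq_square mult.commute)
then have 2: "?n r0 <= Ccont * ?n u" using norm_V2_nonneg[of k "cf r0"] norm_V2_nonneg[of k "cf u"] Cc
 by (cases "?n r0 = 0") (simp_all add: mult_le_cancel_left)
have "norm_P D r <= a * norm_P D r0" using red by (simp only: r_def r0_def)
moreover have "norm_P D r = ?n r" "norm_P D r0 = ?n r0" using norm_mat_D[OF r(1)] norm_mat_D[OF r0(1)] by (simp_all only: D_def)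
ultimately have "?n r <= a * ?n r0" by simp
also have "... <= a * (Ccont * ?n u)" using 2 a by (intro mult_left_mono) simp_all
finally have "Ccoer * ?n e <= a * (Ccont * ?n u)" using 1 by linarith
then have "?n e <= Ccont / Ccoer * a * ?n u" using Cc by (simp add: field_simps)
then show ?thesis unfolding fe using norm_V2_nonneg[of k "cf u"] Cc a by (cases "?n u = 0") (simp_all add: pos_divide_le_eq)
qed

end

lemma (in star_domain) diameter_pos: "0 < diameter Y"
proof -
obtain b :: 'a where b: "b : Basis" by (metis nonempty_Basis ex_in_conv)
have n: "norm ((r / 2) *r b) = r / 2" using b r_pos by simp
then have "(r / 2) *r b : Y" "0 : Y" using ball_subset r_pos by auto
from diameter_bounded_bound[OF bounded_domain this] show ?thesis using n r_pos by (simp add: dist_norm)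
qed

theorem theorem4p7:
 fixes \<Omega> :: "(real ^ 'n::finite) set" and \<sigma> :: "(real ^ 'n) measure"
  and \<nu> :: "real ^ 'n \<Rightarrow> real ^ 'n" and \<gamma> C k0 :: real
 assumes "lipschitz_domain \<Omega>" and "surface_measure \<Omega> \<sigma>" and "outward_normal \<Omega> \<nu>"
  and "star_shaped_wrt_ball \<Omega> 0"
  and "0 < \<gamma>" and "AE x in \<sigma>. \<gamma> * diameter \<Omega> \<le> inner x (\<nu> x)"
  and "0 < C" and "0 < k0"
 shows "\<exists>C2>0. \<forall>\<beta> :: real \<Rightarrow> real.
  (\<forall>k\<ge>k0. diameter \<Omega> / 2 * (1 + 4 / \<gamma> + \<gamma> / 2) \<le> \<beta> k \<and> \<beta> k \<le> C * diameter \<Omega>) \<longrightarrow>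
   (\<forall>k\<ge>k0. \<forall>N \<phi> f g u0 um m \<delta>.
     galerkin_basis \<Omega> \<sigma> \<nu> N \<phi> \<and> L2 (lebesgue_on \<Omega>) f \<and> L2 \<sigma> g \<and> u0 \<in> carrier_vec N \<and>
     precond_gmres_iterate N (mat_D \<Omega> \<sigma> \<nu> k N \<phi>) (mat_B \<Omega> \<sigma> \<nu> k (\<beta> k) (k\<^sup>2) N \<phi>)
      (vec_g \<Omega> \<sigma> \<nu> k (\<beta> k) (k\<^sup>2) f g N \<phi>) u0 m um \<and>
     0 < \<delta> \<and> \<delta> < 1 \<and> C2 * ln (12 / \<delta>) \<le> real m \<longrightarrow>
     norm_P (mat_D \<Omega> \<sigma> \<nu> k N \<phi>)
       (precond_residual (mat_D \<Omega> \<sigma> \<nu> k N \<phi>) (mat_B \<Omega> \<sigma> \<nu> k (\<beta> k) (k\<^sup>2) N \<phi>)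
        (vec_g \<Omega> \<sigma> \<nu> k (\<beta> k) (k\<^sup>2) f g N \<phi>) um)
      / norm_P (mat_D \<Omega> \<sigma> \<nu> k N \<phi>)
        (precond_residual (mat_D \<Omega> \<sigma> \<nu> k N \<phi>) (mat_B \<Omega> \<sigma> \<nu> k (\<beta> k) (k\<^sup>2) N \<phi>)
         (vec_g \<Omega> \<sigma> \<nu> k (\<beta> k) (k\<^sup>2) f g N \<phi>) u0)
      \<le> \<delta>)
  \<and> (\<forall>k\<ge>k0. \<forall>N \<phi> f g u um m \<delta> Ccont Ccoer.
     continuity_constant \<Omega> \<sigma> \<nu> k (\<beta> k) (k\<^sup>2) Ccont \<and>
     coercivity_constant \<Omega> \<sigma> \<nu> k (\<beta> k) (k\<^sup>2) Ccoer \<and>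
     galerkin_basis \<Omega> \<sigma> \<nu> N \<phi> \<and> L2 (lebesgue_on \<Omega>) f \<and> L2 \<sigma> g \<and>
     u \<in> carrier_vec N \<and>
     galerkin_solution \<Omega> \<sigma> \<nu> k (\<beta> k) (k\<^sup>2) f g N \<phi> (coeff_fun N \<phi> u) \<and>
     precond_gmres_iterate N (mat_D \<Omega> \<sigma> \<nu> k N \<phi>) (mat_B \<Omega> \<sigma> \<nu> k (\<beta> k) (k\<^sup>2) N \<phi>)
      (vec_g \<Omega> \<sigma> \<nu> k (\<beta> k) (k\<^sup>2) f g N \<phi>) (0\<^sub>v N) m um \<and>
     0 < \<delta> \<and> \<delta> < 1 \<and> C2 * ln (12 / \<delta>) \<le> real m \<longrightarrow>
     norm_V2 \<Omega> \<sigma> \<nu> k (\<lambda>x. coeff_fun N \<phi> u x - coeff_fun N \<phi> um x)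
      / norm_V2 \<Omega> \<sigma> \<nu> k (coeff_fun N \<phi> u)
      \<le> Ccont / Ccoer * \<delta>)
  \<and> (\<forall>Ccont Ccoer :: real \<Rightarrow> real.
     (\<forall>k\<ge>k0. continuity_constant \<Omega> \<sigma> \<nu> k (\<beta> k) (k\<^sup>2) (Ccont k) \<and>
          coercivity_constant \<Omega> \<sigma> \<nu> k (\<beta> k) (k\<^sup>2) (Ccoer k)) \<and>
     comparable k0 Ccont (\<lambda>k. 1) \<and> comparable k0 Ccoer (\<lambda>k. 1) \<longrightarrow>
     (\<exists>c>0. \<exists>c'>0. \<forall>k\<ge>k0. \<forall>\<delta>. 0 < \<delta> \<and> \<delta> < 1 \<longrightarrow>
      c * \<delta> \<le> Ccont k / Ccoer k * \<delta> \<and> Ccont k / Ccoer k * \<delta> \<le> c' * \<delta>))"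
proof -
let ?r = "%\<beta> k N \<phi> f g u. norm_P (mat_D \<Omega> \<sigma> \<nu> k N \<phi>)
 (precond_residual (mat_D \<Omega> \<sigma> \<nu> k N \<phi>) (mat_B \<Omega> \<sigma> \<nu> k \<beta> (k^2) N \<phi>) (vec_g \<Omega> \<sigma> \<nu> k \<beta> (k^2) f g N \<phi>) u)"
obtain r where r: "0 < r" "!!p x. p : ball 0 r ==> p : \<Omega> & (x : \<Omega> --> closed_segment p x <= \<Omega>)"
 using assms(4) unfolding star_shaped_wrt_ball_def by blast
have sd: "star_domain \<Omega> r" using assms(1) r unfolding star_domain_def lipschitz_domain_def by blast
interpret star_domain \<Omega> r by (rule sd)
let ?a = "diameter \<Omega>"
have L: "0 < ?a" by (rule diameter_pos)
have c0: "0 < \<gamma> * ?a" using assms(5) L by simp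
have \<nu>m: "\<nu> : borel_measurable borel" using assms(3) by (simp add: outward_normal_def)
note cone = surface_meas_cone[OF sd assms(1-3) c0 assms(6)]
interpret boundary_domain \<Omega> r \<sigma> \<nu> using cone \<nu>m by unfold_locales
define \<alpha> where "\<alpha> = min (1 / 2) (min (\<gamma> * ?a / 4) (?a / \<gamma>))"
define d where "d = (real CARD('n) - 1) / (2 * k0)"
define cd where "cd = C * ?a"
define K where "K = 3 + 5 * ?a + 2 * d + 2 * cd"
have card1: "1 <= CARD('n)" by (simp add: Suc_leI)
have \<alpha>0: "0 < \<alpha>" using assms(5) L by (simp add: \<alpha>_def)
have "0 <= d" using card1 assms(8) by (simp add: d_def)
moreover have "0 < cd" using assms(7) L by (simp add: cd_def)
ultimately have K3: "3 <= K" using L by (simp add: K_def)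
have "\<alpha> <= 1 / 2" unfolding \<alpha>_def by (rule min.cobounded1)
then have \<alpha>K: "\<alpha> <= K" using K3 by linarith
have Kp: "0 < K" using K3 by linarith
let ?b = "\<alpha> / K"
have s: "0 < ?b" "?b <= 1" using divide_pos_pos[OF \<alpha>0 Kp] \<alpha>K Kp by (simp_all only: pos_divide_le_eq mult_1)
define C2 where "C2 = 2 / ?b^2"
have C2: "0 < C2" unfolding C2_def by (rule divide_pos_pos[OF zero_less_numeral zero_less_power[OF s(1)]])
let ?c = "?a / 2 * (1 + 4 / \<gamma> + \<gamma> / 2)"
have bounds: "um : cvec N &
  0 <= ?r \<beta> k N \<phi> f g u0 &
  ?r \<beta> k N \<phi> f g um
  <= \<delta> * ?r \<beta> k N \<phi> f g u0"
 if k: "k0 <= k" and \<beta>: "?c <= \<beta>" "\<beta> <= C * ?a"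
  and gb: "galerkin_basis \<Omega> \<sigma> \<nu> N \<phi>" and u0: "u0 : cvec N"
  and it: "precond_gmres_iterate N (mat_D \<Omega> \<sigma> \<nu> k N \<phi>) (mat_B \<Omega> \<sigma> \<nu> k \<beta> (k^2) N \<phi>) (vec_g \<Omega> \<sigma> \<nu> k \<beta> (k^2) f g N \<phi>) u0 m um"
  and \<delta>: "0 < \<delta>" and m: "C2 * ln (12 / \<delta>) <= real m" for k \<beta> \<delta> N \<phi> f g u0 um m
proof -
 have kp: "0 < k" using k assms(8) by linarith
 interpret galerkin \<Omega> r \<sigma> \<nu> N \<phi> k using gb kp by unfold_locales
 have "0 <= ?c" using L assms(5) by simp
 then have "\<bar>\<beta>\<bar> <= cd" unfolding cd_def using \<beta> by simp
 then have Kb: "3 + 5 * ?a + 2 * norm (multiplier_coeff CARD('n) k \<beta>) <= K"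
  using norm_multiplier_coeff[OF card1 assms(8) k, of \<beta>] unfolding d_def[symmetric] by (simp add: K_def)
 have coer: "\<alpha> * (norm_V2 \<Omega> \<sigma> \<nu> k (coeff_fun N \<phi> c))^2 <= Re (form_b \<Omega> \<sigma> \<nu> k \<beta> (k^2) (coeff_fun N \<phi> c) (coeff_fun N \<phi> c))"
  if "c : cvec N" for c unfolding \<alpha>_def by (rule coeff_fun_coercive[OF that assms(5) L assms(6) \<beta>(1)])
 note G = gmres_error_bounds[OF coer Kb \<alpha>0 \<alpha>K u0 mat_carriers(3) it]
 have "sqrt (1 - ?b^2) ^ m <= \<delta>" by (rule contr_power_le[OF s \<delta> m[unfolded C2_def]])
 then have "sqrt (1 - ?b^2) ^ m * ?r \<beta> k N \<phi> f g u0
  <= \<delta> * ?r \<beta> k N \<phi> f g u0" by (rule mult_right_mono) (rule resid_norm_nonneg)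
 with G resid_norm_nonneg[of \<beta> f g u0] show ?thesis by (auto intro: order_trans)
qed
show ?thesis
proof (rule exI[of _ C2], intro conjI C2 allI impI, goal_cases)
 case (1 \<beta> k N \<phi> f g u0 um m \<delta>)
 let ?q = "?r (\<beta> k) k N \<phi> f g"
 have "um : cvec N & 0 <= ?q u0 & ?q um <= \<delta> * ?q u0" using 1 by (intro bounds) auto
 then show ?case using 1 by (cases "?q u0 = 0") (simp_all add: pos_divide_le_eq)
next
 case (2 \<beta> k N \<phi> f g u um m \<delta> Ccont Ccoer)
 then have kp: "0 < k" and gb: "galerkin_basis \<Omega> \<sigma> \<nu> N \<phi>" using assms(8) by auto
 interpret galerkin \<Omega> r \<sigma> \<nu> N \<phi> k using gb kp by unfold_locales
 let ?d = "?r (\<beta> k) k N \<phi> f g (0\<^sub>v N)"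
 have "um : cvec N &
  0 <= ?d &
  ?r (\<beta> k) k N \<phi> f g um
  <= \<delta> * ?d" using 2 by (intro bounds) auto
 then show ?case using 2 by (intro galerkin_error[of "\<beta> k" Ccont Ccoer u f g um \<delta>]) auto
next
 case (3 \<beta> Ccont Ccoer)
 then obtain a1 a2 b1 b2 where ab: "0 < a1" "0 < a2" "0 < b1" "0 < b2"
  "!!k. k0 <= k ==> a1 <= Ccont k & Ccont k <= a2" "!!k. k0 <= k ==> b1 <= Ccoer k & Ccoer k <= b2"
  unfolding comparable_def by auto
 have "a1 / b2 * \<delta> <= Ccont k / Ccoer k * \<delta> & Ccont k / Ccoer k * \<delta> <= a2 / b1 * \<delta>"
  if k: "k0 <= k" and \<delta>: "0 < \<delta> & \<delta> < 1" for k \<delta>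
 proof -
  have "a1 / b2 <= Ccont k / Ccoer k" "Ccont k / Ccoer k <= a2 / b1" using ab(1-4) ab(5,6)[OF k] by (intro frac_le; linarith)+
  then show ?thesis using \<delta> by (intro conjI mult_right_mono; simp)
 qed
 moreover have "0 < a1 / b2" "0 < a2 / b1" using ab by simp_all
 ultimately show ?case by blast
qed
qed

end
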